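(* Let $m\neq n$. All coefficients of the series $z(u)$ and $z^+(u)$ belong to the centre of the extended double Yangian $\widetilde{\mathrm{DY}}(\mathfrak{gl}_{m|n})$.
   Context: Everything is over $\mathbb{C}$; $m,n$ are nonnegative integers with $m\neq n$. Put $\bar i=0$ for $i=1,\ldots,m$ and $\bar i=1$ for $i=m+1,\ldots,m+n$. The matrix units $e_{ij}\in\mathrm{End}\,\mathbb{C}^{m|n}$ have parity $\bar i+\bar j$. Tensor products of superalgebras have multiplication $(a\otimes b)(c\otimes d)=(-1)^{|b||c|}ac\otimes bd$. $R(u)=1-Pu^{-1}$ with $P=\sum_{i,j=1}^{m+n}e_{ij}\otimes e_{ji}(-1)^{\bar j}$; $g(u)\in 1+u^{-1}\mathbb{C}[[u^{-1}]]$ is the unique series with $g(u+m-n)=(1-u^{-2})g(u)$, and $\overline R(u)=g(u)R(u)$. The double Yangian $\mathrm{DY}(\mathfrak{gl}_{m|n})$ is the $\mathbb{Z}_2$-graded unital associative algebra generated by an even central element $C$ and elements $t_{ij}^{(r)},t_{ij}^{(-r)}$ ($i,j=1,\ldots,m+n$, $r=1,2,\ldots$) of parity $\bar i+\bar j$, with defining relations $$R(u-v)T_1(u)T_2(v)=T_2(v)T_1(u)R(u-v),\qquad R(u-v)T_1^+(u)T_2^+(v)=T_2^+(v)T_1^+(u)R(u-v),$$ $$\overline R(u-v+C/2)\,T_1(u)T_2^+(v)=T_2^+(v)T_1(u)\,\overline R(u-v-C/2),$$ where $T(u)=\sum_{i,j}(-1)^{\bar i\bar j+\bar j}e_{ij}\otimes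 t_{ij}(u)$, $t_{ij}(u)=\delta_{ij}+\sum_{r\geqslant1}t_{ij}^{(r)}u^{-r}$, $T^+(u)=\sum_{i,j}(-1)^{\bar i\bar j+\bar j}e_{ij}\otimes t_{ij}^+(u)$, $t^+_{ij}(u)=\delta_{ij}-\sum_{r\geqslant1}t_{ij}^{(-r)}u^{r-1}$; subscripts $1,2$ indicate the copy of $\mathrm{End}\,\mathbb{C}^{m|n}$ on which the matrix acts, and in the third relation $\overline R(u-v\pm C/2)$ is expanded in nonnegative powers of $v$ and $C$ and negative powers of $u$. The subalgebra generated by all $t_{ij}^{(r)}$ (resp. all $t_{ij}^{(-r)}$), $r\geqslant1$, is the Yangian $\mathrm{Y}(\mathfrak{gl}_{m|n})$ (resp. the dual Yangian $\mathrm{Y}^+(\mathfrak{gl}_{m|n})$), i.e. the algebra with these generators and the first (resp. second) relation. The extended dual Yangian $\widetilde{\mathrm{Y}}^+(\mathfrak{gl}_{m|n})$ is the completion of $\mathrm{Y}^+(\mathfrak{gl}_{m|n})$ with respect to the descending filtration defined by giving $t_{ij}^{(-r)}$ degree $r$. The extended double Yangian $\widetilde{\mathrm{DY}}(\mathfrak{gl}_{m|n})$ is the space of all finite $\mathbb{C}[C]$-linear combinations of products $xy$ with $x\in\widetilde{\mathrm{Y}}^+(\mathfrak{gl}_{m|n})$ and $y\in\mathrm{Y}(\mathfrak{gl}_{m|n})$, with multiplication extended by continuity from $\mathrm{DY}(\mathfrak{gl}_{m|n})$. Let $\tau\colon e_{ij}\mapsto(-1)^{\bar i\bar j+\bar i}e_{ji}$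 be the transposition on $\mathrm{End}\,\mathbb{C}^{m|n}$; $\tau_2$ means that $\tau$ is applied to the second tensor factor, and $(X_2)^\tau$ means that $\tau$ is applied to the copy of $\mathrm{End}\,\mathbb{C}^{m|n}$ on which $X_2$ acts. The series $z(u)\in\mathrm{Y}(\mathfrak{gl}_{m|n})[[u^{-1}]]$ and $z^+(u)\in\widetilde{\mathrm{Y}}^+(\mathfrak{gl}_{m|n})[[u]]$ are uniquely determined by $$P^{\tau_2}\,T_1(u+m-n)\big(T_2(u)^{-1}\big)^\tau=P^{\tau_2}\otimes z(u),\qquad P^{\tau_2}\,T^+_1(u+m-n)\big(T^+_2(u)^{-1}\big)^\tau=P^{\tau_2}\otimes z^+(u).$$ *)

theory Defs
  imports
    Complex_Main
    "HOL-Library.Poly_Mapping"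
    "HOL-Computational_Algebra.Formal_Power_Series"
    "HOL-Algebra.QuotRing"
    "HOL-Algebra.Generated_Rings"
    "HOL-Algebra.Generated_Groups"
begin

section \<open>Superalgebras over the complex numbers\<close>

text \<open>
  A complex superalgebra is a ring record with the structure map \<open>scal\<close> of scalars and
  the grading involution \<open>par\<close>, i.e. \<open>par a = (-1)^|a| a\<close> for homogeneous \<open>a\<close>.
  The involution determines the grading and makes the sign rule expressible for elements that
  need not be homogeneous: if \<open>c\<close> is homogeneous, then
  \<open>(a \<otimes> b)(c \<otimes> d) = ac \<otimes> par^|c|(b) d\<close>.
\<close>

record 'a superalg = "'a ring" +
  scal :: "complex \<Rightarrow> 'a"
  par :: "'a \<Rightarrow> 'a"

definition quot_superalg :: "('a, 'b) superalg_scheme \<Rightarrow> 'a set \<Rightarrow> 'a set superalg" where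
  "quot_superalg A I = ring.extend (A Quot I)
     (superalg.fields (\<lambda>c. I +>\<^bsub>A\<^esub> scal A c) (\<lambda>X. par A ` X))"

definition subalg_gen :: "('a, 'b) superalg_scheme \<Rightarrow> 'a set \<Rightarrow> 'a set" where
  "subalg_gen A S = generate_ring A (range (scal A) \<union> S)"

definition centre :: "('a, 'b) ring_scheme \<Rightarrow> 'a set" where
  "centre A = {z \<in> carrier A. \<forall>w \<in> carrier A. z \<otimes>\<^bsub>A\<^esub> w = w \<otimes>\<^bsub>A\<^esub> z}"

definition with_sign :: "('a, 'b) ring_scheme \<Rightarrow> nat \<Rightarrow> 'a \<Rightarrow> 'a" where
  "with_sign A e x = (if even e then x else \<ominus>\<^bsub>A\<^esub> x)"

definition delta :: "('a, 'b) ring_scheme \<Rightarrow> nat \<Rightarrow> nat \<Rightarrow> 'a" where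
  "delta A i j = (if i = j then \<one>\<^bsub>A\<^esub> else \<zero>\<^bsub>A\<^esub>)"

text \<open>Formal power series in one variable; the variable is read as \<open>u\<close> or as \<open>u\<inverse>\<close>.\<close>

definition power_series :: "('a, 'b) superalg_scheme \<Rightarrow> (nat \<Rightarrow> 'a) superalg" where
  "power_series A =
    \<lparr> carrier = {f. \<forall>k. f k \<in> carrier A},
      mult = (\<lambda>f g k. \<Oplus>\<^bsub>A\<^esub>i\<in>{..k}. f i \<otimes>\<^bsub>A\<^esub> g (k - i)),
      one = (\<lambda>k. if k = 0 then \<one>\<^bsub>A\<^esub> else \<zero>\<^bsub>A\<^esub>),
      zero = (\<lambda>k. \<zero>\<^bsub>A\<^esub>),
      add = (\<lambda>f g k. f k \<oplus>\<^bsub>A\<^esub> g k),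
      scal = (\<lambda>c k. if k = 0 then scal A c else \<zero>\<^bsub>A\<^esub>),
      par = (\<lambda>f k. par A (f k)) \<rparr>"

text \<open>
  Two-sided formal series in \<open>u\<close> and \<open>v\<close>; \<open>f p q\<close> is the coefficient of \<open>u^p v^q\<close>.
  Multiplication is only meaningful when each coefficient of the product is a finite sum.  This
  is the case for all products in the defining relations below: \<open>R(u - v + x)\<close> has only terms
  \<open>u^(-a) v^b\<close> with \<open>0 \<le> b \<le> a\<close>, and for the power series \<open>1\<close> in \<open>1 - P/(u - v)\<close> moreover
  \<open>a \<in> {0, b + 1}\<close>.
\<close>

definition two_sided_series :: "('a, 'b) superalg_scheme \<Rightarrow> (int \<Rightarrow> int \<Rightarrow> 'a) superalg" where
  "two_sided_series A =
    \<lparr> carrier = {f. \<forall>p q. f p q \<in> carrier A},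
      mult = (\<lambda>f g p q.
        finsum A (\<lambda>(a, b). f a b \<otimes>\<^bsub>A\<^esub> g (p - a) (q - b))
          {(a, b). f a b \<noteq> \<zero>\<^bsub>A\<^esub> \<and> g (p - a) (q - b) \<noteq> \<zero>\<^bsub>A\<^esub>}),
      one = (\<lambda>p q. if p = 0 \<and> q = 0 then \<one>\<^bsub>A\<^esub> else \<zero>\<^bsub>A\<^esub>),
      zero = (\<lambda>p q. \<zero>\<^bsub>A\<^esub>),
      add = (\<lambda>f g p q. f p q \<oplus>\<^bsub>A\<^esub> g p q),
      scal = (\<lambda>c p q. if p = 0 \<and> q = 0 then scal A c else \<zero>\<^bsub>A\<^esub>),
      par = (\<lambda>f p q. par A (f p q)) \<rparr>"

definition in_u_inv :: "('a, 'b) ring_scheme \<Rightarrow> (nat \<Rightarrow> 'a) \<Rightarrow> int \<Rightarrow> int \<Rightarrow> 'a" where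
  "in_u_inv A f p q = (if q = 0 \<and> p \<le> 0 then f (nat (- p)) else \<zero>\<^bsub>A\<^esub>)"

definition in_v_inv :: "('a, 'b) ring_scheme \<Rightarrow> (nat \<Rightarrow> 'a) \<Rightarrow> int \<Rightarrow> int \<Rightarrow> 'a" where
  "in_v_inv A f p q = (if p = 0 \<and> q \<le> 0 then f (nat (- q)) else \<zero>\<^bsub>A\<^esub>)"

definition in_u :: "('a, 'b) ring_scheme \<Rightarrow> (nat \<Rightarrow> 'a) \<Rightarrow> int \<Rightarrow> int \<Rightarrow> 'a" where
  "in_u A f p q = (if q = 0 \<and> p \<ge> 0 then f (nat p) else \<zero>\<^bsub>A\<^esub>)"

definition in_v :: "('a, 'b) ring_scheme \<Rightarrow> (nat \<Rightarrow> 'a) \<Rightarrow> int \<Rightarrow> int \<Rightarrow> 'a" where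
  "in_v A f p q = (if p = 0 \<and> q \<ge> 0 then f (nat q) else \<zero>\<^bsub>A\<^esub>)"


section \<open>The superalgebra \<open>End \<otimes> End \<otimes> A\<close>\<close>

definition pbar :: "nat \<Rightarrow> nat \<Rightarrow> nat" where
  "pbar m i = (if i \<le> m then 0 else 1)"

definition in_range4 :: "nat \<Rightarrow> nat \<Rightarrow> nat \<Rightarrow> nat \<Rightarrow> nat \<Rightarrow> nat \<Rightarrow> bool" where
  "in_range4 m n i j k l \<longleftrightarrow> {i, j, k, l} \<subseteq> {1..m + n}"

type_synonym 'a mat2 = "nat \<Rightarrow> nat \<Rightarrow> nat \<Rightarrow> nat \<Rightarrow> 'a"

text \<open>
  \<open>X i j k l\<close> is the coefficient \<open>a\<close> of \<open>e\<^sub>i\<^sub>j \<otimes> e\<^sub>k\<^sub>l \<otimes> a\<close>.  The product is given by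
  \<open>(e\<^sub>i\<^sub>p \<otimes> e\<^sub>k\<^sub>q \<otimes> a)(e\<^sub>p\<^sub>j \<otimes> e\<^sub>q\<^sub>l \<otimes> b) = (-1)^|e\<^sub>k\<^sub>q||e\<^sub>p\<^sub>j| e\<^sub>i\<^sub>j \<otimes> e\<^sub>k\<^sub>l \<otimes> par^(|e\<^sub>p\<^sub>j|+|e\<^sub>q\<^sub>l|)(a) b\<close>.
\<close>

definition End2 :: "nat \<Rightarrow> nat \<Rightarrow> ('a, 'b) superalg_scheme \<Rightarrow> 'a mat2 ring" where
  "End2 m n A =
    \<lparr> carrier = {X. \<forall>i j k l. if in_range4 m n i j k l then X i j k l \<in> carrier A
                               else X i j k l = \<zero>\<^bsub>A\<^esub>},
      mult = (\<lambda>X Y i j k l. if in_range4 m n i j k l then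
          (\<Oplus>\<^bsub>A\<^esub>p\<in>{1..m + n}. \<Oplus>\<^bsub>A\<^esub>q\<in>{1..m + n}.
             with_sign A ((pbar m k + pbar m q) * (pbar m p + pbar m j))
               ((par A ^^ (pbar m p + pbar m j + pbar m q + pbar m l)) (X i p k q)
                 \<otimes>\<^bsub>A\<^esub> Y p j q l))
        else \<zero>\<^bsub>A\<^esub>),
      one = (\<lambda>i j k l. if in_range4 m n i j k l \<and> i = j \<and> k = l then \<one>\<^bsub>A\<^esub> else \<zero>\<^bsub>A\<^esub>),
      zero = (\<lambda>i j k l. \<zero>\<^bsub>A\<^esub>),
      add = (\<lambda>X Y i j k l. X i j k l \<oplus>\<^bsub>A\<^esub> Y i j k l) \<rparr>"

text \<open>
  \<open>copy1\<close> and \<open>copy2\<close> turn a family \<open>t\<^sub>i\<^sub>j\<close> of entries into the matrices \<open>T\<^sub>1\<close> and \<open>T\<^sub>2\<close>, where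
  \<open>T = \<Sum> (-1)^(ij+j) e\<^sub>i\<^sub>j \<otimes> t\<^sub>i\<^sub>j\<close> (with parities of indices in the exponent).
\<close>

definition copy1 :: "nat \<Rightarrow> nat \<Rightarrow> ('a, 'b) superalg_scheme \<Rightarrow> (nat \<Rightarrow> nat \<Rightarrow> 'a) \<Rightarrow> 'a mat2" where
  "copy1 m n A t i j k l = (if in_range4 m n i j k l \<and> k = l
     then with_sign A (pbar m i * pbar m j + pbar m j) (t i j) else \<zero>\<^bsub>A\<^esub>)"

definition copy2 :: "nat \<Rightarrow> nat \<Rightarrow> ('a, 'b) superalg_scheme \<Rightarrow> (nat \<Rightarrow> nat \<Rightarrow> 'a) \<Rightarrow> 'a mat2" where
  "copy2 m n A t i j k l = (if in_range4 m n i j k l \<and> i = j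
     then with_sign A (pbar m k * pbar m l + pbar m l) (t k l) else \<zero>\<^bsub>A\<^esub>)"

definition perm_op :: "nat \<Rightarrow> nat \<Rightarrow> ('a, 'b) superalg_scheme \<Rightarrow> 'a mat2" where
  "perm_op m n A i j k l = (if in_range4 m n i j k l \<and> k = j \<and> l = i
     then with_sign A (pbar m j) \<one>\<^bsub>A\<^esub> else \<zero>\<^bsub>A\<^esub>)"

text \<open>The coefficient of \<open>e\<^sub>k\<^sub>l = \<tau>((-1)^(lk+l) e\<^sub>l\<^sub>k)\<close> in the second factor.\<close>

definition tau2 :: "nat \<Rightarrow> ('a, 'b) superalg_scheme \<Rightarrow> 'a mat2 \<Rightarrow> 'a mat2" where
  "tau2 m A X i j k l = with_sign A (pbar m l * pbar m k + pbar m l) (X i j l k)"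

text \<open>\<open>X \<otimes> s\<close> for \<open>X\<close> in \<open>End \<otimes> End\<close>, viewed in \<open>End \<otimes> End \<otimes> A\<close>, and \<open>s\<close> in \<open>A\<close>.\<close>

definition tens :: "('a, 'b) superalg_scheme \<Rightarrow> 'a mat2 \<Rightarrow> 'a \<Rightarrow> 'a mat2" where
  "tens A X s i j k l = X i j k l \<otimes>\<^bsub>A\<^esub> s"


section \<open>The free superalgebra on the generators\<close>

datatype 'g fword = FWord (letters: "'g list")

instantiation fword :: (type) monoid_add
begin

definition zero_fword :: "'a fword" where
  "0 = FWord []"

definition plus_fword :: "'a fword \<Rightarrow> 'a fword \<Rightarrow> 'a fword" where
  "a + b = FWord (letters a @ letters b)"

instance
  by standard (auto simp: zero_fword_def plus_fword_def)

end

text \<open>\<open>TGen i j r\<close> and \<open>TMinusGen i j r\<close> stand for \<open>t\<^sub>i\<^sub>j\<close> with superscript \<open>(r)\<close> and \<open>(-r)\<close>.\<close>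

datatype dy_gen = CGen | TGen nat nat nat | TMinusGen nat nat nat

definition plus_gens :: "nat \<Rightarrow> nat \<Rightarrow> dy_gen set" where
  "plus_gens m n = {TMinusGen i j r | i j r. i \<in> {1..m + n} \<and> j \<in> {1..m + n} \<and> 1 \<le> r}"

definition yangian_gens :: "nat \<Rightarrow> nat \<Rightarrow> dy_gen set" where
  "yangian_gens m n = {TGen i j r | i j r. i \<in> {1..m + n} \<and> j \<in> {1..m + n} \<and> 1 \<le> r}"

definition dy_gens :: "nat \<Rightarrow> nat \<Rightarrow> dy_gen set" where
  "dy_gens m n = {CGen} \<union> yangian_gens m n \<union> plus_gens m n"

fun gen_parity :: "nat \<Rightarrow> dy_gen \<Rightarrow> nat" where
  "gen_parity m CGen = 0"
| "gen_parity m (TGen i j r) = pbar m i + pbar m j"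
| "gen_parity m (TMinusGen i j r) = pbar m i + pbar m j"

definition word_parity :: "nat \<Rightarrow> dy_gen fword \<Rightarrow> nat" where
  "word_parity m w = sum_list (map (gen_parity m) (letters w))"

type_synonym free_el = "dy_gen fword \<Rightarrow>\<^sub>0 complex"

definition free_superalg :: "nat \<Rightarrow> nat \<Rightarrow> free_el superalg" where
  "free_superalg m n =
    \<lparr> carrier = {f. \<forall>w \<in> Poly_Mapping.keys f. set (letters w) \<subseteq> dy_gens m n},
      mult = (*), one = 1, zero = 0, add = (+),
      scal = Poly_Mapping.single 0,
      par = Poly_Mapping.mapp (\<lambda>w c. (- 1) ^ word_parity m w * c) \<rparr>"

definition gen_el :: "dy_gen \<Rightarrow> free_el" where
  "gen_el x = Poly_Mapping.single (FWord [x]) 1"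


section \<open>The double Yangian\<close>

text \<open>
  \<open>t r i j\<close> stands for the generator with superscript \<open>(r)\<close>, respectively \<open>(-r)\<close>; the results
  are power series in \<open>u\<inverse>\<close>, respectively in \<open>u\<close>.
\<close>

definition t_series ::
  "('a, 'b) superalg_scheme \<Rightarrow> (nat \<Rightarrow> nat \<Rightarrow> nat \<Rightarrow> 'a) \<Rightarrow> nat \<Rightarrow> nat \<Rightarrow> nat \<Rightarrow> 'a" where
  "t_series A t i j k = (if k = 0 then delta A i j else t i j k)"

definition tplus_series ::
  "('a, 'b) superalg_scheme \<Rightarrow> (nat \<Rightarrow> nat \<Rightarrow> nat \<Rightarrow> 'a) \<Rightarrow> nat \<Rightarrow> nat \<Rightarrow> nat \<Rightarrow> 'a" where
  "tplus_series A t i j k =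
     (if k = 0 then delta A i j else \<zero>\<^bsub>A\<^esub>) \<ominus>\<^bsub>A\<^esub> t i j (Suc k)"

text \<open>
  Series in \<open>u\<inverse>\<close> with complex coefficients are formal power series; the substitution
  \<open>u \<mapsto> u + c\<close> is \<open>u\<inverse> \<mapsto> u\<inverse> / (1 + c u\<inverse>)\<close>.
\<close>

definition g_series :: "nat \<Rightarrow> nat \<Rightarrow> complex fps" where
  "g_series m n = (THE g. fps_nth g 0 = 1 \<and>
     fps_compose g (fps_X / (1 + fps_const (of_nat m - of_nat n) * fps_X)) = (1 - fps_X\<^sup>2) * g)"

text \<open>
  \<open>f(u - v + x)\<close> for \<open>f = \<Sum>\<^sub>s f\<^sub>s u^(-s)\<close>, expanded in nonnegative powers of \<open>v\<close> and \<open>x\<close> and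
  negative powers of \<open>u\<close> by
  \<open>(u + (x - v))^(-s) = \<Sum>\<^sub>d (-s choose d) u^(-s-d) \<Sum>\<^sub>b (d choose b) (-v)^b x^(d-b)\<close>.
\<close>

definition subst_diff :: "('a, 'b) superalg_scheme \<Rightarrow> complex fps \<Rightarrow> 'a \<Rightarrow> int \<Rightarrow> int \<Rightarrow> 'a" where
  "subst_diff A f x p q = (if p \<le> 0 \<and> 0 \<le> q then
     let a = nat (- p); b = nat q in
       \<Oplus>\<^bsub>A\<^esub>s\<in>{s. s \<le> a \<and> b \<le> a - s}.
         scal A (fps_nth f s * ((- of_nat s) gchoose (a - s)) * of_nat ((a - s) choose b) * (- 1) ^ b)
           \<otimes>\<^bsub>A\<^esub> (x [^]\<^bsub>A\<^esub> (a - s - b))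
     else \<zero>\<^bsub>A\<^esub>)"

text \<open>The series \<open>f(w) (1 - P w\<inverse>)\<close> with \<open>w = u - v + x\<close>.\<close>

definition R_matrix ::
  "nat \<Rightarrow> nat \<Rightarrow> ('a, 'b) superalg_scheme \<Rightarrow> complex fps \<Rightarrow> 'a \<Rightarrow> (int \<Rightarrow> int \<Rightarrow> 'a) mat2" where
  "R_matrix m n A f x = (let L = two_sided_series A; M = End2 m n L in
     tens L \<one>\<^bsub>M\<^esub> (subst_diff A f x) \<ominus>\<^bsub>M\<^esub>
     tens L (perm_op m n L) (subst_diff A (f * fps_X) x))"

definition mat_coeffs :: "(int \<Rightarrow> int \<Rightarrow> 'a) mat2 \<Rightarrow> 'a set" where
  "mat_coeffs X = {X i j k l p q | i j k l p q. True}"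

definition dy_relators :: "nat \<Rightarrow> nat \<Rightarrow> free_el set" where
  "dy_relators m n = (let
      A = free_superalg m n;
      L = two_sided_series A;
      M = End2 m n L;
      t = t_series A (\<lambda>i j r. gen_el (TGen i j r));
      tp = tplus_series A (\<lambda>i j r. gen_el (TMinusGen i j r));
      T1_u = copy1 m n L (\<lambda>i j. in_u_inv A (t i j));
      T2_v = copy2 m n L (\<lambda>i j. in_v_inv A (t i j));
      Tp1_u = copy1 m n L (\<lambda>i j. in_u A (tp i j));
      Tp2_v = copy2 m n L (\<lambda>i j. in_v A (tp i j));
      C = gen_el CGen;
      R = R_matrix m n A 1 \<zero>\<^bsub>A\<^esub>;
      Rbar_plus = R_matrix m n A (g_series m n) (scal A (1 / 2) \<otimes>\<^bsub>A\<^esub> C);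
      Rbar_minus = R_matrix m n A (g_series m n) (scal A (- 1 / 2) \<otimes>\<^bsub>A\<^esub> C)
    in
      {C \<otimes>\<^bsub>A\<^esub> gen_el x \<ominus>\<^bsub>A\<^esub> gen_el x \<otimes>\<^bsub>A\<^esub> C | x. x \<in> dy_gens m n}
      \<union> mat_coeffs (R \<otimes>\<^bsub>M\<^esub> T1_u \<otimes>\<^bsub>M\<^esub> T2_v \<ominus>\<^bsub>M\<^esub> T2_v \<otimes>\<^bsub>M\<^esub> T1_u \<otimes>\<^bsub>M\<^esub> R)
      \<union> mat_coeffs (R \<otimes>\<^bsub>M\<^esub> Tp1_u \<otimes>\<^bsub>M\<^esub> Tp2_v \<ominus>\<^bsub>M\<^esub> Tp2_v \<otimes>\<^bsub>M\<^esub> Tp1_u \<otimes>\<^bsub>M\<^esub> R)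
      \<union> mat_coeffs (Rbar_plus \<otimes>\<^bsub>M\<^esub> T1_u \<otimes>\<^bsub>M\<^esub> Tp2_v
                    \<ominus>\<^bsub>M\<^esub> Tp2_v \<otimes>\<^bsub>M\<^esub> T1_u \<otimes>\<^bsub>M\<^esub> Rbar_minus))"

definition dy_ideal :: "nat \<Rightarrow> nat \<Rightarrow> free_el set" where
  "dy_ideal m n = genideal (free_superalg m n) (dy_relators m n)"

definition DY :: "nat \<Rightarrow> nat \<Rightarrow> free_el set superalg" where
  "DY m n = quot_superalg (free_superalg m n) (dy_ideal m n)"

definition dy_class :: "nat \<Rightarrow> nat \<Rightarrow> free_el \<Rightarrow> free_el set" where
  "dy_class m n f = dy_ideal m n +>\<^bsub>free_superalg m n\<^esub> f"

definition yangian :: "nat \<Rightarrow> nat \<Rightarrow> free_el set set" where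
  "yangian m n = subalg_gen (DY m n) ((\<lambda>x. dy_class m n (gen_el x)) ` yangian_gens m n)"

definition dual_yangian :: "nat \<Rightarrow> nat \<Rightarrow> free_el set set" where
  "dual_yangian m n = subalg_gen (DY m n) ((\<lambda>x. dy_class m n (gen_el x)) ` plus_gens m n)"


section \<open>The extended double Yangian\<close>

fun gen_degree :: "dy_gen \<Rightarrow> nat" where
  "gen_degree (TMinusGen i j r) = r"
| "gen_degree _ = 0"

definition word_degree :: "dy_gen fword \<Rightarrow> nat" where
  "word_degree w = sum_list (map gen_degree (letters w))"

text \<open>The \<open>p\<close>-th term of the descending filtration of the dual Yangian.\<close>

definition dual_yangian_filt :: "nat \<Rightarrow> nat \<Rightarrow> nat \<Rightarrow> free_el set set" where
  "dual_yangian_filt m n p = generate (add_monoid (DY m n))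
     {dy_class m n (Poly_Mapping.single w c) | w c.
        set (letters w) \<subseteq> plus_gens m n \<and> p \<le> word_degree w}"

text \<open>
  Continuity on the double Yangian refers to the topology in which the right ideals generated by
  the terms of the filtration of the dual Yangian are a base of neighbourhoods of zero.  Right
  multiplication by all elements is uniformly continuous, and left multiplication by each element
  is continuous, because moving an element of the Yangian to the right past an element of the
  dual Yangian lowers the degree of the latter by a bounded amount.
\<close>

definition dy_filt :: "nat \<Rightarrow> nat \<Rightarrow> nat \<Rightarrow> free_el set set" where
  "dy_filt m n p = generate (add_monoid (DY m n))
     {x \<otimes>\<^bsub>DY m n\<^esub> y | x y. x \<in> dual_yangian_filt m n p \<and> y \<in> carrier (DY m n)}"

definition cauchy_seqs :: "('a, 'b) ring_scheme \<Rightarrow> (nat \<Rightarrow> 'a set) \<Rightarrow> (nat \<Rightarrow> 'a) set" where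
  "cauchy_seqs A J = {x. (\<forall>k. x k \<in> carrier A) \<and>
     (\<forall>p. \<exists>N. \<forall>k\<ge>N. \<forall>l\<ge>N. x k \<ominus>\<^bsub>A\<^esub> x l \<in> J p)}"

definition null_seqs :: "('a, 'b) ring_scheme \<Rightarrow> (nat \<Rightarrow> 'a set) \<Rightarrow> (nat \<Rightarrow> 'a) set" where
  "null_seqs A J = {x. (\<forall>k. x k \<in> carrier A) \<and> (\<forall>p. \<exists>N. \<forall>k\<ge>N. x k \<in> J p)}"

definition cauchy_superalg ::
  "('a, 'b) superalg_scheme \<Rightarrow> (nat \<Rightarrow> 'a set) \<Rightarrow> (nat \<Rightarrow> 'a) superalg" where
  "cauchy_superalg A J =
    \<lparr> carrier = cauchy_seqs A J,
      mult = (\<lambda>x y k. x k \<otimes>\<^bsub>A\<^esub> y k),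
      one = (\<lambda>k. \<one>\<^bsub>A\<^esub>),
      zero = (\<lambda>k. \<zero>\<^bsub>A\<^esub>),
      add = (\<lambda>x y k. x k \<oplus>\<^bsub>A\<^esub> y k),
      scal = (\<lambda>c k. scal A c),
      par = (\<lambda>x k. par A (x k)) \<rparr>"

text \<open>The completion of the double Yangian; an auxiliary ambient superalgebra.\<close>

definition DY_hat :: "nat \<Rightarrow> nat \<Rightarrow> (nat \<Rightarrow> free_el set) set superalg" where
  "DY_hat m n = quot_superalg (cauchy_superalg (DY m n) (dy_filt m n))
     (null_seqs (DY m n) (dy_filt m n))"

definition dy_limit :: "nat \<Rightarrow> nat \<Rightarrow> (nat \<Rightarrow> free_el set) \<Rightarrow> (nat \<Rightarrow> free_el set) set" where
  "dy_limit m n x = null_seqs (DY m n) (dy_filt m n)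
     +>\<^bsub>cauchy_superalg (DY m n) (dy_filt m n)\<^esub> x"

definition dy_embed :: "nat \<Rightarrow> nat \<Rightarrow> free_el set \<Rightarrow> (nat \<Rightarrow> free_el set) set" where
  "dy_embed m n x = dy_limit m n (\<lambda>_. x)"

text \<open>
  The completion of the dual Yangian with respect to its own filtration, mapped to the
  completion of the double Yangian.
\<close>

definition ext_dual_yangian :: "nat \<Rightarrow> nat \<Rightarrow> (nat \<Rightarrow> free_el set) set set" where
  "ext_dual_yangian m n = dy_limit m n `
     {x \<in> cauchy_seqs (DY m n) (dual_yangian_filt m n). \<forall>k. x k \<in> dual_yangian m n}"

definition ext_DY :: "nat \<Rightarrow> nat \<Rightarrow> (nat \<Rightarrow> free_el set) set superalg" where
  "ext_DY m n = (DY_hat m n) \<lparr> carrier := generate (add_monoid (DY_hat m n))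
     {c \<otimes>\<^bsub>DY_hat m n\<^esub> x \<otimes>\<^bsub>DY_hat m n\<^esub> y | c x y.
        c \<in> subalg_gen (DY_hat m n) {dy_embed m n (dy_class m n (gen_el CGen))} \<and>
        x \<in> ext_dual_yangian m n \<and> y \<in> dy_embed m n ` yangian m n} \<rparr>"


section \<open>The series \<open>z(u)\<close> and \<open>z\<^sup>+(u)\<close>\<close>

definition tY :: "nat \<Rightarrow> nat \<Rightarrow> nat \<Rightarrow> nat \<Rightarrow> nat \<Rightarrow> free_el set" where
  "tY m n i j r = dy_class m n (gen_el (TGen i j r))"

definition tYplus :: "nat \<Rightarrow> nat \<Rightarrow> nat \<Rightarrow> nat \<Rightarrow> nat \<Rightarrow> free_el set" where
  "tYplus m n i j r = dy_class m n (gen_el (TMinusGen i j r))"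

text \<open>\<open>t\<^sub>i\<^sub>j(u + c)\<close>, where \<open>(u + c)^(-r) = \<Sum>\<^sub>d (-r choose d) c^d u^(-r-d)\<close>.\<close>

definition t_shift :: "nat \<Rightarrow> nat \<Rightarrow> complex \<Rightarrow> nat \<Rightarrow> nat \<Rightarrow> nat \<Rightarrow> (nat \<Rightarrow> free_el set) set" where
  "t_shift m n c i j k = dy_embed m n
     (\<Oplus>\<^bsub>DY m n\<^esub>r\<in>{..k}. scal (DY m n) (((- of_nat r) gchoose (k - r)) * c ^ (k - r))
        \<otimes>\<^bsub>DY m n\<^esub> t_series (DY m n) (tY m n) i j r)"

text \<open>
  \<open>t\<^sup>+\<^sub>i\<^sub>j(u + c)\<close>: the coefficient of \<open>u^k\<close> is the sum over \<open>s \<ge> k\<close> of \<open>(s choose k) c^(s-k)\<close> times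
  the coefficient of \<open>u^s\<close> in \<open>t\<^sup>+\<^sub>i\<^sub>j(u)\<close>, which converges in the extended dual Yangian.
\<close>

definition tplus_shift :: "nat \<Rightarrow> nat \<Rightarrow> complex \<Rightarrow> nat \<Rightarrow> nat \<Rightarrow> nat \<Rightarrow> (nat \<Rightarrow> free_el set) set" where
  "tplus_shift m n c i j k = dy_limit m n
     (\<lambda>N. \<Oplus>\<^bsub>DY m n\<^esub>s\<in>{k..N}. scal (DY m n) (of_nat (s choose k) * c ^ (s - k))
        \<otimes>\<^bsub>DY m n\<^esub> tplus_series (DY m n) (tYplus m n) i j s)"

text \<open>
  For a family \<open>t c i j\<close> of series standing for \<open>t\<^sub>i\<^sub>j(u + c)\<close>, the equation
  \<open>P\<^sup>\<tau> T\<^sub>1(u + m - n) (T\<^sub>2(u)\<inverse>)\<^sup>\<tau> = P\<^sup>\<tau> \<otimes> z(u)\<close>, with \<open>\<tau>\<close> acting on the second factor.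
\<close>

definition z_equation :: "nat \<Rightarrow> nat \<Rightarrow>
    (complex \<Rightarrow> nat \<Rightarrow> nat \<Rightarrow> nat \<Rightarrow> (nat \<Rightarrow> free_el set) set) \<Rightarrow>
    (nat \<Rightarrow> (nat \<Rightarrow> free_el set) set) \<Rightarrow> bool" where
  "z_equation m n t z \<longleftrightarrow> (let
      S = power_series (ext_DY m n);
      M = End2 m n S;
      Ptau = tau2 m S (perm_op m n S)
    in
      Ptau \<otimes>\<^bsub>M\<^esub> copy1 m n S (t (of_nat m - of_nat n))
           \<otimes>\<^bsub>M\<^esub> tau2 m S (inv\<^bsub>M\<^esub> (copy2 m n S (t 0)))
        = tens S Ptau z)"

definition is_z_series :: "nat \<Rightarrow> nat \<Rightarrow> (nat \<Rightarrow> (nat \<Rightarrow> free_el set) set) \<Rightarrow> bool" where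
  "is_z_series m n z \<longleftrightarrow>
     (\<forall>k. z k \<in> dy_embed m n ` yangian m n) \<and> z_equation m n (t_shift m n) z"

definition is_zplus_series :: "nat \<Rightarrow> nat \<Rightarrow> (nat \<Rightarrow> (nat \<Rightarrow> free_el set) set) \<Rightarrow> bool" where
  "is_zplus_series m n z \<longleftrightarrow>
     (\<forall>k. z k \<in> ext_dual_yangian m n) \<and> z_equation m n (tplus_shift m n) z"

end

theory Submission
  imports Defs "HOL-Computational_Algebra.Polynomial"
begin

unbundle fps_syntax

text \<open>
  The entry \<open>(j, l)\<close> of the equation for \<open>z(u)\<close> says that the contraction of \<open>T(u + \<kappa>)\<close>, where
  \<open>\<kappa> = m - n\<close>, with \<open>S = T(u)\<inverse>\<close> is \<open>\<delta>\<^sub>j\<^sub>l z(u)\<close>.  Let \<open>B\<close> be \<open>T(v)\<close> or \<open>T\<^sup>+(v)\<close>.  The relation between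
  \<open>T(u)\<close> and \<open>B\<close> moves \<open>B\<close> past \<open>S\<close>, the relation for \<open>T(u + \<kappa>)\<close> moves it past \<open>T(u + \<kappa>)\<close>; the additional
  terms, in which \<open>B\<close> is contracted with \<open>S\<close>, cancel because \<open>h(w) = 1/w\<close> satisfies
  \<open>h(w + \<kappa>) = h(w)/(1 + \<kappa> h(w))\<close>.  There remains \<open>c\<^sub>- B z = c\<^sub>+ z B\<close> with scalar series \<open>c\<^sub>\<plusminus>\<close>.  Between the
  Yangian and its dual both are \<open>1\<close> by the functional equation of \<open>g\<close>, and within each of them
  \<open>c\<^sub>+ = c\<^sub>-\<close> is not a zero divisor.  So \<open>z\<close> commutes with the generators, and by continuity with their limits.
  The same argument applies to \<open>z\<^sup>+\<close>.
\<close>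

section \<open>Signs and RTT relations in a ring\<close>

text \<open>The shift \<open>m - n\<close> in the equation of \<open>z\<close> is the supertrace of
  the identity: summing the relation between \<open>B\<close> and \<open>S\<close> over a repeated
  index produces the factor \<open>1 + \<kappa> h(w)\<close>, and this is the factor by which
  \<open>h(w)\<close> and \<open>h(w + \<kappa>)\<close> differ. Three obstacles shape the rest.
  \<open>T(u + \<kappa>)\<close> is a substitution with finite sums, but
  \<open>T\<^sup>+(v + \<kappa>)\<close> is a limit, so its relations are obtained from the
  uniqueness of limits. The neighbourhoods of zero are only right ideals, so the completion is a
  ring only once it is known how far left multiplication by a generator of the Yangian lowers
  degrees. And \<open>ext_DY\<close> is a span that is visibly stable only under the dual Yangian on
  the left and the Yangian on the right, so the inverse of \<open>T\<close> among matrices over it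
  has to be identified by one-sided cancellation. The algebraic core is proved in a ring given by a
  type class, with all parities turned into explicit signs.\<close>

definition sg :: "nat => 'a::ab_group_add => 'a" where
  "sg e x = (if even e then x else - x)"

lemma sg_0 [simp]: "sg e 0 = 0"
  by (simp add: sg_def)

lemma sg_zero [simp]: "sg 0 x = x"
  by (simp add: sg_def)

lemma sg_sg [simp]: "sg d (sg e x) = sg (d + e) x"
  by (auto simp: sg_def)

lemma sg_mult_right: "x * sg e y = sg e (x * y)" for x y :: "'a::ring_1"
  by (simp add: sg_def)

lemma sg_mult_left: "sg e x * y = sg e (x * y)" for x y :: "'a::ring_1"
  by (simp add: sg_def)

lemma sg_add: "sg e (x + y) = sg e x + sg e y"
  by (simp add: sg_def)

lemma sg_diff: "sg e (x - y) = sg e x - sg e y"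
  by (simp add: sg_def)

lemma sg_minus: "sg e (- x) = - sg e x"
  by (simp add: sg_def)

lemma sg_sum: "sg e (sum f A) = (\<Sum>x\<in>A. sg e (f x))"
  by (simp add: sg_def sum_negf)

text \<open>Every sign computation below ends here: both sides are brought to the form
  \<open>sg d x\<close> with \<open>d\<close> a polynomial in the parities of the indices, and
  agreement modulo 2 is left to propositional reasoning.\<close>

lemma sg_cong: "even d = even e ==> x = y ==> sg d x = sg e y"
  by (simp add: sg_def)

lemma sg_cancel: "even e ==> sg e x = x"
  by (simp add: sg_def)

lemma sg_eq_0 [simp]: "sg e x = 0 \<longleftrightarrow> x = 0"
  by (simp add: sg_def)

definition is_central :: "'a::ring_1 => bool" where
  "is_central c \<longleftrightarrow> (\<forall>x. c * x = x * c)"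

lemma is_centralD: "is_central c ==> c * x = x * c"
  by (simp add: is_central_def)

lemma central_left_commute: "is_central c ==> x * (c * y) = c * (x * y)"
  by (metis is_centralD mult.assoc)

text \<open>\<open>pp\<close> is the exponent of the sign for passing
  \<open>e\<^sub>i\<^sub>j\<close> across \<open>e\<^sub>k\<^sub>l\<close>; \<open>pt\<close> is the
  exponent that \<open>P\<close> leaves on a product of entries with exchanged indices.\<close>

abbreviation pp :: "(nat => nat) => nat => nat => nat => nat => nat" where
  "pp p i j k l \<equiv> (p i + p j) * (p k + p l)"

abbreviation pt :: "(nat => nat) => nat => nat => nat => nat" where
  "pt p k j l \<equiv> p k * p j + p k * p l + p j * p l"

text \<open>
  The entries of \<open>(\<alpha>\<^sub>+ - \<beta>\<^sub>+ P) A\<^sub>1 B\<^sub>2 = B\<^sub>2 A\<^sub>1 (\<alpha>\<^sub>- - \<beta>\<^sub>- P)\<close> for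
  \<open>A = \<Sum> e\<^sub>i\<^sub>j \<otimes> a\<^sub>i\<^sub>j\<close> and \<open>B = \<Sum> e\<^sub>i\<^sub>j \<otimes> b\<^sub>i\<^sub>j\<close> with \<open>a\<^sub>i\<^sub>j\<close> and \<open>b\<^sub>i\<^sub>j\<close> of parity \<open>i + j\<close>.
\<close>

definition rtt :: "nat set => (nat => nat) => 'r => 'r => 'r => 'r =>
    (nat => nat => 'r::ring_1) => (nat => nat => 'r) => bool" where
  "rtt I p \<alpha>p \<beta>p \<alpha>m \<beta>m a b \<longleftrightarrow> (\<forall>i\<in>I. \<forall>j\<in>I. \<forall>k\<in>I. \<forall>l\<in>I.
     \<alpha>p * sg (pp p i j k l) (a i j * b k l)
       - \<beta>p * sg (pt p k j l) (a k j * b i l)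
     = \<alpha>m * (b k l * a i j) - \<beta>m * sg (pt p k j l) (b k j * a i l))"

lemma rttD:
  assumes "rtt I p \<alpha>p \<beta>p \<alpha>m \<beta>m a b" "i \<in> I" "j \<in> I" "k \<in> I" "l \<in> I"
  shows "\<alpha>p * sg (pp p i j k l) (a i j * b k l)
       - \<beta>p * sg (pt p k j l) (a k j * b i l)
     = \<alpha>m * (b k l * a i j) - \<beta>m * sg (pt p k j l) (b k j * a i l)"
  using assms unfolding rtt_def by blast

text \<open>\<open>s\<close> is the inverse of \<open>a\<close>. The relation is taken with
  \<open>b\<close> as first factor because multiplying it by \<open>s\<close> on both sides moves
  \<open>b\<close> past \<open>s\<close>. A local unit \<open>e\<close> replaces 1: the application
  lives in a product of rings, where the unit of one factor is only an idempotent.\<close>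

locale rtt_inverse =
  fixes I :: "nat set" and p :: "nat => nat"
    and \<gamma>p \<delta>p \<gamma>m \<delta>m e :: "'r::ring_1"
    and a b s :: "nat => nat => 'r"
  assumes fin: "finite I"
    and dual: "rtt I p \<gamma>p (- \<delta>p) \<gamma>m (- \<delta>m) b a"
    and central: "is_central \<gamma>p" "is_central \<delta>p" "is_central \<gamma>m" "is_central \<delta>m"
    and unit_b: "!!i j. i \<in> I ==> j \<in> I ==> e * b i j = b i j \<and> b i j * e = b i j"
    and right_inv: "!!k l. k \<in> I ==> l \<in> I ==>
      (\<Sum>q\<in>I. sg (pp p q l k q) (a k q * s q l)) = (if k = l then e else 0)"
    and left_inv: "!!k l. k \<in> I ==> l \<in> I ==>
      (\<Sum>q\<in>I. sg (pp p q l k q) (s k q * a q l)) = (if k = l then e else 0)"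
begin

definition BS :: "nat => nat => 'r" where
  "BS k l = (\<Sum>q\<in>I. sg (pp p q l k q) (b k q * s q l))"

definition SB :: "nat => nat => 'r" where
  "SB k l = (\<Sum>q\<in>I. sg (pp p q l k q) (s k q * b q l))"

lemma pull: "x * (\<gamma>p * y) = \<gamma>p * (x * y)" "x * (\<delta>p * y) = \<delta>p * (x * y)"
  "x * (\<gamma>m * y) = \<gamma>m * (x * y)" "x * (\<delta>m * y) = \<delta>m * (x * y)"
  using central by (simp_all add: central_left_commute)

lemma s_b_relation:
  assumes x: "x \<in> I" and y: "y \<in> I" and i: "i \<in> I" and j: "j \<in> I"
  shows "\<gamma>p * sg (pp p x y i j) (s x y * b i j)
      + (if i = y then \<delta>p * sg (p y) (SB x j) else 0)
    = \<gamma>m * (b i j * s x y)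
      + (if x = j then \<delta>m * sg (p x * p y + p x * p i + p i * p y) (BS i y) else 0)"
proof -
  define c where "c = 1 + p x + p y + p i + p j"
  \<comment> \<open>The first part of the weight makes the sum of \<open>s x k * a k l\<close> over
    \<open>k\<close> a graded matrix product; the second part makes, together with the sign from the
    relation, the sum of \<open>a k l * s l y\<close> over \<open>l\<close> one as well. In each of
    the four terms an inverse pair is then summed away, and two of them leave \<open>SB\<close> and
    \<open>BS\<close>.\<close>
  define \<epsilon> where "\<epsilon> k l = pp p k l x k + p l * c" for k l
  have D: "\<gamma>p * sg (pp p i j k l) (b i j * a k l)
       + \<delta>p * sg (pt p k j l) (b k j * a i l)
     = \<gamma>m * (a k l * b i j) + \<delta>m * sg (pt p k j l) (a k j * b i l)"
    if "k \<in> I" "l \<in> I" for k l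
    using rttD[OF dual i j that] by simp
  have unit: "e * b u v = b u v" "b u v * e = b u v" if "u \<in> I" "v \<in> I" for u v
    using unit_b that by auto
  have t1: "(\<Sum>k\<in>I. \<Sum>l\<in>I. sg (\<epsilon> k l) (s x k *
      (\<gamma>p * sg (pp p i j k l) (b i j * a k l)) * s l y)) = \<gamma>p * sg (p y * c) (s x y * b i j)"
  proof -
    have "(\<Sum>l\<in>I. sg (\<epsilon> k l) (s x k * (\<gamma>p * sg (pp p i j k l) (b i j * a k l)) * s l y))
	= (if k = y then \<gamma>p * sg (p k * c) (s x k * b i j) else 0)" if k: "k \<in> I" for k
    proof -
      have "sg (\<epsilon> k l) (s x k * (\<gamma>p * sg (pp p i j k l) (b i j * a k l)) * s l y)
	  = \<gamma>p * sg (p k * c) (s x k * b i j * sg (pp p l y k l) (a k l * s l y))" for l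
	by (simp add: sg_mult_left sg_mult_right pull mult.assoc, rule sg_cong)
	   (auto simp: \<epsilon>_def c_def)
      then have "(\<Sum>l\<in>I. sg (\<epsilon> k l) (s x k * (\<gamma>p * sg (pp p i j k l) (b i j * a k l)) * s l y))
	 = \<gamma>p * sg (p k * c) (s x k * b i j * (\<Sum>l\<in>I. sg (pp p l y k l) (a k l * s l y)))"
	by (simp add: sg_sum sum_distrib_left)
      then show ?thesis
	using right_inv[OF k y] unit[OF i j] by (simp add: mult.assoc)
    qed
    then show ?thesis
      using fin y by simp
  qed
  have t3: "(\<Sum>k\<in>I. \<Sum>l\<in>I. sg (\<epsilon> k l) (s x k * (\<gamma>m * (a k l * b i j)) * s l y))
      = \<gamma>m * sg (p x * c) (b i j * s x y)"
  proof -
    have "(\<Sum>k\<in>I. sg (\<epsilon> k l) (s x k * (\<gamma>m * (a k l * b i j)) * s l y))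
	= (if x = l then \<gamma>m * sg (p l * c) (b i j * s l y) else 0)" if l: "l \<in> I" for l
    proof -
      have "sg (\<epsilon> k l) (s x k * (\<gamma>m * (a k l * b i j)) * s l y)
	  = \<gamma>m * sg (p l * c) (sg (pp p k l x k) (s x k * a k l) * (b i j * s l y))" for k
	by (simp add: sg_mult_left sg_mult_right pull mult.assoc, rule sg_cong)
	   (auto simp: \<epsilon>_def c_def)
      then have "(\<Sum>k\<in>I. sg (\<epsilon> k l) (s x k * (\<gamma>m * (a k l * b i j)) * s l y))
	 = \<gamma>m * sg (p l * c) ((\<Sum>k\<in>I. sg (pp p k l x k) (s x k * a k l)) * (b i j * s l y))"
	by (simp add: sg_sum sum_distrib_left sum_distrib_right)
      then show ?thesis
	using left_inv[OF x l] unit[OF i j] by (simp flip: mult.assoc)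
    qed
    then show ?thesis
      using fin x by (subst sum.swap) simp
  qed
  have t2: "(\<Sum>k\<in>I. \<Sum>l\<in>I. sg (\<epsilon> k l) (s x k *
      (\<delta>p * sg (pt p k j l) (b k j * a i l)) * s l y))
      = (if i = y then \<delta>p * sg (p i + p j * p x) (SB x j) else 0)"
  proof -
    have "(\<Sum>l\<in>I. sg (\<epsilon> k l) (s x k * (\<delta>p * sg (pt p k j l) (b k j * a i l)) * s l y))
	= (if i = y then \<delta>p * sg (p i + p j * p x) (sg (pp p k j x k) (s x k * b k j)) else 0)"
      if k: "k \<in> I" for k
    proof -
      have "sg (\<epsilon> k l) (s x k * (\<delta>p * sg (pt p k j l) (b k j * a i l)) * s l y)
	  = \<delta>p * sg (p i * p y + p k * (1 + p x + p j)) (s x k * b k j * sg (pp p l y i l) (a i l * s l y))" for l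
	by (simp add: sg_mult_left sg_mult_right pull mult.assoc, rule sg_cong)
	   (auto simp: \<epsilon>_def c_def)
      then have "(\<Sum>l\<in>I. sg (\<epsilon> k l) (s x k * (\<delta>p * sg (pt p k j l) (b k j * a i l)) * s l y))
	 = \<delta>p * sg (p i * p y + p k * (1 + p x + p j)) (s x k * b k j * (\<Sum>l\<in>I. sg (pp p l y i l) (a i l * s l y)))"
	by (simp add: sg_sum sum_distrib_left)
      then show ?thesis
	using right_inv[OF i y] unit[OF k j]
	by (auto simp add: mult.assoc intro!: arg_cong[of _ _ "(*) \<delta>p"] sg_cong)
    qed
    then show ?thesis
      using fin y by (simp add: SB_def sg_sum sum_distrib_left)
  qed
  have t4: "(\<Sum>k\<in>I. \<Sum>l\<in>I. sg (\<epsilon> k l) (s x k *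
      (\<delta>m * sg (pt p k j l) (a k j * b i l)) * s l y))
      = (if x = j then \<delta>m * sg (p x + p i * p y) (BS i y) else 0)"
  proof -
    have "(\<Sum>k\<in>I. sg (\<epsilon> k l) (s x k * (\<delta>m * sg (pt p k j l) (a k j * b i l)) * s l y))
	= (if x = j then \<delta>m * sg (p x + p i * p y) (sg (pp p l y i l) (b i l * s l y)) else 0)"
      if l: "l \<in> I" for l
    proof -
      have "sg (\<epsilon> k l) (s x k * (\<delta>m * sg (pt p k j l) (a k j * b i l)) * s l y)
	  = \<delta>m * sg (p j * p x + p l * (1 + p i + p y)) (sg (pp p k j x k) (s x k * a k j) * (b i l * s l y))" for k
	by (simp add: sg_mult_left sg_mult_right pull mult.assoc, rule sg_cong)
	   (auto simp: \<epsilon>_def c_def)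
      then have "(\<Sum>k\<in>I. sg (\<epsilon> k l) (s x k * (\<delta>m * sg (pt p k j l) (a k j * b i l)) * s l y))
	 = \<delta>m * sg (p j * p x + p l * (1 + p i + p y)) ((\<Sum>k\<in>I. sg (pp p k j x k) (s x k * a k j)) * (b i l * s l y))"
	by (simp add: sg_sum sum_distrib_left sum_distrib_right)
      then show ?thesis
	using left_inv[OF x j] unit[OF i l]
	by (auto simp flip: mult.assoc intro!: arg_cong[of _ _ "(*) \<delta>m"] sg_cong)
    qed
    then show ?thesis
      using fin x by (subst sum.swap) (simp add: BS_def sg_sum sum_distrib_left)
  qed
  have "(\<Sum>k\<in>I. \<Sum>l\<in>I. sg (\<epsilon> k l) (s x k *
      (\<gamma>p * sg (pp p i j k l) (b i j * a k l)
       + \<delta>p * sg (pt p k j l) (b k j * a i l)) * s l y))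
    = (\<Sum>k\<in>I. \<Sum>l\<in>I. sg (\<epsilon> k l) (s x k *
      (\<gamma>m * (a k l * b i j) + \<delta>m * sg (pt p k j l) (a k j * b i l)) * s l y))"
    by (intro sum.cong refl) (simp only: D)
  then have "\<gamma>p * sg (p y * c) (s x y * b i j) + (if i = y then \<delta>p * sg (p i + p j * p x) (SB x j) else 0)
     = \<gamma>m * sg (p x * c) (b i j * s x y) + (if x = j then \<delta>m * sg (p x + p i * p y) (BS i y) else 0)"
    by (simp add: distrib_left[where 'a='r] distrib_right[where 'a='r] sg_add sum.distrib t1 t2 t3 t4)
  then have "sg (p x * c) (\<gamma>p * sg (p y * c) (s x y * b i j) + (if i = y then \<delta>p * sg (p i + p j * p x) (SB x j) else 0))
     = sg (p x * c) (\<gamma>m * sg (p x * c) (b i j * s x y) + (if x = j then \<delta>m * sg (p x + p i * p y) (BS i y) else 0))"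
    by simp
  moreover have "sg (p x * c) (\<gamma>p * sg (p y * c) (s x y * b i j)) = \<gamma>p * sg (pp p x y i j) (s x y * b i j)"
    by (simp add: sg_mult_right, rule sg_cong) (auto simp: c_def)
  moreover have "sg (p x * c) (\<gamma>m * sg (p x * c) (b i j * s x y)) = \<gamma>m * (b i j * s x y)"
    by (simp add: sg_mult_right sg_cancel)
  moreover have "sg (p x * c) (if i = y then \<delta>p * sg (p i + p j * p x) (SB x j) else 0)
      = (if i = y then \<delta>p * sg (p y) (SB x j) else 0)"
    by (auto simp add: sg_mult_right c_def intro!: sg_cong)
  moreover have "sg (p x * c) (if x = j then \<delta>m * sg (p x + p i * p y) (BS i y) else 0)
      = (if x = j then \<delta>m * sg (p x * p y + p x * p i + p i * p y) (BS i y) else 0)"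
    by (auto simp add: sg_mult_right c_def intro!: sg_cong)
  ultimately show ?thesis
    by (simp only: sg_add)
qed

text \<open>
  With \<open>w = u - v\<close>, the hypotheses on the scalars say that \<open>\<beta>/\<alpha> = h(w + \<kappa>)\<close> for \<open>h(w) = \<delta>/\<gamma>\<close> with
  \<open>h(w + \<kappa>) = h(w)/(1 + \<kappa>h(w))\<close>.  The families \<open>W\<close> and \<open>V\<close> below are the two ways to insert an
  entry of \<open>B\<close> between \<open>a'\<close> and \<open>s\<close>; eliminating \<open>SB\<close> leaves only their contractions.
\<close>

lemma contraction_commutes:
  fixes \<kappa> \<alpha>p \<beta>p \<alpha>m \<beta>m z :: 'r and a' :: "nat => nat => 'r"
  assumes shifted: "rtt I p \<alpha>p \<beta>p \<alpha>m \<beta>m a' b"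
    and central': "is_central \<alpha>p" "is_central \<beta>p" "is_central \<alpha>m" "is_central \<beta>m"
    and \<kappa>: "\<kappa> = (\<Sum>i\<in>I. sg (p i) 1)"
    and ratio_p: "\<beta>p * (\<gamma>p + \<kappa> * \<delta>p) = \<alpha>p * \<delta>p"
    and ratio_m: "\<beta>m * (\<gamma>m + \<kappa> * \<delta>m) = \<alpha>m * \<delta>m"
    and contraction: "!!j l. j \<in> I ==> l \<in> I ==> (\<Sum>q\<in>I. a' q j * s l q) = (if j = l then z else 0)"
    and k: "k \<in> I" and l: "l \<in> I"
  shows "\<alpha>m * \<gamma>m * (b k l * z) = \<alpha>p * \<gamma>p * (z * b k l)"
proof -
  have \<kappa>c: "is_central \<kappa>"
    unfolding \<kappa> is_central_def by (simp add: sum_distrib_left sum_distrib_right sg_mult_left sg_mult_right)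
  note pulls = pull central_left_commute[OF central'(1)] central_left_commute[OF central'(2)]
    central_left_commute[OF central'(3)] central_left_commute[OF central'(4)] central_left_commute[OF \<kappa>c]
  define \<omega> where "\<omega> j k l = pt p j k l" for j k l
  define W where "W i j k l = (\<Sum>q\<in>I. sg (pp p k l j q) (a' q i * b k l * s j q))" for i j k l
  define V where "V k i j l = (\<Sum>q\<in>I. a' k i * b q l * s j q)" for k i j l
  define Y where "Y i k = (\<Sum>q\<in>I. W i q k q)" for i k
  define U where "U k i = (\<Sum>q\<in>I. sg (p q) (V k i q q))" for k i
  have Y_BS: "Y i k = (\<Sum>q\<in>I. a' q i * BS k q)" if "k \<in> I" for i k
    unfolding Y_def W_def BS_def
    by (subst sum.swap) (auto simp: sum_distrib_left sg_mult_right mult.assoc intro!: sum.cong sg_cong)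
  have U_BS: "U k i = (\<Sum>q\<in>I. sg (p q) (a' k i * BS q q))" for i k
    unfolding U_def V_def BS_def
    by (simp add: sum_distrib_left sg_mult_right sg_sum, subst sum.swap)
       (auto simp: mult.assoc intro!: sum.cong sg_cong)
  \<comment> \<open>\<open>s_b_relation\<close> contracted with \<open>a'\<close> from the left. The
    contraction of \<open>a'\<close> with \<open>s\<close> turns the first term into
    \<open>z * b k l\<close>; the term with \<open>SB\<close> is the obstruction.\<close>
  have eq1: "\<gamma>m * W i j k l + (if j = l then \<delta>m * sg (p l) (Y i k) else 0)
      = (if i = j then \<gamma>p * (z * b k l) else 0) + \<delta>p * sg (\<omega> j k l) (a' k i * SB j l)"
    if i: "i \<in> I" and j: "j \<in> I" and k: "k \<in> I" and l: "l \<in> I" for i j k l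
  proof -
    have "(\<Sum>q\<in>I. sg (pp p k l j q) (a' q i * (\<gamma>p * sg (pp p j q k l) (s j q * b k l)
	  + (if k = q then \<delta>p * sg (p q) (SB j l) else 0))))
	= (\<Sum>q\<in>I. sg (pp p k l j q) (a' q i * (\<gamma>m * (b k l * s j q)
	  + (if j = l then \<delta>m * sg (p j * p q + p j * p k + p k * p q) (BS k q) else 0))))"
      by (intro sum.cong refl) (simp only: s_b_relation[OF j _ k l])
    moreover have "(\<Sum>q\<in>I. sg (pp p k l j q) (a' q i * (\<gamma>p * sg (pp p j q k l) (s j q * b k l)
	  + (if k = q then \<delta>p * sg (p q) (SB j l) else 0))))
	= \<gamma>p * ((\<Sum>q\<in>I. a' q i * s j q) * b k l) + \<delta>p * sg (\<omega> j k l) (a' k i * SB j l)"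
    proof -
      have "sg (pp p k l j q) (a' q i * (\<gamma>p * sg (pp p j q k l) (s j q * b k l)
	  + (if k = q then \<delta>p * sg (p q) (SB j l) else 0)))
	 = \<gamma>p * (a' q i * s j q * b k l) + (if k = q then \<delta>p * sg (\<omega> j k l) (a' k i * SB j l) else 0)" for q
	by (auto simp: distrib_left[where 'a='r] sg_add sg_mult_right pulls mult.assoc \<omega>_def
	    intro!: arg_cong2[of _ _ _ _ "(+)"] sg_cong sg_cancel)
      then show ?thesis
	using fin k by (simp add: sum.distrib sum_distrib_left sum_distrib_right)
    qed
    moreover have "(\<Sum>q\<in>I. sg (pp p k l j q) (a' q i * (\<gamma>m * (b k l * s j q)
	  + (if j = l then \<delta>m * sg (p j * p q + p j * p k + p k * p q) (BS k q) else 0))))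
	= \<gamma>m * W i j k l + (if j = l then \<delta>m * sg (p l) (Y i k) else 0)"
    proof -
      have "sg (pp p k l j q) (a' q i * (\<gamma>m * (b k l * s j q)
	  + (if j = l then \<delta>m * sg (p j * p q + p j * p k + p k * p q) (BS k q) else 0)))
	 = \<gamma>m * sg (pp p k l j q) (a' q i * b k l * s j q)
	   + (if j = l then \<delta>m * sg (p l) (a' q i * BS k q) else 0)" for q
	by (auto simp: distrib_left[where 'a='r] sg_add sg_mult_right pulls mult.assoc
	    intro!: arg_cong2[of _ _ _ _ "(+)"] sg_cong sg_cancel)
      then show ?thesis
	using fin k by (auto simp add: sum.distrib sum_distrib_left sg_sum W_def Y_BS)
    qed
    ultimately show ?thesis
      using contraction[OF i j] by auto
  qed
  \<comment> \<open>Here the row index of \<open>b\<close> is set equal to the column index of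
    \<open>s\<close> and summed. The term with \<open>SB\<close> then occurs once per index with its
    sign, so the supertrace \<open>\<kappa>\<close> appears; multiplying by the single entry
    \<open>a' k i\<close> yields the same obstruction as in \<open>eq1\<close>.\<close>
  have eq2: "\<gamma>m * V k i j l + (if j = l then \<delta>m * U k i else 0)
      = (\<gamma>p + \<kappa> * \<delta>p) * (a' k i * SB j l)"
    if i: "i \<in> I" and j: "j \<in> I" and k: "k \<in> I" and l: "l \<in> I" for i j k l
  proof -
    have "(\<Sum>q\<in>I. a' k i * (\<gamma>p * sg (pp p j q q l) (s j q * b q l)
	  + \<delta>p * sg (p q) (SB j l)))
	= (\<Sum>q\<in>I. a' k i * (\<gamma>m * (b q l * s j q)
	  + (if j = l then \<delta>m * sg (pt p j q q) (BS q q) else 0)))"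
      using s_b_relation[OF j _ _ l] by (intro sum.cong refl) fastforce
    moreover have "(\<Sum>q\<in>I. a' k i * (\<gamma>p * sg (pp p j q q l) (s j q * b q l)
	  + \<delta>p * sg (p q) (SB j l))) = (\<gamma>p + \<kappa> * \<delta>p) * (a' k i * SB j l)"
    proof -
      have "a' k i * (\<gamma>p * sg (pp p j q q l) (s j q * b q l) + \<delta>p * sg (p q) (SB j l))
	 = \<gamma>p * (a' k i * sg (pp p q l j q) (s j q * b q l))
	   + sg (p q) 1 * (\<delta>p * (a' k i * SB j l))" for q
	by (simp add: distrib_left[where 'a='r] sg_mult_right sg_mult_left pulls mult.assoc mult.commute[of "p j + p q"])
      then have "(\<Sum>q\<in>I. a' k i * (\<gamma>p * sg (pp p j q q l) (s j q * b q l)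
	  + \<delta>p * sg (p q) (SB j l)))
	= \<gamma>p * (a' k i * (\<Sum>q\<in>I. sg (pp p q l j q) (s j q * b q l)))
	  + (\<Sum>q\<in>I. sg (p q) 1) * (\<delta>p * (a' k i * SB j l))"
	by (simp add: sum.distrib sum_distrib_left sum_distrib_right)
      then show ?thesis
	by (simp add: SB_def[symmetric] \<kappa>[symmetric] distrib_right[where 'a='r] mult.assoc)
    qed
    moreover have "(\<Sum>q\<in>I. a' k i * (\<gamma>m * (b q l * s j q)
	  + (if j = l then \<delta>m * sg (pt p j q q) (BS q q) else 0)))
	= \<gamma>m * V k i j l + (if j = l then \<delta>m * U k i else 0)"
    proof -
      have "a' k i * (\<gamma>m * (b q l * s j q)
	  + (if j = l then \<delta>m * sg (pt p j q q) (BS q q) else 0))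
	 = \<gamma>m * (a' k i * b q l * s j q) + (if j = l then \<delta>m * sg (p q) (a' k i * BS q q) else 0)" for q
	by (auto simp: distrib_left[where 'a='r] sg_mult_right pulls mult.assoc
	    intro!: arg_cong2[of _ _ _ _ "(+)"] sg_cong)
      then show ?thesis
	by (auto simp add: sum.distrib sum_distrib_left V_def U_BS)
    qed
    ultimately show ?thesis by simp
  qed
  \<comment> \<open>The combination of \<open>W\<close> and \<open>V\<close> to which the relation
    between \<open>a'\<close> and \<open>b\<close> applies inside the sum over
    \<open>q\<close>.\<close>
  define E where "E i j k l = \<alpha>p * W i j k l - \<beta>p * sg (\<omega> j k l) (V k i j l)" for i j k l
  have eq3: "E i j k l = \<alpha>m * sg (pp p i j k l) (if i = j then b k l * z else 0)
	- (if j = l then \<beta>m * sg (p l) (b k i * z) else 0)"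
    if i: "i \<in> I" and j: "j \<in> I" and k: "k \<in> I" and l: "l \<in> I" for i j k l
  proof -
    have "(\<Sum>q\<in>I. sg (pp p i j k l)
	  ((\<alpha>p * sg (pp p q i k l) (a' q i * b k l)
	    - \<beta>p * sg (pt p k i l) (a' k i * b q l)) * s j q))
      = (\<Sum>q\<in>I. sg (pp p i j k l)
	  ((\<alpha>m * (b k l * a' q i) - \<beta>m * sg (pt p k i l) (b k i * a' q l)) * s j q))"
      by (intro sum.cong refl) (simp only: rttD[OF shifted _ i k l])
    moreover have "sg (pp p i j k l)
	  ((\<alpha>p * sg (pp p q i k l) (a' q i * b k l)
	    - \<beta>p * sg (pt p k i l) (a' k i * b q l)) * s j q)
	= \<alpha>p * sg (pp p k l j q) (a' q i * b k l * s j q)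
	  - \<beta>p * sg (\<omega> j k l) (a' k i * b q l * s j q)" for q
      by (auto simp: left_diff_distrib[where 'a='r] sg_diff sg_mult_right sg_mult_left mult.assoc \<omega>_def
	  intro!: arg_cong2[of _ _ _ _ "(-)"] sg_cong)
    moreover have "sg (pp p i j k l)
	  ((\<alpha>m * (b k l * a' q i) - \<beta>m * sg (pt p k i l) (b k i * a' q l)) * s j q)
	= \<alpha>m * sg (pp p i j k l) (b k l * (a' q i * s j q))
	  - \<beta>m * sg (\<omega> j k l) (b k i * (a' q l * s j q))" for q
      by (auto simp: left_diff_distrib[where 'a='r] sg_diff sg_mult_right sg_mult_left mult.assoc \<omega>_def
	  intro!: arg_cong2[of _ _ _ _ "(-)"] sg_cong)
    ultimately have "E i j k l = \<alpha>m * sg (pp p i j k l) (b k l * (\<Sum>q\<in>I. a' q i * s j q))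
	  - \<beta>m * sg (\<omega> j k l) (b k i * (\<Sum>q\<in>I. a' q l * s j q))"
      by (simp add: E_def W_def V_def sum_subtractf sum_distrib_left sg_sum)
    then show ?thesis
      using contraction[OF i j] contraction[OF l j]
      by (auto simp: \<omega>_def intro!: arg_cong[of _ _ "(*) \<beta>m"] sg_cong)
  qed
  \<comment> \<open>The contractions \<open>Y\<close> and \<open>U\<close> left over in
    \<open>eq1\<close> and \<open>eq2\<close> are needed only in this combination. It is a partial
    trace of \<open>E\<close>, so it reduces to multiples of \<open>b k l * z\<close>, again with a
    supertrace.\<close>
  have "(\<Sum>q\<in>I. E l q k q) = \<alpha>p * Y l k - \<beta>p * U k l"
    by (simp add: E_def Y_def U_def \<omega>_def sum_subtractf sum_distrib_left)
       (intro sum.cong refl arg_cong[of _ _ "(*) \<beta>p"] sg_cong, auto)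
  moreover have "(\<Sum>q\<in>I. E l q k q) = \<alpha>m * (b k l * z) - \<beta>m * (\<kappa> * (b k l * z))"
  proof -
    have "(\<Sum>q\<in>I. E l q k q) = (\<Sum>q\<in>I. (if l = q then \<alpha>m * (b k l * z) else 0) - \<beta>m * (sg (p q) 1 * (b k l * z)))"
      by (intro sum.cong refl) (auto simp: eq3 k l sg_mult_left sg_mult_right sg_cancel)
    then show ?thesis
      using fin l by (simp add: sum_subtractf sum_distrib_left \<kappa> sum_distrib_right)
  qed
  ultimately have trace: "\<alpha>p * Y l k - \<beta>p * U k l = \<alpha>m * (b k l * z) - \<beta>m * (\<kappa> * (b k l * z))"
    by simp
  \<comment> \<open>At \<open>i = j = l\<close> both Kronecker terms are present.
    \<open>ratio_p\<close> is exactly what makes the multiples of \<open>SB l l\<close> cancel;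
    \<open>ratio_m\<close> does the same below for the sign-dependent terms in
    \<open>b k l * z\<close>.\<close>
  have "\<alpha>p * (\<gamma>m * W l l k l + \<delta>m * sg (p l) (Y l k)) - \<beta>p * sg (p l) (\<gamma>m * V k l l l + \<delta>m * U k l)
      = \<alpha>p * (\<gamma>p * (z * b k l))"
  proof -
    have "sg (\<omega> l k l) x = sg (p l) x" for x :: 'r
      by (rule sg_cong) (auto simp: \<omega>_def)
    with eq1[OF l l k l] have 1: "\<gamma>m * W l l k l + \<delta>m * sg (p l) (Y l k)
	= \<gamma>p * (z * b k l) + \<delta>p * sg (p l) (a' k l * SB l l)"
      by simp
    have 2: "\<gamma>m * V k l l l + \<delta>m * U k l = (\<gamma>p + \<kappa> * \<delta>p) * (a' k l * SB l l)"
      using eq2[OF l l k l] by simp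
    have "\<alpha>p * (\<gamma>p * (z * b k l) + \<delta>p * sg (p l) (a' k l * SB l l))
	- \<beta>p * sg (p l) ((\<gamma>p + \<kappa> * \<delta>p) * (a' k l * SB l l))
      = \<alpha>p * (\<gamma>p * (z * b k l)) + sg (p l) ((\<alpha>p * \<delta>p - \<beta>p * (\<gamma>p + \<kappa> * \<delta>p)) * (a' k l * SB l l))"
      by (simp add: algebra_simps sg_mult_right sg_mult_left sg_diff sg_add)
    then show ?thesis
      unfolding 1 2 by (simp add: ratio_p)
  qed
  also have "\<alpha>p * (\<gamma>m * W l l k l + \<delta>m * sg (p l) (Y l k)) - \<beta>p * sg (p l) (\<gamma>m * V k l l l + \<delta>m * U k l)
      = \<gamma>m * E l l k l + \<delta>m * sg (p l) (\<alpha>p * Y l k - \<beta>p * U k l)"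
  proof -
    have "sg (\<omega> l k l) x = sg (p l) x" for x :: 'r
      by (rule sg_cong) (auto simp: \<omega>_def)
    then show ?thesis
      by (simp add: E_def algebra_simps sg_mult_right sg_mult_left sg_diff sg_add
	  pull(3)[of \<alpha>p] pull(3)[of \<beta>p] pull(4)[of \<alpha>p] pull(4)[of \<beta>p])
  qed
  also have "E l l k l = \<alpha>m * (b k l * z) - \<beta>m * sg (p l) (b k l * z)"
    using eq3[OF l l k l] by (simp add: sg_cancel)
  also note trace
  finally have "\<gamma>m * (\<alpha>m * (b k l * z)) + sg (p l) ((\<alpha>m * \<delta>m - \<beta>m * (\<gamma>m + \<kappa> * \<delta>m)) * (b k l * z)) = \<alpha>p * (\<gamma>p * (z * b k l))"
    by (simp add: algebra_simps sg_mult_right sg_mult_left sg_diff sg_add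
	pull(3)[of \<beta>m] pull(4)[of \<alpha>m] pull(4)[of \<beta>m] pull(4)[of \<kappa>])
  then show ?thesis
    by (simp add: ratio_m mult.assoc pull(3)[of \<alpha>m])
qed

end

section \<open>Series in \<open>u - v\<close>\<close>

text \<open>The variable \<open>fps_X\<close> stands for \<open>u\<inverse>\<close>, so \<open>shift_fps \<kappa>\<close> is \<open>(u + \<kappa>)\<inverse>\<close>.\<close>

definition shift_fps :: "complex => complex fps" where
  "shift_fps \<kappa> = fps_X / (1 + fps_const \<kappa> * fps_X)"

lemma shift_fps_mult: "shift_fps \<kappa> * (1 + fps_const \<kappa> * fps_X) = fps_X"
proof -
  have "(1 + fps_const \<kappa> * fps_X :: complex fps) $ 0 \<noteq> 0" by simp
  then show ?thesis
    unfolding shift_fps_def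
    by (simp only: fps_divide_unit mult.assoc inverse_mult_eq_1 mult_1_right not_False_eq_True)
qed

lemma shift_fps_0 [simp]: "shift_fps \<kappa> $ 0 = 0"
proof -
  have "(shift_fps \<kappa> * (1 + fps_const \<kappa> * fps_X)) $ 0 = 0"
    by (simp add: shift_fps_mult)
  then show ?thesis by simp
qed

text \<open>\<open>F\<close> is \<open>1/(u + x)\<close> in the variable \<open>1/u\<close>.
  Multiplying \<open>F ^ Suc s\<close> by the denominator gives a recursion, which Pascal's rule
  with negative upper index solves. \<open>\<theta>\<close> carries the binomials into the
  coefficient ring, so that \<open>x\<close> may be a number or the polynomial
  \<open>- y\<close>.\<close>

lemma geometric_power_nth:
  fixes F :: "'c::comm_ring_1 fps" and \<theta> :: "complex => 'c"
  assumes F: "F * (1 + fps_const x * fps_X) = fps_X"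
    and \<theta>: "!!a b. \<theta> (a + b) = \<theta> a + \<theta> b" "\<theta> 1 = 1" "\<theta> 0 = 0"
  shows "(F ^ s) $ n = (if s \<le> n then \<theta> ((- of_nat s) gchoose (n - s)) * x ^ (n - s) else 0)"
proof (induction s arbitrary: n)
  case 0
  show ?case by (cases n) (auto simp: \<theta> gbinomial_0_left)
next
  case (Suc s)
  have "F ^ Suc s * (1 + fps_const x * fps_X) = fps_X * F ^ s"
    by (simp only: power_Suc2 mult.assoc F) (rule mult.commute)
  then have rec: "(F ^ Suc s) $ n + x * (if n = 0 then 0 else (F ^ Suc s) $ (n - 1)) = (if n = 0 then 0 else (F ^ s) $ (n - 1))" for n
  proof -
    have "F ^ Suc s * (1 + fps_const x * fps_X) = F ^ Suc s + fps_const x * (F ^ Suc s * fps_X)"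
      by (simp add: algebra_simps)
    then have "(F ^ Suc s + fps_const x * (F ^ Suc s * fps_X)) $ n = (fps_X * F ^ s) $ n"
      using \<open>F ^ Suc s * (1 + fps_const x * fps_X) = fps_X * F ^ s\<close> by simp
    then show ?thesis by (simp add: fps_X_mult_right_nth del: power_Suc)
  qed
  show ?case
  proof (induction n)
    case 0
    then show ?case using rec[of 0] by simp
  next
    case (Suc n)
    have eq: "(F ^ Suc s) $ Suc n = (F ^ s) $ n - x * (F ^ Suc s) $ n"
      using rec[of "Suc n"] by (simp add: eq_diff_eq)
    consider "n < s" | "n = s" | k where "n = Suc (s + k)"
      by (metis add_Suc_right less_imp_Suc_add linorder_neqE_nat)
    then show ?case
    proof cases
      case 1
      then show ?thesis unfolding eq Suc.IH \<open>!!n. (F ^ s) $ n = _\<close> by simp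
    next
      case 2
      then show ?thesis unfolding eq Suc.IH \<open>!!n. (F ^ s) $ n = _\<close> by (simp add: \<theta>)
    next
      case 3
      have "(- of_nat s :: complex) gchoose Suc k = ((- of_nat (Suc s)) gchoose k) + ((- of_nat (Suc s)) gchoose Suc k)"
	using gbinomial_Suc_Suc[of "- of_nat (Suc s) :: complex" k] by simp
      then have "\<theta> ((- of_nat s) gchoose Suc k) = \<theta> ((- of_nat (Suc s)) gchoose k) + \<theta> ((- of_nat (Suc s)) gchoose Suc k)"
	by (metis \<theta>(1))
      then show ?thesis
	unfolding eq Suc.IH \<open>!!n. (F ^ s) $ n = _\<close> using 3 by (simp add: algebra_simps)
    qed
  qed
qed

lemma shift_fps_power_nth:
  "(shift_fps \<kappa> ^ s) $ n = (if s \<le> n then ((- of_nat s) gchoose (n - s)) * \<kappa> ^ (n - s) else 0)"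
  using geometric_power_nth[OF shift_fps_mult, of "\<lambda>c. c"] by simp

definition fpsc :: "complex fps => complex poly fps" where
  "fpsc f = Abs_fps (\<lambda>n. [:f $ n:])"

lemma fpsc_nth [simp]: "fpsc f $ n = [:f $ n:]"
  by (simp add: fpsc_def)

lemma const_poly_sum: "[:sum f A:] = (\<Sum>x\<in>A. [:f x:])"
proof -
  have "(\<Sum>x\<in>A. [:f x:]) = [:sum f A:]"
    by (induction A rule: infinite_finite_induct) auto
  then show ?thesis ..
qed

lemma fpsc_mult: "fpsc (f * g) = fpsc f * fpsc g"
  by (rule fps_ext) (simp add: fps_mult_nth const_poly_sum mult.commute)

lemma fpsc_add: "fpsc (f + g) = fpsc f + fpsc g"
  by (rule fps_ext) simp

lemma fpsc_diff: "fpsc (f - g) = fpsc f - fpsc g"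
  by (rule fps_ext) simp

lemma fpsc_1: "fpsc 1 = 1"
  by (rule fps_ext) simp

lemma fpsc_power: "fpsc (f ^ k) = fpsc f ^ k"
  by (induction k) (simp_all add: fpsc_1 fpsc_mult)

lemma fpsc_X: "fpsc fps_X = fps_X"
  by (rule fps_ext) simp

lemma fpsc_const: "fpsc (fps_const c) = fps_const [:c:]"
  by (rule fps_ext) simp

lemma fpsc_compose: "fpsc (f oo g) = fpsc f oo fpsc g"
  by (rule fps_ext) (simp add: fps_compose_nth const_poly_sum mult.commute flip: fpsc_power)

text \<open>The series \<open>1/(u - y)\<close>, a power series in \<open>u\<inverse>\<close> whose coefficients are polynomials in \<open>y\<close>.\<close>

definition Hser :: "complex poly fps" where
  "Hser = Abs_fps (\<lambda>k. if k = 0 then 0 else monom 1 (k - 1))"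

lemma Hser_0 [simp]: "Hser $ 0 = 0"
  by (simp add: Hser_def)

lemma Hser_mult: "Hser * (1 - fps_const [:0, 1:] * fps_X) = fps_X"
proof (rule fps_ext)
  fix n
  have "Hser * (1 - fps_const [:0, 1:] * fps_X) = Hser - fps_const [:0, 1:] * (Hser * fps_X)"
    by (simp add: algebra_simps)
  then have eq: "(Hser * (1 - fps_const [:0, 1:] * fps_X)) $ n = Hser $ n - [:0, 1:] * (if n = 0 then 0 else Hser $ (n - 1))"
    by simp
  show "(Hser * (1 - fps_const [:0, 1:] * fps_X)) $ n = fps_X $ n"
  proof (cases n)
    case 0
    then show ?thesis unfolding eq by (simp add: Hser_def)
  next
    case (Suc k)
    then show ?thesis unfolding eq by (cases k) (simp_all add: Hser_def monom_Suc monom_0)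
  qed
qed

lemma Hser_power_nth:
  "(Hser ^ s) $ n = (if s \<le> n then [:(- of_nat s) gchoose (n - s):] * (- [:0, 1:]) ^ (n - s) else 0)"
proof (rule geometric_power_nth)
  show "Hser * (1 + fps_const (- [:0, 1:]) * fps_X) = fps_X"
    using Hser_mult by (simp only: fps_const_neg[symmetric] mult_minus_left add_uminus_conv_diff)
qed simp_all

text \<open>\<open>Sf f\<close> is \<open>f(u - y)\<close> for a series \<open>f(u)\<close> in \<open>u\<inverse>\<close>.\<close>

definition Sf :: "complex fps => complex poly fps" where
  "Sf f = fpsc f oo Hser"

lemma Sf_mult: "Sf (f * g) = Sf f * Sf g"
  by (simp add: Sf_def fpsc_mult fps_compose_mult_distrib)

lemma Sf_add: "Sf (f + g) = Sf f + Sf g"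
  by (simp add: Sf_def fpsc_add fps_compose_add_distrib)

lemma Sf_diff: "Sf (f - g) = Sf f - Sf g"
  by (simp add: Sf_def fpsc_diff fps_compose_sub_distrib)

lemma Sf_1: "Sf 1 = 1"
  by (simp add: Sf_def fpsc_1)

lemma Sf_const: "Sf (fps_const c) = fps_const [:c:]"
  by (simp add: Sf_def fpsc_const)

lemma Sf_X: "Sf fps_X = Hser"
  by (simp add: Sf_def fpsc_X)

lemma Sf_nth:
  "Sf f $ n = (\<Sum>s\<le>n. [:f $ s * ((- of_nat s) gchoose (n - s)):] * (- [:0, 1:]) ^ (n - s))"
proof -
  have "Sf f $ n = (\<Sum>s=0..n. [:f $ s:] * (Hser ^ s) $ n)"
    by (simp add: Sf_def fps_compose_nth)
  also have "\<dots> = (\<Sum>s\<le>n. [:f $ s * ((- of_nat s) gchoose (n - s)):] * (- [:0, 1:]) ^ (n - s))"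
    by (intro sum.cong) (auto simp: Hser_power_nth mult.commute)
  finally show ?thesis .
qed

section \<open>Shifting either variable of \<open>f(u - y)\<close>\<close>

definition pshift :: "complex => complex poly fps => complex poly fps" where
  "pshift c f = Abs_fps (\<lambda>n. pcompose (f $ n) [:c, 1:])"

lemma pshift_nth [simp]: "pshift c f $ n = pcompose (f $ n) [:c, 1:]"
  by (simp add: pshift_def)

lemma pshift_mult: "pshift c (f * g) = pshift c f * pshift c g"
  by (rule fps_ext) (simp add: fps_mult_nth pcompose_sum pcompose_mult)

lemma pshift_1: "pshift c 1 = 1"
  by (rule fps_ext) (simp add: pcompose_1)

lemma pshift_power: "pshift c (f ^ k) = pshift c f ^ k"
  by (induction k) (simp_all add: pshift_1 pshift_mult)

lemma pshift_pshift: "pshift c (pshift d f) = pshift (c + d) f"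
  by (rule fps_ext) (simp add: pcompose_assoc[symmetric] pcompose_pCons add.commute)

lemma pshift_0: "pshift 0 f = f"
  by (rule fps_ext) simp

text \<open>Recognises the expansion of \<open>1/(u + \<kappa> - y)\<close> by its denominator,
  which is nonzero in an integral domain. The substitutions \<open>u + \<kappa>\<close> for
  \<open>u\<close> and \<open>y - \<kappa>\<close> for \<open>y\<close> are both identified through
  it.\<close>

lemma Sf_shift_eqn:
  assumes "G * (1 + fps_const [:\<kappa>:] * fps_X - fps_const [:0, 1:] * fps_X) = fps_X"
  shows "G = Sf (shift_fps \<kappa>)"
proof -
  have "Sf (shift_fps \<kappa>) * (1 + fps_const [:\<kappa>:] * Hser) = Hser"
    using arg_cong[OF shift_fps_mult, of Sf \<kappa>] by (simp add: Sf_mult Sf_add Sf_const Sf_X Sf_1)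
  then have "Sf (shift_fps \<kappa>) * ((1 + fps_const [:\<kappa>:] * Hser) * (1 - fps_const [:0, 1:] * fps_X)) = fps_X"
    by (simp only: mult.assoc[symmetric] Hser_mult)
  moreover have "(1 + fps_const [:\<kappa>:] * Hser) * (1 - fps_const [:0, 1:] * fps_X)
      = 1 + fps_const [:\<kappa>:] * fps_X - fps_const [:0, 1:] * fps_X"
    by (subst Hser_mult[symmetric]) (simp add: algebra_simps)
  ultimately have "(G - Sf (shift_fps \<kappa>)) * (1 + fps_const [:\<kappa>:] * fps_X - fps_const [:0, 1:] * fps_X) = 0"
    using assms by (simp add: left_diff_distrib)
  moreover have "(1 + fps_const [:\<kappa>:] * fps_X - fps_const [:0, 1:] * fps_X) \<noteq> (0 :: complex poly fps)"
  proof
    assume "1 + fps_const [:\<kappa>:] * fps_X - fps_const [:0, 1:] * fps_X = (0 :: complex poly fps)"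
    then have "(1 + fps_const [:\<kappa>:] * fps_X - fps_const [:0, 1:] * fps_X :: complex poly fps) $ 0 = 0" by simp
    then show False by simp
  qed
  ultimately show ?thesis by simp
qed

lemma Hser_compose: "Hser oo fpsc (shift_fps \<kappa>) = Sf (shift_fps \<kappa>)"
proof (rule Sf_shift_eqn)
  let ?\<Phi> = "fpsc (shift_fps \<kappa>)"
  have \<Phi>: "?\<Phi> * (1 + fps_const [:\<kappa>:] * fps_X) = fps_X"
    using arg_cong[OF shift_fps_mult, of fpsc \<kappa>] by (simp add: fpsc_mult fpsc_add fpsc_const fpsc_X fpsc_1)
  have "(Hser oo ?\<Phi>) * (1 - fps_const [:0, 1:] * ?\<Phi>) = ?\<Phi>"
    using arg_cong[OF Hser_mult, of "\<lambda>f. f oo ?\<Phi>"]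
    by (simp add: fps_compose_mult_distrib fps_compose_sub_distrib)
  then have "(Hser oo ?\<Phi>) * ((1 - fps_const [:0, 1:] * ?\<Phi>) * (1 + fps_const [:\<kappa>:] * fps_X)) = fps_X"
    by (simp only: mult.assoc[symmetric] \<Phi>)
  moreover have "(1 - fps_const [:0, 1:] * ?\<Phi>) * (1 + fps_const [:\<kappa>:] * fps_X)
      = 1 + fps_const [:\<kappa>:] * fps_X - fps_const [:0, 1:] * fps_X"
    by (subst (3) \<Phi>[symmetric]) (simp add: algebra_simps)
  ultimately show "(Hser oo ?\<Phi>) * (1 + fps_const [:\<kappa>:] * fps_X - fps_const [:0, 1:] * fps_X) = fps_X"
    by simp
qed

lemma pshift_Hser: "pshift (- \<kappa>) Hser = Sf (shift_fps \<kappa>)"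
proof (rule Sf_shift_eqn)
  have "pshift (- \<kappa>) Hser * pshift (- \<kappa>) (1 - fps_const [:0, 1:] * fps_X) = pshift (- \<kappa>) fps_X"
    by (simp flip: pshift_mult add: Hser_mult)
  moreover have "pshift (- \<kappa>) fps_X = fps_X"
    by (rule fps_ext) (simp add: pcompose_1)
  moreover have "pshift (- \<kappa>) (1 - fps_const [:0, 1:] * fps_X) = 1 + fps_const [:\<kappa>:] * fps_X - fps_const [:0, 1:] * fps_X"
    by (rule fps_ext) (auto simp: pcompose_diff pcompose_1 pcompose_pCons)
  ultimately show "pshift (- \<kappa>) Hser * (1 + fps_const [:\<kappa>:] * fps_X - fps_const [:0, 1:] * fps_X) = fps_X"
    by simp
qed

lemma Sf_compose: "Sf f oo fpsc (shift_fps \<kappa>) = Sf (f oo shift_fps \<kappa>)"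
proof -
  have "Sf f oo fpsc (shift_fps \<kappa>) = fpsc f oo (Hser oo fpsc (shift_fps \<kappa>))"
    unfolding Sf_def by (rule fps_compose_assoc[symmetric]) auto
  also have "\<dots> = fpsc f oo (fpsc (shift_fps \<kappa>) oo Hser)"
    by (simp add: Hser_compose Sf_def)
  also have "\<dots> = fpsc f oo fpsc (shift_fps \<kappa>) oo Hser"
    by (rule fps_compose_assoc) auto
  finally show ?thesis by (simp add: Sf_def fpsc_compose)
qed

lemma pshift_Sf: "pshift (- \<kappa>) (Sf f) = Sf (f oo shift_fps \<kappa>)"
proof -
  have "pshift (- \<kappa>) (Sf f) = fpsc f oo pshift (- \<kappa>) Hser"
    by (rule fps_ext)
       (simp add: Sf_def fps_compose_nth pcompose_sum pcompose_smult flip: pshift_power)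
  also have "\<dots> = fpsc f oo (fpsc (shift_fps \<kappa>) oo Hser)"
    by (simp add: pshift_Hser Sf_def)
  also have "\<dots> = fpsc f oo fpsc (shift_fps \<kappa>) oo Hser"
    by (rule fps_compose_assoc) auto
  finally show ?thesis by (simp add: Sf_def fpsc_compose)
qed

text \<open>Only \<open>u - y\<close> matters, so moving \<open>y\<close> by \<open>\<kappa>\<close>
  undoes moving \<open>u\<close> by \<open>\<kappa>\<close>. For \<open>z\<^sup>+\<close> it is
  \<open>y\<close> that is shifted, whereas the functional equation of \<open>g\<close> speaks of
  \<open>u\<close>.\<close>

lemma Sf_eq_pshift: "Sf f = pshift \<kappa> (Sf (f oo shift_fps \<kappa>))"
  by (simp add: pshift_Sf[symmetric] pshift_pshift pshift_0)

subsection \<open>The normalising series\<close>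

fun g_coeff :: "complex => nat => complex" where
  "g_coeff \<kappa> 0 = 1"
| "g_coeff \<kappa> (Suc k) = ((\<Sum>i<Suc k. g_coeff \<kappa> i * (shift_fps \<kappa> ^ i) $ (k + 2)) + g_coeff \<kappa> k) / (of_nat (Suc k) * \<kappa>)"

text \<open>In the coefficient of \<open>X ^ (k + 2)\<close> the unknown \<open>g $ (k + 2)\<close>
  has the factor 1 on both sides and drops out, while \<open>g $ Suc k\<close> occurs on the left
  only, with the factor \<open>- of_nat (Suc k) * \<kappa>\<close>. So for
  \<open>\<kappa> \<noteq> 0\<close> the equation is a recursion.\<close>

lemma g_equation_iff:
  fixes g :: "complex fps"
  assumes "\<kappa> \<noteq> 0"
  shows "g oo shift_fps \<kappa> = (1 - fps_X\<^sup>2) * g \<longleftrightarrow>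
    (\<forall>k. g $ Suc k = ((\<Sum>i<Suc k. g $ i * (shift_fps \<kappa> ^ i) $ (k + 2)) + g $ k) / (of_nat (Suc k) * \<kappa>))"
proof -
  have lhs: "(g oo shift_fps \<kappa>) $ (k + 2) = (\<Sum>i<Suc k. g $ i * (shift_fps \<kappa> ^ i) $ (k + 2)) - of_nat (Suc k) * \<kappa> * g $ Suc k + g $ (k + 2)" for k
  proof -
    have "(g oo shift_fps \<kappa>) $ (k + 2) = (\<Sum>i\<in>{..<Suc k} \<union> {Suc k, k + 2}. g $ i * (shift_fps \<kappa> ^ i) $ (k + 2))"
      unfolding fps_compose_nth by (intro sum.cong) auto
    also have "\<dots> = (\<Sum>i<Suc k. g $ i * (shift_fps \<kappa> ^ i) $ (k + 2)) + (\<Sum>i\<in>{Suc k, k + 2}. g $ i * (shift_fps \<kappa> ^ i) $ (k + 2))"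
      by (rule sum.union_disjoint) auto
    finally show ?thesis
      by (simp add: shift_fps_power_nth algebra_simps)
  qed
  have rhs: "((1 - fps_X\<^sup>2) * g) $ n = g $ n - (if n < 2 then 0 else g $ (n - 2))" for n
    by (simp add: left_diff_distrib fps_X_power_mult_nth)
  \<comment> \<open>The coefficients 0 and 1 agree for every \<open>g\<close>; this is why the
    initial value has to be prescribed separately.\<close>
  have low: "(g oo shift_fps \<kappa>) $ n = g $ n" if "n < 2" for n
    using that by (cases n) (auto simp: fps_compose_nth less_Suc_eq shift_fps_power_nth)
  have "g oo shift_fps \<kappa> = (1 - fps_X\<^sup>2) * g \<longleftrightarrow> (\<forall>k. (g oo shift_fps \<kappa>) $ (k + 2) = ((1 - fps_X\<^sup>2) * g) $ (k + 2))"
  proof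
    assume *: "\<forall>k. (g oo shift_fps \<kappa>) $ (k + 2) = ((1 - fps_X\<^sup>2) * g) $ (k + 2)"
    show "g oo shift_fps \<kappa> = (1 - fps_X\<^sup>2) * g"
    proof (rule fps_ext)
      fix n show "(g oo shift_fps \<kappa>) $ n = ((1 - fps_X\<^sup>2) * g) $ n"
      proof (cases "n < 2")
	case True then show ?thesis by (simp add: low rhs)
      next
	case False
	then obtain k where "n = k + 2" by (intro that[of "n - 2"]) simp
	then show ?thesis using *[rule_format, of k] by (simp only:)
      qed
    qed
  qed auto
  also have "\<dots> \<longleftrightarrow> (\<forall>k. of_nat (Suc k) * \<kappa> * g $ Suc k = (\<Sum>i<Suc k. g $ i * (shift_fps \<kappa> ^ i) $ (k + 2)) + g $ k)"
    unfolding lhs rhs by (auto simp: algebra_simps)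
  also have "\<dots> \<longleftrightarrow> (\<forall>k. g $ Suc k = ((\<Sum>i<Suc k. g $ i * (shift_fps \<kappa> ^ i) $ (k + 2)) + g $ k) / (of_nat (Suc k) * \<kappa>))"
  proof -
    have "x = y / (of_nat (Suc k) * \<kappa>) \<longleftrightarrow> of_nat (Suc k) * \<kappa> * x = y" for x y k
      using assms by (simp add: nonzero_eq_divide_eq ac_simps del: of_nat_Suc)
    then show ?thesis by (simp only:)
  qed
  finally show ?thesis .
qed

lemma g_series_spec:
  assumes "m \<noteq> n"
  shows "g_series m n $ 0 = 1"
    and "g_series m n oo shift_fps (of_nat m - of_nat n) = (1 - fps_X\<^sup>2) * g_series m n"
proof -
  let ?\<kappa> = "of_nat m - of_nat n :: complex"
  have \<kappa>: "?\<kappa> \<noteq> 0" using assms by simp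
  let ?P = "\<lambda>g. g $ 0 = 1 \<and> g oo shift_fps ?\<kappa> = (1 - fps_X\<^sup>2) * g"
  have "?P (Abs_fps (g_coeff ?\<kappa>))"
    unfolding g_equation_iff[OF \<kappa>] by simp
  moreover have "g = Abs_fps (g_coeff ?\<kappa>)" if "?P g" for g
  proof (rule fps_ext)
    fix k
    have rec: "g $ Suc k = ((\<Sum>i<Suc k. g $ i * (shift_fps ?\<kappa> ^ i) $ (k + 2)) + g $ k) / (of_nat (Suc k) * ?\<kappa>)" for k
      using that unfolding g_equation_iff[OF \<kappa>] by blast
    show "g $ k = Abs_fps (g_coeff ?\<kappa>) $ k"
    proof (induction k rule: less_induct)
      case (less k)
      show ?case
      proof (cases k)
	case 0 then show ?thesis using that by simp
      next
	case (Suc l)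
	then have "(\<Sum>i<Suc l. g $ i * (shift_fps ?\<kappa> ^ i) $ (l + 2)) = (\<Sum>i<Suc l. g_coeff ?\<kappa> i * (shift_fps ?\<kappa> ^ i) $ (l + 2))"
	  using less by (intro sum.cong) auto
	then show ?thesis using Suc less rec[of l] by simp
      qed
    qed
  qed
  ultimately have "\<exists>!g. ?P g" by blast
  from theI'[OF this] show "g_series m n $ 0 = 1"
    and "g_series m n oo shift_fps (of_nat m - of_nat n) = (1 - fps_X\<^sup>2) * g_series m n"
    unfolding g_series_def shift_fps_def by blast+
qed

subsection \<open>Evaluation of the scalars in a noncommutative ring\<close>

text \<open>Used at three levels: for a ring, for power series over it, and for power series over
  those. \<open>pev\<close> evaluates polynomials in the noncommutative ring; it is multiplicative
  because both the scalars and the point of evaluation are central.\<close>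

locale scalar_hom =
  fixes cs :: "complex => 's::ring_1"
  assumes cs_add: "cs (a + b) = cs a + cs b"
    and cs_mult: "cs (a * b) = cs a * cs b"
    and cs_1: "cs 1 = 1"
    and cs_central: "is_central (cs a)"
begin

lemma cs_0: "cs 0 = 0"
  using cs_add[of 0 0] by simp

lemma cs_minus: "cs (- a) = - cs a"
  using cs_add[of a "- a"] by (simp add: cs_0 eq_neg_iff_add_eq_0 add.commute)

lemma cs_sum: "cs (sum f A) = (\<Sum>x\<in>A. cs (f x))"
  by (induction A rule: infinite_finite_induct) (simp_all add: cs_0 cs_add)

lemma cs_commute: "cs a * x = x * cs a"
  using cs_central by (simp add: is_central_def)

definition pev :: "'s => complex poly => 's" where
  "pev y p = (\<Sum>k\<le>degree p. cs (coeff p k) * y ^ k)"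

lemma pev_alt: "degree p \<le> N ==> pev y p = (\<Sum>k\<le>N. cs (coeff p k) * y ^ k)"
  unfolding pev_def by (rule sum.mono_neutral_left) (auto simp: coeff_eq_0 cs_0)

lemma pev_add: "pev y (p + q) = pev y p + pev y q"
  using pev_alt[of p "max (degree p) (degree q)" y] pev_alt[of q "max (degree p) (degree q)" y]
    pev_alt[of "p + q" "max (degree p) (degree q)" y]
  by (simp add: degree_add_le_max cs_add distrib_right sum.distrib)

lemma pev_0 [simp]: "pev y 0 = 0"
  by (simp add: pev_def cs_0)

lemma pev_sum: "pev y (sum f A) = (\<Sum>x\<in>A. pev y (f x))"
  by (induction A rule: infinite_finite_induct) (simp_all add: pev_add)

lemma pev_pCons: "is_central y ==> pev y (pCons a p) = cs a + y * pev y p"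
proof -
  assume y: "is_central y"
  have "pev y (pCons a p) = (\<Sum>k\<le>Suc (degree p). cs (coeff (pCons a p) k) * y ^ k)"
    by (rule pev_alt) (rule degree_pCons_le)
  also have "\<dots> = cs a + y * pev y p"
    using y unfolding pev_def
    by (subst sum.atMost_Suc_shift)
       (simp add: sum_distrib_left central_left_commute[OF cs_central] mult.assoc)
  finally show ?thesis .
qed

lemma pev_smult: "pev y (smult a p) = cs a * pev y p"
  using pev_alt[of "smult a p" "degree p" y]
  by (simp add: degree_smult_le cs_mult pev_def sum_distrib_left mult.assoc)

lemma pev_mult: "is_central y ==> pev y (p * q) = pev y p * pev y q"
  by (induction p) (simp_all add: pev_add pev_smult pev_pCons cs_0 distrib_right mult.assoc)

lemma pev_const: "pev y [:c:] = cs c"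
  by (simp add: pev_def)

lemma pev_1: "pev y 1 = 1"
  by (simp add: pev_def cs_1)

lemma pev_minus: "pev y (- p) = - pev y p"
  using pev_add[of y p "- p"] by (simp add: eq_neg_iff_add_eq_0 add.commute)

lemma pev_power: "is_central y ==> pev y (p ^ k) = pev y p ^ k"
  by (induction k) (simp_all add: pev_1 pev_mult)

lemma pev_X: "pev y [:0, 1:] = y"
  by (simp add: pev_def cs_0 cs_1)

lemma is_central_add: "is_central x ==> is_central y ==> is_central (x + y :: 's)"
  by (simp add: is_central_def distrib_left distrib_right)

lemma is_central_pev:
  assumes y: "is_central y"
  shows "is_central (pev y p)"
proof (induction p)
  case 0 show ?case by (simp add: is_central_def)
next
  case (pCons a p)
  then show ?case
    unfolding pev_pCons[OF y] is_central_def
    by (simp add: distrib_left distrib_right cs_commute mult.assoc is_centralD[OF pCons(2)]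
	central_left_commute[OF y])
qed

lemma pev_pcompose:
  assumes "is_central y"
  shows "pev y (pcompose p [:c, 1:]) = pev (y + cs c) p"
proof -
  have "is_central (y + cs c)"
    using assms cs_central by (rule is_central_add)
  then show ?thesis
    by (induction p)
       (simp_all add: pcompose_pCons pev_add pev_mult assms pev_pCons cs_1 cs_0 pev_const pev_smult distrib_right)
qed

definition fev :: "'s => complex poly fps => 's fps" where
  "fev y f = Abs_fps (\<lambda>n. pev y (f $ n))"

lemma fev_nth [simp]: "fev y f $ n = pev y (f $ n)"
  by (simp add: fev_def)

lemma fev_mult: "is_central y ==> fev y (f * g) = fev y f * fev y g"
  by (rule fps_ext) (simp add: fps_mult_nth pev_sum pev_mult)

lemma fev_add: "fev y (f + g) = fev y f + fev y g"
  by (rule fps_ext) (simp add: pev_add)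

lemma fev_minus: "fev y (- f) = - fev y f"
  by (rule fps_ext) (simp add: pev_minus)

lemma fev_1: "fev y 1 = 1"
  by (rule fps_ext) (simp add: pev_1)

lemma fev_const: "fev y (fps_const [:c:]) = fps_const (cs c)"
  by (rule fps_ext) (simp add: pev_const)

lemma is_central_fps: "(!!n. is_central (f $ n)) ==> is_central (f :: 's fps)"
  unfolding is_central_def
proof (intro allI fps_ext)
  fix x n assume *: "!!n. \<forall>x. f $ n * x = x * f $ n"
  have "(x * f) $ n = (\<Sum>i=0..n. x $ (n - i) * f $ i)"
    unfolding fps_mult_nth by (rule sum.reindex_bij_witness[of _ "\<lambda>i. n - i" "\<lambda>i. n - i"]) auto
  then show "(f * x) $ n = (x * f) $ n"
    unfolding fps_mult_nth using * by simp
qed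

lemma is_central_fev: "is_central y ==> is_central (fev y f)"
  by (rule is_central_fps) (simp add: is_central_pev)

lemma fev_pshift: "is_central y ==> fev y (pshift c f) = fev (y + cs c) f"
  by (rule fps_ext) (simp add: pev_pcompose)

text \<open>The substitution \<open>u \<mapsto> u + \<kappa>\<close> in a power series in \<open>u\<inverse>\<close>.\<close>

definition shU :: "complex => 's fps => 's fps" where
  "shU \<kappa> f = Abs_fps (\<lambda>n. \<Sum>i\<le>n. cs ((shift_fps \<kappa> ^ i) $ n) * f $ i)"

lemma shU_alt: "n \<le> N ==> shU \<kappa> f $ n = (\<Sum>i\<le>N. cs ((shift_fps \<kappa> ^ i) $ n) * f $ i)"
  unfolding shU_def
  by simp (rule sum.mono_neutral_left, auto simp: shift_fps_power_nth cs_0)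

text \<open>The substituted series has central coefficients, so its powers \<open>i\<close> and
  \<open>j\<close> combine to the power \<open>i + j\<close> although the coefficients of
  \<open>f\<close> and \<open>g\<close> do not commute.\<close>

lemma shU_mult: "shU \<kappa> (f * g) = shU \<kappa> f * shU \<kappa> g"
proof (rule fps_ext)
  fix n
  let ?c = "\<lambda>i n. (shift_fps \<kappa> ^ i) $ n"
  have "(shU \<kappa> f * shU \<kappa> g) $ n = (\<Sum>a\<le>n. (\<Sum>i\<le>n. cs (?c i a) * f $ i) * (\<Sum>j\<le>n. cs (?c j (n - a)) * g $ j))"
    unfolding fps_mult_nth
    by (intro sum.cong) (auto simp: shU_alt[of _ n])
  also have "\<dots> = (\<Sum>a\<le>n. \<Sum>i\<le>n. \<Sum>j\<le>n. cs (?c i a * ?c j (n - a)) * (f $ i * g $ j))"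
  proof -
    have "f $ i * (cs c * y) = cs c * (f $ i * y)" for i c y
      by (rule central_left_commute[OF cs_central])
    then show ?thesis
      by (simp add: sum_product cs_mult mult.assoc)
  qed
  also have "\<dots> = (\<Sum>i\<le>n. \<Sum>j\<le>n. (\<Sum>a\<le>n. cs (?c i a * ?c j (n - a))) * (f $ i * g $ j))"
  proof -
    have "(\<Sum>a\<le>n. \<Sum>i\<le>n. \<Sum>j\<le>n. F a i j) = (\<Sum>i\<le>n. \<Sum>j\<le>n. \<Sum>a\<le>n. F a i j)" for F :: "nat => nat => nat => 's"
      by (subst sum.swap, rule sum.cong[OF refl], rule sum.swap)
    then show ?thesis by (simp add: sum_distrib_right)
  qed
  also have "\<dots> = (\<Sum>i\<le>n. \<Sum>j\<le>n. cs (?c (i + j) n) * (f $ i * g $ j))"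
    by (simp add: cs_sum[symmetric] power_add fps_mult_nth atLeast0AtMost)
  also have "\<dots> = (\<Sum>(i, j)\<in>{..n} \<times> {..n}. cs (?c (i + j) n) * (f $ i * g $ j))"
    by (simp add: sum.cartesian_product)
  \<comment> \<open>\<open>shift_fps \<kappa> ^ (i + j)\<close> has order \<open>i + j\<close>, so
    the square of indices may be cut down to a triangle.\<close>
  also have "\<dots> = (\<Sum>(i, j)\<in>{(i, j). i + j \<le> n}. cs (?c (i + j) n) * (f $ i * g $ j))"
    by (rule sum.mono_neutral_right) (auto simp: shift_fps_power_nth cs_0 split: if_splits)
  also have "\<dots> = (\<Sum>(k, i)\<in>(SIGMA k:{..n}. {..k}). cs (?c k n) * (f $ i * g $ (k - i)))"
    by (rule sum.reindex_bij_witness[of _ "\<lambda>(k, i). (i, k - i)" "\<lambda>(i, j). (i + j, i)"]) auto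
  also have "\<dots> = (\<Sum>k\<le>n. \<Sum>i\<le>k. cs (?c k n) * (f $ i * g $ (k - i)))"
    by (simp add: sum.Sigma)
  also have "\<dots> = shU \<kappa> (f * g) $ n"
    by (simp add: shU_def fps_mult_nth atLeast0AtMost sum_distrib_left)
  finally show "shU \<kappa> (f * g) $ n = (shU \<kappa> f * shU \<kappa> g) $ n" ..
qed

lemma shU_add: "shU \<kappa> (f + g) = shU \<kappa> f + shU \<kappa> g"
  by (rule fps_ext) (simp add: shU_def distrib_left sum.distrib)

lemma shU_const: "shU \<kappa> (fps_const c) = fps_const c"
proof (rule fps_ext)
  fix n
  have "shU \<kappa> (fps_const c) $ n = (\<Sum>i\<le>n. if i = 0 then cs ((shift_fps \<kappa> ^ 0) $ n) * c else 0)"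
    unfolding shU_def fps_nth_Abs_fps by (intro sum.cong) auto
  then show "shU \<kappa> (fps_const c) $ n = fps_const c $ n"
    by (simp add: cs_0 cs_1)
qed

lemma shU_fev:
  assumes "is_central y"
  shows "shU \<kappa> (fev y f) = fev y (f oo fpsc (shift_fps \<kappa>))"
proof (rule fps_ext)
  fix n
  have "fev y (f oo fpsc (shift_fps \<kappa>)) $ n = (\<Sum>i\<le>n. pev y (f $ i * [:(shift_fps \<kappa> ^ i) $ n:]))"
    by (simp add: fps_compose_nth pev_sum atLeast0AtMost flip: fpsc_power)
  also have "\<dots> = shU \<kappa> (fev y f) $ n"
    unfolding shU_def fps_nth_Abs_fps pev_mult[OF assms] pev_const fev_nth
    by (intro sum.cong refl cs_commute[symmetric])
  finally show "shU \<kappa> (fev y f) $ n = fev y (f oo fpsc (shift_fps \<kappa>)) $ n" ..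
qed

lemma shU_fps_X: "shU \<kappa> fps_X * (1 + fps_const (cs \<kappa>) * fps_X) = fps_X"
proof -
  have 0: "is_central (0 :: 's)" by (simp add: is_central_def)
  have X: "fev 0 fps_X = fps_X"
    by (rule fps_ext) (simp add: pev_1)
  have "shU \<kappa> fps_X = fev 0 (fpsc (shift_fps \<kappa>))"
    using shU_fev[OF 0, of \<kappa> fps_X] by (simp add: X)
  moreover have "1 + fps_const (cs \<kappa>) * fps_X = fev 0 (fpsc (1 + fps_const \<kappa> * fps_X))"
    by (simp add: fpsc_add fpsc_1 fpsc_mult fpsc_const fpsc_X fev_add fev_1 fev_mult 0 fev_const X)
  ultimately show ?thesis
    by (simp add: fev_mult[OF 0, symmetric] fpsc_mult[symmetric] shift_fps_mult fpsc_X X)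
qed

end

section \<open>The free superalgebra\<close>

text \<open>The passage from sums over a carrier to sums in a type. Below, \<open>\<phi>\<close> is
  the extraction of a coefficient, the identity, or an injection into \<open>dyp\<close> or into
  series over it; such maps are additive on the carrier only.\<close>

lemma (in abelian_group) finsum_hom:
  fixes \<phi> :: "'a => 'c::ab_group_add"
  assumes add: "!!x y. x \<in> carrier G ==> y \<in> carrier G ==> \<phi> (x \<oplus> y) = \<phi> x + \<phi> y"
    and f: "!!t. t \<in> T ==> f t \<in> carrier G"
  shows "\<phi> (finsum G f T) = (\<Sum>t\<in>T. \<phi> (f t))"
proof -
  have zero: "\<phi> \<zero> = 0"
    using add[of \<zero> \<zero>] by simp
  show ?thesis
    using f
  proof (induction T rule: infinite_finite_induct)
    case (insert t T)
    then have "finsum G f (insert t T) = f t \<oplus> finsum G f T"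
      by (intro finsum_insert) auto
    moreover have "finsum G f T \<in> carrier G"
      using insert by (intro finsum_closed) auto
    ultimately show ?case using insert by (simp add: add)
  qed (auto simp: zero finsum_infinite)
qed

lemma (in abelian_group) with_sign_hom:
  fixes \<phi> :: "'a => 'c::ab_group_add"
  assumes add: "!!x y. x \<in> carrier G ==> y \<in> carrier G ==> \<phi> (x \<oplus> y) = \<phi> x + \<phi> y"
    and x: "x \<in> carrier G"
  shows "\<phi> (with_sign G e x) = sg e (\<phi> x)"
proof -
  have "\<phi> \<zero> = 0"
    using add[of \<zero> \<zero>] by simp
  then have "\<phi> (\<ominus> x) = - \<phi> x"
    using add[of "\<ominus> x" x] x by (simp add: l_neg eq_neg_iff_add_eq_0)
  then show ?thesis by (simp add: with_sign_def sg_def)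
qed

lemma (in abelian_group) with_sign_closed: "x \<in> carrier G ==> with_sign G e x \<in> carrier G"
  by (simp add: with_sign_def)

lemma poly_mapping_decomp:
  fixes f :: "'a \<Rightarrow>\<^sub>0 'b::comm_monoid_add"
  shows "f = (\<Sum>w\<in>Poly_Mapping.keys f. Poly_Mapping.single w (Poly_Mapping.lookup f w))"
  by (rule poly_mapping_eqI) (simp add: lookup_sum lookup_single when_def in_keys_iff)

lemma free_el_induct [case_names zero add single]:
  fixes f :: "'a \<Rightarrow>\<^sub>0 'b::comm_monoid_add"
  assumes "P 0" "!!f g. P f ==> P g ==> P (f + g)"
    and "!!w c. w \<in> Poly_Mapping.keys f ==> P (Poly_Mapping.single w c)"
  shows "P f"
proof -
  have "P (\<Sum>w\<in>S. Poly_Mapping.single w (Poly_Mapping.lookup f w))" if "S \<subseteq> Poly_Mapping.keys f" for S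
    using finite_subset[OF that finite_keys] that
    by (induction rule: finite_induct) (auto intro: assms)
  then show ?thesis using poly_mapping_decomp[of f] by (metis order_refl)
qed

lemma letters_plus [simp]: "letters (a + b) = letters a @ letters b"
  by (simp add: plus_fword_def)

lemma letters_zero [simp]: "letters 0 = []"
  by (simp add: zero_fword_def)

abbreviation cst :: "complex => free_el" where
  "cst c \<equiv> Poly_Mapping.single 0 c"

lemma cst_commute: "cst c * f = f * cst c"
  by (induction f rule: free_el_induct)
     (simp_all add: distrib_left distrib_right mult_single mult.commute)

definition freeC :: "nat => nat => free_el set" where
  "freeC m n = {f. \<forall>w \<in> Poly_Mapping.keys f. set (letters w) \<subseteq> dy_gens m n}"

definition freepar :: "nat => free_el => free_el" where
  "freepar m = Poly_Mapping.mapp (\<lambda>w c. (- 1) ^ word_parity m w * c)"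

lemma free_superalg_simps [simp]:
  "carrier (free_superalg m n) = freeC m n"
  "mult (free_superalg m n) = (*)"
  "one (free_superalg m n) = 1"
  "zero (free_superalg m n) = 0"
  "add (free_superalg m n) = (+)"
  "scal (free_superalg m n) = cst"
  "par (free_superalg m n) = freepar m"
  by (simp_all add: free_superalg_def freeC_def freepar_def)

lemma freeC_0 [simp]: "0 \<in> freeC m n"
  by (simp add: freeC_def)

lemma freeC_single: "set (letters w) \<subseteq> dy_gens m n ==> Poly_Mapping.single w c \<in> freeC m n"
  by (auto simp: freeC_def)

lemma freeC_cst [simp]: "cst c \<in> freeC m n"
  by (rule freeC_single) simp

lemma freeC_1 [simp]: "1 \<in> freeC m n"
  using freeC_cst[of 1 m n] by simp

lemma freeC_gen: "x \<in> dy_gens m n ==> gen_el x \<in> freeC m n"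
  unfolding gen_el_def by (rule freeC_single) simp

lemma freeC_add [intro]: "f \<in> freeC m n ==> g \<in> freeC m n ==> f + g \<in> freeC m n"
  using keys_add[of f g] unfolding freeC_def by blast

lemma freeC_minus [intro]: "f \<in> freeC m n ==> - f \<in> freeC m n"
  by (simp add: freeC_def)

lemma freeC_diff [intro]: "f \<in> freeC m n ==> g \<in> freeC m n ==> f - g \<in> freeC m n"
  using freeC_add[of f m n "- g"] freeC_minus[of g m n] by simp

lemma freeC_mult [intro]: "f \<in> freeC m n ==> g \<in> freeC m n ==> f * g \<in> freeC m n"
  using keys_mult[of f g] unfolding freeC_def by fastforce

lemma freeC_sg [intro]: "f \<in> freeC m n ==> sg e f \<in> freeC m n"
  by (auto simp: sg_def)

lemma freeC_sum [intro]: "(!!x. x \<in> S ==> f x \<in> freeC m n) ==> sum f S \<in> freeC m n"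
  by (induction S rule: infinite_finite_induct) auto

lemma freeC_power [intro]: "f \<in> freeC m n ==> f ^ k \<in> freeC m n"
  by (induction k) auto

lemma ring_free: "ring (free_superalg m n)"
proof (rule ringI)
  show "abelian_group (free_superalg m n)"
  proof (rule abelian_groupI)
    fix x assume x: "x \<in> carrier (free_superalg m n)"
    show "\<exists>y\<in>carrier (free_superalg m n). y \<oplus>\<^bsub>free_superalg m n\<^esub> x = \<zero>\<^bsub>free_superalg m n\<^esub>"
      using x by (intro bexI[of _ "- x"]) auto
  qed (auto simp: add.assoc add.commute)
  show "monoid (free_superalg m n)"
    by (rule monoidI) (auto simp: mult.assoc)
qed (auto simp: distrib_left distrib_right)

lemma abelian_group_free: "abelian_group (free_superalg m n)"
  using ring_free by (rule ring.is_abelian_group)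

lemma finsum_free: "(!!x. x \<in> S ==> f x \<in> freeC m n) ==> finsum (free_superalg m n) f S = sum f S"
  using abelian_group.finsum_hom[OF abelian_group_free, of m n "\<lambda>x. x" S f] by simp

lemma a_inv_free [simp]:
  assumes "x \<in> freeC m n"
  shows "\<ominus>\<^bsub>free_superalg m n\<^esub> x = - x"
  by (rule abelian_group.minus_equality[OF abelian_group_free]) (use assms in auto)

lemma a_minus_free [simp]:
  "y \<in> freeC m n ==> x \<ominus>\<^bsub>free_superalg m n\<^esub> y = x - y"
  by (simp add: a_minus_def)

lemma nat_pow_free [simp]: "x [^]\<^bsub>free_superalg m n\<^esub> (k::nat) = x ^ k"
  by (induction k) (simp_all add: monoid.nat_pow_Suc ring.is_monoid[OF ring_free]
      monoid.nat_pow_0 power_Suc2 del: power_Suc)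

subsection \<open>The grading involution\<close>

lemma word_parity_plus: "word_parity m (v + w) = word_parity m v + word_parity m w"
  by (simp add: word_parity_def)

lemma lookup_freepar: "Poly_Mapping.lookup (freepar m f) w = (- 1) ^ word_parity m w * Poly_Mapping.lookup f w"
  by (simp add: freepar_def lookup_mapp when_def in_keys_iff)

lemma freepar_add: "freepar m (f + g) = freepar m f + freepar m g"
  by (rule poly_mapping_eqI) (simp add: lookup_freepar lookup_add distrib_left)

lemma freepar_0 [simp]: "freepar m 0 = 0"
  by (rule poly_mapping_eqI) (simp add: lookup_freepar)

lemma freepar_minus: "freepar m (- f) = - freepar m f"
  by (rule poly_mapping_eqI) (simp add: lookup_freepar)

lemma freepar_diff: "freepar m (f - g) = freepar m f - freepar m g"
  using freepar_add[of m f "- g"] by (simp add: freepar_minus)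

lemma freepar_sum: "freepar m (sum f S) = (\<Sum>x\<in>S. freepar m (f x))"
  by (induction S rule: infinite_finite_induct) (auto simp: freepar_add)

lemma freepar_sg: "freepar m (sg e x) = sg e (freepar m x)"
  by (simp add: sg_def freepar_minus)

lemma freepar_single: "freepar m (Poly_Mapping.single w c) = sg (word_parity m w) (Poly_Mapping.single w c)"
  by (rule poly_mapping_eqI)
     (simp add: lookup_freepar lookup_single when_def sg_def lookup_uminus single_uminus[symmetric])

lemma freepar_cst [simp]: "freepar m (cst c) = cst c"
  by (simp add: freepar_single word_parity_def)

lemma freepar_1 [simp]: "freepar m 1 = 1"
  using freepar_cst[of m 1] by simp

lemma freepar_mult: "freepar m (f * g) = freepar m f * freepar m g"
proof (induction f rule: free_el_induct)
  case (single v c)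
  show ?case
    by (induction g rule: free_el_induct)
       (simp_all add: freepar_single mult_single distrib_left freepar_add word_parity_plus
	 sg_mult_left sg_mult_right add.commute[where 'a=nat])
qed (simp_all add: freepar_add distrib_right)

lemma freepar_power: "freepar m (f ^ k) = freepar m f ^ k"
  by (induction k) (simp_all add: freepar_mult)

lemma freepar_freepar [simp]: "freepar m (freepar m f) = f"
  by (rule poly_mapping_eqI) (simp add: lookup_freepar)

lemma freepar_closed [intro]: "f \<in> freeC m n ==> freepar m f \<in> freeC m n"
  by (auto simp: freeC_def in_keys_iff lookup_freepar)

lemma freepar_gen: "freepar m (gen_el x) = sg (gen_parity m x) (gen_el x)"
  by (simp add: gen_el_def freepar_single word_parity_def)

lemma freepar_pow_homog:
  assumes "freepar m x = sg d x"
  shows "(freepar m ^^ e) x = sg (e * d) x"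
  by (induction e) (simp_all add: freepar_sg assms add.commute)

lemma freepar_pow_closed: "x \<in> freeC m n ==> (freepar m ^^ e) x \<in> freeC m n"
  by (induction e) auto

lemma freepar_pow_0 [simp]: "(freepar m ^^ e) 0 = 0"
  by (induction e) auto

lemma freepar_pow_even: "even e ==> (freepar m ^^ e) x = x"
proof (elim evenE)
  fix k assume "e = 2 * k"
  moreover have "(freepar m ^^ (2 * k)) x = x"
    by (induction k) simp_all
  ultimately show "(freepar m ^^ e) x = x" by simp
qed

section \<open>Entries of the defining relators\<close>

subsection \<open>Two-sided series\<close>

abbreviation tss :: "nat => nat => (int => int => free_el) superalg" where
  "tss m n \<equiv> two_sided_series (free_superalg m n)"

abbreviation tss_carrier :: "nat => nat => (int => int => free_el) => bool" where
  "tss_carrier m n f \<equiv> (\<forall>p q. f p q \<in> freeC m n)"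

lemma tss_simps:
  "f \<in> carrier (tss m n) \<longleftrightarrow> tss_carrier m n f"
  "zero (tss m n) = (\<lambda>p q. 0)"
  "add (tss m n) = (\<lambda>f g p q. f p q + g p q)"
  "par (tss m n) = (\<lambda>f p q. freepar m (f p q))"
  "one (tss m n) = (\<lambda>p q. if p = 0 \<and> q = 0 then 1 else 0)"
  by (simp_all add: two_sided_series_def cong: if_cong)

lemma abelian_group_tss: "abelian_group (tss m n)"
proof (rule abelian_groupI)
  fix x assume x: "x \<in> carrier (tss m n)"
  show "\<exists>y\<in>carrier (tss m n). y \<oplus>\<^bsub>tss m n\<^esub> x = \<zero>\<^bsub>tss m n\<^esub>"
    using x by (intro bexI[of _ "\<lambda>p q. - x p q"]) (auto simp: tss_simps)
qed (auto simp: tss_simps ac_simps)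

lemma tss_par_pow: "(par (tss m n) ^^ e) f = (\<lambda>p q. (freepar m ^^ e) (f p q))"
  by (induction e) (simp_all add: tss_simps)

text \<open>The defining sum runs over the common support. Any finite set containing it serves, so
  the entries of the relators can be written over explicit ranges of exponents.\<close>

lemma tss_mult_eq:
  assumes "tss_carrier m n f" "tss_carrier m n g"
    and D: "finite D" "!!a b. f a b \<noteq> 0 ==> g (p - a) (q - b) \<noteq> 0 ==> (a, b) \<in> D"
  shows "(f \<otimes>\<^bsub>tss m n\<^esub> g) p q = (\<Sum>(a, b)\<in>D. f a b * g (p - a) (q - b))"
proof -
  let ?S = "{(a, b). f a b \<noteq> 0 \<and> g (p - a) (q - b) \<noteq> 0}"
  have "(f \<otimes>\<^bsub>tss m n\<^esub> g) p q = (\<Sum>(a, b)\<in>?S. f a b * g (p - a) (q - b))"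
    using assms by (simp add: two_sided_series_def, subst finsum_free) (auto simp: case_prod_beta)
  also have "\<dots> = (\<Sum>(a, b)\<in>D. f a b * g (p - a) (q - b))"
    using D by (intro sum.mono_neutral_left) auto
  finally show ?thesis .
qed

text \<open>Over an infinite support both kinds of sum have the default value 0, which lies in the
  carrier.\<close>

lemma tss_mult_closed:
  assumes "tss_carrier m n f" "tss_carrier m n g"
  shows "tss_carrier m n (f \<otimes>\<^bsub>tss m n\<^esub> g)"
proof (intro allI)
  fix p q
  have "(f \<otimes>\<^bsub>tss m n\<^esub> g) p q = (\<Sum>(a, b)\<in>{(a, b). f a b \<noteq> 0 \<and> g (p - a) (q - b) \<noteq> 0}. f a b * g (p - a) (q - b))"
    using assms by (simp add: two_sided_series_def, subst finsum_free) (auto simp: case_prod_beta)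
  then show "(f \<otimes>\<^bsub>tss m n\<^esub> g) p q \<in> freeC m n"
    using assms by (auto intro!: freeC_sum)
qed

definition Uvar :: "(int => free_el) => int => int => free_el" where
  "Uvar x p q = (if q = 0 then x p else 0)"

definition Vvar :: "(int => free_el) => int => int => free_el" where
  "Vvar y p q = (if p = 0 then y q else 0)"

lemma tss_mult_Uvar:
  assumes "tss_carrier m n f" "!!p. x p \<in> freeC m n"
    and D: "finite D" "!!c. f c q \<noteq> 0 ==> x (p - c) \<noteq> 0 ==> c \<in> D"
  shows "(f \<otimes>\<^bsub>tss m n\<^esub> Uvar x) p q = (\<Sum>c\<in>D. f c q * x (p - c))"
proof -
  have "(f \<otimes>\<^bsub>tss m n\<^esub> Uvar x) p q = (\<Sum>(a, b)\<in>(\<lambda>c. (c, q)) ` D. f a b * Uvar x (p - a) (q - b))"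
    using assms by (intro tss_mult_eq) (auto simp: Uvar_def split: if_splits)
  also have "\<dots> = (\<Sum>c\<in>D. f c q * x (p - c))"
    by (subst sum.reindex) (auto simp: inj_on_def Uvar_def)
  finally show ?thesis .
qed

lemma tss_mult_Vvar:
  assumes "tss_carrier m n f" "!!p. y p \<in> freeC m n"
    and D: "finite D" "!!d. f p d \<noteq> 0 ==> y (q - d) \<noteq> 0 ==> d \<in> D"
  shows "(f \<otimes>\<^bsub>tss m n\<^esub> Vvar y) p q = (\<Sum>d\<in>D. f p d * y (q - d))"
proof -
  have "(f \<otimes>\<^bsub>tss m n\<^esub> Vvar y) p q = (\<Sum>(a, b)\<in>(\<lambda>d. (p, d)) ` D. f a b * Vvar y (p - a) (q - b))"
    using assms by (intro tss_mult_eq) (auto simp: Vvar_def split: if_splits)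
  also have "\<dots> = (\<Sum>d\<in>D. f p d * y (q - d))"
    by (subst sum.reindex) (auto simp: inj_on_def Vvar_def)
  finally show ?thesis .
qed

lemma tss_mult_Vvar_Uvar:
  assumes "!!p. y p \<in> freeC m n" "!!p. x p \<in> freeC m n"
  shows "(Vvar y \<otimes>\<^bsub>tss m n\<^esub> Uvar x) p q = y q * x p"
proof -
  have "(Vvar y \<otimes>\<^bsub>tss m n\<^esub> Uvar x) p q = (\<Sum>c\<in>{0}. Vvar y c q * x (p - c))"
    using assms by (intro tss_mult_Uvar) (auto simp: Vvar_def split: if_splits)
  then show ?thesis by (simp add: Vvar_def)
qed

lemma tss_mult_right:
  assumes "tss_carrier m n f" "tss_carrier m n g"
    and D: "finite D2" "!!d. finite (D1 d)"
      "!!c d. f (p - c) (q - d) \<noteq> 0 ==> g c d \<noteq> 0 ==> d \<in> D2 \<and> c \<in> D1 d"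
  shows "(f \<otimes>\<^bsub>tss m n\<^esub> g) p q = (\<Sum>d\<in>D2. \<Sum>c\<in>D1 d. f (p - c) (q - d) * g c d)"
proof -
  let ?h = "\<lambda>(d, c). (p - c, q - d)"
  have "(f \<otimes>\<^bsub>tss m n\<^esub> g) p q = (\<Sum>(a, b)\<in>?h ` Sigma D2 D1. f a b * g (p - a) (q - b))"
  proof (rule tss_mult_eq)
    fix a b assume "f a b \<noteq> 0" "g (p - a) (q - b) \<noteq> 0"
    then have "q - b \<in> D2 \<and> p - a \<in> D1 (q - b)"
      using D(3)[of "p - a" "q - b"] by simp
    then show "(a, b) \<in> ?h ` Sigma D2 D1"
      by (intro image_eqI[of _ _ "(q - b, p - a)"]) auto
  qed (use assms in auto)
  also have "\<dots> = (\<Sum>(d, c)\<in>Sigma D2 D1. f (p - c) (q - d) * g c d)"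
    by (subst sum.reindex) (auto simp: inj_on_def intro!: sum.cong)
  also have "\<dots> = (\<Sum>d\<in>D2. \<Sum>c\<in>D1 d. f (p - c) (q - d) * g c d)"
    using D by (simp add: sum.Sigma)
  finally show ?thesis .
qed

lemma tss_mult_0:
  assumes "tss_carrier m n f"
  shows "f \<otimes>\<^bsub>tss m n\<^esub> (\<lambda>p q. 0) = (\<lambda>p q. 0)" "(\<lambda>p q. 0) \<otimes>\<^bsub>tss m n\<^esub> f = (\<lambda>p q. 0)"
proof -
  have "(f \<otimes>\<^bsub>tss m n\<^esub> (\<lambda>p q. 0)) p q = (\<Sum>(a, b)\<in>{}. f a b * 0)" for p q
    using tss_mult_eq[where m = m and n = n and f = f and g = "\<lambda>p q. 0" and D = "{}"] assms by simp
  then show "f \<otimes>\<^bsub>tss m n\<^esub> (\<lambda>p q. 0) = (\<lambda>p q. 0)" by (intro ext) simp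
  have "((\<lambda>p q. 0) \<otimes>\<^bsub>tss m n\<^esub> f) p q = (\<Sum>(a, b)\<in>{}. f a b * 0)" for p q
    using tss_mult_eq[where m = m and n = n and g = f and f = "\<lambda>p q. 0" and D = "{}"] assms by simp
  then show "(\<lambda>p q. 0) \<otimes>\<^bsub>tss m n\<^esub> f = (\<lambda>p q. 0)" by (intro ext) simp
qed

lemma tss_one_mult:
  assumes "tss_carrier m n f"
  shows "one (tss m n) \<otimes>\<^bsub>tss m n\<^esub> f = f"
proof (intro ext)
  fix p q
  have "(one (tss m n) \<otimes>\<^bsub>tss m n\<^esub> f) p q = (\<Sum>(a, b)\<in>{(0, 0)}. one (tss m n) a b * f (p - a) (q - b))"
    using assms by (intro tss_mult_eq) (auto simp: tss_simps split: if_splits)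
  then show "(one (tss m n) \<otimes>\<^bsub>tss m n\<^esub> f) p q = f p q"
    by (simp add: tss_simps)
qed

lemma tss_sg_one_mult:
  assumes "tss_carrier m n f"
  shows "(\<lambda>p q. sg e (one (tss m n) p q)) \<otimes>\<^bsub>tss m n\<^esub> f = (\<lambda>p q. sg e (f p q))"
proof (intro ext)
  fix p q
  have "((\<lambda>p q. sg e (one (tss m n) p q)) \<otimes>\<^bsub>tss m n\<^esub> f) p q
      = (\<Sum>(a, b)\<in>{(0, 0)}. sg e (one (tss m n) a b) * f (p - a) (q - b))"
    using assms by (intro tss_mult_eq) (auto simp: tss_simps split: if_splits)
  then show "((\<lambda>p q. sg e (one (tss m n) p q)) \<otimes>\<^bsub>tss m n\<^esub> f) p q = sg e (f p q)"
    by (simp add: tss_simps sg_mult_left)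
qed

lemma tss_with_sign:
  assumes "tss_carrier m n f"
  shows "with_sign (tss m n) e f = (\<lambda>p q. sg e (f p q))"
proof (intro ext)
  fix p q
  show "with_sign (tss m n) e f p q = sg e (f p q)"
    using assms
    by (intro abelian_group.with_sign_hom[OF abelian_group_tss]) (auto simp: tss_simps)
qed

subsection \<open>Matrices of two-sided series\<close>

abbreviation Mtss :: "nat => nat => (int => int => free_el) mat2 ring" where
  "Mtss m n \<equiv> End2 m n (tss m n)"

lemma Mtss_carrier:
  "X \<in> carrier (Mtss m n) \<longleftrightarrow>
     (\<forall>i j k l. (in_range4 m n i j k l --> tss_carrier m n (X i j k l)) \<and>
       (\<not> in_range4 m n i j k l --> X i j k l = (\<lambda>p q. 0)))"
  by (simp add: End2_def tss_simps)

lemma Mtss_ops: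
  "zero (Mtss m n) = (\<lambda>i j k l p q. 0)"
  "add (Mtss m n) = (\<lambda>X Y i j k l p q. X i j k l p q + Y i j k l p q)"
  by (simp_all add: End2_def tss_simps)

lemma Mtss_uminus_closed:
  "X \<in> carrier (Mtss m n) ==> (\<lambda>i j k l p q. - X i j k l p q) \<in> carrier (Mtss m n)"
  unfolding Mtss_carrier by (auto intro: freeC_minus)

lemma abelian_group_Mtss: "abelian_group (Mtss m n)"
proof (rule abelian_groupI)
  fix X assume "X \<in> carrier (Mtss m n)"
  then show "\<exists>Y\<in>carrier (Mtss m n). Y \<oplus>\<^bsub>Mtss m n\<^esub> X = \<zero>\<^bsub>Mtss m n\<^esub>"
    by (intro bexI[of _ "\<lambda>i j k l p q. - X i j k l p q"] Mtss_uminus_closed)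
       (auto simp: Mtss_ops)
qed (auto simp: Mtss_carrier Mtss_ops ac_simps)

lemma Mtss_minus:
  assumes "X \<in> carrier (Mtss m n)" "Y \<in> carrier (Mtss m n)"
  shows "(X \<ominus>\<^bsub>Mtss m n\<^esub> Y) i j k l p q = X i j k l p q - Y i j k l p q"
proof -
  have "\<ominus>\<^bsub>Mtss m n\<^esub> Y = (\<lambda>i j k l p q. - Y i j k l p q)"
  proof (rule abelian_group.minus_equality[OF abelian_group_Mtss _ assms(2)])
    show "(\<lambda>i j k l p q. - Y i j k l p q) \<oplus>\<^bsub>Mtss m n\<^esub> Y = \<zero>\<^bsub>Mtss m n\<^esub>"
      by (simp add: End2_def tss_simps)
    show "(\<lambda>i j k l p q. - Y i j k l p q) \<in> carrier (Mtss m n)"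
      using assms(2) by (rule Mtss_uminus_closed)
  qed
  then show ?thesis by (simp add: a_minus_def End2_def tss_simps)
qed

lemma Mtss_carrierD:
  "X \<in> carrier (Mtss m n) ==> tss_carrier m n (X i j k l)"
  unfolding Mtss_carrier by (metis freeC_0)

lemma Mtss_mult:
  assumes "X \<in> carrier (Mtss m n)" "Y \<in> carrier (Mtss m n)" and r: "in_range4 m n i j k l"
  shows "(X \<otimes>\<^bsub>Mtss m n\<^esub> Y) i j k l p q = (\<Sum>p'=1..m+n. \<Sum>q'=1..m+n.
     sg (pp (pbar m) k q' p' j)
       (((\<lambda>p q. (freepar m ^^ (pbar m p' + pbar m j + pbar m q' + pbar m l)) (X i p' k q' p q))
	 \<otimes>\<^bsub>tss m n\<^esub> Y p' j q' l) p q))"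
proof -
  interpret abelian_group "tss m n" by (rule abelian_group_tss)
  have hom: "(x \<oplus>\<^bsub>tss m n\<^esub> y) p q = x p q + y p q" for x y
    by (simp add: tss_simps)
  have cl: "(\<lambda>p q. (freepar m ^^ e) (X i p' k q' p q)) \<otimes>\<^bsub>tss m n\<^esub> Y p' j q' l \<in> carrier (tss m n)" for p' q' e
    unfolding tss_simps(1)
    by (rule tss_mult_closed) (use Mtss_carrierD[OF assms(1)] Mtss_carrierD[OF assms(2)] in \<open>auto intro: freepar_pow_closed\<close>)
  show ?thesis
    using r
    apply (simp add: End2_def tss_par_pow)
    apply (subst finsum_hom[where \<phi> = "\<lambda>f. f p q"])
      apply (simp add: hom)
     apply (intro finsum_closed funcsetI with_sign_closed cl)
    apply (rule sum.cong[OF refl])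
    apply (subst finsum_hom[where \<phi> = "\<lambda>f. f p q"])
      apply (simp add: hom)
     apply (intro with_sign_closed cl)
    apply (rule sum.cong[OF refl])
    apply (subst with_sign_hom[where \<phi> = "\<lambda>f. f p q"])
      apply (simp add: hom)
     apply (rule cl)
    apply simp
    done
qed

lemma Mtss_mult_closed:
  assumes "X \<in> carrier (Mtss m n)" "Y \<in> carrier (Mtss m n)"
  shows "X \<otimes>\<^bsub>Mtss m n\<^esub> Y \<in> carrier (Mtss m n)"
proof -
  have "(X \<otimes>\<^bsub>Mtss m n\<^esub> Y) i j k l = (\<lambda>p q. 0)" if "\<not> in_range4 m n i j k l" for i j k l
    using that by (simp add: End2_def tss_simps)
  moreover have "tss_carrier m n ((X \<otimes>\<^bsub>Mtss m n\<^esub> Y) i j k l)" if "in_range4 m n i j k l" for i j k l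
    unfolding Mtss_mult[OF assms that]
    using Mtss_carrierD[OF assms(1)] Mtss_carrierD[OF assms(2)] that
    by (intro allI freeC_sum freeC_sg tss_mult_closed[THEN spec, THEN spec]) (auto intro: freepar_pow_closed)
  ultimately show ?thesis unfolding Mtss_carrier by simp
qed

lemma sum_sum_delta:
  fixes A B :: "'x set"
  assumes "finite A" "finite B" "u \<in> A" "v \<in> B"
  shows "(\<Sum>x\<in>A. \<Sum>y\<in>B. if x = u then if y = v then t else 0 else 0) = (t :: 'c::comm_monoid_add)"
proof -
  have "(\<Sum>y\<in>B. if x = u then if y = v then t else 0 else 0) = (if x = u then t else 0)" for x
    using assms by (cases "x = u") simp_all
  then show ?thesis using assms by simp
qed

text \<open>Common frame of the three matrix relations: \<open>a\<close> and \<open>b\<close> are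
  the coefficients of the two factors, \<open>f1\<close> and \<open>f2\<close> those of 1 and
  \<open>- P\<close> in the left R-matrix, \<open>g1\<close> and \<open>g2\<close> those in the
  right one. \<open>D1\<close> and \<open>D2\<close> bound the exponents that the R-matrix
  contributes; \<open>D1\<close> depends on the exponent of \<open>v\<close> because the relation of
  the dual Yangian requires it.\<close>

locale relator_data =
  fixes m n :: nat
    and a b :: "nat => nat => int => free_el"
    and f1 f2 g1 g2 :: "int => int => free_el"
    and D1 D2 :: "int => int => int set"
  assumes a_closed: "!!i j p. i \<in> {1..m+n} ==> j \<in> {1..m+n} ==> a i j p \<in> freeC m n"
    and b_closed: "!!i j p. i \<in> {1..m+n} ==> j \<in> {1..m+n} ==> b i j p \<in> freeC m n"
    and a_par: "!!i j p. freepar m (a i j p) = sg (pbar m i + pbar m j) (a i j p)"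
    and b_par: "!!i j p. freepar m (b i j p) = sg (pbar m i + pbar m j) (b i j p)"
    and f_closed: "!!p q. f1 p q \<in> freeC m n" "!!p q. f2 p q \<in> freeC m n"
      "!!p q. g1 p q \<in> freeC m n" "!!p q. g2 p q \<in> freeC m n"
    and f_par: "!!p q. freepar m (f1 p q) = f1 p q" "!!p q. freepar m (f2 p q) = f2 p q"
      "!!p q. freepar m (g1 p q) = g1 p q" "!!p q. freepar m (g2 p q) = g2 p q"
    and finite_D: "!!p q. finite (D1 p q)" "!!p q. finite (D2 p q)"
    and D1: "!!c d i j p. f1 c d \<noteq> 0 \<or> f2 c d \<noteq> 0 \<or> g1 c d \<noteq> 0 \<or> g2 c d \<noteq> 0 ==>
      a i j (p - c) \<noteq> 0 ==> c \<in> D1 p d"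
    and D2: "!!c d i j k l p q. f1 c d \<noteq> 0 \<or> f2 c d \<noteq> 0 \<or> g1 c d \<noteq> 0 \<or> g2 c d \<noteq> 0 ==>
      a i j (p - c) \<noteq> 0 ==> b k l (q - d) \<noteq> 0 ==> d \<in> D2 p q"
begin

abbreviation "N \<equiv> m + n"

definition T1 :: "(int => int => free_el) mat2" where
  "T1 i j k l = (if in_range4 m n i j k l \<and> k = l then Uvar (a i j) else (\<lambda>p q. 0))"

definition T2 :: "(int => int => free_el) mat2" where
  "T2 i j k l = (if in_range4 m n i j k l \<and> i = j then Vvar (b k l) else (\<lambda>p q. 0))"

definition Rm :: "(int => int => free_el) => (int => int => free_el) => (int => int => free_el) mat2" where
  "Rm f g i j k l = (\<lambda>p q. if in_range4 m n i j k l
     then (if i = j \<and> k = l then f p q else 0) - (if k = j \<and> l = i then sg (pbar m j) (g p q) else 0) else 0)"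

lemma Rm_apply: "Rm f g i j k l p q = (if in_range4 m n i j k l
     then (if i = j \<and> k = l then f p q else 0) - (if k = j \<and> l = i then sg (pbar m j) (g p q) else 0) else 0)"
  by (simp only: Rm_def)

lemma Rm_zero: "\<not> (i = j \<and> k = l) ==> \<not> (k = j \<and> l = i) ==> Rm f g i j k l = (\<lambda>p q. 0)"
  by (simp only: Rm_def if_False diff_self if_cancel)

lemma T1_carrier: "T1 \<in> carrier (Mtss m n)"
  unfolding Mtss_carrier T1_def using a_closed
  by (auto simp: Uvar_def in_range4_def)

lemma T2_carrier: "T2 \<in> carrier (Mtss m n)"
  unfolding Mtss_carrier T2_def using b_closed
  by (auto simp: Vvar_def in_range4_def)

lemma Rm_carrier:
  "(!!p q. f p q \<in> freeC m n) ==> (!!p q. g p q \<in> freeC m n) ==> Rm f g \<in> carrier (Mtss m n)"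
  unfolding Mtss_carrier Rm_apply
  by (auto simp: freeC_diff freeC_sg freeC_minus)

lemma R_T1:
  assumes r: "in_range4 m n i j k l"
  shows "(Rm f1 f2 \<otimes>\<^bsub>Mtss m n\<^esub> T1) i j k l p q = (\<Sum>c\<in>D1 p q.
     (if k = l then f1 c q * a i j (p - c) else 0)
     - (if l = i then sg (pp (pbar m) k l k j + pbar m k) (f2 c q * a k j (p - c)) else 0))"
proof -
  have ijkl: "i \<in> {1..N}" "j \<in> {1..N}" "k \<in> {1..N}" "l \<in> {1..N}"
    using r by (auto simp: in_range4_def)
  note Rc = Rm_carrier[of f1 f2, OF f_closed(1,2)]
  have par: "(freepar m ^^ e) (Rm f1 f2 i' j' k' l' p q) = Rm f1 f2 i' j' k' l' p q" for e i' j' k' l' p q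
  proof -
    have "freepar m (Rm f1 f2 i' j' k' l' p q) = sg 0 (Rm f1 f2 i' j' k' l' p q)"
      by (simp only: Rm_apply if_distrib[of "freepar m"] freepar_diff freepar_sg f_par freepar_0 sg_zero)
    from freepar_pow_homog[OF this, of e] show ?thesis by simp
  qed
  have "(Rm f1 f2 \<otimes>\<^bsub>Mtss m n\<^esub> T1) i j k l p q = (\<Sum>p'=1..N. \<Sum>q'=1..N.
     sg (pp (pbar m) k q' p' j) ((Rm f1 f2 i p' k q' \<otimes>\<^bsub>tss m n\<^esub> T1 p' j q' l) p q))"
    by (simp only: Mtss_mult[OF Rc T1_carrier r] par)
  also have "\<dots> = (\<Sum>p'=1..N. \<Sum>q'=1..N. if q' = l then
     sg (pp (pbar m) k q' p' j) (\<Sum>c\<in>D1 p q. Rm f1 f2 i p' k q' c q * a p' j (p - c)) else 0)"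
  proof (intro sum.cong refl)
    fix p' q' assume p': "p' \<in> {1..N}" and q': "q' \<in> {1..N}"
    have "Rm f1 f2 i p' k l \<otimes>\<^bsub>tss m n\<^esub> Uvar (a p' j) = (\<lambda>p q. \<Sum>c\<in>D1 p q. Rm f1 f2 i p' k l c q * a p' j (p - c))"
    proof (intro ext, rule tss_mult_Uvar)
      fix p q c assume R: "Rm f1 f2 i p' k l c q \<noteq> 0" and "a p' j (p - c) \<noteq> 0"
      moreover have "f1 c q \<noteq> 0 \<or> f2 c q \<noteq> 0"
      proof (rule ccontr)
	assume "\<not> (f1 c q \<noteq> 0 \<or> f2 c q \<noteq> 0)"
	then have "f1 c q = 0" "f2 c q = 0" by simp_all
	then have "Rm f1 f2 i p' k l c q = 0"
	  by (simp only: Rm_apply sg_0 diff_self if_cancel)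
	with R show False by contradiction
      qed
      ultimately show "c \<in> D1 p q" using D1 by blast
    qed (use Mtss_carrierD[OF Rc] a_closed p' ijkl(2) finite_D(1) in blast)+
    then show "sg (pp (pbar m) k q' p' j) ((Rm f1 f2 i p' k q' \<otimes>\<^bsub>tss m n\<^esub> T1 p' j q' l) p q)
      = (if q' = l then sg (pp (pbar m) k q' p' j) (\<Sum>c\<in>D1 p q. Rm f1 f2 i p' k q' c q * a p' j (p - c)) else 0)"
      using p' q' ijkl by (auto simp: T1_def tss_mult_0[OF Mtss_carrierD[OF Rc]] in_range4_def)
  qed
  also have "\<dots> = (\<Sum>p'=1..N. sg (pp (pbar m) k l p' j) (\<Sum>c\<in>D1 p q. Rm f1 f2 i p' k l c q * a p' j (p - c)))"
    using ijkl(4) by simp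
  also have "\<dots> = (\<Sum>c\<in>D1 p q. \<Sum>p'=1..N. sg (pp (pbar m) k l p' j) (Rm f1 f2 i p' k l c q * a p' j (p - c)))"
    by (simp add: sg_sum, rule sum.swap)
  also have "\<dots> = (\<Sum>c\<in>D1 p q. (if k = l then f1 c q * a i j (p - c) else 0)
     - (if l = i then sg (pp (pbar m) k l k j + pbar m k) (f2 c q * a k j (p - c)) else 0))"
  proof (intro sum.cong refl)
    fix c
    have "(\<Sum>p'=1..N. sg (pp (pbar m) k l p' j) (Rm f1 f2 i p' k l c q * a p' j (p - c)))
      = (\<Sum>p'=1..N. (if p' = i then (if k = l then f1 c q * a i j (p - c) else 0) else 0)
	- (if p' = k then (if l = i then sg (pp (pbar m) k l k j + pbar m k) (f2 c q * a k j (p - c)) else 0) else 0))"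
      using ijkl by (intro sum.cong refl)
	(auto simp: Rm_apply in_range4_def left_diff_distrib sg_diff sg_mult_left sg_minus sg_cancel
	  intro!: arg_cong2[of _ _ _ _ "(-)"] sg_cong arg_cong[of _ _ uminus])
    then show "(\<Sum>p'=1..N. sg (pp (pbar m) k l p' j) (Rm f1 f2 i p' k l c q * a p' j (p - c)))
      = (if k = l then f1 c q * a i j (p - c) else 0)
     - (if l = i then sg (pp (pbar m) k l k j + pbar m k) (f2 c q * a k j (p - c)) else 0)"
      using ijkl by (simp only: sum_subtractf sum.delta finite_atLeastAtMost) auto
  qed
  finally show ?thesis .
qed

lemma R_T1_T2:
  assumes r: "in_range4 m n i j k l"
  shows "(Rm f1 f2 \<otimes>\<^bsub>Mtss m n\<^esub> T1 \<otimes>\<^bsub>Mtss m n\<^esub> T2) i j k l p q = (\<Sum>d\<in>D2 p q. \<Sum>c\<in>D1 p d.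
     sg (pp (pbar m) i j k l) (f1 c d * a i j (p - c) * b k l (q - d))
     - sg (pt (pbar m) k j l) (f2 c d * a k j (p - c) * b i l (q - d)))"
proof -
  have ijkl: "i \<in> {1..N}" "j \<in> {1..N}" "k \<in> {1..N}" "l \<in> {1..N}"
    using r by (auto simp: in_range4_def)
  let ?X = "Rm f1 f2 \<otimes>\<^bsub>Mtss m n\<^esub> T1"
  have Xc: "?X \<in> carrier (Mtss m n)"
    by (intro Mtss_mult_closed T1_carrier Rm_carrier f_closed)
  \<comment> \<open>The product in \<open>End2\<close> twists its left factor by the grading
    involution. Each summand of an entry of \<open>?X\<close> is homogeneous, but the two kinds of
    summands have different index parities, so the twist becomes a separate sign on each.\<close>
  have parX: "(\<lambda>p q. (freepar m ^^ e) (?X i j k q' p q)) = (\<lambda>p q. \<Sum>c\<in>D1 p q.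
     (if k = q' then sg (e * (pbar m i + pbar m j)) (f1 c q * a i j (p - c)) else 0)
     - (if q' = i then sg (pp (pbar m) k q' k j + pbar m k + e * (pbar m k + pbar m j)) (f2 c q * a k j (p - c)) else 0))"
    if "q' \<in> {1..N}" for e q'
  proof (intro ext)
    fix p q
    have pp: "(freepar m ^^ e) (x - y) = (freepar m ^^ e) x - (freepar m ^^ e) y"
      "(freepar m ^^ e) (sum h S) = (\<Sum>s\<in>S. (freepar m ^^ e) (h s))" 
      "(freepar m ^^ e) (sg d x) = sg d ((freepar m ^^ e) x)" for x y d h and S :: "int set"
      by (induction e) (simp_all add: freepar_diff freepar_sum freepar_sg)
    have fa: "(freepar m ^^ e) (f * a u v w) = sg (e * (pbar m u + pbar m v)) (f * a u v w)"
      if "freepar m f = f" for f u v w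
      by (rule freepar_pow_homog) (simp add: freepar_mult that a_par sg_mult_right)
    have "in_range4 m n i j k q'"
      using ijkl that by (auto simp: in_range4_def)
    then show "(freepar m ^^ e) (?X i j k q' p q) = (\<Sum>c\<in>D1 p q.
     (if k = q' then sg (e * (pbar m i + pbar m j)) (f1 c q * a i j (p - c)) else 0)
     - (if q' = i then sg (pp (pbar m) k q' k j + pbar m k + e * (pbar m k + pbar m j)) (f2 c q * a k j (p - c)) else 0))"
      by (simp only: R_T1 pp if_distrib[of "freepar m ^^ e"] freepar_pow_0 fa f_par sg_sg)
  qed
  have "(?X \<otimes>\<^bsub>Mtss m n\<^esub> T2) i j k l p q = (\<Sum>p'=1..N. \<Sum>q'=1..N. if p' = j then \<Sum>d\<in>D2 p q. \<Sum>c\<in>D1 p d.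
      (if q' = k then sg (pp (pbar m) i j k l) (f1 c d * a i j (p - c) * b k l (q - d)) else 0)
     - (if q' = i then sg (pt (pbar m) k j l) (f2 c d * a k j (p - c) * b i l (q - d)) else 0) else 0)"
    unfolding Mtss_mult[OF Xc T2_carrier r]
  proof (intro sum.cong refl)
    fix p' q' assume p': "p' \<in> {1..N}" and q': "q' \<in> {1..N}"
    let ?e = "pbar m p' + pbar m j + pbar m q' + pbar m l"
    let ?Y = "\<lambda>p q. (freepar m ^^ ?e) (?X i p' k q' p q)"
    have Yc: "tss_carrier m n ?Y"
      using Mtss_carrierD[OF Xc] freepar_pow_closed by blast
    show "sg (pp (pbar m) k q' p' j) ((?Y \<otimes>\<^bsub>tss m n\<^esub> T2 p' j q' l) p q)
      = (if p' = j then \<Sum>d\<in>D2 p q. \<Sum>c\<in>D1 p d.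
      (if q' = k then sg (pp (pbar m) i j k l) (f1 c d * a i j (p - c) * b k l (q - d)) else 0)
     - (if q' = i then sg (pt (pbar m) k j l) (f2 c d * a k j (p - c) * b i l (q - d)) else 0) else 0)"
    proof (cases "p' = j")
      case False
      then show ?thesis by (simp add: T2_def tss_mult_0[OF Yc])
    next
      case True
      have "(?Y \<otimes>\<^bsub>tss m n\<^esub> Vvar (b q' l)) p q = (\<Sum>d\<in>D2 p q. ?Y p d * b q' l (q - d))"
      proof (rule tss_mult_Vvar[OF Yc])
	fix d assume *: "?Y p d \<noteq> 0" "b q' l (q - d) \<noteq> 0"
	obtain c where "(if k = q' then sg (?e * (pbar m i + pbar m j)) (f1 c d * a i j (p - c)) else 0)
	    - (if q' = i then sg (pp (pbar m) k q' k j + pbar m k + ?e * (pbar m k + pbar m j)) (f2 c d * a k j (p - c)) else 0) \<noteq> 0"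
	  using *(1) unfolding True fun_cong[OF fun_cong[OF parX[OF q']]]
	  by (rule sum.not_neutral_contains_not_neutral)
	then have "(f1 c d \<noteq> 0 \<and> a i j (p - c) \<noteq> 0) \<or> (f2 c d \<noteq> 0 \<and> a k j (p - c) \<noteq> 0)"
	  by (auto split: if_splits)
	then show "d \<in> D2 p q"
	  using *(2) D2 by metis
      qed (use b_closed q' ijkl finite_D in auto)
      also have "\<dots> = (\<Sum>d\<in>D2 p q. \<Sum>c\<in>D1 p d.
	 (if q' = k then sg (pp (pbar m) i j k l) (f1 c d * a i j (p - c) * b k l (q - d)) else 0)
	 - (if q' = i then sg (pt (pbar m) k j l) (f2 c d * a k j (p - c) * b i l (q - d)) else 0))"
	unfolding True fun_cong[OF fun_cong[OF parX[OF q']]] sum_distrib_right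
	by (intro sum.cong refl)
	   (auto simp: left_diff_distrib sg_mult_left intro!: arg_cong2[of _ _ _ _ "(-)"] sg_cong arg_cong[of _ _ uminus])
      finally show ?thesis
	using True q' ijkl by (simp add: T2_def in_range4_def sg_cancel)
    qed
  qed
  also have "\<dots> = (\<Sum>q'=1..N. \<Sum>d\<in>D2 p q. \<Sum>c\<in>D1 p d.
      (if q' = k then sg (pp (pbar m) i j k l) (f1 c d * a i j (p - c) * b k l (q - d)) else 0)
     - (if q' = i then sg (pt (pbar m) k j l) (f2 c d * a k j (p - c) * b i l (q - d)) else 0))"
    using ijkl(2) by (subst sum.swap) simp
  also have "\<dots> = (\<Sum>d\<in>D2 p q. \<Sum>c\<in>D1 p d. \<Sum>q'=1..N.
      (if q' = k then sg (pp (pbar m) i j k l) (f1 c d * a i j (p - c) * b k l (q - d)) else 0)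
     - (if q' = i then sg (pt (pbar m) k j l) (f2 c d * a k j (p - c) * b i l (q - d)) else 0))"
    by (subst sum.swap, rule sum.cong[OF refl], rule sum.swap)
  also have "\<dots> = (\<Sum>d\<in>D2 p q. \<Sum>c\<in>D1 p d.
     sg (pp (pbar m) i j k l) (f1 c d * a i j (p - c) * b k l (q - d))
     - sg (pt (pbar m) k j l) (f2 c d * a k j (p - c) * b i l (q - d)))"
    using ijkl by (simp only: sum_subtractf sum.delta finite_atLeastAtMost if_True)
  finally show ?thesis .
qed

lemma T2_T1:
  assumes r: "in_range4 m n i j k l"
  shows "(T2 \<otimes>\<^bsub>Mtss m n\<^esub> T1) i j k l p q = b k l q * a i j p"
proof -
  have ijkl: "i \<in> {1..N}" "j \<in> {1..N}" "k \<in> {1..N}" "l \<in> {1..N}"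
    using r by (auto simp: in_range4_def)
  have "(T2 \<otimes>\<^bsub>Mtss m n\<^esub> T1) i j k l p q = (\<Sum>p'=1..N. \<Sum>q'=1..N. if p' = i then if q' = l then b k l q * a i j p else 0 else 0)"
    unfolding Mtss_mult[OF T2_carrier T1_carrier r]
  proof (intro sum.cong refl)
    fix p' q' assume p': "p' \<in> {1..N}" and q': "q' \<in> {1..N}"
    let ?e = "pbar m p' + pbar m j + pbar m q' + pbar m l"
    let ?Y = "\<lambda>p q. (freepar m ^^ ?e) (T2 i p' k q' p q)"
    have Yc: "tss_carrier m n ?Y"
      using Mtss_carrierD[OF T2_carrier] freepar_pow_closed by blast
    show "sg (pp (pbar m) k q' p' j) ((?Y \<otimes>\<^bsub>tss m n\<^esub> T1 p' j q' l) p q)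
      = (if p' = i then if q' = l then b k l q * a i j p else 0 else 0)"
    proof (cases "p' = i \<and> q' = l")
      case False
      then show ?thesis
	using tss_mult_0(2)[OF Mtss_carrierD[OF T1_carrier, of p' j q' l]] tss_mult_0(1)[OF Yc]
	by (auto simp: T2_def T1_def)
    next
      case True
      have "?Y = Vvar (\<lambda>q. sg (pp (pbar m) i j k l) (b k l q))"
      proof (intro ext)
	fix p q
	have "(freepar m ^^ ?e) (b k l q) = sg (pp (pbar m) i j k l) (b k l q)"
	  using True freepar_pow_homog[OF b_par, of ?e k l q] by (auto intro: sg_cong)
	then show "?Y p q = Vvar (\<lambda>q. sg (pp (pbar m) i j k l) (b k l q)) p q"
	  using True r by (auto simp: T2_def Vvar_def in_range4_def)
      qed
      then have "(?Y \<otimes>\<^bsub>tss m n\<^esub> T1 p' j q' l) p q = sg (pp (pbar m) i j k l) (b k l q * a i j p)"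
	using True r ijkl a_closed b_closed
	by (simp add: T1_def in_range4_def tss_mult_Vvar_Uvar freeC_sg sg_mult_left)
      moreover have "even (pp (pbar m) k l i j + pp (pbar m) i j k l)"
	by (simp add: mult.commute)
      ultimately show ?thesis
	using True by (simp add: sg_cancel)
    qed
  qed
  then show ?thesis
    by (simp only: sum_sum_delta[OF finite_atLeastAtMost finite_atLeastAtMost ijkl(1,4)])
qed

lemma T2_T1_R:
  assumes r: "in_range4 m n i j k l"
  shows "(T2 \<otimes>\<^bsub>Mtss m n\<^esub> T1 \<otimes>\<^bsub>Mtss m n\<^esub> Rm g1 g2) i j k l p q = (\<Sum>d\<in>D2 p q. \<Sum>c\<in>D1 p d.
     b k l (q - d) * a i j (p - c) * g1 c d
     - sg (pt (pbar m) k j l) (b k j (q - d) * a i l (p - c) * g2 c d))"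
proof -
  have ijkl: "i \<in> {1..N}" "j \<in> {1..N}" "k \<in> {1..N}" "l \<in> {1..N}"
    using r by (auto simp: in_range4_def)
  let ?X = "T2 \<otimes>\<^bsub>Mtss m n\<^esub> T1"
  have Xc: "?X \<in> carrier (Mtss m n)"
    by (intro Mtss_mult_closed T1_carrier T2_carrier)
  note Rc = Rm_carrier[of g1 g2, OF f_closed(3,4)]
  let ?t1 = "\<lambda>d c. b k l (q - d) * a i j (p - c) * g1 c d"
  let ?t2 = "\<lambda>d c. sg (pt (pbar m) k j l) (b k j (q - d) * a i l (p - c) * g2 c d)"
  have "(?X \<otimes>\<^bsub>Mtss m n\<^esub> Rm g1 g2) i j k l p q = (\<Sum>p'=1..N. \<Sum>q'=1..N. \<Sum>d\<in>D2 p q. \<Sum>c\<in>D1 p d.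
      (if p' = j then if q' = l then ?t1 d c else 0 else 0) - (if p' = l then if q' = j then ?t2 d c else 0 else 0))"
    unfolding Mtss_mult[OF Xc Rc r]
  proof (intro sum.cong refl)
    fix p' q' assume p': "p' \<in> {1..N}" and q': "q' \<in> {1..N}"
    let ?e = "pbar m p' + pbar m j + pbar m q' + pbar m l"
    let ?Y = "\<lambda>p q. (freepar m ^^ ?e) (?X i p' k q' p q)"
    have Yc: "tss_carrier m n ?Y"
      using Mtss_carrierD[OF Xc] freepar_pow_closed by blast
    have r': "in_range4 m n i p' k q'"
      using ijkl p' q' by (auto simp: in_range4_def)
    show "sg (pp (pbar m) k q' p' j) ((?Y \<otimes>\<^bsub>tss m n\<^esub> Rm g1 g2 p' j q' l) p q)
      = (\<Sum>d\<in>D2 p q. \<Sum>c\<in>D1 p d.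
      (if p' = j then if q' = l then ?t1 d c else 0 else 0) - (if p' = l then if q' = j then ?t2 d c else 0 else 0))"
    proof (cases "(p' = j \<and> q' = l) \<or> (p' = l \<and> q' = j)")
      case False
      then have "Rm g1 g2 p' j q' l = (\<lambda>p q. 0)"
	by (intro Rm_zero) auto
      then show ?thesis
	using False tss_mult_0(1)[OF Yc] by (auto intro!: sum.neutral)
    next
      case True
      \<comment> \<open>Both 1 and \<open>P\<close> are even, so no twist remains where
        \<open>Rm\<close> is nonzero.\<close>
      then have "even ?e" by auto
      then have Y: "?Y = (\<lambda>p q. b k q' q * a i p' p)"
	by (simp add: freepar_pow_even T2_T1[OF r'])
      have "(?Y \<otimes>\<^bsub>tss m n\<^esub> Rm g1 g2 p' j q' l) p q
	  = (\<Sum>d\<in>D2 p q. \<Sum>c\<in>D1 p d. ?Y (p - c) (q - d) * Rm g1 g2 p' j q' l c d)"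
      proof (rule tss_mult_right[OF Yc Mtss_carrierD[OF Rc] finite_D(2,1)])
	fix c d assume "?Y (p - c) (q - d) \<noteq> 0" and R: "Rm g1 g2 p' j q' l c d \<noteq> 0"
	then have "a i p' (p - c) \<noteq> 0" "b k q' (q - d) \<noteq> 0"
	  by (auto simp: fun_cong[OF fun_cong[OF Y]])
	moreover have "g1 c d \<noteq> 0 \<or> g2 c d \<noteq> 0"
	proof (rule ccontr)
	  assume "\<not> (g1 c d \<noteq> 0 \<or> g2 c d \<noteq> 0)"
	  then have "g1 c d = 0" "g2 c d = 0" by simp_all
	  then have "Rm g1 g2 p' j q' l c d = 0"
	    by (simp only: Rm_apply sg_0 diff_self if_cancel)
	  with R show False by contradiction
	qed
	ultimately show "d \<in> D2 p q \<and> c \<in> D1 p d"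
	  using D1 D2 by metis
      qed
      then have *: "(?Y \<otimes>\<^bsub>tss m n\<^esub> Rm g1 g2 p' j q' l) p q
	  = (\<Sum>d\<in>D2 p q. \<Sum>c\<in>D1 p d. (b k q' (q - d) * a i p' (p - c)) * Rm g1 g2 p' j q' l c d)"
	by (simp only: fun_cong[OF fun_cong[OF Y]])
      show ?thesis
	unfolding * sg_sum using True p' q' ijkl
	by (intro sum.cong refl)
	   (auto simp: Rm_apply in_range4_def right_diff_distrib sg_mult_right sg_diff sg_cancel sg_minus
	     intro!: arg_cong2[of _ _ _ _ "(-)"] sg_cong arg_cong[of _ _ uminus])
    qed
  qed
  also have "\<dots> = (\<Sum>d\<in>D2 p q. \<Sum>c\<in>D1 p d. \<Sum>p'=1..N. \<Sum>q'=1..N.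
      (if p' = j then if q' = l then ?t1 d c else 0 else 0) - (if p' = l then if q' = j then ?t2 d c else 0 else 0))"
  proof -
    have "(\<Sum>x\<in>A. \<Sum>y\<in>B. \<Sum>d\<in>C. \<Sum>c\<in>E d. F x y d c) = (\<Sum>d\<in>C. \<Sum>c\<in>E d. \<Sum>x\<in>A. \<Sum>y\<in>B. F x y d c)"
      for A B :: "nat set" and C :: "int set" and E and F :: "nat => nat => int => int => free_el"
    proof -
      have "(\<Sum>x\<in>A. \<Sum>y\<in>B. \<Sum>d\<in>C. \<Sum>c\<in>E d. F x y d c) = (\<Sum>x\<in>A. \<Sum>d\<in>C. \<Sum>c\<in>E d. \<Sum>y\<in>B. F x y d c)"
	by (intro sum.cong refl, subst sum.swap) (intro sum.cong refl sum.swap)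
      also have "\<dots> = (\<Sum>d\<in>C. \<Sum>c\<in>E d. \<Sum>x\<in>A. \<Sum>y\<in>B. F x y d c)"
	by (subst sum.swap) (intro sum.cong refl sum.swap)
      finally show ?thesis .
    qed
    then show ?thesis .
  qed
  also have "\<dots> = (\<Sum>d\<in>D2 p q. \<Sum>c\<in>D1 p d. ?t1 d c - ?t2 d c)"
    by (simp only: sum_subtractf sum_sum_delta[OF finite_atLeastAtMost finite_atLeastAtMost ijkl(2,4)]
	sum_sum_delta[OF finite_atLeastAtMost finite_atLeastAtMost ijkl(4,2)])
  finally show ?thesis .
qed

definition relator :: "(int => int => free_el) mat2" where
  "relator = Rm f1 f2 \<otimes>\<^bsub>Mtss m n\<^esub> T1 \<otimes>\<^bsub>Mtss m n\<^esub> T2 \<ominus>\<^bsub>Mtss m n\<^esub> T2 \<otimes>\<^bsub>Mtss m n\<^esub> T1 \<otimes>\<^bsub>Mtss m n\<^esub> Rm g1 g2"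

lemma relator_entry:
  "relator i j k l p q = (if in_range4 m n i j k l then
     (\<Sum>d\<in>D2 p q. \<Sum>c\<in>D1 p d.
       (sg (pp (pbar m) i j k l) (f1 c d * a i j (p - c) * b k l (q - d))
       - sg (pt (pbar m) k j l) (f2 c d * a k j (p - c) * b i l (q - d)))
       - (b k l (q - d) * a i j (p - c) * g1 c d
       - sg (pt (pbar m) k j l) (b k j (q - d) * a i l (p - c) * g2 c d)))
     else 0)"
proof -
  have 1: "Rm f1 f2 \<otimes>\<^bsub>Mtss m n\<^esub> T1 \<otimes>\<^bsub>Mtss m n\<^esub> T2 \<in> carrier (Mtss m n)"
    and 2: "T2 \<otimes>\<^bsub>Mtss m n\<^esub> T1 \<otimes>\<^bsub>Mtss m n\<^esub> Rm g1 g2 \<in> carrier (Mtss m n)"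
    by (intro Mtss_mult_closed T1_carrier T2_carrier Rm_carrier f_closed)+
  show ?thesis
  proof (cases "in_range4 m n i j k l")
    case True
    then show ?thesis
      by (simp add: relator_def Mtss_minus[OF 1 2] R_T1_T2 T2_T1_R sum_subtractf)
  next
    case False
    then show ?thesis
      using 1 2 unfolding relator_def Mtss_minus[OF 1 2] Mtss_carrier by simp
  qed
qed

lemma relator_closed: "relator i j k l p q \<in> freeC m n"
  unfolding relator_entry using a_closed b_closed f_closed
  by (auto simp: in_range4_def intro!: freeC_sum freeC_diff freeC_sg freeC_mult)

lemma relator_par:
  "freepar m (relator i j k l p q) = sg (pbar m i + pbar m j + pbar m k + pbar m l) (relator i j k l p q)"
  unfolding relator_entry
  by (auto simp: freepar_sum freepar_diff freepar_sg freepar_mult a_par b_par f_par sg_sum sg_diff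
      sg_mult_left sg_mult_right intro!: sum.cong arg_cong2[of _ _ _ _ "(-)"] sg_cong)

end

section \<open>Quotients and completions\<close>

lemma quot_superalg_ops:
  "mult (quot_superalg A I) = mult (A Quot I)"
  "one (quot_superalg A I) = one (A Quot I)"
  "zero (quot_superalg A I) = zero (A Quot I)"
  "add (quot_superalg A I) = add (A Quot I)"
  "carrier (quot_superalg A I) = carrier (A Quot I)"
  "scal (quot_superalg A I) = (\<lambda>c. I +>\<^bsub>A\<^esub> scal A c)"
  "par (quot_superalg A I) = (\<lambda>X. par A ` X)"
  by (simp_all add: quot_superalg_def ring.defs superalg.defs)

context
  fixes A :: "('a, 'b) superalg_scheme" and I
  assumes I: "ideal I A"
begin

interpretation ideal I A by (rule I)

interpretation Q: ring "A Quot I" by (rule quotient_is_ring)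

lemma ring_quot_superalg: "ring (quot_superalg A I)"
proof (rule ringI)
  show "abelian_group (quot_superalg A I)"
  proof (rule abelian_groupI)
    fix x assume "x \<in> carrier (quot_superalg A I)"
    then show "\<exists>y\<in>carrier (quot_superalg A I). y \<oplus>\<^bsub>quot_superalg A I\<^esub> x = \<zero>\<^bsub>quot_superalg A I\<^esub>"
      by (intro bexI[of _ "\<ominus>\<^bsub>A Quot I\<^esub> x"]) (auto simp: Q.l_neg quot_superalg_ops)
  qed (auto simp: Q.a_ac quot_superalg_ops)
  show "monoid (quot_superalg A I)"
    by (rule monoidI) (auto simp: Q.m_assoc quot_superalg_ops)
qed (auto simp: Q.l_distr Q.r_distr quot_superalg_ops)

lemma quot_superalg_hom: "(+>\<^bsub>A\<^esub>) I \<in> ring_hom A (quot_superalg A I)"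
  using rcos_ring_hom by (auto simp: ring_hom_def quot_superalg_ops)

lemma quot_superalg_carrier: "carrier (quot_superalg A I) = (+>\<^bsub>A\<^esub>) I ` carrier A"
  by (auto simp: quot_superalg_ops FactRing_def A_RCOSETS_def' a_r_coset_def')

lemma quot_superalg_eq_iff:
  "x \<in> carrier A ==> y \<in> carrier A ==> I +>\<^bsub>A\<^esub> x = I +>\<^bsub>A\<^esub> y \<longleftrightarrow> x \<ominus>\<^bsub>A\<^esub> y \<in> I"
  using quotient_eq_iff_same_a_r_cos[OF I] by simp

text \<open>On the quotient the involution is the image of a coset. For this to be a coset of
  \<open>I\<close> again, the image of \<open>I\<close> must be all of \<open>I\<close>: stability
  gives one inclusion and involutivity the other.\<close>

lemma quot_superalg_par:
  assumes add: "!!x y. x \<in> carrier A ==> y \<in> carrier A ==> par A (x \<oplus>\<^bsub>A\<^esub> y) = par A x \<oplus>\<^bsub>A\<^esub> par A y"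
    and closed: "!!x. x \<in> I ==> par A x \<in> I"
    and invol: "!!x. x \<in> carrier A ==> par A (par A x) = x"
    and x: "x \<in> carrier A"
  shows "par (quot_superalg A I) (I +>\<^bsub>A\<^esub> x) = I +>\<^bsub>A\<^esub> par A x"
proof -
  have "par A ` (I +>\<^bsub>A\<^esub> x) = (\<lambda>h. par A h \<oplus>\<^bsub>A\<^esub> par A x) ` I"
  proof -
    have "I +>\<^bsub>A\<^esub> x = (\<lambda>h. h \<oplus>\<^bsub>A\<^esub> x) ` I"
      by (auto simp: a_r_coset_def')
    then show ?thesis
      using add[OF a_Hcarr x] by (simp add: image_image)
  qed
  also have "\<dots> = (\<lambda>h. h \<oplus>\<^bsub>A\<^esub> par A x) ` I"
  proof -
    have "par A ` I = I"
    proof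
      show "par A ` I \<subseteq> I" using closed by blast
      show "I \<subseteq> par A ` I"
      proof
	fix h assume "h \<in> I"
	then have "par A h \<in> I" "h = par A (par A h)"
	  using closed invol[OF a_Hcarr] by auto
	then show "h \<in> par A ` I" by blast
      qed
    qed
    then have "(\<lambda>h. h \<oplus>\<^bsub>A\<^esub> par A x) ` I = (\<lambda>h. h \<oplus>\<^bsub>A\<^esub> par A x) ` par A ` I" by simp
    then show ?thesis by (simp only: image_image)
  qed
  also have "\<dots> = I +>\<^bsub>A\<^esub> par A x"
    by (auto simp: a_r_coset_def')
  finally show ?thesis by (simp add: quot_superalg_ops)
qed

end

text \<open>The \<open>J p\<close> are right ideals. On the left only continuity at zero is asked
  for, with a \<open>q\<close> that may depend on the multiplier \<open>w\<close>; this is all that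
  the generators of the Yangian allow below.\<close>

locale filtered_ring = ring A for A :: "('a, 'b) superalg_scheme" (structure) +
  fixes J :: "nat => 'a set"
  assumes J_subgroup: "subgroup (J p) (add_monoid A)"
    and J_right: "x \<in> J p ==> y \<in> carrier A ==> x \<otimes> y \<in> J p"
    and J_mono: "p \<le> q ==> J q \<subseteq> J p"
    and J_left: "w \<in> carrier A ==> \<exists>q. \<forall>x\<in>J q. w \<otimes> x \<in> J p"
begin

abbreviation "CA \<equiv> cauchy_superalg A J"

lemma J_carrier: "x \<in> J p ==> x \<in> carrier A"
  using subgroup.mem_carrier[OF J_subgroup] by simp

lemma J_add: "x \<in> J p ==> y \<in> J p ==> x \<oplus> y \<in> J p"
  using subgroup.m_closed[OF J_subgroup] by simp

lemma J_zero: "\<zero> \<in> J p"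
  using subgroup.one_closed[OF J_subgroup] by simp

lemma J_neg: "x \<in> J p ==> \<ominus> x \<in> J p"
  using subgroup.m_inv_closed[OF J_subgroup] by (simp add: a_inv_def)

lemma J_minus: "x \<in> J p ==> y \<in> J p ==> x \<ominus> y \<in> J p"
  unfolding a_minus_def by (intro J_add J_neg)

lemma cauchy_ops:
  "carrier CA = cauchy_seqs A J" "mult CA = (\<lambda>x y k. x k \<otimes> y k)" "one CA = (\<lambda>k. \<one>)"
  "zero CA = (\<lambda>k. \<zero>)" "add CA = (\<lambda>x y k. x k \<oplus> y k)"
  "scal CA = (\<lambda>c k. scal A c)" "par CA = (\<lambda>x k. par A (x k))"
  by (simp_all add: cauchy_superalg_def)

lemma cauchyI:
  "(!!k. x k \<in> carrier A) ==> (!!p. \<exists>N. \<forall>k\<ge>N. \<forall>l\<ge>N. x k \<ominus> x l \<in> J p) ==> x \<in> cauchy_seqs A J"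
  by (simp add: cauchy_seqs_def)

lemma cauchy_closed: "x \<in> cauchy_seqs A J ==> x k \<in> carrier A"
  by (simp add: cauchy_seqs_def)

lemma cauchyD: "x \<in> cauchy_seqs A J ==> \<exists>N. \<forall>k\<ge>N. \<forall>l\<ge>N. x k \<ominus> x l \<in> J p"
  by (simp add: cauchy_seqs_def)

lemma cauchy_const: "c \<in> carrier A ==> (\<lambda>k. c) \<in> cauchy_seqs A J"
  by (rule cauchyI) (simp_all add: J_zero a_minus_def r_neg)

lemma cauchy_add:
  assumes x: "x \<in> cauchy_seqs A J" and y: "y \<in> cauchy_seqs A J"
  shows "(\<lambda>k. x k \<oplus> y k) \<in> cauchy_seqs A J"
proof (rule cauchyI)
  fix p
  obtain N1 N2 where N1: "\<forall>k\<ge>N1. \<forall>l\<ge>N1. x k \<ominus> x l \<in> J p" and N2: "\<forall>k\<ge>N2. \<forall>l\<ge>N2. y k \<ominus> y l \<in> J p"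
    using cauchyD[OF x] cauchyD[OF y] by metis
  have "(x k \<oplus> y k) \<ominus> (x l \<oplus> y l) = (x k \<ominus> x l) \<oplus> (y k \<ominus> y l)" for k l
    using cauchy_closed[OF x] cauchy_closed[OF y]
    by (simp add: a_minus_def minus_add a_ac)
  then show "\<exists>N. \<forall>k\<ge>N. \<forall>l\<ge>N. x k \<oplus> y k \<ominus> (x l \<oplus> y l) \<in> J p"
    using N1 N2 by (intro exI[of _ "max N1 N2"]) (auto intro: J_add)
qed (use x y in \<open>auto intro: cauchy_closed\<close>)

lemma cauchy_neg:
  assumes x: "x \<in> cauchy_seqs A J"
  shows "(\<lambda>k. \<ominus> x k) \<in> cauchy_seqs A J"
proof (rule cauchyI)
  fix p
  obtain N where N: "\<forall>k\<ge>N. \<forall>l\<ge>N. x k \<ominus> x l \<in> J p"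
    using cauchyD[OF x] by metis
  have "\<ominus> x k \<ominus> (\<ominus> x l) = \<ominus> (x k \<ominus> x l)" for k l
    using cauchy_closed[OF x] by (simp add: a_minus_def minus_add)
  then show "\<exists>N. \<forall>k\<ge>N. \<forall>l\<ge>N. \<ominus> x k \<ominus> (\<ominus> x l) \<in> J p"
    using N by (intro exI[of _ N]) (auto intro: J_neg)
qed (use x in \<open>auto intro: cauchy_closed\<close>)

text \<open>Along a Cauchy sequence a single \<open>q\<close> suffices, although
  \<open>J_left\<close> is not uniform: \<open>x k\<close> differs from a fixed \<open>x N\<close>
  by an element of the right ideal \<open>J p\<close>, and \<open>x N\<close> is one element. This
  makes products of Cauchy sequences Cauchy and the null sequences an ideal.\<close>

lemma cauchy_left_bound:
  assumes x: "x \<in> cauchy_seqs A J"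
  shows "\<exists>N q. \<forall>k\<ge>N. \<forall>h\<in>J q. x k \<otimes> h \<in> J p"
proof -
  obtain N where N: "\<forall>k\<ge>N. \<forall>l\<ge>N. x k \<ominus> x l \<in> J p"
    using cauchyD[OF x] by metis
  obtain q where q: "\<forall>h\<in>J q. x N \<otimes> h \<in> J p"
    using J_left cauchy_closed[OF x] by metis
  have "x k \<otimes> h \<in> J p" if "k \<ge> N" "h \<in> J q" for k h
  proof -
    have "x k \<otimes> h = (x k \<ominus> x N) \<otimes> h \<oplus> x N \<otimes> h"
      using cauchy_closed[OF x] J_carrier[OF that(2)]
      by (simp add: a_minus_def l_distr l_minus a_assoc l_neg)
    moreover have "(x k \<ominus> x N) \<otimes> h \<in> J p" "x N \<otimes> h \<in> J p"
      using N q that J_carrier[OF that(2)] by (auto intro: J_right)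
    ultimately show ?thesis by (simp add: J_add)
  qed
  then show ?thesis by blast
qed

lemma cauchy_mult:
  assumes x: "x \<in> cauchy_seqs A J" and y: "y \<in> cauchy_seqs A J"
  shows "(\<lambda>k. x k \<otimes> y k) \<in> cauchy_seqs A J"
proof (rule cauchyI)
  fix p
  obtain N q where N: "\<forall>k\<ge>N. \<forall>h\<in>J q. x k \<otimes> h \<in> J p"
    using cauchy_left_bound[OF x] by metis
  obtain N1 N2 where N1: "\<forall>k\<ge>N1. \<forall>l\<ge>N1. x k \<ominus> x l \<in> J p" and N2: "\<forall>k\<ge>N2. \<forall>l\<ge>N2. y k \<ominus> y l \<in> J q"
    using cauchyD[OF x] cauchyD[OF y] by metis
  have "x k \<otimes> y k \<ominus> x l \<otimes> y l = x k \<otimes> (y k \<ominus> y l) \<oplus> (x k \<ominus> x l) \<otimes> y l" for k l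
  proof -
    note c = cauchy_closed[OF x] cauchy_closed[OF y]
    have "x k \<otimes> (y k \<ominus> y l) \<oplus> (x k \<ominus> x l) \<otimes> y l
	= x k \<otimes> y k \<oplus> (\<ominus> (x k \<otimes> y l) \<oplus> x k \<otimes> y l) \<oplus> \<ominus> (x l \<otimes> y l)"
      using c by (simp add: a_minus_def l_distr r_distr l_minus r_minus a_assoc)
    then show ?thesis using c by (simp add: a_minus_def l_neg)
  qed
  then show "\<exists>N. \<forall>k\<ge>N. \<forall>l\<ge>N. x k \<otimes> y k \<ominus> x l \<otimes> y l \<in> J p"
    using N N1 N2 cauchy_closed[OF y]
    by (intro exI[of _ "max N (max N1 N2)"]) (auto intro!: J_add[OF _ J_right])
qed (use x y in \<open>auto intro: cauchy_closed\<close>)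

lemma ring_cauchy: "ring CA"
proof (rule ringI)
  show "abelian_group CA"
  proof (rule abelian_groupI)
    fix x assume "x \<in> carrier CA"
    then show "\<exists>y\<in>carrier CA. y \<oplus>\<^bsub>CA\<^esub> x = \<zero>\<^bsub>CA\<^esub>"
      by (intro bexI[of _ "\<lambda>k. \<ominus> x k"]) (auto simp: cauchy_ops cauchy_neg cauchy_closed l_neg)
  qed (auto simp: cauchy_ops cauchy_add cauchy_const cauchy_closed a_ac)
  show "monoid CA"
    by (rule monoidI) (auto simp: cauchy_ops cauchy_mult cauchy_const cauchy_closed m_assoc)
qed (auto simp: cauchy_ops cauchy_closed l_distr r_distr)

lemma cauchy_a_inv: "x \<in> carrier CA ==> \<ominus>\<^bsub>CA\<^esub> x = (\<lambda>k. \<ominus> x k)"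
  by (rule abelian_group.minus_equality[OF ring.is_abelian_group[OF ring_cauchy]])
     (auto simp: cauchy_ops cauchy_neg cauchy_closed l_neg)

lemma null_cauchy: "x \<in> null_seqs A J ==> x \<in> cauchy_seqs A J"
  unfolding null_seqs_def cauchy_seqs_def using J_minus by blast

lemma ideal_null: "ideal (null_seqs A J) CA"
proof (rule idealI[OF ring_cauchy])
  interpret CA: ring CA by (rule ring_cauchy)
  show "subgroup (null_seqs A J) (add_monoid CA)"
  proof (rule CA.add.subgroupI)
    show "null_seqs A J \<subseteq> carrier CA"
      using null_cauchy by (auto simp: cauchy_ops)
    show "null_seqs A J \<noteq> {}"
      using J_zero by (auto simp: null_seqs_def intro!: exI[of _ "\<lambda>k. \<zero>"])
    fix x assume x: "x \<in> null_seqs A J"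
    then have "\<ominus>\<^bsub>CA\<^esub> x = (\<lambda>k. \<ominus> x k)"
      by (intro cauchy_a_inv) (simp add: cauchy_ops null_cauchy)
    then show "\<ominus>\<^bsub>CA\<^esub> x \<in> null_seqs A J"
      using x J_neg unfolding null_seqs_def by fastforce
    fix y assume y: "y \<in> null_seqs A J"
    have "\<exists>N. \<forall>k\<ge>N. x k \<oplus> y k \<in> J p" for p
    proof -
      obtain N1 N2 where "\<forall>k\<ge>N1. x k \<in> J p" "\<forall>k\<ge>N2. y k \<in> J p"
	using x y unfolding null_seqs_def by blast
      then show ?thesis by (intro exI[of _ "max N1 N2"]) (auto intro: J_add)
    qed
    then show "x \<oplus>\<^bsub>CA\<^esub> y \<in> null_seqs A J"
      using x y by (auto simp: null_seqs_def cauchy_ops)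
  qed
  fix x w assume x: "x \<in> null_seqs A J" and w: "w \<in> carrier CA"
  then have wc: "w \<in> cauchy_seqs A J" by (simp add: cauchy_ops)
  have "\<exists>N. \<forall>k\<ge>N. w k \<otimes> x k \<in> J p" for p
  proof -
    obtain N1 q where N1: "\<forall>k\<ge>N1. \<forall>h\<in>J q. w k \<otimes> h \<in> J p"
      using cauchy_left_bound[OF wc] by metis
    obtain N2 where N2: "\<forall>k\<ge>N2. x k \<in> J q"
      using x unfolding null_seqs_def by blast
    then show ?thesis using N1 by (intro exI[of _ "max N1 N2"]) auto
  qed
  then show "w \<otimes>\<^bsub>CA\<^esub> x \<in> null_seqs A J"
    using x cauchy_closed[OF wc] by (auto simp: null_seqs_def cauchy_ops)
  have "\<exists>N. \<forall>k\<ge>N. x k \<otimes> w k \<in> J p" for p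
    using x cauchy_closed[OF wc] J_right unfolding null_seqs_def by blast
  then show "x \<otimes>\<^bsub>CA\<^esub> w \<in> null_seqs A J"
    using x cauchy_closed[OF wc] by (auto simp: null_seqs_def cauchy_ops)
qed

end

section \<open>The double Yangian\<close>

subsection \<open>The relators\<close>

definition tF :: "nat => nat => nat => free_el" where
  "tF i j k = (if k = 0 then if i = j then 1 else 0 else gen_el (TGen i j k))"

definition tpF :: "nat => nat => nat => free_el" where
  "tpF i j k = (if k = 0 \<and> i = j then 1 else 0) - gen_el (TMinusGen i j (Suc k))"

definition tsg :: "nat => nat => nat => nat" where
  "tsg m i j = pbar m i * pbar m j + pbar m j"

definition taI :: "nat => nat => nat => int => free_el" where
  "taI m i j p = sg (tsg m i j) (if p \<le> 0 then tF i j (nat (- p)) else 0)"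

definition tbI :: "nat => nat => nat => int => free_el" where
  "tbI m i j p = sg (tsg m i j) (if 0 \<le> p then tpF i j (nat p) else 0)"

definition sdF :: "complex fps => free_el => int => int => free_el" where
  "sdF f x p q = (if p \<le> 0 \<and> 0 \<le> q then
     \<Sum>s\<in>{s. s \<le> nat (- p) \<and> nat q \<le> nat (- p) - s}.
       cst (f $ s * ((- of_nat s) gchoose (nat (- p) - s)) * of_nat ((nat (- p) - s) choose nat q) * (- 1) ^ nat q)
	 * x ^ (nat (- p) - s - nat q)
     else 0)"

definition Chalf :: "complex => free_el" where
  "Chalf c = cst c * gen_el CGen"

lemma dy_gens_simps [simp]:
  "CGen \<in> dy_gens m n"
  "TGen i j r \<in> dy_gens m n \<longleftrightarrow> i \<in> {1..m+n} \<and> j \<in> {1..m+n} \<and> 1 \<le> r"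
  "TMinusGen i j r \<in> dy_gens m n \<longleftrightarrow> i \<in> {1..m+n} \<and> j \<in> {1..m+n} \<and> 1 \<le> r"
  by (auto simp: dy_gens_def yangian_gens_def plus_gens_def)

lemma tF_closed: "i \<in> {1..m+n} ==> j \<in> {1..m+n} ==> tF i j k \<in> freeC m n"
  by (auto simp: tF_def intro!: freeC_gen)

lemma tpF_closed: "i \<in> {1..m+n} ==> j \<in> {1..m+n} ==> tpF i j k \<in> freeC m n"
  unfolding tpF_def by (intro freeC_diff freeC_gen) auto

lemma tF_par: "freepar m (tF i j k) = sg (pbar m i + pbar m j) (tF i j k)"
  by (auto simp: tF_def freepar_gen sg_cancel)

lemma tpF_par: "freepar m (tpF i j k) = sg (pbar m i + pbar m j) (tpF i j k)"
  by (auto simp: tpF_def freepar_gen freepar_diff sg_diff sg_cancel)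

lemma taI_closed: "i \<in> {1..m+n} ==> j \<in> {1..m+n} ==> taI m i j p \<in> freeC m n"
  using tF_closed[of i m n j] by (auto simp: taI_def intro!: freeC_sg)

lemma tbI_closed: "i \<in> {1..m+n} ==> j \<in> {1..m+n} ==> tbI m i j p \<in> freeC m n"
  using tpF_closed[of i m n j] by (auto simp: tbI_def intro!: freeC_sg)

lemma taI_par: "freepar m (taI m i j p) = sg (pbar m i + pbar m j) (taI m i j p)"
  by (auto simp: taI_def freepar_sg tF_par add.commute)

lemma tbI_par: "freepar m (tbI m i j p) = sg (pbar m i + pbar m j) (tbI m i j p)"
  by (auto simp: tbI_def freepar_sg tpF_par add.commute)

lemma Chalf_closed: "Chalf c \<in> freeC m n"
  unfolding Chalf_def by (intro freeC_mult freeC_cst freeC_gen) simp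

lemma Chalf_par: "freepar m (Chalf c) = Chalf c"
  by (simp add: Chalf_def freepar_mult freepar_gen)

lemma sdF_closed: "x \<in> freeC m n ==> sdF f x p q \<in> freeC m n"
  unfolding sdF_def by (auto intro!: freeC_sum freeC_mult freeC_power)

lemma sdF_par: "freepar m x = x ==> freepar m (sdF f x p q) = sdF f x p q"
  unfolding sdF_def by (simp add: freepar_sum freepar_mult freepar_power)

lemma sdF_support:
  assumes "sdF f x p q \<noteq> 0"
  shows "p \<le> 0" "0 \<le> q" "q \<le> - p"
proof -
  show pq: "p \<le> 0" "0 \<le> q"
    using assms by (auto simp: sdF_def split: if_splits)
  show "q \<le> - p"
  proof (rule ccontr)
    assume "\<not> q \<le> - p"
    then have "{s. s \<le> nat (- p) \<and> nat q \<le> nat (- p) - s} = {}"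
      using pq by auto
    then have "sdF f x p q = 0"
      by (simp only: sdF_def sum.empty if_cancel)
    then show False using assms by contradiction
  qed
qed

lemma subst_diff_free:
  assumes "x \<in> freeC m n"
  shows "subst_diff (free_superalg m n) f x = sdF f x"
proof (intro ext)
  fix p q
  show "subst_diff (free_superalg m n) f x p q = sdF f x p q"
    unfolding subst_diff_def sdF_def Let_def
    using assms by (simp add: finsum_free freeC_mult freeC_power cong: if_cong)
qed

lemma sdF_one: "sdF 1 0 p q = (if p = 0 \<and> q = 0 then 1 else 0)"
proof (cases "p \<le> 0 \<and> 0 \<le> q")
  case True
  let ?a = "nat (- p)" and ?b = "nat q"
  have "sdF 1 0 p q = (\<Sum>s\<in>{s. s \<le> ?a \<and> ?b \<le> ?a - s}.
      if s = 0 then if ?a = 0 then 1 else 0 else 0)"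
  proof -
    have "sdF 1 0 p q = (\<Sum>s\<in>{s. s \<le> ?a \<and> ?b \<le> ?a - s}.
       cst (1 $ s * ((- of_nat s) gchoose (?a - s)) * of_nat ((?a - s) choose ?b) * (- 1) ^ ?b) * 0 ^ (?a - s - ?b))"
      by (simp only: sdF_def if_P[OF True])
    also have "\<dots> = (\<Sum>s\<in>{s. s \<le> ?a \<and> ?b \<le> ?a - s}. if s = 0 then if ?a = 0 then 1 else 0 else 0)"
      by (intro sum.cong refl) (auto simp: gbinomial_0_left)
    finally show ?thesis .
  qed
  also have "\<dots> = (if p = 0 \<and> q = 0 then 1 else 0)"
    using True by (auto simp: sum.delta)
  finally show ?thesis .
qed (auto simp: sdF_def)

text \<open>This is the geometric series of \<open>1/(u - v)\<close>: with \<open>x = 0\<close> only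
  the term of full degree \<open>b\<close> in \<open>v\<close> is left, and its binomial is
  \<open>(-1)^b\<close>, which cancels the sign of \<open>(-v)^b\<close>.\<close>

lemma sdF_X: "sdF fps_X 0 p q = (if 0 \<le> q \<and> p = - (q + 1) then 1 else 0)"
proof (cases "p \<le> 0 \<and> 0 \<le> q")
  case True
  let ?a = "nat (- p)" and ?b = "nat q"
  have b: "((- 1) gchoose k) * (- 1) ^ k = (1 :: complex)" for k
    using gbinomial_negated_upper[of "- 1 :: complex" k]
    by (simp add: power_mult_distrib[symmetric] flip: binomial_gbinomial)
  have "sdF fps_X 0 p q = (\<Sum>s\<in>{s. s \<le> ?a \<and> ?b \<le> ?a - s}.
      if s = 1 then if ?a = Suc ?b then 1 else 0 else 0)"
  proof -
    have "sdF fps_X 0 p q = (\<Sum>s\<in>{s. s \<le> ?a \<and> ?b \<le> ?a - s}.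
       cst (fps_X $ s * ((- of_nat s) gchoose (?a - s)) * of_nat ((?a - s) choose ?b) * (- 1) ^ ?b) * 0 ^ (?a - s - ?b))"
      by (simp only: sdF_def if_P[OF True])
    also have "\<dots> = (\<Sum>s\<in>{s. s \<le> ?a \<and> ?b \<le> ?a - s}. if s = 1 then if ?a = Suc ?b then 1 else 0 else 0)"
      using b[of "?b"] by (intro sum.cong refl) (auto simp: power_0_left)
    finally show ?thesis .
  qed
  also have "\<dots> = (if 0 \<le> q \<and> p = - (q + 1) then 1 else 0)"
    using True by (auto simp: sum.delta)
  finally show ?thesis .
qed (auto simp: sdF_def)

lemma perm_op_tss: "perm_op m n (tss m n) i j k l =
    (if in_range4 m n i j k l \<and> k = j \<and> l = i then (\<lambda>p q. sg (pbar m j) (one (tss m n) p q)) else (\<lambda>p q. 0))"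
proof -
  have "tss_carrier m n (one (tss m n))" by (simp add: tss_simps)
  then show ?thesis by (simp add: perm_op_def tss_with_sign tss_simps(2) split del: if_split cong: if_cong)
qed

lemma one_Mtss: "one (Mtss m n) i j k l =
    (if in_range4 m n i j k l \<and> i = j \<and> k = l then one (tss m n) else (\<lambda>p q. 0))"
  by (simp add: End2_def tss_simps(2) split del: if_split cong: if_cong)

lemma Rm_relator_data: "relator_data.Rm m n f g i j k l p q = (if in_range4 m n i j k l
     then (if i = j \<and> k = l then f p q else 0) - (if k = j \<and> l = i then sg (pbar m j) (g p q) else 0) else 0)"
  if "relator_data m n a b f1 f2 g1 g2 D1 D2" for a b f1 f2 g1 g2 D1 D2
  by (rule relator_data.Rm_apply[OF that])

lemma R_matrix_free:
  assumes x: "x \<in> freeC m n" and R: "relator_data m n a b f1 f2 g1 g2 D1 D2"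
  shows "R_matrix m n (free_superalg m n) f x = relator_data.Rm m n (sdF f x) (sdF (f * fps_X) x)"
proof -
  have c: "tss_carrier m n (sdF h x)" for h
    using sdF_closed[OF x] by blast
  let ?X1 = "\<lambda>i j k l p q. if in_range4 m n i j k l \<and> i = j \<and> k = l then sdF f x p q else 0"
  let ?X2 = "\<lambda>i j k l p q. if in_range4 m n i j k l \<and> k = j \<and> l = i then sg (pbar m j) (sdF (f * fps_X) x p q) else 0"
  have c1: "tens (tss m n) (one (Mtss m n)) (sdF f x) = ?X1"
  proof (intro ext)
    fix i j k l p q
    show "tens (tss m n) (one (Mtss m n)) (sdF f x) i j k l p q = ?X1 i j k l p q"
    proof (cases "in_range4 m n i j k l \<and> i = j \<and> k = l")
      case True
      show ?thesis by (simp only: tens_def one_Mtss tss_one_mult[OF c] if_P[OF True])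
    next
      case False
      show ?thesis by (simp only: tens_def one_Mtss tss_mult_0[OF c] if_not_P[OF False])
    qed
  qed
  have c2: "tens (tss m n) (perm_op m n (tss m n)) (sdF (f * fps_X) x) = ?X2"
  proof (intro ext)
    fix i j k l p q
    show "tens (tss m n) (perm_op m n (tss m n)) (sdF (f * fps_X) x) i j k l p q = ?X2 i j k l p q"
    proof (cases "in_range4 m n i j k l \<and> k = j \<and> l = i")
      case True
      show ?thesis by (simp only: tens_def perm_op_tss tss_sg_one_mult[OF c] if_P[OF True])
    next
      case False
      show ?thesis by (simp only: tens_def perm_op_tss tss_mult_0[OF c] if_not_P[OF False])
    qed
  qed
  have 1: "?X1 \<in> carrier (Mtss m n)" and 2: "?X2 \<in> carrier (Mtss m n)"
    unfolding Mtss_carrier using c by (auto intro!: freeC_sg ext)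
  have "R_matrix m n (free_superalg m n) f x = ?X1 \<ominus>\<^bsub>Mtss m n\<^esub> ?X2"
    unfolding R_matrix_def Let_def subst_diff_free[OF x] c1 c2 ..
  moreover have "(?X1 \<ominus>\<^bsub>Mtss m n\<^esub> ?X2) i j k l p q = relator_data.Rm m n (sdF f x) (sdF (f * fps_X) x) i j k l p q" for i j k l p q
    unfolding Mtss_minus[OF 1 2] Rm_relator_data[OF R]
    by (cases "in_range4 m n i j k l") (simp_all only: simp_thms if_True if_False diff_self)
  ultimately show ?thesis by (simp add: fun_eq_iff)
qed

lemma relator_TT:
  "relator_data m n (taI m) (taI m) (sdF 1 0) (sdF fps_X 0) (sdF 1 0) (sdF fps_X 0)
     (\<lambda>p d. {p..0}) (\<lambda>p q. {0..-p})"
proof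
  fix c d p q :: int and i j k l :: nat
  assume *: "sdF 1 0 c d \<noteq> 0 \<or> sdF fps_X 0 c d \<noteq> 0 \<or> sdF 1 0 c d \<noteq> 0 \<or> sdF fps_X 0 c d \<noteq> 0"
    and a: "taI m i j (p - c) \<noteq> 0"
  have "p - c \<le> 0" using a by (auto simp: taI_def split: if_splits)
  moreover have "c \<le> 0" "0 \<le> d" "d \<le> - c" using * sdF_support by blast+
  ultimately show "c \<in> {p..0}" "d \<in> {0..-p}" by auto
qed (auto simp: taI_closed taI_par sdF_closed sdF_par)

text \<open>\<open>T\<^sup>+(u)\<close> has arbitrarily high powers of \<open>u\<close>, so it gives
  no lower bound for the exponent \<open>c\<close> coming from the R-matrix. The bound comes from
  the special form of \<open>1 - P/(u - v)\<close>, which allows only \<open>c = 0\<close> and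
  \<open>c = - (d + 1)\<close>.\<close>

lemma relator_T'T':
  "relator_data m n (tbI m) (tbI m) (sdF 1 0) (sdF fps_X 0) (sdF 1 0) (sdF fps_X 0)
     (\<lambda>p d. {- (d + 1)..0}) (\<lambda>p q. {0..q})"
proof
  fix c d p q :: int and i j k l :: nat
  assume *: "sdF 1 0 c d \<noteq> 0 \<or> sdF fps_X 0 c d \<noteq> 0 \<or> sdF 1 0 c d \<noteq> 0 \<or> sdF fps_X 0 c d \<noteq> 0"
  then show "c \<in> {- (d + 1)..0}" by (auto simp: sdF_one sdF_X split: if_splits)
  assume "tbI m k l (q - d) \<noteq> 0"
  then have "0 \<le> q - d" by (auto simp: tbI_def split: if_splits)
  moreover have "0 \<le> d" using * sdF_support by blast
  ultimately show "d \<in> {0..q}" by auto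
qed (auto simp: tbI_closed tbI_par sdF_closed sdF_par)

abbreviation "gp \<equiv> Chalf (1 / 2)"
abbreviation "gm \<equiv> Chalf (- 1 / 2)"

lemma relator_TT':
  "relator_data m n (taI m) (tbI m) (sdF g gp) (sdF (g * fps_X) gp) (sdF g gm) (sdF (g * fps_X) gm)
     (\<lambda>p d. {p..0}) (\<lambda>p q. {0..q})"
proof
  fix c d p q :: int and i j k l :: nat
  assume *: "sdF g gp c d \<noteq> 0 \<or> sdF (g * fps_X) gp c d \<noteq> 0 \<or> sdF g gm c d \<noteq> 0 \<or> sdF (g * fps_X) gm c d \<noteq> 0"
    and a: "taI m i j (p - c) \<noteq> 0"
  have "p - c \<le> 0" using a by (auto simp: taI_def split: if_splits)
  moreover have c: "c \<le> 0" "0 \<le> d" using * sdF_support by blast+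
  ultimately show "c \<in> {p..0}" by auto
  assume "tbI m k l (q - d) \<noteq> 0"
  then have "0 \<le> q - d" by (auto simp: tbI_def split: if_splits)
  then show "d \<in> {0..q}" using c by auto
qed (auto simp: taI_closed taI_par tbI_closed tbI_par sdF_closed sdF_par Chalf_closed Chalf_par)

definition rel_TT where "rel_TT m n = relator_data.relator m n (taI m) (taI m) (sdF 1 0) (sdF fps_X 0) (sdF 1 0) (sdF fps_X 0)"
definition rel_T'T' where "rel_T'T' m n = relator_data.relator m n (tbI m) (tbI m) (sdF 1 0) (sdF fps_X 0) (sdF 1 0) (sdF fps_X 0)"
definition rel_TT' where "rel_TT' m n = relator_data.relator m n (taI m) (tbI m)
  (sdF (g_series m n) gp) (sdF (g_series m n * fps_X) gp) (sdF (g_series m n) gm) (sdF (g_series m n * fps_X) gm)"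

lemma copy1_free:
  assumes R: "relator_data m n a b f1 f2 g1 g2 D1 D2"
    and x: "!!i j. i \<in> {1..m+n} ==> j \<in> {1..m+n} ==> tss_carrier m n (x i j) \<and> (\<lambda>p q. sg (tsg m i j) (x i j p q)) = Uvar (a i j)"
  shows "copy1 m n (tss m n) x = relator_data.T1 m n a"
proof (intro ext)
  fix i j k l p q
  show "copy1 m n (tss m n) x i j k l p q = relator_data.T1 m n a i j k l p q"
  proof (cases "in_range4 m n i j k l \<and> k = l")
    case True
    then have "i \<in> {1..m+n}" "j \<in> {1..m+n}" by (auto simp: in_range4_def)
    then have "with_sign (tss m n) (tsg m i j) (x i j) = Uvar (a i j)"
      using x tss_with_sign by metis
    then show ?thesis
      by (simp only: copy1_def relator_data.T1_def[OF R] tsg_def if_P[OF True])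
  next
    case False
    show ?thesis
      by (simp only: copy1_def relator_data.T1_def[OF R] if_not_P[OF False] tss_simps(2))
  qed
qed

lemma copy2_free:
  assumes R: "relator_data m n a b f1 f2 g1 g2 D1 D2"
    and x: "!!i j. i \<in> {1..m+n} ==> j \<in> {1..m+n} ==> tss_carrier m n (x i j) \<and> (\<lambda>p q. sg (tsg m i j) (x i j p q)) = Vvar (b i j)"
  shows "copy2 m n (tss m n) x = relator_data.T2 m n b"
proof (intro ext)
  fix i j k l p q
  show "copy2 m n (tss m n) x i j k l p q = relator_data.T2 m n b i j k l p q"
  proof (cases "in_range4 m n i j k l \<and> i = j")
    case True
    then have "k \<in> {1..m+n}" "l \<in> {1..m+n}" by (auto simp: in_range4_def)
    then have "with_sign (tss m n) (tsg m k l) (x k l) = Vvar (b k l)"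
      using x tss_with_sign by metis
    then show ?thesis
      by (simp only: copy2_def relator_data.T2_def[OF R] tsg_def if_P[OF True])
  next
    case False
    show ?thesis
      by (simp only: copy2_def relator_data.T2_def[OF R] if_not_P[OF False] tss_simps(2))
  qed
qed

lemma t_series_free: "t_series (free_superalg m n) (\<lambda>i j r. gen_el (TGen i j r)) i j k = tF i j k"
  by (simp add: t_series_def tF_def delta_def cong: if_cong)

lemma tplus_series_free:
  assumes "i \<in> {1..m+n}" "j \<in> {1..m+n}"
  shows "tplus_series (free_superalg m n) (\<lambda>i j r. gen_el (TMinusGen i j r)) i j k = tpF i j k"
proof -
  have "gen_el (TMinusGen i j (Suc k)) \<in> freeC m n"
    using assms by (intro freeC_gen) auto
  then show ?thesis by (simp add: tplus_series_def tpF_def delta_def cong: if_cong)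
qed

lemma dy_relators_eq:
  "dy_relators m n = {gen_el CGen * gen_el x - gen_el x * gen_el CGen | x. x \<in> dy_gens m n}
     \<union> mat_coeffs (rel_TT m n) \<union> mat_coeffs (rel_T'T' m n) \<union> mat_coeffs (rel_TT' m n)"
proof -
  note simps = t_series_free tplus_series_free tF_closed tpF_closed
  have u1: "copy1 m n (tss m n) (\<lambda>i j. in_u_inv (free_superalg m n) (t_series (free_superalg m n) (\<lambda>i j r. gen_el (TGen i j r)) i j))
      = relator_data.T1 m n (taI m)"
    by (rule copy1_free[OF relator_TT]) (auto simp: in_u_inv_def Uvar_def taI_def simps intro!: ext)
  have v1: "copy2 m n (tss m n) (\<lambda>i j. in_v_inv (free_superalg m n) (t_series (free_superalg m n) (\<lambda>i j r. gen_el (TGen i j r)) i j))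
      = relator_data.T2 m n (taI m)"
    by (rule copy2_free[OF relator_TT]) (auto simp: in_v_inv_def Vvar_def taI_def simps intro!: ext)
  have u2: "copy1 m n (tss m n) (\<lambda>i j. in_u (free_superalg m n) (tplus_series (free_superalg m n) (\<lambda>i j r. gen_el (TMinusGen i j r)) i j))
      = relator_data.T1 m n (tbI m)"
    by (rule copy1_free[OF relator_T'T']) (auto simp: in_u_def Uvar_def tbI_def simps intro!: ext)
  have v2: "copy2 m n (tss m n) (\<lambda>i j. in_v (free_superalg m n) (tplus_series (free_superalg m n) (\<lambda>i j r. gen_el (TMinusGen i j r)) i j))
      = relator_data.T2 m n (tbI m)"
    by (rule copy2_free[OF relator_T'T']) (auto simp: in_v_def Vvar_def tbI_def simps intro!: ext)
  have R0: "R_matrix m n (free_superalg m n) 1 0 = relator_data.Rm m n (sdF 1 0) (sdF fps_X 0)"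
    using R_matrix_free[OF freeC_0 relator_TT, where f = 1] by simp
  have Rp: "R_matrix m n (free_superalg m n) (g_series m n) (cst (1 / 2) * gen_el CGen)
      = relator_data.Rm m n (sdF (g_series m n) gp) (sdF (g_series m n * fps_X) gp)"
    using R_matrix_free[OF Chalf_closed relator_TT] by (simp add: Chalf_def)
  have Rm: "R_matrix m n (free_superalg m n) (g_series m n) (cst (- 1 / 2) * gen_el CGen)
      = relator_data.Rm m n (sdF (g_series m n) gm) (sdF (g_series m n * fps_X) gm)"
    using R_matrix_free[OF Chalf_closed relator_TT] by (simp add: Chalf_def)
  have C: "gen_el CGen * gen_el x \<ominus>\<^bsub>free_superalg m n\<^esub> gen_el x * gen_el CGen = gen_el CGen * gen_el x - gen_el x * gen_el CGen"
    if "x \<in> dy_gens m n" for x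
    using that by (intro a_minus_free freeC_mult freeC_gen) simp_all
  have *: "{gen_el CGen * gen_el x \<ominus>\<^bsub>free_superalg m n\<^esub> gen_el x * gen_el CGen | x. x \<in> dy_gens m n}
     = {gen_el CGen * gen_el x - gen_el x * gen_el CGen | x. x \<in> dy_gens m n}"
    using C by (metis (no_types, lifting))
  show ?thesis
    unfolding dy_relators_def Let_def free_superalg_simps u1 v1 u2 v2 R0 Rp Rm *
      rel_TT_def rel_T'T'_def rel_TT'_def
      relator_data.relator_def[OF relator_TT] relator_data.relator_def[OF relator_T'T'] relator_data.relator_def[OF relator_TT']
    ..
qed

subsection \<open>The defining ideal\<close>

lemma dy_relators_closed: "dy_relators m n \<subseteq> freeC m n"
  unfolding dy_relators_eq mat_coeffs_def rel_TT_def rel_T'T'_def rel_TT'_def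
  using relator_data.relator_closed[OF relator_TT] relator_data.relator_closed[OF relator_T'T']
    relator_data.relator_closed[OF relator_TT']
  by (auto intro!: freeC_diff freeC_mult freeC_gen)

lemma ideal_dy: "ideal (dy_ideal m n) (free_superalg m n)"
  unfolding dy_ideal_def
  by (rule ring.genideal_ideal[OF ring_free]) (simp add: dy_relators_closed)

lemma dy_ideal_closed: "f \<in> dy_ideal m n ==> f \<in> freeC m n"
  using ideal.Icarr[OF ideal_dy] by fastforce

lemma dy_ideal_add: "f \<in> dy_ideal m n ==> g \<in> dy_ideal m n ==> f + g \<in> dy_ideal m n"
  using additive_subgroup.a_closed[OF ideal.axioms(1)[OF ideal_dy]] by fastforce

lemma dy_ideal_0 [simp]: "0 \<in> dy_ideal m n"
  using additive_subgroup.zero_closed[OF ideal.axioms(1)[OF ideal_dy]] by fastforce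

lemma dy_ideal_minus: "f \<in> dy_ideal m n ==> - f \<in> dy_ideal m n"
  using additive_subgroup.a_inv_closed[OF ideal.axioms(1)[OF ideal_dy]] dy_ideal_closed by fastforce

lemma dy_ideal_sg: "f \<in> dy_ideal m n ==> sg e f \<in> dy_ideal m n"
  by (auto simp: sg_def dy_ideal_minus)

lemma dy_ideal_mult_left: "f \<in> dy_ideal m n ==> g \<in> freeC m n ==> g * f \<in> dy_ideal m n"
  using ideal.I_l_closed[OF ideal_dy] by fastforce

lemma dy_ideal_mult_right: "f \<in> dy_ideal m n ==> g \<in> freeC m n ==> f * g \<in> dy_ideal m n"
  using ideal.I_r_closed[OF ideal_dy] by fastforce

lemma dy_relators_in_ideal: "f \<in> dy_relators m n ==> f \<in> dy_ideal m n"
  unfolding dy_ideal_def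
  using ring.genideal_self[OF ring_free, of "dy_relators m n" m n] dy_relators_closed by fastforce

lemma rel_in_ideal:
  "rel_TT m n i j k l p q \<in> dy_ideal m n"
  "rel_T'T' m n i j k l p q \<in> dy_ideal m n"
  "rel_TT' m n i j k l p q \<in> dy_ideal m n"
  by (rule dy_relators_in_ideal, unfold dy_relators_eq mat_coeffs_def, blast)+

lemma freepar_relator:
  assumes "f \<in> dy_relators m n"
  shows "\<exists>e. freepar m f = sg e f"
proof -
  have "\<exists>e. freepar m (gen_el CGen * gen_el x - gen_el x * gen_el CGen) = sg e (gen_el CGen * gen_el x - gen_el x * gen_el CGen)" for x
    by (intro exI[of _ "gen_parity m x"])
       (simp add: freepar_diff freepar_mult freepar_gen sg_mult_left sg_mult_right sg_diff)
  moreover have "freepar m (rel_TT m n i j k l p q) = sg (pbar m i + pbar m j + pbar m k + pbar m l) (rel_TT m n i j k l p q)"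
      "freepar m (rel_T'T' m n i j k l p q) = sg (pbar m i + pbar m j + pbar m k + pbar m l) (rel_T'T' m n i j k l p q)"
      "freepar m (rel_TT' m n i j k l p q) = sg (pbar m i + pbar m j + pbar m k + pbar m l) (rel_TT' m n i j k l p q)" for i j k l p q
    unfolding rel_TT_def rel_T'T'_def rel_TT'_def
    by (rule relator_data.relator_par[OF relator_TT] relator_data.relator_par[OF relator_T'T']
      relator_data.relator_par[OF relator_TT'])+
  ultimately show ?thesis
    using assms unfolding dy_relators_eq mat_coeffs_def by blast
qed

text \<open>All relators are homogeneous, and the elements whose image under \<open>freepar\<close>
  lies in the ideal form an ideal themselves, so minimality applies. This is what gives
  \<open>DY\<close> a grading.\<close>

lemma freepar_ideal:
  assumes "f \<in> dy_ideal m n"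
  shows "freepar m f \<in> dy_ideal m n"
proof -
  let ?P = "{f \<in> freeC m n. freepar m f \<in> dy_ideal m n}"
  have "ideal ?P (free_superalg m n)"
  proof (rule idealI[OF ring_free])
    interpret A: ring "free_superalg m n" by (rule ring_free)
    show "subgroup ?P (add_monoid (free_superalg m n))"
    proof (rule A.add.subgroupI)
      show "?P \<noteq> {}" by (auto intro!: exI[of _ 0])
    qed (auto simp: freepar_minus dy_ideal_minus freepar_add dy_ideal_add)
  qed (auto simp: freepar_mult dy_ideal_mult_left dy_ideal_mult_right freepar_closed)
  moreover have "dy_relators m n \<subseteq> ?P"
  proof
    fix f assume f: "f \<in> dy_relators m n"
    then obtain e where "freepar m f = sg e f" using freepar_relator by blast
    then show "f \<in> ?P"
      using f dy_relators_closed dy_ideal_sg[OF dy_relators_in_ideal[OF f]] by auto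
  qed
  ultimately have "dy_ideal m n \<subseteq> ?P"
    unfolding dy_ideal_def by (rule ring.genideal_minimal[OF ring_free])
  then show ?thesis using assms by blast
qed

subsection \<open>The quotient map\<close>

lemma ring_DY: "ring (DY m n)"
  unfolding DY_def by (rule ring_quot_superalg[OF ideal_dy])

lemma dy_class_hom: "dy_class m n \<in> ring_hom (free_superalg m n) (DY m n)"
  using quot_superalg_hom[OF ideal_dy] unfolding DY_def dy_class_def .

lemma dy_class_closed: "f \<in> freeC m n ==> dy_class m n f \<in> carrier (DY m n)"
  using ring_hom_closed[OF dy_class_hom] by simp

lemma dy_class_add: "f \<in> freeC m n ==> g \<in> freeC m n ==>
    dy_class m n f \<oplus>\<^bsub>DY m n\<^esub> dy_class m n g = dy_class m n (f + g)"
  using ring_hom_add[OF dy_class_hom] by simp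

lemma dy_class_mult: "f \<in> freeC m n ==> g \<in> freeC m n ==>
    dy_class m n f \<otimes>\<^bsub>DY m n\<^esub> dy_class m n g = dy_class m n (f * g)"
  using ring_hom_mult[OF dy_class_hom] by simp

lemma dy_class_1: "one (DY m n) = dy_class m n 1"
  using ring_hom_one[OF dy_class_hom] by simp

lemma dy_class_0: "zero (DY m n) = dy_class m n 0"
  using ring_hom_zero[OF dy_class_hom ring_free ring_DY] by simp

lemma dy_class_neg: 
  assumes "f \<in> freeC m n"
  shows "\<ominus>\<^bsub>DY m n\<^esub> dy_class m n f = dy_class m n (- f)"
  by (rule abelian_group.minus_equality[OF ring.is_abelian_group[OF ring_DY]])
     (use assms in \<open>auto simp: dy_class_closed dy_class_add dy_class_0 freeC_minus\<close>)

lemma dy_class_minus: "f \<in> freeC m n ==> g \<in> freeC m n ==>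
    dy_class m n f \<ominus>\<^bsub>DY m n\<^esub> dy_class m n g = dy_class m n (f - g)"
  by (simp add: a_minus_def dy_class_neg dy_class_add freeC_minus)

lemma dy_class_eq_iff: "f \<in> freeC m n ==> g \<in> freeC m n ==>
    dy_class m n f = dy_class m n g \<longleftrightarrow> f - g \<in> dy_ideal m n"
  using quot_superalg_eq_iff[OF ideal_dy, where x = f and y = g] by (simp add: dy_class_def)

lemma DY_carrier: "carrier (DY m n) = dy_class m n ` freeC m n"
  using quot_superalg_carrier[OF ideal_dy] by (simp add: DY_def dy_class_def)

lemma DY_scal: "scal (DY m n) c = dy_class m n (cst c)"
  by (simp add: DY_def dy_class_def quot_superalg_ops)

lemma DY_par: "f \<in> freeC m n ==> par (DY m n) (dy_class m n f) = dy_class m n (freepar m f)"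
  unfolding DY_def dy_class_def
  using quot_superalg_par[OF ideal_dy, where x = f] by (simp add: freepar_add freepar_ideal)

lemma dy_class_sum:
  assumes "!!x. x \<in> S ==> f x \<in> freeC m n"
  shows "finsum (DY m n) (\<lambda>x. dy_class m n (f x)) S = dy_class m n (sum f S)"
proof -
  interpret ring "DY m n" by (rule ring_DY)
  show ?thesis using assms
  proof (induction S rule: infinite_finite_induct)
    case (insert x S)
    then have "finsum (DY m n) (\<lambda>x. dy_class m n (f x)) (insert x S)
	= dy_class m n (f x) \<oplus>\<^bsub>DY m n\<^esub> finsum (DY m n) (\<lambda>x. dy_class m n (f x)) S"
      by (intro finsum_insert) (auto intro: dy_class_closed)
    also have "\<dots> = dy_class m n (f x) \<oplus>\<^bsub>DY m n\<^esub> dy_class m n (sum f S)"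
      using insert by simp
    also have "\<dots> = dy_class m n (f x + sum f S)"
      by (rule dy_class_add) (use insert.prems in \<open>auto intro: freeC_sum\<close>)
    finally show ?case using insert by simp
  qed (auto simp: finsum_infinite dy_class_0)
qed

subsection \<open>The filtration\<close>

definition plus_word :: "nat => nat => dy_gen fword => bool" where
  "plus_word m n w \<longleftrightarrow> set (letters w) \<subseteq> plus_gens m n"

definition wmono :: "dy_gen fword => free_el" where
  "wmono w = Poly_Mapping.single w 1"

lemma single_wmono: "Poly_Mapping.single w c = wmono w * cst c"
  by (simp add: wmono_def mult_single)

lemma plus_gens_subset: "plus_gens m n \<subseteq> dy_gens m n"
  by (auto simp: dy_gens_def)

lemma wmono_closed: "plus_word m n w ==> wmono w \<in> freeC m n"
  unfolding wmono_def plus_word_def using plus_gens_subset by (intro freeC_single) blast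

lemma wmono_Cons: "wmono (FWord (g # gs)) = gen_el g * wmono (FWord gs)"
  by (simp add: wmono_def gen_el_def mult_single plus_fword_def)

lemma wmono_Nil: "wmono (FWord []) = 1"
  using single_one[where 'a = "dy_gen fword"] by (simp add: wmono_def zero_fword_def)

lemma word_degree_Cons: "word_degree (FWord (g # gs)) = gen_degree g + word_degree (FWord gs)"
  by (simp add: word_degree_def)

lemma plus_word_Cons: "plus_word m n (FWord (g # gs)) \<longleftrightarrow> g \<in> plus_gens m n \<and> plus_word m n (FWord gs)"
  by (simp add: plus_word_def)

lemma freeC_induct [consumes 1, case_names add mult cst gen]:
  assumes f: "f \<in> freeC m n"
    and add: "!!f g. f \<in> freeC m n ==> g \<in> freeC m n ==> P f ==> P g ==> P (f + g)"
    and mult: "!!f g. f \<in> freeC m n ==> g \<in> freeC m n ==> P f ==> P g ==> P (f * g)"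
    and cst: "!!c. P (cst c)"
    and gen: "!!x. x \<in> dy_gens m n ==> P (gen_el x)"
  shows "P f"
proof -
  have w: "P (wmono (FWord gs)) \<and> wmono (FWord gs) \<in> freeC m n" if "set gs \<subseteq> dy_gens m n" for gs
    using that
  proof (induction gs)
    case Nil
    then show ?case using cst[of 1] by (simp add: wmono_Nil)
  next
    case (Cons g gs)
    then show ?case by (auto simp: wmono_Cons intro!: mult gen freeC_gen freeC_mult)
  qed
  have single: "P (Poly_Mapping.single w c) \<and> Poly_Mapping.single w c \<in> freeC m n" if "set (letters w) \<subseteq> dy_gens m n" for w c
    using w[of "letters w"] that unfolding single_wmono[of w c] by (auto intro!: mult cst freeC_mult)
  have "P (\<Sum>w\<in>S. Poly_Mapping.single w (Poly_Mapping.lookup f w))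
      \<and> (\<Sum>w\<in>S. Poly_Mapping.single w (Poly_Mapping.lookup f w)) \<in> freeC m n"
    if "S \<subseteq> Poly_Mapping.keys f" for S
    using finite_subset[OF that finite_keys] that
  proof (induction rule: finite_induct)
    case empty
    then show ?case using cst[of 0] by simp
  next
    case (insert w S)
    then have "P (Poly_Mapping.single w (Poly_Mapping.lookup f w)) \<and> Poly_Mapping.single w (Poly_Mapping.lookup f w) \<in> freeC m n"
      using f by (intro single) (auto simp: freeC_def)
    then show ?case using insert by (auto intro!: add)
  qed
  from this[of "Poly_Mapping.keys f"] show ?thesis
    using poly_mapping_decomp[of f] by simp
qed

context
  fixes m n :: nat
begin

interpretation D: ring "DY m n" by (rule ring_DY)

lemma dual_filt_gens_closed:
  "{dy_class m n (Poly_Mapping.single w c) | w c. set (letters w) \<subseteq> plus_gens m n \<and> p \<le> word_degree w} \<subseteq> carrier (DY m n)"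
proof -
  have "Poly_Mapping.single w c \<in> freeC m n" if "set (letters w) \<subseteq> plus_gens m n" for w c
    using that plus_gens_subset by (intro freeC_single) blast
  then show ?thesis by (auto intro!: dy_class_closed)
qed

lemma dual_filt_subgroup: "subgroup (dual_yangian_filt m n p) (add_monoid (DY m n))"
  unfolding dual_yangian_filt_def
  by (rule D.add.generate_is_subgroup) (use dual_filt_gens_closed in simp)

lemma dual_filt_carrier: "x \<in> dual_yangian_filt m n p ==> x \<in> carrier (DY m n)"
  using subgroup.mem_carrier[OF dual_filt_subgroup] by simp

lemma dy_filt_subgroup: "subgroup (dy_filt m n p) (add_monoid (DY m n))"
  unfolding dy_filt_def
  by (rule D.add.generate_is_subgroup) (use dual_filt_carrier in auto)

lemma dy_filt_carrier: "x \<in> dy_filt m n p ==> x \<in> carrier (DY m n)"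
  using subgroup.mem_carrier[OF dy_filt_subgroup] by simp

lemma dy_filt_add: "x \<in> dy_filt m n p ==> y \<in> dy_filt m n p ==> x \<oplus>\<^bsub>DY m n\<^esub> y \<in> dy_filt m n p"
  using subgroup.m_closed[OF dy_filt_subgroup] by simp

lemma dy_filt_zero: "\<zero>\<^bsub>DY m n\<^esub> \<in> dy_filt m n p"
  using subgroup.one_closed[OF dy_filt_subgroup] by simp

lemma dy_filt_neg: "x \<in> dy_filt m n p ==> \<ominus>\<^bsub>DY m n\<^esub> x \<in> dy_filt m n p"
  using subgroup.m_inv_closed[OF dy_filt_subgroup] by (simp add: a_inv_def)

lemma dy_filt_induct [consumes 1, case_names zero gen add neg]:
  assumes x: "x \<in> dy_filt m n p"
    and zero: "P \<zero>\<^bsub>DY m n\<^esub>"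
    and gen: "!!w y. plus_word m n w ==> p \<le> word_degree w ==> y \<in> carrier (DY m n) ==> P (dy_class m n (wmono w) \<otimes>\<^bsub>DY m n\<^esub> y)"
    and add: "!!x y. x \<in> carrier (DY m n) ==> y \<in> carrier (DY m n) ==> P x ==> P y ==> P (x \<oplus>\<^bsub>DY m n\<^esub> y)"
    and neg: "!!x. x \<in> carrier (DY m n) ==> P x ==> P (\<ominus>\<^bsub>DY m n\<^esub> x)"
  shows "P x"
proof -
  let ?S = "{dy_class m n (Poly_Mapping.single w c) | w c. set (letters w) \<subseteq> plus_gens m n \<and> p \<le> word_degree w}"
  have word: "P (h \<otimes>\<^bsub>DY m n\<^esub> y) \<and> h \<in> carrier (DY m n)" if "h \<in> ?S" and y: "y \<in> carrier (DY m n)" for h y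
  proof -
    obtain w c where w: "plus_word m n w" "p \<le> word_degree w" and h: "h = dy_class m n (Poly_Mapping.single w c)"
      using \<open>h \<in> ?S\<close> unfolding plus_word_def by blast
    have h': "h = dy_class m n (wmono w) \<otimes>\<^bsub>DY m n\<^esub> dy_class m n (cst c)"
      unfolding h single_wmono[of w c] using w by (intro dy_class_mult[symmetric] wmono_closed freeC_cst)
    have c: "dy_class m n (cst c) \<in> carrier (DY m n)" "dy_class m n (wmono w) \<in> carrier (DY m n)"
      using w by (auto intro!: dy_class_closed wmono_closed)
    then show ?thesis
      using y gen[OF w, of "dy_class m n (cst c) \<otimes>\<^bsub>DY m n\<^esub> y"] by (simp add: h' D.m_assoc)
  qed
  have dual: "P (a \<otimes>\<^bsub>DY m n\<^esub> y) \<and> a \<in> carrier (DY m n)"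
    if "a \<in> generate (add_monoid (DY m n)) ?S" and y: "y \<in> carrier (DY m n)" for a y
    using that(1)
  proof (induction rule: generate.induct)
    case one
    show ?case using zero y by simp
  next
    case (incl h)
    show ?case using word[OF incl y] .
  next
    case (inv h)
    have "P (\<ominus>\<^bsub>DY m n\<^esub> h \<otimes>\<^bsub>DY m n\<^esub> y)"
      using word[OF inv y] y neg[of "h \<otimes>\<^bsub>DY m n\<^esub> y"] by (simp add: D.l_minus)
    then show ?case using word[OF inv y] by (simp add: a_inv_def[symmetric])
  next
    case (eng h1 h2)
    then show ?case using y add[of "h1 \<otimes>\<^bsub>DY m n\<^esub> y" "h2 \<otimes>\<^bsub>DY m n\<^esub> y"] by (simp add: D.l_distr)
  qed
  have "P x \<and> x \<in> carrier (DY m n)"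
    using x unfolding dy_filt_def dual_yangian_filt_def
  proof (induction rule: generate.induct)
    case one
    show ?case using zero by simp
  next
    case (incl h)
    then show ?case using dual by auto
  next
    case (inv h)
    then have "P h \<and> h \<in> carrier (DY m n)" using dual by auto
    then show ?case using neg by (simp add: a_inv_def[symmetric])
  next
    case (eng h1 h2)
    then show ?case using add by simp
  qed
  then show ?thesis ..
qed

lemma dy_filt_word:
  assumes "plus_word m n w" "p \<le> word_degree w" "y \<in> carrier (DY m n)"
  shows "dy_class m n (wmono w) \<otimes>\<^bsub>DY m n\<^esub> y \<in> dy_filt m n p"
proof -
  have "dy_class m n (wmono w) \<in> dual_yangian_filt m n p"
    unfolding dual_yangian_filt_def wmono_def using assms unfolding plus_word_def
    by (intro generate.incl) blast
  then show ?thesis unfolding dy_filt_def using assms(3) by (intro generate.incl) blast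
qed

lemma dy_filt_right:
  assumes "x \<in> dy_filt m n p" and y: "y \<in> carrier (DY m n)"
  shows "x \<otimes>\<^bsub>DY m n\<^esub> y \<in> dy_filt m n p"
  using assms(1)
proof (induction rule: dy_filt_induct)
  case zero
  then show ?case using y dy_filt_zero by simp
next
  case (gen w z)
  then show ?case
    using y dy_filt_word[of w p "z \<otimes>\<^bsub>DY m n\<^esub> y"] dy_class_closed[OF wmono_closed[OF gen(1)]]
    by (simp add: D.m_assoc)
next
  case (add x z)
  then show ?case using y dy_filt_add by (simp add: D.l_distr)
next
  case (neg x)
  then show ?case using y dy_filt_neg by (simp add: D.l_minus)
qed

lemma dy_filt_left_by_words:
  assumes c: "c \<in> carrier (DY m n)"
    and words: "!!w. plus_word m n w ==> p \<le> word_degree w ==> c \<otimes>\<^bsub>DY m n\<^esub> dy_class m n (wmono w) \<in> dy_filt m n q"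
    and x: "x \<in> dy_filt m n p"
  shows "c \<otimes>\<^bsub>DY m n\<^esub> x \<in> dy_filt m n q"
  using x
proof (induction rule: dy_filt_induct)
  case zero
  then show ?case using c dy_filt_zero by simp
next
  case (gen w y)
  then show ?case
    using dy_filt_right[OF words[OF gen(1,2)] gen(3)] c dy_class_closed[OF wmono_closed[OF gen(1)]]
    by (simp add: D.m_assoc)
next
  case (add x z)
  then show ?case using c dy_filt_add by (simp add: D.r_distr)
next
  case (neg x)
  then show ?case using c dy_filt_neg by (simp add: D.r_minus)
qed

lemma dy_filt_mono:
  assumes "p \<le> q" "x \<in> dy_filt m n q"
  shows "x \<in> dy_filt m n p"
  using assms(2)
  by (induction rule: dy_filt_induct)
     (use assms(1) in \<open>auto intro: dy_filt_zero dy_filt_word dy_filt_add dy_filt_neg\<close>)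

text \<open>The preimage of the filtration in the free algebra. There estimates can use the ring
  operations of a type, and the relators simply lie in every \<open>Kf p\<close>.\<close>

definition Kf :: "nat => free_el set" where
  "Kf p = {f \<in> freeC m n. dy_class m n f \<in> dy_filt m n p}"

lemma Kf_closed: "f \<in> Kf p ==> f \<in> freeC m n"
  by (simp add: Kf_def)

lemma Kf_0: "0 \<in> Kf p"
  using dy_filt_zero by (simp add: Kf_def dy_class_0)

lemma Kf_add: "f \<in> Kf p ==> g \<in> Kf p ==> f + g \<in> Kf p"
  using dy_filt_add by (auto simp: Kf_def dy_class_add[symmetric])

lemma Kf_minus: "f \<in> Kf p ==> - f \<in> Kf p"
  using dy_filt_neg by (auto simp: Kf_def dy_class_neg[symmetric])

lemma Kf_diff: "f \<in> Kf p ==> g \<in> Kf p ==> f - g \<in> Kf p"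
  unfolding diff_conv_add_uminus by (intro Kf_add Kf_minus)

lemma Kf_sg: "f \<in> Kf p ==> sg e f \<in> Kf p"
  by (simp add: sg_def Kf_minus)

lemma Kf_sum: "(!!x. x \<in> S ==> f x \<in> Kf p) ==> sum f S \<in> Kf p"
  by (induction S rule: infinite_finite_induct) (auto simp: Kf_0 Kf_add)

lemma Kf_right: "f \<in> Kf p ==> g \<in> freeC m n ==> f * g \<in> Kf p"
  using dy_filt_right dy_class_closed by (auto simp: Kf_def dy_class_mult[symmetric])

lemma Kf_ideal: "f \<in> dy_ideal m n ==> f \<in> Kf p"
proof -
  assume f: "f \<in> dy_ideal m n"
  then have "dy_class m n f = dy_class m n 0"
    by (simp add: dy_class_eq_iff dy_ideal_closed)
  then show "f \<in> Kf p" using f dy_filt_zero by (simp add: Kf_def dy_ideal_closed dy_class_0)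
qed

lemma Kf_cong: "f - g \<in> dy_ideal m n ==> g \<in> Kf p ==> f \<in> Kf p"
  using Kf_add[OF Kf_ideal] by fastforce

lemma Kf_mono: "p \<le> q ==> f \<in> Kf q ==> f \<in> Kf p"
  using dy_filt_mono by (auto simp: Kf_def)

lemma Kf_word: "plus_word m n w ==> p \<le> word_degree w ==> wmono w \<in> Kf p"
  using dy_filt_word[of w p "\<one>\<^bsub>DY m n\<^esub>"] dy_class_closed[OF wmono_closed[of m n w]]
  by (simp add: Kf_def wmono_closed)

lemma Kf_all: "f \<in> freeC m n ==> f \<in> Kf 0"
  using Kf_right[OF Kf_word[of "FWord []" 0], of f] by (simp add: plus_word_def wmono_Nil)

text \<open>Modulo the ideal, \<open>Kf p\<close> is the right ideal generated by the words of
  degree at least \<open>p\<close>; so a bound for a left multiplication has to be tested on words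
  only.\<close>

lemma Kf_left_by_words:
  assumes c: "c \<in> freeC m n"
    and words: "!!w. plus_word m n w ==> p \<le> word_degree w ==> c * wmono w \<in> Kf q"
    and x: "x \<in> Kf p"
  shows "c * x \<in> Kf q"
proof -
  have "dy_class m n c \<otimes>\<^bsub>DY m n\<^esub> dy_class m n x \<in> dy_filt m n q"
  proof (rule dy_filt_left_by_words[OF dy_class_closed[OF c]])
    fix w assume "plus_word m n w" "p \<le> word_degree w"
    then show "dy_class m n c \<otimes>\<^bsub>DY m n\<^esub> dy_class m n (wmono w) \<in> dy_filt m n q"
      using words c by (auto simp: Kf_def dy_class_mult wmono_closed)
  qed (use x in \<open>simp add: Kf_def\<close>)
  then show ?thesis using c x by (simp add: Kf_def dy_class_mult freeC_mult)
qed

lemma Kf_minus_gen: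
  assumes g: "i \<in> {1..m+n}" "j \<in> {1..m+n}" "1 \<le> r" and x: "x \<in> Kf p"
  shows "gen_el (TMinusGen i j r) * x \<in> Kf (r + p)"
proof (rule Kf_left_by_words[OF _ _ x])
  show "gen_el (TMinusGen i j r) \<in> freeC m n" using g by (intro freeC_gen) simp
  fix w assume w: "plus_word m n w" "p \<le> word_degree w"
  have "gen_el (TMinusGen i j r) * wmono w = wmono (FWord (TMinusGen i j r # letters w))"
    by (simp add: wmono_Cons)
  moreover have "wmono (FWord (TMinusGen i j r # letters w)) \<in> Kf (r + p)"
    using w g by (intro Kf_word) (auto simp: plus_word_Cons word_degree_Cons plus_gens_def)
  ultimately show "gen_el (TMinusGen i j r) * wmono w \<in> Kf (r + p)" by simp
qed

subsection \<open>Elements that are central modulo the ideal\<close>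

definition modcentral :: "free_el => bool" where
  "modcentral c \<longleftrightarrow> c \<in> freeC m n \<and> (\<forall>f\<in>freeC m n. c * f - f * c \<in> dy_ideal m n)"

lemma modcentral_add: "modcentral c ==> modcentral d ==> modcentral (c + d)"
  unfolding modcentral_def
proof safe
  fix f assume "\<forall>f\<in>freeC m n. c * f - f * c \<in> dy_ideal m n" "\<forall>f\<in>freeC m n. d * f - f * d \<in> dy_ideal m n" "f \<in> freeC m n"
  then have "(c * f - f * c) + (d * f - f * d) \<in> dy_ideal m n" by (intro dy_ideal_add) auto
  then show "(c + d) * f - f * (c + d) \<in> dy_ideal m n" by (simp add: algebra_simps)
qed auto

lemma modcentral_mult: "modcentral c ==> modcentral d ==> modcentral (c * d)"
  unfolding modcentral_def
proof safe
  fix f assume "\<forall>f\<in>freeC m n. c * f - f * c \<in> dy_ideal m n" "\<forall>f\<in>freeC m n. d * f - f * d \<in> dy_ideal m n" "f \<in> freeC m n"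
    "c \<in> freeC m n" "d \<in> freeC m n"
  then have "c * (d * f - f * d) + (c * f - f * c) * d \<in> dy_ideal m n"
    by (intro dy_ideal_add dy_ideal_mult_left dy_ideal_mult_right) auto
  then show "c * d * f - f * (c * d) \<in> dy_ideal m n" by (simp add: algebra_simps)
qed auto

lemma modcentral_cst: "modcentral (cst c)"
  by (simp add: modcentral_def cst_commute)

lemma modcentral_power: "modcentral c ==> modcentral (c ^ k)"
  using modcentral_cst[of 1] by (induction k) (auto intro: modcentral_mult)

lemma modcentral_sum: "(!!x. x \<in> S ==> modcentral (f x)) ==> modcentral (sum f S)"
  using modcentral_cst[of 0] by (induction S rule: infinite_finite_induct) (auto intro: modcentral_add)

lemma modcentral_CGen: "modcentral (gen_el CGen)"
  unfolding modcentral_def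
proof
  have C: "gen_el CGen \<in> freeC m n" by (rule freeC_gen) simp
  then show "gen_el CGen \<in> freeC m n" .
  show "\<forall>f\<in>freeC m n. gen_el CGen * f - f * gen_el CGen \<in> dy_ideal m n"
  proof
    fix f assume "f \<in> freeC m n"
    then show "gen_el CGen * f - f * gen_el CGen \<in> dy_ideal m n"
    proof (induction rule: freeC_induct)
      case (add f g)
      then have "(gen_el CGen * f - f * gen_el CGen) + (gen_el CGen * g - g * gen_el CGen) \<in> dy_ideal m n"
	by (intro dy_ideal_add)
      then show ?case by (simp add: algebra_simps)
    next
      case (mult f g)
      then have "(gen_el CGen * f - f * gen_el CGen) * g + f * (gen_el CGen * g - g * gen_el CGen) \<in> dy_ideal m n"
	using C by (intro dy_ideal_add dy_ideal_mult_left dy_ideal_mult_right)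
      then show ?case by (simp add: algebra_simps)
    next
      case (cst c)
      then show ?case by (simp add: cst_commute)
    next
      case (gen x)
      then show ?case
	by (intro dy_relators_in_ideal) (unfold dy_relators_eq, blast)
    qed
  qed
qed

lemma modcentral_Chalf: "modcentral (Chalf c)"
  unfolding Chalf_def by (intro modcentral_mult modcentral_cst modcentral_CGen)

lemma modcentral_sdF: "modcentral x ==> modcentral (sdF f x p q)"
  unfolding sdF_def using modcentral_cst[of 0]
  by (auto intro!: modcentral_sum modcentral_mult modcentral_cst modcentral_power)

lemma Kf_modcentral_left: "modcentral c ==> x \<in> Kf p ==> c * x \<in> Kf p"
  using Kf_cong[of "c * x" "x * c" p] Kf_right[of x p c] Kf_closed[of x p]
  by (auto simp: modcentral_def)

end

subsection \<open>Continuity of left multiplication\<close>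

definition aN :: "nat => nat => nat => nat => free_el" where
  "aN m i j r = sg (tsg m i j) (tF i j r)"

definition bN :: "nat => nat => nat => nat => free_el" where
  "bN m i j q = sg (tsg m i j) (tpF i j q)"

definition sdN :: "complex fps => free_el => nat => nat => free_el" where
  "sdN f x a b = sdF f x (- int a) (int b)"

lemma aN_closed: "i \<in> {1..m+n} ==> j \<in> {1..m+n} ==> aN m i j r \<in> freeC m n"
  unfolding aN_def by (intro freeC_sg tF_closed)

lemma bN_closed: "i \<in> {1..m+n} ==> j \<in> {1..m+n} ==> bN m i j r \<in> freeC m n"
  unfolding bN_def by (intro freeC_sg tpF_closed)

lemma sdN_support: "sdN f x a b \<noteq> 0 ==> b \<le> a"
  using sdF_support[of f x "- int a" "int b"] by (simp add: sdN_def)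

lemma sdN_0: "sdN f x 0 0 = cst (f $ 0)"
proof -
  have "{s::nat. s \<le> 0} = {0}" by auto
  then show ?thesis by (simp add: sdN_def sdF_def)
qed

lemma modcentral_sdN: "modcentral m n x ==> modcentral m n (sdN f x a b)"
  unfolding sdN_def by (rule modcentral_sdF)

text \<open>What the term \<open>u^(-x) v^y\<close> of the R-matrices contributes to the coefficient
  of \<open>u^(-r) v^q\<close> in the mixed relation. At \<open>x = y = 0\<close> it is a
  supercommutator, because \<open>g\<close> starts with 1.\<close>

definition TT'_term :: "nat => complex fps => nat => nat => nat => nat => nat => nat => nat => nat => free_el" where
  "TT'_term m g i j k l r q x y =
     (sg (pp (pbar m) i j k l) (sdN g gp x y * aN m i j (r - x) * bN m k l (q - y))
       - sg (pt (pbar m) k j l)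
	   (sdN (g * fps_X) gp x y * aN m k j (r - x) * bN m i l (q - y)))
     - (bN m k l (q - y) * aN m i j (r - x) * sdN g gm x y
       - sg (pt (pbar m) k j l)
	   (bN m k j (q - y) * aN m i l (r - x) * sdN (g * fps_X) gm x y))"

lemma TT'_relation:
  assumes "in_range4 m n i j k l"
  shows "(\<Sum>y\<le>q. \<Sum>x\<le>r. TT'_term m (g_series m n) i j k l r q x y) \<in> dy_ideal m n"
proof -
  have int_q: "(\<Sum>d\<in>{0..int q}. f d) = (\<Sum>y\<le>q. f (int y))" for f :: "int => free_el"
    by (rule sum.reindex_bij_witness[of _ int nat]) auto
  have int_r: "(\<Sum>c\<in>{- int r..0}. f c) = (\<Sum>x\<le>r. f (- int x))" for f :: "int => free_el"
    by (rule sum.reindex_bij_witness[of _ "\<lambda>x. - int x" "\<lambda>c. nat (- c)"]) auto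
  have a: "taI m i j (int x - int r) = aN m i j (r - x)" if "x \<le> r" for i j x
  proof -
    have "nat (int r - int x) = r - x" using that by auto
    then show ?thesis using that by (simp add: taI_def aN_def)
  qed
  have b: "tbI m k l (int q - int y) = bN m k l (q - y)" if "y \<le> q" for k l y
  proof -
    have "nat (int q - int y) = q - y" using that by auto
    then show ?thesis using that by (simp add: tbI_def bN_def)
  qed
  have "rel_TT' m n i j k l (- int r) (int q) = (\<Sum>y\<le>q. \<Sum>x\<le>r. TT'_term m (g_series m n) i j k l r q x y)"
    unfolding rel_TT'_def relator_data.relator_entry[OF relator_TT'] if_P[OF assms] int_q int_r
    by (intro sum.cong refl) (simp add: TT'_term_def a b sdN_def)
  then show ?thesis
    using rel_in_ideal(3)[of m n i j k l "- int r" "int q"] by simp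
qed

context
  fixes m n :: nat
  assumes mn: "m \<noteq> n"
begin

lemma Kf_tpF_word:
  assumes g: "k \<in> {1..m+n}" "l \<in> {1..m+n}" and x: "x \<in> Kf m n p" and q: "q \<le> Suc e + p" "e = 0 ==> q \<le> p"
  shows "tpF k l e * x \<in> Kf m n q"
proof -
  have "gen_el (TMinusGen k l (Suc e)) * x \<in> Kf m n q"
    using Kf_mono[OF q(1) Kf_minus_gen[OF g _ x, of "Suc e"]] by simp
  moreover have "(if e = 0 \<and> k = l then 1 else 0) * x \<in> Kf m n q"
    using Kf_mono[OF q(2) x] by (auto simp: Kf_0)
  ultimately show ?thesis
    unfolding tpF_def left_diff_distrib by (rule Kf_diff[rotated])
qed

text \<open>By the mixed relation, moving level \<open>r\<close> past a letter of degree
  \<open>s + 1\<close> leaves terms with level \<open>r - x\<close> and a letter of degree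
  \<open>s - y + 1\<close>, where \<open>0 < x\<close> and \<open>y \<le> x\<close>. The factor in
  \<open>2 * r\<close> is due to the constant 1 in \<open>T\<^sup>+\<close>: for
  \<open>y = s\<close> it removes a whole letter of degree \<open>s + 1\<close>, and
  \<open>s + 1 \<le> x + 1 \<le> 2 * x\<close> is covered by what is gained from lowering
  \<open>r\<close> to \<open>r - x\<close>.\<close>

lemma Kf_tF_word:
  assumes "i \<in> {1..m+n}" "j \<in> {1..m+n}" "plus_word m n w"
  shows "tF i j r * wmono w \<in> Kf m n (word_degree w - 2 * r)"
  using assms
proof (induction r arbitrary: i j w rule: less_induct)
  case (less r)
  note outer = less.IH
  show ?case
  proof (cases "r = 0")
    case True
    then show ?thesis using less.prems by (auto simp: tF_def Kf_0 intro: Kf_word)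
  next
    case r: False
    have "tF i j r * wmono (FWord gs) \<in> Kf m n (word_degree (FWord gs) - 2 * r)"
      if "plus_word m n (FWord gs)" "i \<in> {1..m+n}" "j \<in> {1..m+n}" for gs i j
      using that
    proof (induction gs arbitrary: i j)
      case Nil
      then show ?case by (simp add: word_degree_def wmono_Nil Kf_all tF_closed)
    next
      case (Cons g gs)
      obtain k l s where g: "g = TMinusGen k l (Suc s)" and kl: "k \<in> {1..m+n}" "l \<in> {1..m+n}"
	and gs: "plus_word m n (FWord gs)"
	using Cons.prems(1) unfolding plus_word_Cons plus_gens_def by (auto simp: Suc_le_eq gr0_conv_Suc)
      let ?W = "wmono (FWord gs)"
      let ?P = "Suc s + word_degree (FWord gs) - 2 * r"
      have W: "?W \<in> freeC m n" using gs by (rule wmono_closed)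
      have deg: "word_degree (FWord (g # gs)) = Suc s + word_degree (FWord gs)"
	by (simp add: word_degree_Cons g)
      have rng: "in_range4 m n i j k l" using Cons.prems kl by (auto simp: in_range4_def)
      have ab: "tF u v (r - x) * (tpF u' v' (s - y) * ?W) \<in> Kf m n ?P"
	if uv: "u \<in> {1..m+n}" "v \<in> {1..m+n}" "u' \<in> {1..m+n}" "v' \<in> {1..m+n}" and xy: "0 < x" "x \<le> r" "y \<le> x" "y \<le> s"
	for u v u' v' x y
      proof -
	have "tF u v (r - x) * (gen_el (TMinusGen u' v' (Suc (s - y))) * ?W)
	    = tF u v (r - x) * wmono (FWord (TMinusGen u' v' (Suc (s - y)) # gs))"
	  by (simp add: wmono_Cons)
	moreover have "\<dots> \<in> Kf m n (word_degree (FWord (TMinusGen u' v' (Suc (s - y)) # gs)) - 2 * (r - x))"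
	  using xy uv gs r by (intro outer) (auto simp: plus_word_Cons plus_gens_def)
	ultimately have 1: "tF u v (r - x) * (gen_el (TMinusGen u' v' (Suc (s - y))) * ?W) \<in> Kf m n ?P"
	  using xy by (auto simp: word_degree_Cons intro: Kf_mono[rotated])
	have "tF u v (r - x) * ?W \<in> Kf m n (word_degree (FWord gs) - 2 * (r - x))"
	  using xy uv gs r by (intro outer) auto
	then have 2: "tF u v (r - x) * ((if s - y = 0 \<and> u' = v' then 1 else 0) * ?W) \<in> Kf m n ?P"
	  using xy by (auto simp: Kf_0 intro: Kf_mono[rotated])
	show ?thesis
	  using Kf_diff[OF 2 1] by (simp only: tpF_def left_diff_distrib right_diff_distrib)
      qed
      have ba: "tpF u' v' (s - y) * (tF u v (r - x) * ?W) \<in> Kf m n ?P"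
	if uv: "u \<in> {1..m+n}" "v \<in> {1..m+n}" "u' \<in> {1..m+n}" "v' \<in> {1..m+n}" and xy: "0 < x" "x \<le> r" "y \<le> x" "y \<le> s"
	for u v u' v' x y
      proof -
	have "tF u v (r - x) * ?W \<in> Kf m n (word_degree (FWord gs) - 2 * (r - x))"
	  using xy uv gs r by (intro outer) auto
	then show ?thesis
	  by (rule Kf_tpF_word[OF uv(3,4)]) (use xy in auto)
      qed
      have f_left: "f * x \<in> Kf m n ?P" if "modcentral m n f" "x \<in> Kf m n ?P" for f x
	using that by (rule Kf_modcentral_left)
      have f_right: "x * f * ?W \<in> Kf m n ?P" if f: "modcentral m n f" and x: "x \<in> freeC m n" "x * ?W \<in> Kf m n ?P" for f x
      proof (rule Kf_cong)
	show "x * ?W * f \<in> Kf m n ?P"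
	  using f by (intro Kf_right[OF x(2)]) (simp add: modcentral_def)
	have "x * (f * ?W - ?W * f) \<in> dy_ideal m n"
	  using f x W by (intro dy_ideal_mult_left) (auto simp: modcentral_def)
	then show "x * f * ?W - x * ?W * f \<in> dy_ideal m n" by (simp add: algebra_simps)
      qed
      let ?T = "TT'_term m (g_series m n) i j k l r s"
      have lower: "?T x y * ?W \<in> Kf m n ?P" if xy: "x \<le> r" "y \<le> s" "(y, x) \<noteq> (0, 0)" for x y
      proof (cases "y \<le> x")
	case False
	then have "sdN f h x y = 0" for f h using sdN_support by blast
	then show ?thesis by (simp add: TT'_term_def Kf_0)
      next
	case True
	with xy have xy': "0 < x" "x \<le> r" "y \<le> x" "y \<le> s" by auto
	have mc: "modcentral m n (sdN f (Chalf c) x y)" for f c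
	  by (intro modcentral_sdN modcentral_Chalf)
	have L: "f * aN m u v (r - x) * bN m u' v' (s - y) * ?W \<in> Kf m n ?P"
	  if "modcentral m n f" "u \<in> {1..m+n}" "v \<in> {1..m+n}" "u' \<in> {1..m+n}" "v' \<in> {1..m+n}" for f u v u' v'
	  using f_left[OF that(1) Kf_sg[OF ab[OF that(2-5) xy'], of "tsg m u v + tsg m u' v'"]]
	  by (simp add: aN_def bN_def sg_mult_left sg_mult_right mult.assoc add.commute)
	have R: "bN m u' v' (s - y) * aN m u v (r - x) * f * ?W \<in> Kf m n ?P"
	  if "modcentral m n f" "u \<in> {1..m+n}" "v \<in> {1..m+n}" "u' \<in> {1..m+n}" "v' \<in> {1..m+n}" for f u v u' v'
	proof (rule f_right[OF that(1)])
	  show "bN m u' v' (s - y) * aN m u v (r - x) \<in> freeC m n"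
	    using that by (intro freeC_mult aN_closed bN_closed)
	  show "bN m u' v' (s - y) * aN m u v (r - x) * ?W \<in> Kf m n ?P"
	    using Kf_sg[OF ba[OF that(2-5) xy'], of "tsg m u v + tsg m u' v'"]
	    by (simp add: aN_def bN_def sg_mult_left sg_mult_right mult.assoc add.commute)
	qed
	show ?thesis
	  unfolding TT'_term_def left_diff_distrib sg_mult_left
	  using Cons.prems kl by (intro Kf_diff Kf_sg L R mc)
      qed
      have "(\<Sum>y\<le>s. \<Sum>x\<le>r. ?T x y) = (\<Sum>(y, x)\<in>{..s} \<times> {..r}. ?T x y)"
	by (simp add: sum.cartesian_product)
      also have "\<dots> = ?T 0 0 + (\<Sum>(y, x)\<in>{..s} \<times> {..r} - {(0, 0)}. ?T x y)"
	by (subst sum.remove[of _ "(0, 0)"]) auto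
      \<comment> \<open>The relation is solved for its supercommutator; all other summands are
        bounded by the induction on \<open>r\<close>.\<close>
      finally have split: "?T 0 0 * ?W = (\<Sum>y\<le>s. \<Sum>x\<le>r. ?T x y) * ?W - (\<Sum>(y, x)\<in>{..s} \<times> {..r} - {(0, 0)}. ?T x y * ?W)"
	by (simp add: algebra_simps sum_distrib_right case_prod_beta)
      have top: "?T 0 0 * ?W \<in> Kf m n ?P"
	unfolding split
      proof (rule Kf_diff)
	show "(\<Sum>y\<le>s. \<Sum>x\<le>r. ?T x y) * ?W \<in> Kf m n ?P"
	  by (intro Kf_ideal dy_ideal_mult_right[OF TT'_relation[OF rng] W])
	show "(\<Sum>(y, x)\<in>{..s} \<times> {..r} - {(0, 0)}. ?T x y * ?W) \<in> Kf m n ?P"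
	proof (rule Kf_sum)
	  fix z assume "z \<in> {..s} \<times> {..r} - {(0, 0)}"
	  then have "snd z \<le> r" "fst z \<le> s" "(fst z, snd z) \<noteq> (0, 0)" by auto
	  from lower[OF this] show "(case z of (y, x) => ?T x y * ?W) \<in> Kf m n ?P"
	    by (simp add: case_prod_beta)
	qed
      qed
      have T00: "?T 0 0 = sg (pp (pbar m) i j k l) (aN m i j r * bN m k l s) - bN m k l s * aN m i j r"
	using g_series_spec(1)[OF mn] by (simp add: TT'_term_def sdN_0)
      \<comment> \<open>The constant 1 in \<open>tpF\<close> occurs for \<open>k = l\<close> only,
        where the sign is trivial, so it drops out of the supercommutator.\<close>
      have comm: "?T 0 0 = sg (tsg m i j + tsg m k l) (gen_el g * tF i j r
	  - sg (pp (pbar m) i j k l) (tF i j r * gen_el g))"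
      proof -
	have "sg (pp (pbar m) i j k l) (tF i j r * (if s = 0 \<and> k = l then 1 else 0))
	    = (if s = 0 \<and> k = l then 1 else 0) * tF i j r"
	  by (auto simp: sg_cancel)
	then show ?thesis
	  unfolding T00 aN_def bN_def tpF_def g
	  by (simp add: sg_mult_left sg_mult_right left_diff_distrib right_diff_distrib sg_diff add.commute add.left_commute)
	     (auto intro!: sg_cong)
      qed
      have "sg (tsg m i j + tsg m k l) (?T 0 0 * ?W)
	 = gen_el g * (tF i j r * ?W) - sg (pp (pbar m) i j k l) (tF i j r * gen_el g * ?W)"
	unfolding comm by (simp add: sg_mult_left left_diff_distrib mult.assoc sg_cancel)
      then have "sg (pp (pbar m) i j k l) (tF i j r * gen_el g * ?W)
	 = gen_el g * (tF i j r * ?W) - sg (tsg m i j + tsg m k l) (?T 0 0 * ?W)"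
	by simp
      moreover have "gen_el g * (tF i j r * ?W) \<in> Kf m n ?P"
	using Kf_minus_gen[OF kl _ Cons.IH[OF gs Cons.prems(2,3)], of "Suc s"]
	unfolding g by (auto intro: Kf_mono[rotated])
      ultimately have "sg (pp (pbar m) i j k l) (tF i j r * gen_el g * ?W) \<in> Kf m n ?P"
	using Kf_diff[OF _ Kf_sg[OF top]] by simp
      from Kf_sg[OF this, of "pp (pbar m) i j k l"]
      have "tF i j r * gen_el g * ?W \<in> Kf m n ?P"
	by (simp add: sg_cancel)
      then show ?case unfolding wmono_Cons deg by (simp add: mult.assoc)
    qed
    from this[of "letters w"] show ?thesis using less.prems by simp
  qed
qed

lemma Kf_left_continuous:
  assumes "f \<in> freeC m n"
  shows "\<exists>q. \<forall>x\<in>Kf m n q. f * x \<in> Kf m n p"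
  using assms
proof (induction arbitrary: p rule: freeC_induct)
  case (add f g)
  obtain q1 q2 where "\<forall>x\<in>Kf m n q1. f * x \<in> Kf m n p" "\<forall>x\<in>Kf m n q2. g * x \<in> Kf m n p"
    using add.IH by metis
  moreover have "x \<in> Kf m n q1 \<and> x \<in> Kf m n q2" if "x \<in> Kf m n (max q1 q2)" for x
    using Kf_mono[OF _ that] by simp
  ultimately show ?case
    by (intro exI[of _ "max q1 q2"]) (auto simp: distrib_right intro!: Kf_add)
next
  case (mult f g)
  obtain q1 where "\<forall>x\<in>Kf m n q1. f * x \<in> Kf m n p" using mult.IH(1) by metis
  moreover obtain q2 where "\<forall>x\<in>Kf m n q2. g * x \<in> Kf m n q1" using mult.IH(2) by metis
  ultimately show ?case by (intro exI[of _ q2]) (auto simp: mult.assoc)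
next
  case (cst c)
  show ?case by (intro exI[of _ p] ballI Kf_modcentral_left modcentral_cst)
next
  case (gen x)
  show ?case
  proof (cases x)
    case CGen
    then show ?thesis by (intro exI[of _ p] ballI) (auto intro!: Kf_modcentral_left modcentral_CGen)
  next
    case (TGen i j r)
    then have ij: "i \<in> {1..m+n}" "j \<in> {1..m+n}" "1 \<le> r" using gen by auto
    then have "gen_el x = tF i j r" using TGen by (simp add: tF_def)
    moreover have "tF i j r * h \<in> Kf m n p" if "h \<in> Kf m n (p + 2 * r)" for h
    proof (rule Kf_left_by_words[OF tF_closed _ that])
      fix w assume "plus_word m n w" "p + 2 * r \<le> word_degree w"
      then show "tF i j r * wmono w \<in> Kf m n p"
	using Kf_mono[OF _ Kf_tF_word[OF ij(1,2)]] by fastforce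
    qed (use ij in auto)
    ultimately show ?thesis by auto
  next
    case (TMinusGen i j r)
    then have "gen_el x * h \<in> Kf m n p" if "h \<in> Kf m n p" for h
      using gen Kf_minus_gen[OF _ _ _ that, of i j r] Kf_mono[of p "r + p" "gen_el x * h"] by simp
    then show ?thesis by blast
  qed
qed

lemma filtered_DY: "filtered_ring (DY m n) (dy_filt m n)"
proof (intro filtered_ring.intro filtered_ring_axioms.intro ring_DY dy_filt_subgroup)
  fix w p assume "w \<in> carrier (DY m n)"
  then obtain f where f: "f \<in> freeC m n" "w = dy_class m n f" by (auto simp: DY_carrier)
  obtain q where q: "\<forall>x\<in>Kf m n q. f * x \<in> Kf m n p" using Kf_left_continuous[OF f(1)] by metis
  have "w \<otimes>\<^bsub>DY m n\<^esub> x \<in> dy_filt m n p" if x: "x \<in> dy_filt m n q" for x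
  proof -
    obtain h where h: "h \<in> freeC m n" "x = dy_class m n h"
      using dy_filt_carrier[OF x] by (auto simp: DY_carrier)
    then have "f * h \<in> Kf m n p" using q x by (auto simp: Kf_def)
    then show ?thesis using f h by (simp add: Kf_def dy_class_mult)
  qed
  then show "\<exists>q. \<forall>x\<in>dy_filt m n q. w \<otimes>\<^bsub>DY m n\<^esub> x \<in> dy_filt m n p" by blast
qed (auto intro: dy_filt_right dy_filt_mono)

end

section \<open>The completed double Yangian\<close>

lemma freepar_wmono: "freepar m (wmono w) = sg (word_parity m w) (wmono w)"
  by (simp add: wmono_def freepar_single)

lemma Kf_freepar:
  assumes f: "f \<in> Kf m n p"
  shows "freepar m f \<in> Kf m n p"
proof -
  interpret D: ring "DY m n" by (rule ring_DY)
  \<comment> \<open>Quantified over all representatives, since \<open>freepar\<close> acts on the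
    free algebra but the filtration lives in the quotient.\<close>
  let ?P = "\<lambda>x. \<forall>f\<in>freeC m n. x = dy_class m n f --> freepar m f \<in> Kf m n p"
  have indep: "freepar m f \<in> Kf m n p" if "f \<in> freeC m n" "g \<in> freeC m n" "dy_class m n f = dy_class m n g" "freepar m g \<in> Kf m n p" for f g
  proof (rule Kf_cong)
    show "freepar m f - freepar m g \<in> dy_ideal m n"
      using that freepar_ideal[of "f - g" m n] by (simp add: dy_class_eq_iff freepar_diff)
  qed (rule that(4))
  have P_I: "?P (dy_class m n g)" if "g \<in> freeC m n" "freepar m g \<in> Kf m n p" for g
    using indep that by metis
  have "dy_class m n f \<in> dy_filt m n p" using f by (simp add: Kf_def)
  then have "?P (dy_class m n f)"
  proof (induction "dy_class m n f" arbitrary: f rule: dy_filt_induct[consumes 1])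
    case zero
    then show ?case by (metis P_I Kf_0 dy_class_0 freeC_0 freepar_0)
  next
    case (gen w y)
    then obtain g where g: "g \<in> freeC m n" "y = dy_class m n g" by (auto simp: DY_carrier)
    have w: "wmono w \<in> freeC m n" using gen(1) by (rule wmono_closed)
    have "?P (dy_class m n (wmono w * g))"
      using w g gen by (intro P_I) (auto simp: freepar_mult freepar_wmono intro!: Kf_right Kf_sg Kf_word freepar_closed)
    then show ?case using gen(4) g w by (simp add: dy_class_mult)
  next
    case (add x y)
    then obtain g h where g: "g \<in> freeC m n" "x = dy_class m n g" and h: "h \<in> freeC m n" "y = dy_class m n h"
      by (auto simp: DY_carrier)
    have "?P (dy_class m n (g + h))"
      using add(3,4) g h by (intro P_I) (auto simp: freepar_add intro!: Kf_add)
    then show ?case using add g h by (simp add: dy_class_add)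
  next
    case (neg x)
    then obtain g where g: "g \<in> freeC m n" "x = dy_class m n g" by (auto simp: DY_carrier)
    have "?P (dy_class m n (- g))"
      using neg(2) g by (intro P_I) (auto simp: freepar_minus intro!: Kf_minus)
    then show ?case using neg g by (simp add: dy_class_neg)
  qed
  then show ?thesis using f by (auto simp: Kf_def)
qed

section \<open>Elements of the completion as sequences in the free algebra\<close>

definition FC :: "nat => nat => (nat => free_el) set" where
  "FC m n = {f. (\<forall>k. f k \<in> freeC m n) \<and> (\<forall>p. \<exists>N. \<forall>k\<ge>N. \<forall>l\<ge>N. f k - f l \<in> Kf m n p)}"

definition Fnull :: "nat => nat => (nat => free_el) set" where
  "Fnull m n = {f. (\<forall>k. f k \<in> freeC m n) \<and> (\<forall>p. \<exists>N. \<forall>k\<ge>N. f k \<in> Kf m n p)}"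

definition flim :: "nat => nat => (nat => free_el) => (nat => free_el set) set" where
  "flim m n f = dy_limit m n (\<lambda>k. dy_class m n (f k))"

lemma FC_freepar: "f \<in> FC m n ==> (\<lambda>k. freepar m (f k)) \<in> FC m n"
proof -
  assume f: "f \<in> FC m n"
  have "\<exists>N. \<forall>k\<ge>N. \<forall>l\<ge>N. freepar m (f k) - freepar m (f l) \<in> Kf m n p" for p
  proof -
    obtain N where "\<forall>k\<ge>N. \<forall>l\<ge>N. f k - f l \<in> Kf m n p"
      using f unfolding FC_def by blast
    then show ?thesis
      by (intro exI[of _ N]) (auto simp: freepar_diff[symmetric] intro: Kf_freepar)
  qed
  then show "(\<lambda>k. freepar m (f k)) \<in> FC m n"
    using f by (auto simp: FC_def freepar_closed)
qed

lemma Fnull_freepar: "f \<in> Fnull m n ==> (\<lambda>k. freepar m (f k)) \<in> Fnull m n"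
proof -
  assume f: "f \<in> Fnull m n"
  have "\<exists>N. \<forall>k\<ge>N. freepar m (f k) \<in> Kf m n p" for p
  proof -
    obtain N where "\<forall>k\<ge>N. f k \<in> Kf m n p"
      using f unfolding Fnull_def by blast
    then show ?thesis by (intro exI[of _ N]) (auto intro: Kf_freepar)
  qed
  then show "(\<lambda>k. freepar m (f k)) \<in> Fnull m n"
    using f by (auto simp: Fnull_def freepar_closed)
qed

lemma FC_closed: "f \<in> FC m n ==> f k \<in> freeC m n"
  by (simp add: FC_def)

lemma FC_const: "c \<in> freeC m n ==> (\<lambda>k. c) \<in> FC m n"
  by (simp add: FC_def Kf_0)

lemma FC_iff: "f \<in> FC m n \<longleftrightarrow> (\<forall>k. f k \<in> freeC m n) \<and> (\<lambda>k. dy_class m n (f k)) \<in> cauchy_seqs (DY m n) (dy_filt m n)"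
  by (auto simp: FC_def cauchy_seqs_def Kf_def dy_class_closed dy_class_minus freeC_diff)

lemma Fnull_iff: "f \<in> Fnull m n \<longleftrightarrow> (\<forall>k. f k \<in> freeC m n) \<and> (\<lambda>k. dy_class m n (f k)) \<in> null_seqs (DY m n) (dy_filt m n)"
  by (auto simp: Fnull_def null_seqs_def Kf_def dy_class_closed)

context
  fixes m n :: nat
  assumes mn: "m \<noteq> n"
begin

interpretation filtered_ring "DY m n" "dy_filt m n"
  by (rule filtered_DY[OF mn])

lemma ring_DY_hat: "ring (DY_hat m n)"
  unfolding DY_hat_def by (rule ring_quot_superalg[OF ideal_null])

lemma dy_limit_hom: "dy_limit m n \<in> ring_hom CA (DY_hat m n)"
  using quot_superalg_hom[OF ideal_null] unfolding DY_hat_def dy_limit_def .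

lemma FC_add: "f \<in> FC m n ==> g \<in> FC m n ==> (\<lambda>k. f k + g k) \<in> FC m n"
  using cauchy_add[of "\<lambda>k. dy_class m n (f k)" "\<lambda>k. dy_class m n (g k)"]
  by (auto simp: FC_iff dy_class_add)

lemma FC_mult: "f \<in> FC m n ==> g \<in> FC m n ==> (\<lambda>k. f k * g k) \<in> FC m n"
  using cauchy_mult[of "\<lambda>k. dy_class m n (f k)" "\<lambda>k. dy_class m n (g k)"]
  by (auto simp: FC_iff dy_class_mult)

lemma FC_minus: "f \<in> FC m n ==> (\<lambda>k. - f k) \<in> FC m n"
  using cauchy_neg[of "\<lambda>k. dy_class m n (f k)"]
  by (auto simp: FC_iff dy_class_neg)

lemma flim_closed: "f \<in> FC m n ==> flim m n f \<in> carrier (DY_hat m n)"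
  unfolding flim_def using ring_hom_closed[OF dy_limit_hom] by (simp add: cauchy_ops FC_iff)

lemma flim_add: "f \<in> FC m n ==> g \<in> FC m n ==> flim m n f \<oplus>\<^bsub>DY_hat m n\<^esub> flim m n g = flim m n (\<lambda>k. f k + g k)"
  unfolding flim_def
  using ring_hom_add[OF dy_limit_hom, of "\<lambda>k. dy_class m n (f k)" "\<lambda>k. dy_class m n (g k)"]
  by (simp add: cauchy_ops FC_iff dy_class_add)

lemma flim_mult: "f \<in> FC m n ==> g \<in> FC m n ==> flim m n f \<otimes>\<^bsub>DY_hat m n\<^esub> flim m n g = flim m n (\<lambda>k. f k * g k)"
  unfolding flim_def
  using ring_hom_mult[OF dy_limit_hom, of "\<lambda>k. dy_class m n (f k)" "\<lambda>k. dy_class m n (g k)"]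
  by (simp add: cauchy_ops FC_iff dy_class_mult)

lemma flim_1: "one (DY_hat m n) = flim m n (\<lambda>k. 1)"
  unfolding flim_def using ring_hom_one[OF dy_limit_hom] by (simp add: cauchy_ops dy_class_1)

lemma flim_0: "zero (DY_hat m n) = flim m n (\<lambda>k. 0)"
  unfolding flim_def using ring_hom_zero[OF dy_limit_hom ring_cauchy ring_DY_hat] by (simp add: cauchy_ops dy_class_0)

lemma flim_neg:
  assumes "f \<in> FC m n"
  shows "\<ominus>\<^bsub>DY_hat m n\<^esub> flim m n f = flim m n (\<lambda>k. - f k)"
  by (rule abelian_group.minus_equality[OF ring.is_abelian_group[OF ring_DY_hat]])
     (use assms in \<open>auto simp: flim_closed flim_add flim_0 FC_minus\<close>)

lemma flim_eq_iff:
  assumes f: "f \<in> FC m n" and g: "g \<in> FC m n"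
  shows "flim m n f = flim m n g \<longleftrightarrow> (\<lambda>k. f k - g k) \<in> Fnull m n"
proof -
  let ?f = "\<lambda>k. dy_class m n (f k)" and ?g = "\<lambda>k. dy_class m n (g k)"
  have c: "?f \<in> carrier CA" "?g \<in> carrier CA"
    using f g by (auto simp: cauchy_ops FC_iff)
  have "?f \<ominus>\<^bsub>CA\<^esub> ?g = (\<lambda>k. dy_class m n (f k - g k))"
    unfolding a_minus_def cauchy_a_inv[OF c(2)] using f g
    by (simp add: cauchy_ops FC_closed dy_class_neg dy_class_add freeC_minus)
  then show ?thesis
    unfolding flim_def dy_limit_def quot_superalg_eq_iff[OF ideal_null c]
    using f g by (auto simp: Fnull_iff FC_closed freeC_diff)
qed

lemma DY_hat_elem:
  assumes "x \<in> carrier (DY_hat m n)"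
  obtains f where "f \<in> FC m n" "x = flim m n f"
proof -
  obtain y where y: "y \<in> cauchy_seqs (DY m n) (dy_filt m n)" "x = dy_limit m n y"
    using assms quot_superalg_carrier[OF ideal_null] unfolding DY_hat_def dy_limit_def by (auto simp: cauchy_ops)
  then have "\<forall>k. \<exists>f\<in>freeC m n. y k = dy_class m n f"
    using cauchy_closed[OF y(1)] unfolding DY_carrier by blast
  then obtain f where f: "!!k. f k \<in> freeC m n" "!!k. y k = dy_class m n (f k)" by metis
  then have "y = (\<lambda>k. dy_class m n (f k))" by auto
  then show thesis using that[of f] y f by (auto simp: FC_iff flim_def)
qed

lemma DY_hat_scal: "scal (DY_hat m n) c = flim m n (\<lambda>k. cst c)"
  by (simp add: DY_hat_def quot_superalg_ops flim_def dy_limit_def cauchy_ops DY_scal)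

lemma DY_hat_par:
  assumes "f \<in> FC m n"
  shows "par (DY_hat m n) (flim m n f) = flim m n (\<lambda>k. freepar m (f k))"
proof -
  let ?f = "\<lambda>k. dy_class m n (f k)"
  have f: "?f \<in> carrier CA" using assms by (simp add: cauchy_ops FC_iff)
  have par_add: "par (DY m n) (a \<oplus>\<^bsub>DY m n\<^esub> b) = par (DY m n) a \<oplus>\<^bsub>DY m n\<^esub> par (DY m n) b"
    if "a \<in> carrier (DY m n)" "b \<in> carrier (DY m n)" for a b
    using that by (auto simp: DY_carrier dy_class_add DY_par freepar_add freepar_closed freeC_add)
  have par_invol: "par (DY m n) (par (DY m n) a) = a" if "a \<in> carrier (DY m n)" for a
    using that by (auto simp: DY_carrier DY_par freepar_closed)
  have null: "(\<lambda>k. par (DY m n) (x k)) \<in> null_seqs (DY m n) (dy_filt m n)"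
    if x: "x \<in> null_seqs (DY m n) (dy_filt m n)" for x
  proof -
    have "\<forall>k. \<exists>f\<in>freeC m n. x k = dy_class m n f"
      using cauchy_closed[OF null_cauchy[OF x]] by (auto simp: DY_carrier)
    then obtain h where h: "!!k. h k \<in> freeC m n" "!!k. x k = dy_class m n (h k)" by metis
    then have "h \<in> Fnull m n" using x by (simp add: Fnull_iff flip: h(2))
    then have "(\<lambda>k. freepar m (h k)) \<in> Fnull m n"
      by (rule Fnull_freepar)
    then show ?thesis using h by (simp add: Fnull_iff DY_par)
  qed
  have "par (DY_hat m n) (dy_limit m n ?f) = dy_limit m n (\<lambda>k. par (DY m n) (?f k))"
    unfolding DY_hat_def dy_limit_def
    by (subst quot_superalg_par[OF ideal_null _ _ _ f])
       (auto simp: cauchy_ops cauchy_closed par_add par_invol null)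
  then show ?thesis
    using assms by (simp add: flim_def DY_par FC_closed)
qed

lemma flim_modcentral:
  assumes c: "modcentral m n c" and x: "x \<in> carrier (DY_hat m n)"
  shows "flim m n (\<lambda>k. c) \<otimes>\<^bsub>DY_hat m n\<^esub> x = x \<otimes>\<^bsub>DY_hat m n\<^esub> flim m n (\<lambda>k. c)"
proof -
  obtain f where f: "f \<in> FC m n" "x = flim m n f" using DY_hat_elem[OF x] .
  have cc: "c \<in> freeC m n" using c by (simp add: modcentral_def)
  have "flim m n (\<lambda>k. c * f k) = flim m n (\<lambda>k. f k * c)"
    using f c cc
    by (subst flim_eq_iff) (auto simp: FC_mult FC_const Fnull_def FC_closed modcentral_def intro!: freeC_diff freeC_mult Kf_ideal)
  then show ?thesis using f cc by (simp add: flim_mult FC_const)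
qed

end

subsection \<open>A type for all completed double Yangians\<close>

text \<open>
  The ring \<open>DY_hat m n\<close> depends on the variables \<open>m\<close> and \<open>n\<close>, so there is no type for it.  But the
  product over all \<open>m \<noteq> n\<close> is a closed set; its elements form a type, and with a further factor
  \<open>complex\<close> that guarantees \<open>0 \<noteq> 1\<close> this type is an instance of \<open>ring_1\<close>.
\<close>

definition dyr :: "nat => nat => (nat => free_el set) set superalg" where
  "dyr m n = (if m = n
     then \<lparr> carrier = {{}}, mult = \<lambda>_ _. {}, one = {}, zero = {}, add = \<lambda>_ _. {}, scal = \<lambda>_. {}, par = \<lambda>_. {} \<rparr>
     else DY_hat m n)"

lemma dyr_neq: "m \<noteq> n ==> dyr m n = DY_hat m n"
  by (simp add: dyr_def)

lemma ring_dyr: "ring (dyr m n)"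
proof (cases "m = n")
  case True
  show ?thesis
    unfolding dyr_def if_P[OF True]
    by (rule ringI; (rule abelian_groupI monoidI)?) simp_all
next
  case False
  then show ?thesis using ring_DY_hat by (simp add: dyr_neq)
qed

typedef dyp = "{(c :: complex, f). \<forall>m n. f m n \<in> carrier (dyr m n)}"
proof
  show "(0, \<lambda>m n. zero (dyr m n)) \<in> {(c :: complex, f). \<forall>m n. f m n \<in> carrier (dyr m n)}"
    by (auto intro: ring.ring_simprules(2)[OF ring_dyr])
qed

setup_lifting type_definition_dyp

instantiation dyp :: ring_1
begin

lift_definition zero_dyp :: dyp is "(0, \<lambda>m n. zero (dyr m n))"
  by (auto intro: ring.ring_simprules[OF ring_dyr])

lift_definition one_dyp :: dyp is "(1, \<lambda>m n. one (dyr m n))"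
  by (auto intro: ring.ring_simprules[OF ring_dyr])

lift_definition plus_dyp :: "dyp => dyp => dyp" is
  "\<lambda>x y. (fst x + fst y, \<lambda>m n. snd x m n \<oplus>\<^bsub>dyr m n\<^esub> snd y m n)"
  by (auto intro: ring.ring_simprules[OF ring_dyr])

lift_definition uminus_dyp :: "dyp => dyp" is
  "\<lambda>x. (- fst x, \<lambda>m n. \<ominus>\<^bsub>dyr m n\<^esub> snd x m n)"
  by (auto intro: ring.ring_simprules[OF ring_dyr])

lift_definition times_dyp :: "dyp => dyp => dyp" is
  "\<lambda>x y. (fst x * fst y, \<lambda>m n. snd x m n \<otimes>\<^bsub>dyr m n\<^esub> snd y m n)"
  by (auto intro: ring.ring_simprules[OF ring_dyr])

definition minus_dyp :: "dyp => dyp => dyp" where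
  "minus_dyp x y = x + - y"

instance
proof
  fix a b c :: dyp
  show "a * b * c = a * (b * c)"
    by transfer (auto simp: ring.ring_simprules(11)[OF ring_dyr] mult.assoc)
  show "1 * a = a"
    by transfer (auto simp: ring.ring_simprules(12)[OF ring_dyr])
  show "a * 1 = a"
    by transfer (auto simp: monoid.r_one[OF ring.is_monoid[OF ring_dyr]])
  show "a + b + c = a + (b + c)"
    by transfer (auto simp: ring.ring_simprules(7)[OF ring_dyr] add.assoc)
  show "a + b = b + a"
    by transfer (auto simp: ring.ring_simprules(10)[OF ring_dyr] add.commute)
  show "0 + a = a"
    by transfer (auto simp: ring.ring_simprules(8)[OF ring_dyr])
  show "- a + a = 0"
    by transfer (auto simp: ring.ring_simprules(9)[OF ring_dyr])
  show "a - b = a + - b"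
    by (simp add: minus_dyp_def)
  show "(a + b) * c = a * c + b * c"
    by transfer (auto simp: ring.ring_simprules(13)[OF ring_dyr] distrib_right)
  show "a * (b + c) = a * b + a * c"
    by transfer (auto simp: ring.ring_simprules(23)[OF ring_dyr] distrib_left)
  show "(0 :: dyp) \<noteq> 1"
    by transfer simp
qed

end

definition same_index :: "nat => nat => nat => nat => bool" where
  "same_index m n m' n' \<longleftrightarrow> m' = m \<and> n' = n"

text \<open>Puts an element into one factor and 0 into all others, including \<open>complex\<close>.
  Sums and products are respected but 1 is not, hence the idempotent \<open>e1\<close> below. The
  value 0 outside the carrier only makes the map total.\<close>

lift_definition inj_dyp :: "nat => nat => (nat => free_el set) set => dyp" is
  "\<lambda>m n x. (0, \<lambda>m' n'. if same_index m n m' n' \<and> x \<in> carrier (dyr m' n') then x else zero (dyr m' n'))"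
  by (auto intro: ring.ring_simprules[OF ring_dyr])

lemma dyr_scal:
  "scal (dyr m n) c \<in> carrier (dyr m n)"
  "scal (dyr m n) (c + d) = scal (dyr m n) c \<oplus>\<^bsub>dyr m n\<^esub> scal (dyr m n) d"
  "scal (dyr m n) (c * d) = scal (dyr m n) c \<otimes>\<^bsub>dyr m n\<^esub> scal (dyr m n) d"
  "scal (dyr m n) 1 = one (dyr m n)"
  "x \<in> carrier (dyr m n) ==> scal (dyr m n) c \<otimes>\<^bsub>dyr m n\<^esub> x = x \<otimes>\<^bsub>dyr m n\<^esub> scal (dyr m n) c"
proof -
  show "scal (dyr m n) c \<in> carrier (dyr m n)"
    by (cases "m = n") (auto simp: dyr_def DY_hat_scal intro!: flim_closed FC_const)
  show "scal (dyr m n) (c + d) = scal (dyr m n) c \<oplus>\<^bsub>dyr m n\<^esub> scal (dyr m n) d"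
    by (cases "m = n") (auto simp: dyr_def DY_hat_scal flim_add FC_const single_add)
  show "scal (dyr m n) (c * d) = scal (dyr m n) c \<otimes>\<^bsub>dyr m n\<^esub> scal (dyr m n) d"
    by (cases "m = n") (auto simp: dyr_def DY_hat_scal flim_mult FC_const mult_single)
  show "scal (dyr m n) 1 = one (dyr m n)"
    by (cases "m = n") (auto simp: dyr_def DY_hat_scal flim_1)
  show "scal (dyr m n) c \<otimes>\<^bsub>dyr m n\<^esub> x = x \<otimes>\<^bsub>dyr m n\<^esub> scal (dyr m n) c" if "x \<in> carrier (dyr m n)"
    using that by (cases "m = n") (auto simp: dyr_def DY_hat_scal flim_modcentral[OF _ modcentral_cst])
qed

lift_definition cs_dyp :: "complex => dyp" is "\<lambda>c. (c, \<lambda>m n. scal (dyr m n) c)"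
  by (simp add: dyr_scal(1))

global_interpretation dyp: scalar_hom cs_dyp
  defines dyp_pev = dyp.pev and dyp_fev = dyp.fev and dyp_shU = dyp.shU
proof
  fix a b
  show "cs_dyp (a + b) = cs_dyp a + cs_dyp b"
    by transfer (simp add: dyr_scal(2))
  show "cs_dyp (a * b) = cs_dyp a * cs_dyp b"
    by transfer (simp add: dyr_scal(3))
  show "cs_dyp 1 = 1"
    by transfer (simp add: dyr_scal(4))
  show "is_central (cs_dyp a)"
    unfolding is_central_def by (intro allI, transfer) (auto simp: dyr_scal(5))
qed

lemma dyr_par:
  "x \<in> carrier (dyr m n) ==> par (dyr m n) x \<in> carrier (dyr m n)"
  "x \<in> carrier (dyr m n) ==> y \<in> carrier (dyr m n) ==>
     par (dyr m n) (x \<oplus>\<^bsub>dyr m n\<^esub> y) = par (dyr m n) x \<oplus>\<^bsub>dyr m n\<^esub> par (dyr m n) y"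
  "x \<in> carrier (dyr m n) ==> y \<in> carrier (dyr m n) ==>
     par (dyr m n) (x \<otimes>\<^bsub>dyr m n\<^esub> y) = par (dyr m n) x \<otimes>\<^bsub>dyr m n\<^esub> par (dyr m n) y"
  "x \<in> carrier (dyr m n) ==> par (dyr m n) (par (dyr m n) x) = x"
proof -
  have 1: "par (dyr m n) x \<in> carrier (dyr m n) \<and> par (dyr m n) (par (dyr m n) x) = x" if x: "x \<in> carrier (dyr m n)" for x
  proof (cases "m = n")
    case False
    with x obtain f where "f \<in> FC m n" "x = flim m n f" by (metis DY_hat_elem dyr_neq)
    then show ?thesis using False by (simp add: dyr_neq DY_hat_par flim_closed FC_freepar)
  qed (use x in \<open>simp add: dyr_def\<close>)
  then show "x \<in> carrier (dyr m n) ==> par (dyr m n) x \<in> carrier (dyr m n)"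
    "x \<in> carrier (dyr m n) ==> par (dyr m n) (par (dyr m n) x) = x" by auto
  have 2: "par (dyr m n) (x \<oplus>\<^bsub>dyr m n\<^esub> y) = par (dyr m n) x \<oplus>\<^bsub>dyr m n\<^esub> par (dyr m n) y
      \<and> par (dyr m n) (x \<otimes>\<^bsub>dyr m n\<^esub> y) = par (dyr m n) x \<otimes>\<^bsub>dyr m n\<^esub> par (dyr m n) y"
    if x: "x \<in> carrier (dyr m n)" and y: "y \<in> carrier (dyr m n)"
  proof (cases "m = n")
    case False
    from False x obtain f where f: "f \<in> FC m n" "x = flim m n f" by (metis DY_hat_elem dyr_neq)
    from False y obtain g where g: "g \<in> FC m n" "y = flim m n g" by (metis DY_hat_elem dyr_neq)
    show ?thesis using False f g
      by (simp add: dyr_neq DY_hat_par flim_add flim_mult FC_add FC_mult FC_freepar freepar_add freepar_mult)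
  qed (simp add: dyr_def)
  then show "x \<in> carrier (dyr m n) ==> y \<in> carrier (dyr m n) ==>
     par (dyr m n) (x \<oplus>\<^bsub>dyr m n\<^esub> y) = par (dyr m n) x \<oplus>\<^bsub>dyr m n\<^esub> par (dyr m n) y"
   "x \<in> carrier (dyr m n) ==> y \<in> carrier (dyr m n) ==>
     par (dyr m n) (x \<otimes>\<^bsub>dyr m n\<^esub> y) = par (dyr m n) x \<otimes>\<^bsub>dyr m n\<^esub> par (dyr m n) y"
    by auto
qed

lift_definition par_dyp :: "dyp => dyp" is "\<lambda>x. (fst x, \<lambda>m n. par (dyr m n) (snd x m n))"
  by (auto simp: dyr_par)

lemma par_dyp_add: "par_dyp (x + y) = par_dyp x + par_dyp y"
  by transfer (auto simp: dyr_par)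

lemma par_dyp_mult: "par_dyp (x * y) = par_dyp x * par_dyp y"
  by transfer (auto simp: dyr_par)

lemma par_dyp_invol [simp]: "par_dyp (par_dyp x) = x"
  by transfer (auto simp: dyr_par)

subsection \<open>The embedding of one completed double Yangian\<close>

lemma dyr_null:
  "zero (dyr m n) \<in> carrier (dyr m n)"
  "x \<in> carrier (dyr m n) ==> zero (dyr m n) \<oplus>\<^bsub>dyr m n\<^esub> x = x"
  "x \<in> carrier (dyr m n) ==> zero (dyr m n) \<otimes>\<^bsub>dyr m n\<^esub> x = zero (dyr m n)"
  "x \<in> carrier (dyr m n) ==> x \<otimes>\<^bsub>dyr m n\<^esub> zero (dyr m n) = zero (dyr m n)"
  using ring_dyr[of m n] by (simp_all add: ring.ring_simprules)

lemma DY_hat_closed: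
  assumes "m \<noteq> n" "x \<in> carrier (DY_hat m n)" "y \<in> carrier (DY_hat m n)"
  shows "x \<oplus>\<^bsub>DY_hat m n\<^esub> y \<in> carrier (DY_hat m n)" "x \<otimes>\<^bsub>DY_hat m n\<^esub> y \<in> carrier (DY_hat m n)"
  using ring_DY_hat[OF assms(1)] assms(2,3) by (simp_all add: ring.ring_simprules)

context
  fixes m n :: nat
  assumes mn: "m \<noteq> n"
begin

lemma inj_dyp_Rep:
  assumes "x \<in> carrier (DY_hat m n)"
  shows "Rep_dyp (inj_dyp m n x) = (0, \<lambda>m' n'. if same_index m n m' n' then x else zero (dyr m' n'))"
proof -
  have "same_index m n m' n' \<and> x \<in> carrier (dyr m' n') \<longleftrightarrow> same_index m n m' n'" for m' n'
    using assms by (auto simp: same_index_def dyr_neq mn)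
  then show ?thesis by (simp add: inj_dyp.rep_eq)
qed

lemma dyp_eqI:
  assumes "fst (Rep_dyp x) = fst (Rep_dyp y)" "!!m' n'. snd (Rep_dyp x) m' n' = snd (Rep_dyp y) m' n'"
  shows "x = y"
  using assms by (metis Rep_dyp_inject ext prod_eqI)

lemma inj_dyp_add:
  assumes x: "x \<in> carrier (DY_hat m n)" and y: "y \<in> carrier (DY_hat m n)"
  shows "inj_dyp m n (x \<oplus>\<^bsub>DY_hat m n\<^esub> y) = inj_dyp m n x + inj_dyp m n y"
proof (rule dyp_eqI)
  fix m' n'
  show "snd (Rep_dyp (inj_dyp m n (x \<oplus>\<^bsub>DY_hat m n\<^esub> y))) m' n' = snd (Rep_dyp (inj_dyp m n x + inj_dyp m n y)) m' n'"
    unfolding plus_dyp.rep_eq inj_dyp_Rep[OF x] inj_dyp_Rep[OF y] inj_dyp_Rep[OF DY_hat_closed(1)[OF mn x y]]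
    by (cases "same_index m n m' n'") (simp_all add: dyr_null, simp add: same_index_def dyr_neq mn)
qed (simp add: plus_dyp.rep_eq inj_dyp.rep_eq)

lemma inj_dyp_mult:
  assumes x: "x \<in> carrier (DY_hat m n)" and y: "y \<in> carrier (DY_hat m n)"
  shows "inj_dyp m n (x \<otimes>\<^bsub>DY_hat m n\<^esub> y) = inj_dyp m n x * inj_dyp m n y"
proof (rule dyp_eqI)
  fix m' n'
  show "snd (Rep_dyp (inj_dyp m n (x \<otimes>\<^bsub>DY_hat m n\<^esub> y))) m' n' = snd (Rep_dyp (inj_dyp m n x * inj_dyp m n y)) m' n'"
    unfolding times_dyp.rep_eq inj_dyp_Rep[OF x] inj_dyp_Rep[OF y] inj_dyp_Rep[OF DY_hat_closed(2)[OF mn x y]]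
    by (cases "same_index m n m' n'") (simp_all add: dyr_null, simp add: same_index_def dyr_neq mn)
qed (simp add: times_dyp.rep_eq inj_dyp.rep_eq)

lemma inj_dyp_inj:
  assumes x: "x \<in> carrier (DY_hat m n)" and y: "y \<in> carrier (DY_hat m n)"
    and eq: "inj_dyp m n x = inj_dyp m n y"
  shows "x = y"
proof -
  have "snd (Rep_dyp (inj_dyp m n x)) m n = snd (Rep_dyp (inj_dyp m n y)) m n" by (simp add: eq)
  then show ?thesis by (simp add: inj_dyp_Rep[OF x] inj_dyp_Rep[OF y] same_index_def)
qed

lemma inj_dyp_scal:
  assumes x: "x \<in> carrier (DY_hat m n)"
  shows "inj_dyp m n (scal (DY_hat m n) c \<otimes>\<^bsub>DY_hat m n\<^esub> x) = cs_dyp c * inj_dyp m n x"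
proof (rule dyp_eqI)
  have c: "scal (DY_hat m n) c \<in> carrier (DY_hat m n)"
    using dyr_scal(1)[of m n c] by (simp add: dyr_neq mn)
  fix m' n'
  show "snd (Rep_dyp (inj_dyp m n (scal (DY_hat m n) c \<otimes>\<^bsub>DY_hat m n\<^esub> x))) m' n' = snd (Rep_dyp (cs_dyp c * inj_dyp m n x)) m' n'"
    unfolding times_dyp.rep_eq cs_dyp.rep_eq inj_dyp_Rep[OF x] inj_dyp_Rep[OF DY_hat_closed(2)[OF mn c x]]
    by (cases "same_index m n m' n'") (simp_all add: dyr_null dyr_scal(1), simp add: same_index_def dyr_neq mn)
qed (simp add: times_dyp.rep_eq inj_dyp.rep_eq)

lemma par_dyp_inj: "x \<in> carrier (DY_hat m n) ==> par_dyp (inj_dyp m n x) = inj_dyp m n (par (DY_hat m n) x)"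
proof -
  have 0: "par (dyr a b) (zero (dyr a b)) = zero (dyr a b)" for a b
  proof -
    interpret ring "dyr a b" by (rule ring_dyr)
    have "par (dyr a b) \<zero>\<^bsub>dyr a b\<^esub> = par (dyr a b) \<zero>\<^bsub>dyr a b\<^esub> \<oplus>\<^bsub>dyr a b\<^esub> par (dyr a b) \<zero>\<^bsub>dyr a b\<^esub>"
      using dyr_par(2)[of "\<zero>\<^bsub>dyr a b\<^esub>" a b "\<zero>\<^bsub>dyr a b\<^esub>"] by simp
    then show ?thesis using dyr_par(1)[of "\<zero>\<^bsub>dyr a b\<^esub>" a b]
      by (metis add.r_cancel_one' zero_closed)
  qed
  assume x: "x \<in> carrier (DY_hat m n)"
  then have px: "par (DY_hat m n) x \<in> carrier (DY_hat m n)"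
    using dyr_par(1)[of x m n] by (simp add: dyr_neq mn)
  show ?thesis
  proof (rule dyp_eqI)
    fix m' n'
    show "snd (Rep_dyp (par_dyp (inj_dyp m n x))) m' n' = snd (Rep_dyp (inj_dyp m n (par (DY_hat m n) x))) m' n'"
      unfolding par_dyp.rep_eq inj_dyp_Rep[OF x] inj_dyp_Rep[OF px]
      by (cases "same_index m n m' n'") (simp_all add: 0, simp add: same_index_def dyr_neq mn)
  qed (simp add: par_dyp.rep_eq inj_dyp.rep_eq)
qed

text \<open>In all other factors both products are 0, so commuting inside the one factor is
  enough.\<close>

lemma is_central_inj_dyp:
  assumes c: "c \<in> carrier (DY_hat m n)"
    and comm: "!!x. x \<in> carrier (DY_hat m n) ==> c \<otimes>\<^bsub>DY_hat m n\<^esub> x = x \<otimes>\<^bsub>DY_hat m n\<^esub> c"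
  shows "is_central (inj_dyp m n c)"
  unfolding is_central_def
proof (intro allI)
  fix y
  show "inj_dyp m n c * y = y * inj_dyp m n c"
  proof (rule dyp_eqI)
    fix m' n'
    have y: "snd (Rep_dyp y) m' n' \<in> carrier (dyr m' n')"
      using Rep_dyp[of y] by (auto simp: case_prod_beta)
    show "snd (Rep_dyp (inj_dyp m n c * y)) m' n' = snd (Rep_dyp (y * inj_dyp m n c)) m' n'"
      unfolding times_dyp.rep_eq inj_dyp_Rep[OF c] using y
      by (cases "same_index m n m' n'") (simp_all add: dyr_null, simp add: same_index_def dyr_neq mn comm)
  qed (simp add: times_dyp.rep_eq inj_dyp.rep_eq)
qed

definition Lm :: "(nat => free_el) => dyp" where
  "Lm f = inj_dyp m n (flim m n f)"

lemma Lm_add: "f \<in> FC m n ==> g \<in> FC m n ==> Lm (\<lambda>k. f k + g k) = Lm f + Lm g"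
  by (simp add: Lm_def flim_add[OF mn, symmetric] inj_dyp_add flim_closed[OF mn])

lemma Lm_mult: "f \<in> FC m n ==> g \<in> FC m n ==> Lm (\<lambda>k. f k * g k) = Lm f * Lm g"
  by (simp add: Lm_def flim_mult[OF mn, symmetric] inj_dyp_mult flim_closed[OF mn])

lemma Lm_cst: "f \<in> FC m n ==> Lm (\<lambda>k. cst c * f k) = cs_dyp c * Lm f"
  by (simp add: Lm_def flim_mult[OF mn, symmetric] FC_const flim_closed[OF mn] inj_dyp_scal[symmetric] DY_hat_scal[OF mn])

lemma Lm_par: "f \<in> FC m n ==> par_dyp (Lm f) = Lm (\<lambda>k. freepar m (f k))"
  by (simp add: Lm_def par_dyp_inj flim_closed[OF mn] DY_hat_par[OF mn])

lemma Lm_eq_iff: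
  assumes f: "f \<in> FC m n" and g: "g \<in> FC m n"
  shows "Lm f = Lm g \<longleftrightarrow> (\<lambda>k. f k - g k) \<in> Fnull m n"
proof -
  have "Lm f = Lm g \<longleftrightarrow> flim m n f = flim m n g"
    unfolding Lm_def using inj_dyp_inj[OF flim_closed[OF mn f] flim_closed[OF mn g]] by auto
  then show ?thesis by (simp only: flim_eq_iff[OF mn f g])
qed

lemma Lm_0: "Lm (\<lambda>k. 0) = 0"
  using Lm_add[OF FC_const[OF freeC_0] FC_const[OF freeC_0]] by simp

lemma Lm_minus: "f \<in> FC m n ==> Lm (\<lambda>k. - f k) = - Lm f"
  using Lm_add[of f "\<lambda>k. - f k"] FC_minus[OF mn] by (simp add: Lm_0 eq_neg_iff_add_eq_0 add.commute)

lemma Lm_central: "modcentral m n c ==> is_central (Lm (\<lambda>k. c))"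
  unfolding Lm_def
  by (rule is_central_inj_dyp) (auto simp: flim_modcentral[OF mn] modcentral_def intro!: flim_closed[OF mn] FC_const)

end

section \<open>RTT relations in formal power series\<close>

lemma sg_eq_iff: "sg e x = sg e y \<longleftrightarrow> x = y"
  by (simp add: sg_def)

lemma is_central_mult: "is_central c ==> is_central d ==> is_central (c * d)"
  unfolding is_central_def by (metis mult.assoc)

lemma is_central_uminus: "is_central c ==> is_central (- c)"
  by (simp add: is_central_def)

lemma is_central_diff: "is_central c ==> is_central d ==> is_central (c - d)"
  by (simp add: is_central_def algebra_simps)

lemma is_central_plus: "is_central c ==> is_central d ==> is_central (c + d)"
  by (simp add: is_central_def algebra_simps)

lemma is_central_1: "is_central 1"
  by (simp add: is_central_def)

lemma is_central_fps_X: "is_central (fps_X :: 's::ring_1 fps)"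
  unfolding is_central_def by (intro allI fps_ext) simp

lemma is_central_fps_const: "is_central c ==> is_central (fps_const c)"
  unfolding is_central_def by (intro allI fps_ext) simp

text \<open>
  From \<open>(\<alpha>\<^sub>+ - \<beta>\<^sub>+ P) A\<^sub>1 B\<^sub>2 = B\<^sub>2 A\<^sub>1 (\<alpha>\<^sub>- - \<beta>\<^sub>- P)\<close> by multiplication with
  \<open>\<mu>\<^sub>\<plusminus> (\<alpha>\<^sub>\<plusminus> + \<beta>\<^sub>\<plusminus> P)\<close> on the two sides, where \<open>\<mu>\<^sub>\<plusminus> (\<alpha>\<^sub>\<plusminus>\<^sup>2 - \<beta>\<^sub>\<plusminus>\<^sup>2) = 1\<close>.
\<close>

lemma rtt_dual:
  fixes a b :: "nat => nat => 'r::ring_1"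
  assumes rel: "rtt I p \<alpha>p \<beta>p \<alpha>m \<beta>m a b"
    and c: "is_central \<alpha>p" "is_central \<beta>p" "is_central \<alpha>m" "is_central \<beta>m" "is_central \<mu>p" "is_central \<mu>m"
    and inv: "\<mu>p * (\<alpha>p * \<alpha>p - \<beta>p * \<beta>p) = 1" "\<mu>m * (\<alpha>m * \<alpha>m - \<beta>m * \<beta>m) = 1"
  shows "rtt I p (\<mu>p * \<alpha>p) (- (\<mu>p * \<beta>p)) (\<mu>m * \<alpha>m) (- (\<mu>m * \<beta>m)) b a"
proof -
  define x where "x i j k l = sg (pp p i j k l) (a i j * b k l)" for i j k l
  define y where "y i j k l = b k l * a i j" for i j k l
  define L where "L i j k l = pt p k j l + pp p k j i l" for i j k l
  define R where "R k j l = pt p k j l" for k j l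
  \<comment> \<open>\<open>LL\<close> and \<open>RR\<close> say that \<open>P\<close> squares to 1
    when it acts from the left and from the right, \<open>LR\<close> that the two actions
    commute.\<close>
  have LL: "even (L i j k l + L k j i l)" and RR: "even (R k j l + R k l j)"
    and LR: "even (L i j k l + R i j l) = even (R k j l + L i l k j)" for i j k l
    by (auto simp: L_def R_def)
  have cl: "u * (v * w) = v * (u * w)" if "is_central v" for u v w :: 'r
    using that by (rule central_left_commute)
  have E: "\<alpha>p * x i j k l - \<beta>p * sg (L i j k l) (x k j i l) = \<alpha>m * y i j k l - \<beta>m * sg (R k j l) (y i l k j)"
    if "i \<in> I" "j \<in> I" "k \<in> I" "l \<in> I" for i j k l
  proof -
    have "sg (L i j k l) (x k j i l) = sg (pt p k j l) (a k j * b i l)"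
      unfolding x_def sg_sg by (rule sg_cong) (auto simp: L_def)
    then show ?thesis using rttD[OF rel that] by (simp add: x_def y_def R_def)
  qed
  \<comment> \<open>The entries of
    \<open>(\<alpha>\<^sub>+ + \<beta>\<^sub>+ P) B\<^sub>2 A\<^sub>1\<close>.\<close>
  define z where "z i j k l = \<alpha>p * y i j k l + \<beta>p * sg (L i j k l) (y k j i l)" for i j k l
  have 1: "(\<alpha>p * \<alpha>p - \<beta>p * \<beta>p) * x i j k l = \<alpha>m * z i j k l - \<beta>m * sg (R k j l) (z i l k j)"
    if I: "i \<in> I" "j \<in> I" "k \<in> I" "l \<in> I" for i j k l
  proof -
    have "\<alpha>p * (\<alpha>p * x i j k l - \<beta>p * sg (L i j k l) (x k j i l))
	+ \<beta>p * sg (L i j k l) (\<alpha>p * x k j i l - \<beta>p * sg (L k j i l) (x i j k l))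
      = (\<alpha>p * \<alpha>p - \<beta>p * \<beta>p) * x i j k l"
      using cl[OF c(1), of \<beta>p] by (simp add: algebra_simps sg_diff sg_mult_right sg_cancel[OF LL])
    moreover have "\<alpha>p * (\<alpha>m * y i j k l - \<beta>m * sg (R k j l) (y i l k j))
	+ \<beta>p * sg (L i j k l) (\<alpha>m * y k j i l - \<beta>m * sg (R i j l) (y k l i j))
      = \<alpha>m * z i j k l - \<beta>m * sg (R k j l) (z i l k j)"
      using cl[OF c(3), of \<alpha>p] cl[OF c(3), of \<beta>p] cl[OF c(4), of \<alpha>p] cl[OF c(4), of \<beta>p]
	sg_cong[OF LR[of i j k l] refl, of "\<beta>m * (\<beta>p * y k l i j)"]
      by (simp add: z_def algebra_simps sg_diff sg_add sg_mult_right)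
    ultimately show ?thesis
      using E[OF I] E[OF I(3,2,1,4)] by simp
  qed
  have 2: "\<mu>m * (\<alpha>m * x i j k l + \<beta>m * sg (R k j l) (x i l k j)) = \<mu>p * z i j k l"
    if I: "i \<in> I" "j \<in> I" "k \<in> I" "l \<in> I" for i j k l
  proof -
    let ?np = "\<alpha>p * \<alpha>p - \<beta>p * \<beta>p" and ?nm = "\<alpha>m * \<alpha>m - \<beta>m * \<beta>m"
    have np: "is_central ?np" by (intro is_central_diff is_central_mult c)
    have "?np * (\<alpha>m * x i j k l + \<beta>m * sg (R k j l) (x i l k j))
       = \<alpha>m * (?np * x i j k l) + \<beta>m * sg (R k j l) (?np * x i l k j)"
      using cl[OF np] by (simp add: distrib_left sg_mult_right)
    also have "\<dots> = \<alpha>m * (\<alpha>m * z i j k l - \<beta>m * sg (R k j l) (z i l k j))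
	+ \<beta>m * sg (R k j l) (\<alpha>m * z i l k j - \<beta>m * sg (R k l j) (z i j k l))"
      unfolding 1[OF I] 1[OF I(1,4,3,2)] ..
    also have "\<dots> = ?nm * z i j k l"
      using cl[OF c(3), of \<beta>m] by (simp add: algebra_simps sg_diff sg_mult_right sg_cancel[OF RR])
    finally have "\<mu>p * (\<mu>m * (?np * (\<alpha>m * x i j k l + \<beta>m * sg (R k j l) (x i l k j)))) = \<mu>p * (\<mu>m * (?nm * z i j k l))"
      by simp
    moreover have "\<mu>p * (\<mu>m * (?np * w)) = \<mu>m * w" for w
      using inv(1) cl[OF c(6), of \<mu>p] by (metis mult.assoc mult_1_left)
    moreover have "\<mu>p * (\<mu>m * (?nm * w)) = \<mu>p * w" for w
      using inv(2) by (metis mult.assoc mult_1_left)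
    ultimately show ?thesis by simp
  qed
  show ?thesis
    unfolding rtt_def
  proof (intro ballI)
    fix i j k l assume I: "i \<in> I" "j \<in> I" "k \<in> I" "l \<in> I"
    let ?s = "pp p i j k l"
    \<comment> \<open>The second fact with the two tensor factors exchanged: conjugation by
      \<open>P\<close> makes \<open>b\<close> the first factor.\<close>
    have "sg ?s (\<mu>m * (\<alpha>m * x k l i j + \<beta>m * sg (R i l j) (x k j i l))) = sg ?s (\<mu>p * z k l i j)"
      using 2[OF I(3,4,1,2)] by simp
    moreover have "sg ?s (\<mu>m * (\<alpha>m * x k l i j + \<beta>m * sg (R i l j) (x k j i l)))
	= \<mu>m * \<alpha>m * (a k l * b i j) + \<mu>m * \<beta>m * sg (pt p k j l) (a k j * b i l)"
      unfolding x_def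
      by (auto simp: algebra_simps sg_add sg_mult_right mult.assoc R_def intro!: arg_cong2[of _ _ _ _ "(+)"] sg_cong sg_cancel)
    moreover have "sg ?s (\<mu>p * z k l i j)
	= \<mu>p * \<alpha>p * sg ?s (b i j * a k l) + \<mu>p * \<beta>p * sg (pt p k j l) (b k j * a i l)"
      unfolding z_def y_def
      by (auto simp: algebra_simps sg_add sg_mult_right mult.assoc L_def intro!: arg_cong2[of _ _ _ _ "(+)"] sg_cong sg_cancel)
    ultimately show "\<mu>p * \<alpha>p * sg (pp p i j k l) (b i j * a k l)
	- - (\<mu>p * \<beta>p) * sg (pt p k j l) (b k j * a i l)
      = \<mu>m * \<alpha>m * (a k l * b i j) - - (\<mu>m * \<beta>m) * sg (pt p k j l) (a k j * b i l)"
      by simp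
  qed
qed

section \<open>Relations between series in two variables\<close>

definition outer :: "(nat => nat => nat => 's::ring_1) => nat => nat => 's fps fps" where
  "outer x i j = Abs_fps (\<lambda>r. fps_const (x i j r))"

text \<open>A double series is a power series in an outer variable, written \<open>fps_X\<close>,
  whose coefficients are power series in an inner one, written \<open>Vs\<close>. Which of the two
  variables of a relation is outer varies; for \<open>T(u)\<close> and \<open>T\<^sup>+(v)\<close>
  the outer one is \<open>1/u\<close> and the inner one \<open>v\<close>.\<close>

definition inner :: "(nat => nat => nat => 's::ring_1) => nat => nat => 's fps fps" where
  "inner x i j = fps_const (Abs_fps (\<lambda>q. x i j q))"

lemma sg_fps_nth: "sg e f $ n = sg e (f $ n)"
  by (simp add: sg_def)

lemma outer_inner_nth: "(outer x i j * inner y k l) $ r $ q = x i j r * y k l q"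
  by (simp add: outer_def inner_def)

lemma inner_outer_nth: "(inner y k l * outer x i j) $ r $ q = y k l q * x i j r"
  by (simp add: outer_def inner_def)

lemma fps_fps_mult_nth: "(f * g) $ r $ q = (\<Sum>y\<le>q. \<Sum>x\<le>r. f $ x $ y * g $ (r - x) $ (q - y))"
proof -
  have "(f * g) $ r $ q = (\<Sum>x\<le>r. \<Sum>y\<le>q. f $ x $ y * g $ (r - x) $ (q - y))"
    by (simp add: fps_mult_nth fps_sum_nth atLeast0AtMost)
  then show ?thesis by (simp add: sum.swap[of _ "{..r}"])
qed

text \<open>
  The relation \<open>(u - v) (A\<^sub>1(u) B\<^sub>2(v) - B\<^sub>2(v) A\<^sub>1(u)) = P A\<^sub>1(u) B\<^sub>2(v) - B\<^sub>2(v) A\<^sub>1(u) P\<close> for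
  two-sided series with coefficients \<open>a i j p\<close> at \<open>u^p\<close> and \<open>b k l q\<close> at \<open>v^q\<close>.
\<close>

definition yang_rel :: "nat set => (nat => nat) => (nat => nat => int => 's::ring_1) => (nat => nat => int => 's) => bool" where
  "yang_rel I p a b \<longleftrightarrow> (\<forall>i\<in>I. \<forall>j\<in>I. \<forall>k\<in>I. \<forall>l\<in>I. \<forall>x y.
     (sg (pp p i j k l) (a i j (x - 1) * b k l y) - b k l y * a i j (x - 1))
     - (sg (pp p i j k l) (a i j x * b k l (y - 1)) - b k l (y - 1) * a i j x)
     = sg (pt p k j l) (a k j x * b i l y - b k j y * a i l x))"

definition int_pos :: "(nat => 's::zero) => int => 's" where
  "int_pos f x = (if 0 \<le> x then f (nat x) else 0)"

definition int_neg :: "(nat => 's::zero) => int => 's" where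
  "int_neg f x = (if x \<le> 0 then f (nat (- x)) else 0)"

lemma int_pos_simps [simp]: "int_pos f (int n) = f n" "int_pos f (int n - 1) = (if n = 0 then 0 else f (n - 1))"
  by (auto simp: int_pos_def nat_diff_distrib)

lemma int_neg_simps [simp]: "int_neg f (- int n) = f n" "int_neg f (1 - int n) = (if n = 0 then 0 else f (n - 1))"
  by (auto simp: int_neg_def nat_diff_distrib)

abbreviation "Vs \<equiv> fps_const fps_X"

lemma Vs_mult_nth: "(Vs * f) $ r $ q = (if q = 0 then 0 else f $ r $ (q - 1))" for f :: "'s::ring_1 fps fps"
  by simp

lemma Us_mult_nth: "(fps_X * f) $ r $ q = (if r = 0 then 0 else f $ (r - 1) $ q)" for f :: "'s::ring_1 fps fps"
  by simp

text \<open>Here \<open>fps_X\<close> and \<open>Vs\<close> are the variables of the factors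
  themselves. Both parts keep the scalar \<open>Vs - fps_X\<close>, so when the first factor is the
  outer one, the sign of \<open>u - v\<close> moves into the coefficient of
  \<open>P\<close>.\<close>

lemma yang_rel_pos:
  assumes "yang_rel I p (\<lambda>i j. int_pos (a i j)) (\<lambda>i j. int_pos (b i j))"
  shows "rtt I p (Vs - fps_X) 1 (Vs - fps_X) 1 (inner a) (outer b)"
    and "rtt I p (Vs - fps_X) (- 1) (Vs - fps_X) (- 1) (outer a) (inner b)"
proof -
  show "rtt I p (Vs - fps_X) 1 (Vs - fps_X) 1 (inner a) (outer b)"
    unfolding rtt_def
  proof (intro ballI fps_ext)
    fix i j k l r q assume "i \<in> I" "j \<in> I" "k \<in> I" "l \<in> I"
    with assms have "(sg (pp p i j k l) (int_pos (a i j) (int q - 1) * int_pos (b k l) (int r)) - int_pos (b k l) (int r) * int_pos (a i j) (int q - 1))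
     - (sg (pp p i j k l) (int_pos (a i j) (int q) * int_pos (b k l) (int r - 1)) - int_pos (b k l) (int r - 1) * int_pos (a i j) (int q))
     = sg (pt p k j l) (int_pos (a k j) (int q) * int_pos (b i l) (int r) - int_pos (b k j) (int r) * int_pos (a i l) (int q))"
      unfolding yang_rel_def by blast
    then show "((Vs - fps_X) * sg (pp p i j k l) (inner a i j * outer b k l)
	 - 1 * sg (pt p k j l) (inner a k j * outer b i l)) $ r $ q
      = ((Vs - fps_X) * (outer b k l * inner a i j)
	 - 1 * sg (pt p k j l) (outer b k j * inner a i l)) $ r $ q"
      unfolding left_diff_distrib fps_sub_nth Vs_mult_nth Us_mult_nth sg_fps_nth mult_1_left inner_outer_nth outer_inner_nth
      by (auto simp: sg_diff algebra_simps)
  qed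
  show "rtt I p (Vs - fps_X) (- 1) (Vs - fps_X) (- 1) (outer a) (inner b)"
    unfolding rtt_def
  proof (intro ballI fps_ext)
    fix i j k l r q assume "i \<in> I" "j \<in> I" "k \<in> I" "l \<in> I"
    with assms have "(sg (pp p i j k l) (int_pos (a i j) (int r - 1) * int_pos (b k l) (int q)) - int_pos (b k l) (int q) * int_pos (a i j) (int r - 1))
     - (sg (pp p i j k l) (int_pos (a i j) (int r) * int_pos (b k l) (int q - 1)) - int_pos (b k l) (int q - 1) * int_pos (a i j) (int r))
     = sg (pt p k j l) (int_pos (a k j) (int r) * int_pos (b i l) (int q) - int_pos (b k j) (int q) * int_pos (a i l) (int r))"
      unfolding yang_rel_def by blast
    then show "((Vs - fps_X) * sg (pp p i j k l) (outer a i j * inner b k l)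
	 - - 1 * sg (pt p k j l) (outer a k j * inner b i l)) $ r $ q
      = ((Vs - fps_X) * (inner b k l * outer a i j)
	 - - 1 * sg (pt p k j l) (inner b k j * outer a i l)) $ r $ q"
      unfolding left_diff_distrib fps_sub_nth mult_minus_left fps_neg_nth Vs_mult_nth Us_mult_nth sg_fps_nth mult_1_left inner_outer_nth outer_inner_nth
      by (auto simp: sg_diff algebra_simps)
  qed
qed

text \<open>The series run over nonpositive powers, so the formal variables are the inverses of
  \<open>u\<close> and \<open>v\<close>: from \<open>1/X - 1/V = (V - X)/(X V)\<close> the
  denominator is cleared, which puts \<open>X V\<close> in front of \<open>P\<close>. Hence also the
  exponents \<open>1 - int r\<close> and \<open>1 - int q\<close> in the proof.\<close>

lemma yang_rel_neg:
  assumes "yang_rel I p (\<lambda>i j. int_neg (a i j)) (\<lambda>i j. int_neg (b i j))"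
  shows "rtt I p (Vs - fps_X) (fps_X * Vs) (Vs - fps_X) (fps_X * Vs) (outer a) (inner b)"
    and "rtt I p (Vs - fps_X) (- (fps_X * Vs)) (Vs - fps_X) (- (fps_X * Vs)) (inner a) (outer b)"
proof -
  have neg: "1 - int r = - int r + 1" "1 - int r - 1 = - int r" for r by auto
  show "rtt I p (Vs - fps_X) (fps_X * Vs) (Vs - fps_X) (fps_X * Vs) (outer a) (inner b)"
    unfolding rtt_def
  proof (intro ballI fps_ext)
    fix i j k l r q assume "i \<in> I" "j \<in> I" "k \<in> I" "l \<in> I"
    with assms have "(sg (pp p i j k l) (int_neg (a i j) (1 - int r - 1) * int_neg (b k l) (1 - int q)) - int_neg (b k l) (1 - int q) * int_neg (a i j) (1 - int r - 1))
     - (sg (pp p i j k l) (int_neg (a i j) (1 - int r) * int_neg (b k l) (1 - int q - 1)) - int_neg (b k l) (1 - int q - 1) * int_neg (a i j) (1 - int r))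
     = sg (pt p k j l) (int_neg (a k j) (1 - int r) * int_neg (b i l) (1 - int q) - int_neg (b k j) (1 - int q) * int_neg (a i l) (1 - int r))"
      unfolding yang_rel_def by blast
    then show "((Vs - fps_X) * sg (pp p i j k l) (outer a i j * inner b k l)
	 - fps_X * Vs * sg (pt p k j l) (outer a k j * inner b i l)) $ r $ q
      = ((Vs - fps_X) * (inner b k l * outer a i j)
	 - fps_X * Vs * sg (pt p k j l) (inner b k j * outer a i l)) $ r $ q"
      unfolding left_diff_distrib mult.assoc fps_sub_nth Vs_mult_nth Us_mult_nth sg_fps_nth inner_outer_nth outer_inner_nth neg(2) int_neg_simps
      by (auto simp: sg_diff algebra_simps)
  qed
  show "rtt I p (Vs - fps_X) (- (fps_X * Vs)) (Vs - fps_X) (- (fps_X * Vs)) (inner a) (outer b)"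
    unfolding rtt_def
  proof (intro ballI fps_ext)
    fix i j k l r q assume "i \<in> I" "j \<in> I" "k \<in> I" "l \<in> I"
    with assms have "(sg (pp p i j k l) (int_neg (a i j) (1 - int q - 1) * int_neg (b k l) (1 - int r)) - int_neg (b k l) (1 - int r) * int_neg (a i j) (1 - int q - 1))
     - (sg (pp p i j k l) (int_neg (a i j) (1 - int q) * int_neg (b k l) (1 - int r - 1)) - int_neg (b k l) (1 - int r - 1) * int_neg (a i j) (1 - int q))
     = sg (pt p k j l) (int_neg (a k j) (1 - int q) * int_neg (b i l) (1 - int r) - int_neg (b k j) (1 - int r) * int_neg (a i l) (1 - int q))"
      unfolding yang_rel_def by blast
    then show "((Vs - fps_X) * sg (pp p i j k l) (inner a i j * outer b k l)
	 - - (fps_X * Vs) * sg (pt p k j l) (inner a k j * outer b i l)) $ r $ q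
      = ((Vs - fps_X) * (outer b k l * inner a i j)
	 - - (fps_X * Vs) * sg (pt p k j l) (outer b k j * inner a i l)) $ r $ q"
      unfolding left_diff_distrib mult_minus_left mult.assoc fps_sub_nth fps_neg_nth Vs_mult_nth Us_mult_nth sg_fps_nth inner_outer_nth outer_inner_nth neg(2) int_neg_simps
      by (auto simp: sg_diff algebra_simps)
  qed
qed

text \<open>The hypothesis is the relation with \<open>1/(u - v)\<close> expanded, and
  multiplication by \<open>u - v\<close> telescopes it. The length of the sum may depend on the
  entry, so the truncations \<open>Suc M\<close> and \<open>M\<close> of two neighbouring entries
  are compared for a common large \<open>M\<close>.\<close>

lemma yang_relI:
  fixes a b :: "nat => nat => int => 's::ring_1"
  assumes "!!i j k l x y. i \<in> I ==> j \<in> I ==> k \<in> I ==> l \<in> I ==> \<exists>M0. \<forall>M\<ge>M0.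
     sg (pp p i j k l) (a i j x * b k l y) - b k l y * a i j x
     = (\<Sum>d<M. sg (pt p k j l)
	 (a k j (x + 1 + int d) * b i l (y - int d) - b k j (y - int d) * a i l (x + 1 + int d)))"
  shows "yang_rel I p a b"
  unfolding yang_rel_def
proof (intro ballI allI)
  fix i j k l x y assume I: "i \<in> I" "j \<in> I" "k \<in> I" "l \<in> I"
  let ?Y = "\<lambda>x y. sg (pt p k j l) (a k j x * b i l y - b k j y * a i l x)"
  let ?C = "\<lambda>x y. sg (pp p i j k l) (a i j x * b k l y) - b k l y * a i j x"
  obtain M1 M2 where M1: "\<forall>M\<ge>M1. ?C (x - 1) y = (\<Sum>d<M. ?Y (x - 1 + 1 + int d) (y - int d))"
    and M2: "\<forall>M\<ge>M2. ?C x (y - 1) = (\<Sum>d<M. ?Y (x + 1 + int d) (y - 1 - int d))"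
    using assms[OF I, of "x - 1" y] assms[OF I, of x "y - 1"] by blast
  define M where "M = max M1 M2"
  have "?C (x - 1) y = (\<Sum>d<Suc M. ?Y (x + int d) (y - int d))"
    using M1[rule_format, of "Suc M"] by (simp add: M_def)
  also have "\<dots> = ?Y x y + (\<Sum>d<M. ?Y (x + 1 + int d) (y - 1 - int d))"
    by (subst sum.lessThan_Suc_shift) (simp add: algebra_simps)
  also have "(\<Sum>d<M. ?Y (x + 1 + int d) (y - 1 - int d)) = ?C x (y - 1)"
    using M2[rule_format, of M] by (simp add: M_def)
  finally show "?C (x - 1) y - ?C x (y - 1) = ?Y x y" by simp
qed

lemma (in scalar_hom) const_minus_X_power_nth:
  assumes c: "is_central c"
  shows "((fps_const c - fps_X) ^ d) $ b = cs (of_nat (d choose b) * (- 1) ^ b) * c ^ (d - b)"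
proof (induction d arbitrary: b)
  case 0
  show ?case by (cases b) (auto simp: cs_0 cs_1)
next
  case (Suc d)
  have eq: "((fps_const c - fps_X) ^ Suc d) $ b = c * ((fps_const c - fps_X) ^ d) $ b
      - (if b = 0 then 0 else ((fps_const c - fps_X) ^ d) $ (b - 1))"
    by (simp add: left_diff_distrib)
  have shift: "c * (cs x * c ^ k) = cs x * c ^ Suc k" for x k
    using central_left_commute[OF cs_central] by (simp add: mult.assoc)
  show ?case
  proof (cases b)
    case 0
    then show ?thesis unfolding eq Suc.IH shift by simp
  next
    case (Suc b')
    show ?thesis
    proof (cases "b \<le> d")
      case True
      then have "Suc (d - b) = Suc d - b" "d - b' = Suc d - b" using Suc by auto
      then have "((fps_const c - fps_X) ^ Suc d) $ b
	  = (cs (of_nat (d choose b) * (- 1) ^ b) - cs (of_nat (d choose b') * (- 1) ^ b')) * c ^ (Suc d - b)"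
	unfolding eq Suc.IH shift using Suc by (simp only: left_diff_distrib nat.distinct if_False diff_Suc_1)
      also have "cs (of_nat (d choose b) * (- 1) ^ b) - cs (of_nat (d choose b') * (- 1) ^ b')
	  = cs (of_nat (Suc d choose b) * (- 1) ^ b)"
      proof -
	have "cs u - cs v = cs (u - v)" for u v
	  using cs_add[of u "- v"] by (simp add: cs_minus)
	moreover have "of_nat (d choose b) * (- 1) ^ b - of_nat (d choose b') * (- 1) ^ b' = (of_nat (Suc d choose b) * (- 1) ^ b :: complex)"
	  using Suc by (simp add: algebra_simps)
	ultimately show ?thesis by simp
      qed
      finally show ?thesis .
    next
      case False
      then have "d choose b = 0" by (simp add: binomial_eq_0)
      then show ?thesis
	unfolding eq Suc.IH unfolding Suc by (simp add: cs_0 cs_minus binomial_eq_0)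
    qed
  qed
qed

context
  fixes m n :: nat
  assumes mn: "m \<noteq> n"
begin

definition \<eta> :: "free_el => dyp" where
  "\<eta> f = Lm m n (\<lambda>k. f)"

definition e1 :: dyp where
  "e1 = \<eta> 1"

lemma \<eta>_add: "f \<in> freeC m n ==> g \<in> freeC m n ==> \<eta> (f + g) = \<eta> f + \<eta> g"
  by (simp add: \<eta>_def Lm_add[OF mn, symmetric] FC_const)

lemma \<eta>_mult: "f \<in> freeC m n ==> g \<in> freeC m n ==> \<eta> (f * g) = \<eta> f * \<eta> g"
  by (simp add: \<eta>_def Lm_mult[OF mn, symmetric] FC_const)

lemma \<eta>_0: "\<eta> 0 = 0"
  by (simp add: \<eta>_def Lm_0[OF mn])

lemma \<eta>_minus: "f \<in> freeC m n ==> \<eta> (- f) = - \<eta> f"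
  by (simp add: \<eta>_def Lm_minus[OF mn, symmetric] FC_const)

lemma \<eta>_diff: "f \<in> freeC m n ==> g \<in> freeC m n ==> \<eta> (f - g) = \<eta> f - \<eta> g"
  using \<eta>_add[of f "- g"] by (simp add: \<eta>_minus freeC_minus)

lemma \<eta>_sg: "f \<in> freeC m n ==> \<eta> (sg d f) = sg d (\<eta> f)"
  by (simp add: sg_def \<eta>_minus)

lemma \<eta>_sum: "(!!x. x \<in> S ==> f x \<in> freeC m n) ==> \<eta> (sum f S) = (\<Sum>x\<in>S. \<eta> (f x))"
  by (induction S rule: infinite_finite_induct) (auto simp: \<eta>_0 \<eta>_add freeC_sum)

lemma \<eta>_cst: "f \<in> freeC m n ==> \<eta> (cst c * f) = cs_dyp c * \<eta> f"
  by (simp add: \<eta>_def Lm_cst[OF mn, symmetric] FC_const)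

lemma e1_Lm: "f \<in> FC m n ==> e1 * Lm m n f = Lm m n f" "f \<in> FC m n ==> Lm m n f * e1 = Lm m n f"
  by (simp_all add: e1_def \<eta>_def Lm_mult[OF mn, symmetric] FC_const)

lemma e1_\<eta>: "f \<in> freeC m n ==> e1 * \<eta> f = \<eta> f" "f \<in> freeC m n ==> \<eta> f * e1 = \<eta> f"
  unfolding \<eta>_def by (simp_all add: e1_Lm FC_const)

lemma \<eta>_ideal: "f \<in> dy_ideal m n ==> \<eta> f = 0"
  using Lm_eq_iff[OF mn, of "\<lambda>k. f" "\<lambda>k. 0"] dy_ideal_closed[of f m n] Kf_ideal[of f m n]
  by (simp add: \<eta>_def FC_const Lm_0[OF mn] Fnull_def)

lemma \<eta>_central: "modcentral m n f ==> is_central (\<eta> f)"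
  unfolding \<eta>_def by (rule Lm_central[OF mn])

lemma e1_central: "is_central e1"
  unfolding e1_def by (rule \<eta>_central) (use modcentral_cst[of m n 1] in simp)

lemma \<eta>_power: "f \<in> freeC m n ==> \<eta> (f ^ k) = e1 * \<eta> f ^ k"
proof (induction k)
  case 0
  show ?case by (simp add: e1_def)
next
  case (Suc k)
  then show ?case
    using central_left_commute[OF e1_central, of "\<eta> f"] by (simp add: \<eta>_mult freeC_power)
qed

abbreviation I where "I \<equiv> {1..m + n}"
abbreviation pb where "pb \<equiv> pbar m"

definition A where "A i j r = \<eta> (aN m i j r)"
definition B where "B i j q = \<eta> (bN m i j q)"

lemma e1_A: "i \<in> I ==> j \<in> I ==> e1 * A i j r = A i j r" "i \<in> I ==> j \<in> I ==> A i j r * e1 = A i j r"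
  unfolding A_def by (simp_all only: e1_\<eta> aN_closed)

lemma e1_B: "i \<in> I ==> j \<in> I ==> e1 * B i j r = B i j r" "i \<in> I ==> j \<in> I ==> B i j r * e1 = B i j r"
  unfolding B_def by (simp_all only: e1_\<eta> bN_closed)

subsection \<open>The relation between the Yangian and the dual Yangian\<close>

interpretation S: scalar_hom "\<lambda>c. fps_const (cs_dyp c)"
  by unfold_locales
     (simp_all add: dyp.cs_add dyp.cs_mult dyp.cs_1 is_central_fps_const[OF dyp.cs_central])

text \<open>With \<open>v\<close> as inner variable, \<open>u - yy c\<close> is
  \<open>u - v + c C\<close>; the values 1/2 and -1/2 of \<open>c\<close> give the arguments of the
  two R-matrices in the mixed relation.\<close>

definition yy :: "complex => dyp fps" where
  "yy c = fps_X - fps_const (\<eta> (Chalf c))"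

lemma yy_central: "is_central (yy c)"
  unfolding yy_def
  by (intro is_central_diff is_central_fps_X is_central_fps_const \<eta>_central modcentral_Chalf)

text \<open>The prescribed expansion in \<open>v\<close> and \<open>C\<close> is the evaluation of
  \<open>f(u - y)\<close> at \<open>y = v - c C\<close>: both expand the same powers by the binomial
  theorem. The factor \<open>e1\<close> is needed because the empty power of \<open>C\<close> is
  mapped to \<open>e1\<close> and not to 1.\<close>

lemma sdN_image: "\<eta> (sdN f (Chalf c) a b) = e1 * S.fev (yy c) (Sf f) $ a $ b"
proof -
  let ?x = "\<eta> (Chalf c)"
  let ?k = "\<lambda>s. f $ s * ((- of_nat s) gchoose (a - s))"
  have xc: "is_central ?x" by (intro \<eta>_central modcentral_Chalf)
  have t: "e1 * (fps_const (cs_dyp (?k s)) * (- yy c) ^ (a - s)) $ b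
      = (if b \<le> a - s then \<eta> (cst (?k s * of_nat ((a - s) choose b) * (- 1) ^ b) * Chalf c ^ (a - s - b)) else 0)" for s
  proof -
    have "- yy c = fps_const ?x - fps_X" by (simp add: yy_def)
    then have "(fps_const (cs_dyp (?k s)) * (- yy c) ^ (a - s)) $ b
	= cs_dyp (?k s) * (cs_dyp (of_nat ((a - s) choose b) * (- 1) ^ b) * ?x ^ (a - s - b))"
      by (simp add: dyp.const_minus_X_power_nth[OF xc])
    also have "e1 * \<dots> = cs_dyp (?k s * of_nat ((a - s) choose b) * (- 1) ^ b) * (e1 * ?x ^ (a - s - b))"
      by (simp only: central_left_commute[OF dyp.cs_central, of e1] dyp.cs_mult mult.assoc)
    also have "\<dots> = (if b \<le> a - s then \<eta> (cst (?k s * of_nat ((a - s) choose b) * (- 1) ^ b) * Chalf c ^ (a - s - b)) else 0)"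
      by (auto simp: \<eta>_cst \<eta>_power Chalf_closed freeC_power binomial_eq_0 dyp.cs_0)
    finally show ?thesis .
  qed
  have "e1 * S.fev (yy c) (Sf f) $ a $ b = (\<Sum>s\<le>a. e1 * (fps_const (cs_dyp (?k s)) * (- yy c) ^ (a - s)) $ b)"
    unfolding S.fev_nth Sf_nth S.pev_sum S.pev_mult[OF yy_central] S.pev_const S.pev_power[OF yy_central] S.pev_minus S.pev_X
    by (simp add: fps_sum_nth sum_distrib_left)
  also have "\<dots> = (\<Sum>s\<in>{s. s \<le> a \<and> b \<le> a - s}. \<eta> (cst (?k s * of_nat ((a - s) choose b) * (- 1) ^ b) * Chalf c ^ (a - s - b)))"
    unfolding t by (subst sum.inter_filter[symmetric]) (auto intro!: sum.cong)
  also have "\<dots> = \<eta> (sdN f (Chalf c) a b)"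
    unfolding sdN_def sdF_def using Chalf_closed
    by (simp, subst \<eta>_sum) (auto intro!: freeC_mult freeC_power)
  finally show ?thesis ..
qed

lemma fev_nth_nth_central: "is_central (S.fev (yy c) f $ a $ b)"
proof -
  have "is_central (S.fev (yy c) f $ a)"
    unfolding S.fev_nth by (rule S.is_central_pev[OF yy_central])
  then have *: "S.fev (yy c) f $ a * fps_const x = fps_const x * S.fev (yy c) f $ a" for x
    by (simp add: is_central_def)
  show ?thesis
    unfolding is_central_def
  proof
    fix x show "S.fev (yy c) f $ a $ b * x = x * S.fev (yy c) f $ a $ b"
      using arg_cong[OF *[of x], of "\<lambda>h. h $ b"] by simp
  qed
qed

abbreviation "gs \<equiv> g_series m n"

lemma rtt_TT':
  "rtt I pb (S.fev (yy (1/2)) (Sf gs)) (S.fev (yy (1/2)) (Sf (gs * fps_X)))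
	    (S.fev (yy (-1/2)) (Sf gs)) (S.fev (yy (-1/2)) (Sf (gs * fps_X))) (outer A) (inner B)"
  unfolding rtt_def
proof (intro ballI fps_ext)
  fix i j k l r q assume ijkl: "i \<in> I" "j \<in> I" "k \<in> I" "l \<in> I"
  let ?\<sigma> = "pp pb i j k l" and ?\<theta> = "pt pb k j l"
  let ?F = "\<lambda>c f x y. S.fev (yy c) (Sf f) $ x $ y"
  have rng: "in_range4 m n i j k l" using ijkl by (simp add: in_range4_def)
  note cl = aN_closed bN_closed modcentral_sdN[OF modcentral_Chalf, unfolded modcentral_def]
  have sdc: "sdN f (Chalf c) x y \<in> freeC m n" for f c x y
    using modcentral_sdN[OF modcentral_Chalf] by (simp add: modcentral_def)
  have L: "\<eta> (sdN f (Chalf c) x y * aN m u v r' * bN m u' v' q') = ?F c f x y * (A u v r' * B u' v' q')"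
    if "u \<in> I" "v \<in> I" "u' \<in> I" "v' \<in> I" for f c x y u v r' u' v' q'
  proof -
    have "\<eta> (sdN f (Chalf c) x y * aN m u v r' * bN m u' v' q') = e1 * ?F c f x y * A u v r' * B u' v' q'"
      using that sdc by (simp only: \<eta>_mult freeC_mult aN_closed bN_closed sdN_image A_def B_def)
    also have "\<dots> = ?F c f x y * (e1 * A u v r' * B u' v' q')"
      by (simp only: mult.assoc central_left_commute[OF fev_nth_nth_central[of c "Sf f" x y], of e1])
    finally show ?thesis using that by (simp only: e1_A)
  qed
  have R: "\<eta> (bN m u' v' q' * aN m u v r' * sdN f (Chalf c) x y) = ?F c f x y * (B u' v' q' * A u v r')"
    if "u \<in> I" "v \<in> I" "u' \<in> I" "v' \<in> I" for f c x y u v r' u' v' q'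
  proof -
    have "\<eta> (bN m u' v' q' * aN m u v r' * sdN f (Chalf c) x y) = B u' v' q' * A u v r' * (e1 * ?F c f x y)"
      using that sdc by (simp only: \<eta>_mult freeC_mult aN_closed bN_closed sdN_image A_def B_def)
    also have "\<dots> = B u' v' q' * (A u v r' * e1) * ?F c f x y" by (simp add: mult.assoc)
    also have "\<dots> = ?F c f x y * (B u' v' q' * A u v r')"
      using that is_centralD[OF fev_nth_nth_central[of c "Sf f" x y], of "B u' v' q' * A u v r'"] by (simp add: e1_A)
    finally show ?thesis .
  qed
  have term_closed: "TT'_term m gs i j k l r q x y \<in> freeC m n" for x y
    unfolding TT'_term_def using ijkl sdc by (intro freeC_diff freeC_sg freeC_mult aN_closed bN_closed)
  have tm: "\<eta> (TT'_term m gs i j k l r q x y)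
     = (?F (1/2) gs x y * sg ?\<sigma> (A i j (r - x) * B k l (q - y)) - ?F (1/2) (gs * fps_X) x y * sg ?\<theta> (A k j (r - x) * B i l (q - y)))
       - (?F (-1/2) gs x y * (B k l (q - y) * A i j (r - x)) - ?F (-1/2) (gs * fps_X) x y * sg ?\<theta> (B k j (q - y) * A i l (r - x)))" for x y
    unfolding TT'_term_def using ijkl sdc
    by (simp only: \<eta>_diff \<eta>_sg freeC_diff freeC_sg freeC_mult aN_closed bN_closed L R sg_mult_right)
  have "0 = \<eta> (\<Sum>y\<le>q. \<Sum>x\<le>r. TT'_term m gs i j k l r q x y)"
    using \<eta>_ideal[OF TT'_relation[OF rng]] by simp
  also have "\<dots> = (\<Sum>y\<le>q. \<Sum>x\<le>r. \<eta> (TT'_term m gs i j k l r q x y))"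
    by (subst \<eta>_sum, (intro freeC_sum term_closed)[1], intro sum.cong refl, subst \<eta>_sum, (intro term_closed)[1], rule refl)
  finally have rel: "(\<Sum>y\<le>q. \<Sum>x\<le>r. ?F (1/2) gs x y * sg ?\<sigma> (A i j (r - x) * B k l (q - y)) - ?F (1/2) (gs * fps_X) x y * sg ?\<theta> (A k j (r - x) * B i l (q - y)))
     = (\<Sum>y\<le>q. \<Sum>x\<le>r. ?F (-1/2) gs x y * (B k l (q - y) * A i j (r - x)) - ?F (-1/2) (gs * fps_X) x y * sg ?\<theta> (B k j (q - y) * A i l (r - x)))"
    unfolding tm by (simp add: sum_subtractf)
  show "(S.fev (yy (1/2)) (Sf gs) * sg ?\<sigma> (outer A i j * inner B k l)
       - S.fev (yy (1/2)) (Sf (gs * fps_X)) * sg ?\<theta> (outer A k j * inner B i l)) $ r $ q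
    = (S.fev (yy (-1/2)) (Sf gs) * (inner B k l * outer A i j)
       - S.fev (yy (-1/2)) (Sf (gs * fps_X)) * sg ?\<theta> (inner B k j * outer A i l)) $ r $ q"
  proof -
    have "(f * sg d (outer A u v * inner B u' v')) $ r $ q = (\<Sum>y\<le>q. \<Sum>x\<le>r. f $ x $ y * sg d (A u v (r - x) * B u' v' (q - y)))"
      "(f * sg d (inner B u' v' * outer A u v)) $ r $ q = (\<Sum>y\<le>q. \<Sum>x\<le>r. f $ x $ y * sg d (B u' v' (q - y) * A u v (r - x)))"
      "(f * (inner B u' v' * outer A u v)) $ r $ q = (\<Sum>y\<le>q. \<Sum>x\<le>r. f $ x $ y * (B u' v' (q - y) * A u v (r - x)))"
      for f d u v u' v'
      by (simp_all only: fps_fps_mult_nth[of f] sg_fps_nth outer_inner_nth inner_outer_nth)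
    then show ?thesis
      using rel by (simp only: fps_sub_nth sum_subtractf)
  qed
qed

subsection \<open>The relations of the Yangian and of the dual Yangian\<close>

lemma \<eta>_taI: "\<eta> (taI m i j x) = int_neg (A i j) x"
  by (auto simp: taI_def int_neg_def A_def aN_def \<eta>_0)

lemma \<eta>_tbI: "\<eta> (tbI m i j x) = int_pos (B i j) x"
  by (auto simp: tbI_def int_pos_def B_def bN_def \<eta>_0)

text \<open>\<open>1 - P/(u - v)\<close> contributes only at \<open>c = d = 0\<close> and at
  \<open>c = - (d + 1)\<close>. The assumptions \<open>0\<close> and \<open>M\<close> absorb the
  different exponent ranges of the two relations: whatever a range leaves out has coefficient
  zero.\<close>

lemma yang_entry:
  assumes R: "relator_data m n a a (sdF 1 0) (sdF fps_X 0) (sdF 1 0) (sdF fps_X 0) D1 D2"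
    and ideal: "!!i j k l p q. relator_data.relator m n a a (sdF 1 0) (sdF fps_X 0) (sdF 1 0) (sdF fps_X 0) i j k l p q \<in> dy_ideal m n"
    and ijkl: "i \<in> I" "j \<in> I" "k \<in> I" "l \<in> I"
    and 0: "0 \<in> D2 x y \<and> 0 \<in> D1 x 0 \<or> (\<forall>i j. a i j x = 0) \<or> (\<forall>i j. a i j y = 0)"
    and M: "!!d. M \<le> d ==> (\<forall>i j. a i j (x + 1 + int d) = 0) \<or> (\<forall>i j. a i j (y - int d) = 0)"
  shows "sg (pp pb i j k l) (\<eta> (a i j x) * \<eta> (a k l y)) - \<eta> (a k l y) * \<eta> (a i j x)
     = (\<Sum>d<M. sg (pt pb k j l)
	 (\<eta> (a k j (x + 1 + int d)) * \<eta> (a i l (y - int d)) - \<eta> (a k j (y - int d)) * \<eta> (a i l (x + 1 + int d))))"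
proof -
  interpret R: relator_data m n a a "sdF 1 0" "sdF fps_X 0" "sdF 1 0" "sdF fps_X 0" D1 D2 by (rule R)
  let ?\<sigma> = "pp pb i j k l" and ?\<theta> = "pt pb k j l"
  let ?X = "sg ?\<sigma> (a i j x * a k l y) - a k l y * a i j x"
  let ?Y = "\<lambda>x y. sg ?\<theta> (a k j x * a i l y) - sg ?\<theta> (a k j y * a i l x)"
  have rng: "in_range4 m n i j k l" using ijkl by (simp add: in_range4_def)
  note ac = R.a_closed
  have "R.relator i j k l x y = (\<Sum>d\<in>D2 x y. \<Sum>c\<in>D1 x d. (if c = 0 then if d = 0 then ?X else 0 else 0)
      - (if c = - (d + 1) then if 0 \<le> d then ?Y (x + 1 + d) (y - d) else 0 else 0))"
    unfolding R.relator_entry if_P[OF rng]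
  proof (intro sum.cong refl)
    fix d c :: int
    consider "c = 0" "d = 0" | "0 \<le> d" "c = - (d + 1)" | "\<not> (c = 0 \<and> d = 0)" "\<not> (0 \<le> d \<and> c = - (d + 1))" by blast
    then show "sg ?\<sigma> (sdF 1 0 c d * a i j (x - c) * a k l (y - d)) - sg ?\<theta> (sdF fps_X 0 c d * a k j (x - c) * a i l (y - d))
	- (a k l (y - d) * a i j (x - c) * sdF 1 0 c d - sg ?\<theta> (a k j (y - d) * a i l (x - c) * sdF fps_X 0 c d))
      = (if c = 0 then if d = 0 then ?X else 0 else 0)
	- (if c = - (d + 1) then if 0 \<le> d then ?Y (x + 1 + d) (y - d) else 0 else 0)"
    proof cases
      case 2
      then have xc: "x - c = x + 1 + d" and c0: "c \<noteq> 0" by auto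
      have sd: "sdF 1 0 c d = 0" "sdF fps_X 0 c d = 1"
	using 2 c0 by (simp_all add: sdF_one sdF_X)
      show ?thesis unfolding xc sd using c0 2 by simp
    qed (auto simp: sdF_one sdF_X)
  qed
  also have "\<dots> = (\<Sum>d\<in>D2 x y. (if d = 0 then if 0 \<in> D1 x 0 then ?X else 0 else 0))
      - (\<Sum>d\<in>D2 x y. if 0 \<le> d \<and> - (d + 1) \<in> D1 x d then ?Y (x + 1 + d) (y - d) else 0)"
  proof -
    have "(\<Sum>c\<in>D1 x d. if c = 0 then if d = 0 then ?X else 0 else 0) = (if d = 0 then if 0 \<in> D1 x 0 then ?X else 0 else 0)" for d
      using R.finite_D(1) by (auto simp: sum.delta)
    moreover have "(\<Sum>c\<in>D1 x d. if c = - (d + 1) then if 0 \<le> d then ?Y (x + 1 + d) (y - d) else 0 else 0)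
	= (if 0 \<le> d \<and> - (d + 1) \<in> D1 x d then ?Y (x + 1 + d) (y - d) else 0)" for d
      using R.finite_D(1) by (simp only: sum.delta) auto
    ultimately show ?thesis by (simp only: sum_subtractf)
  qed
  also have "(\<Sum>d\<in>D2 x y. (if d = 0 then if 0 \<in> D1 x 0 then ?X else 0 else 0)) = ?X"
  proof -
    have "0 \<in> D2 x y \<and> 0 \<in> D1 x 0 \<or> ?X = 0" using 0 by auto
    then show ?thesis using R.finite_D(2) by (auto simp: sum.delta)
  qed
  also have "(\<Sum>d\<in>D2 x y. if 0 \<le> d \<and> - (d + 1) \<in> D1 x d then ?Y (x + 1 + d) (y - d) else 0)
      = (\<Sum>d<M. ?Y (x + 1 + int d) (y - int d))"
  proof -
    have supp: "d \<in> D2 x y \<and> - (d + 1) \<in> D1 x d \<and> nat d < M" if "0 \<le> d" "?Y (x + 1 + d) (y - d) \<noteq> 0" for d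
    proof -
      have "(\<exists>i j. a i j (x + 1 + d) \<noteq> 0) \<and> (\<exists>i j. a i j (y - d) \<noteq> 0)"
      proof (rule ccontr)
	assume "\<not> ?thesis"
	then have "?Y (x + 1 + d) (y - d) = 0" by auto
	with that(2) show False by contradiction
      qed
      then obtain u v u' v' where uv: "a u v (x + 1 + d) \<noteq> 0" "a u' v' (y - d) \<noteq> 0" by blast
      have x: "x - - (d + 1) = x + 1 + d" by simp
      have s: "sdF fps_X 0 (- (d + 1)) d \<noteq> 0" using that(1) by (simp add: sdF_X)
      have "d \<in> D2 x y" using R.D2[of "- (d + 1)" d u v x u' v' y] s uv x by metis
      moreover have "- (d + 1) \<in> D1 x d" using R.D1[of "- (d + 1)" d u v x] s uv x by metis
      moreover have "nat d < M" using M[of "nat d"] uv that(1) by fastforce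
      ultimately show ?thesis by blast
    qed
    have "(\<Sum>d\<in>D2 x y. if 0 \<le> d \<and> - (d + 1) \<in> D1 x d then ?Y (x + 1 + d) (y - d) else 0)
	= (\<Sum>d\<in>int ` {..<M}. ?Y (x + 1 + d) (y - d))"
      using R.finite_D(2)
    proof (intro sum.mono_neutral_cong)
      fix d assume "d \<in> int ` {..<M} - D2 x y"
      then have "0 \<le> d" "d \<notin> D2 x y" by auto
      then show "?Y (x + 1 + d) (y - d) = 0" using supp[of d] by blast
    next
      fix d assume d: "d \<in> D2 x y - int ` {..<M}"
      show "(if 0 \<le> d \<and> - (d + 1) \<in> D1 x d then ?Y (x + 1 + d) (y - d) else 0) = 0"
      proof (cases "0 \<le> d")
	case True
	then have "nat d < M ==> d \<in> int ` {..<M}" by (intro image_eqI[of _ _ "nat d"]) auto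
	then have "\<not> nat d < M" using d by blast
	then show ?thesis using supp[OF True] by auto
      qed simp
    next
      fix d assume "d \<in> D2 x y \<inter> int ` {..<M}"
      then have "0 \<le> d" by auto
      then show "(if 0 \<le> d \<and> - (d + 1) \<in> D1 x d then ?Y (x + 1 + d) (y - d) else 0) = ?Y (x + 1 + d) (y - d)"
	using supp by auto
    qed auto
    also have "\<dots> = (\<Sum>d<M. ?Y (x + 1 + int d) (y - int d))"
      by (subst sum.reindex) (auto simp: inj_on_def)
    finally show ?thesis .
  qed
  finally have rel: "R.relator i j k l x y = ?X - (\<Sum>d<M. ?Y (x + 1 + int d) (y - int d))" .
  have Yc: "?Y u v \<in> freeC m n" for u v
    using ijkl by (intro freeC_diff freeC_sg freeC_mult ac)
  have Xc: "?X \<in> freeC m n"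
    using ijkl by (intro freeC_diff freeC_sg freeC_mult ac)
  have "\<eta> ?X - (\<Sum>d<M. \<eta> (?Y (x + 1 + int d) (y - int d))) = 0"
    using \<eta>_ideal[OF ideal[of i j k l x y]] unfolding rel
    by (simp only: \<eta>_diff[OF Xc freeC_sum[OF Yc]] \<eta>_sum[OF Yc])
  moreover have "\<eta> ?X = sg ?\<sigma> (\<eta> (a i j x) * \<eta> (a k l y)) - \<eta> (a k l y) * \<eta> (a i j x)"
    using ijkl by (simp only: \<eta>_diff \<eta>_sg \<eta>_mult freeC_diff freeC_sg freeC_mult ac)
  moreover have "\<eta> (?Y u v) = sg ?\<theta> (\<eta> (a k j u) * \<eta> (a i l v) - \<eta> (a k j v) * \<eta> (a i l u))" for u v
    using ijkl by (simp only: \<eta>_diff \<eta>_sg \<eta>_mult freeC_diff freeC_sg freeC_mult ac sg_diff)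
  ultimately show ?thesis by simp
qed

lemma yang_rel_A: "yang_rel I pb (\<lambda>i j. int_neg (A i j)) (\<lambda>i j. int_neg (A i j))"
  unfolding \<eta>_taI[symmetric]
proof (rule yang_relI, intro exI allI impI)
  fix i j k l x y and M :: nat
  assume ijkl: "i \<in> I" "j \<in> I" "k \<in> I" "l \<in> I" and M: "nat (- x) \<le> M"
  show "sg (pp pb i j k l) (\<eta> (taI m i j x) * \<eta> (taI m k l y)) - \<eta> (taI m k l y) * \<eta> (taI m i j x)
     = (\<Sum>d<M. sg (pt pb k j l)
	 (\<eta> (taI m k j (x + 1 + int d)) * \<eta> (taI m i l (y - int d)) - \<eta> (taI m k j (y - int d)) * \<eta> (taI m i l (x + 1 + int d))))"
  proof (rule yang_entry[OF relator_TT rel_in_ideal(1)[unfolded rel_TT_def] ijkl])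
    show "0 \<in> {0..- x} \<and> 0 \<in> {x..0} \<or> (\<forall>i j. taI m i j x = 0) \<or> (\<forall>i j. taI m i j y = 0)"
      by (auto simp: taI_def)
    fix d assume "M \<le> d"
    then have "\<not> x + 1 + int d \<le> 0" using M by linarith
    then show "(\<forall>i j. taI m i j (x + 1 + int d) = 0) \<or> (\<forall>i j. taI m i j (y - int d) = 0)"
      by (simp add: taI_def)
  qed
qed

lemma yang_rel_B: "yang_rel I pb (\<lambda>i j. int_pos (B i j)) (\<lambda>i j. int_pos (B i j))"
  unfolding \<eta>_tbI[symmetric]
proof (rule yang_relI, intro exI allI impI)
  fix i j k l x y and M :: nat
  assume ijkl: "i \<in> I" "j \<in> I" "k \<in> I" "l \<in> I" and M: "nat (y + 1) \<le> M"
  show "sg (pp pb i j k l) (\<eta> (tbI m i j x) * \<eta> (tbI m k l y)) - \<eta> (tbI m k l y) * \<eta> (tbI m i j x)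
     = (\<Sum>d<M. sg (pt pb k j l)
	 (\<eta> (tbI m k j (x + 1 + int d)) * \<eta> (tbI m i l (y - int d)) - \<eta> (tbI m k j (y - int d)) * \<eta> (tbI m i l (x + 1 + int d))))"
  proof (rule yang_entry[OF relator_T'T' rel_in_ideal(2)[unfolded rel_T'T'_def] ijkl])
    have "(0::int) \<in> {- (0 + 1)..0}" by simp
    then show "0 \<in> {0..y} \<and> (0::int) \<in> {- (0 + 1)..0} \<or> (\<forall>i j. tbI m i j x = 0) \<or> (\<forall>i j. tbI m i j y = 0)"
      by (cases "0 \<le> y") (simp_all add: tbI_def)
    fix d assume "M \<le> d"
    then have "\<not> 0 \<le> y - int d" using M by linarith
    then show "(\<forall>i j. tbI m i j (x + 1 + int d) = 0) \<or> (\<forall>i j. tbI m i j (y - int d) = 0)"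
      by (simp add: tbI_def)
  qed
qed

end

section \<open>Shifted series\<close>

lemma Fnull_closed: "F \<in> Fnull m n ==> F k \<in> freeC m n"
  by (simp add: Fnull_def)

lemma FnullD: "F \<in> Fnull m n ==> \<exists>N. \<forall>k\<ge>N. F k \<in> Kf m n p"
  by (simp add: Fnull_def)

lemma FnullI: "(!!k. F k \<in> freeC m n) ==> (!!p. \<exists>N. \<forall>k\<ge>N. F k \<in> Kf m n p) ==> F \<in> Fnull m n"
  by (simp add: Fnull_def)

lemma Fnull_add: "F \<in> Fnull m n ==> G \<in> Fnull m n ==> (\<lambda>k. F k + G k) \<in> Fnull m n"
proof (rule FnullI)
  fix p assume F: "F \<in> Fnull m n" and G: "G \<in> Fnull m n"
  obtain N1 N2 where "\<forall>k\<ge>N1. F k \<in> Kf m n p" "\<forall>k\<ge>N2. G k \<in> Kf m n p"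
    using FnullD[OF F] FnullD[OF G] by blast
  then show "\<exists>N. \<forall>k\<ge>N. F k + G k \<in> Kf m n p"
    by (intro exI[of _ "max N1 N2"]) (auto intro: Kf_add)
qed (auto intro: Fnull_closed)

lemma Fnull_right: "F \<in> Fnull m n ==> c \<in> freeC m n ==> (\<lambda>k. F k * c) \<in> Fnull m n"
proof (rule FnullI)
  fix p assume F: "F \<in> Fnull m n" and c: "c \<in> freeC m n"
  obtain N1 where "\<forall>k\<ge>N1. F k \<in> Kf m n p" using FnullD[OF F] by blast
  then show "\<exists>N. \<forall>k\<ge>N. F k * c \<in> Kf m n p"
    using c by (intro exI[of _ N1]) (auto intro: Kf_right)
qed (auto intro: Fnull_closed)

lemma Fnull_left: "m \<noteq> n ==> F \<in> Fnull m n ==> c \<in> freeC m n ==> (\<lambda>k. c * F k) \<in> Fnull m n"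
proof (rule FnullI)
  fix p assume mn: "m \<noteq> n" and F: "F \<in> Fnull m n" and c: "c \<in> freeC m n"
  obtain q where q: "\<forall>x\<in>Kf m n q. c * x \<in> Kf m n p" using Kf_left_continuous[OF mn c] by blast
  obtain N1 where "\<forall>k\<ge>N1. F k \<in> Kf m n q" using FnullD[OF F] by blast
  then show "\<exists>N. \<forall>k\<ge>N. c * F k \<in> Kf m n p"
    using q by (intro exI[of _ N1]) auto
qed (auto intro: Fnull_closed)

lemma Fnull_shift: "F \<in> Fnull m n ==> (\<lambda>k. if k = 0 then 0 else F (k - 1)) \<in> Fnull m n"
proof (rule FnullI)
  fix p assume F: "F \<in> Fnull m n"
  obtain N1 where "\<forall>k\<ge>N1. F k \<in> Kf m n p" using FnullD[OF F] by blast
  then show "\<exists>N. \<forall>k\<ge>N. (if k = 0 then 0 else F (k - 1)) \<in> Kf m n p"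
    by (intro exI[of _ "Suc N1"]) auto
qed (auto intro: Fnull_closed)

context
  fixes m n :: nat
  assumes mn: "m \<noteq> n"
begin

abbreviation \<kappa>c :: complex where "\<kappa>c \<equiv> of_nat m - of_nat n"

text \<open>By the binomial theorem, the partial sum up to \<open>N\<close> of the coefficient of
  \<open>u^k\<close> in \<open>F(u + \<kappa>)\<close>.\<close>

definition SF :: "nat => (nat => free_el) => nat => free_el" where
  "SF k F N = (\<Sum>s\<in>{k..N}. cst (of_nat (s choose k) * \<kappa>c ^ (s - k)) * F s)"

lemma SF_closed: "(!!s. F s \<in> freeC m n) ==> SF k F N \<in> freeC m n"
  unfolding SF_def by (intro freeC_sum freeC_mult freeC_cst)

lemma SF_FC:
  assumes F: "F \<in> Fnull m n"
  shows "SF k F \<in> FC m n"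
  unfolding FC_def
proof (intro CollectI conjI allI)
  show "SF k F N \<in> freeC m n" for N
    using F by (intro SF_closed Fnull_closed)
  fix p
  obtain N0 where N0: "\<forall>s\<ge>N0. F s \<in> Kf m n p" using FnullD[OF F] by blast
  have *: "SF k F N - SF k F M \<in> Kf m n p" if "N0 \<le> M" "M \<le> N" for M N
  proof -
    have "SF k F N = SF k F M + (\<Sum>s\<in>{k..N} - {k..M}. cst (of_nat (s choose k) * \<kappa>c ^ (s - k)) * F s)"
      unfolding SF_def using that by (subst sum.subset_diff[of "{k..M}"]) (auto simp: add.commute)
    moreover have "(\<Sum>s\<in>{k..N} - {k..M}. cst (of_nat (s choose k) * \<kappa>c ^ (s - k)) * F s) \<in> Kf m n p"
      using that N0 by (intro Kf_sum Kf_modcentral_left modcentral_cst) auto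
    ultimately show ?thesis by simp
  qed
  show "\<exists>N. \<forall>k'\<ge>N. \<forall>l\<ge>N. SF k F k' - SF k F l \<in> Kf m n p"
  proof (intro exI[of _ N0] allI impI)
    fix k' l assume "N0 \<le> k'" "N0 \<le> l"
    then show "SF k F k' - SF k F l \<in> Kf m n p"
      using *[of l k'] Kf_minus[OF *[of k' l]] by (cases "l \<le> k'") auto
  qed
qed

text \<open>
  \<open>f'\<close> is \<open>f\<close> with \<open>u\<close> replaced by \<open>u + \<kappa>\<close>; this converges only if the coefficients of \<open>f\<close> tend to \<open>0\<close>.
\<close>

definition shrel :: "dyp fps => dyp fps => bool" where
  "shrel f f' \<longleftrightarrow> (\<exists>F\<in>Fnull m n. (\<forall>q. f $ q = \<eta> m n (F q)) \<and> (\<forall>k. f' $ k = Lm m n (SF k F)))"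

lemma shrel_0: "shrel 0 0"
  unfolding shrel_def
proof (intro bexI[of _ "\<lambda>_. 0"] conjI allI)
  have "SF k (\<lambda>_. 0) = (\<lambda>_. 0)" for k by (rule ext) (simp add: SF_def)
  then show "(0 :: dyp fps) $ k = Lm m n (SF k (\<lambda>_. 0))" for k by (simp add: Lm_0[OF mn])
qed (auto simp: \<eta>_0[OF mn] Fnull_def Kf_0)

text \<open>\<open>F\<close> is not determined by \<open>f\<close>. But if \<open>f\<close>
  vanishes, every \<open>F q\<close> lies in all terms of the filtration, hence so do the partial
  sums, and the limit is 0. By additivity the shifted series then depends on \<open>f\<close> alone,
  which is \<open>shrel_unique\<close>.\<close>

lemma shrel_0_imp:
  assumes "shrel 0 f'"
  shows "f' = 0"
proof -
  obtain F where F: "F \<in> Fnull m n" "!!q. \<eta> m n (F q) = 0" "!!k. f' $ k = Lm m n (SF k F)"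
    using assms unfolding shrel_def by auto
  have K: "F q \<in> Kf m n p" for p q
  proof -
    have "(\<lambda>k. F q - 0) \<in> Fnull m n"
      using Lm_eq_iff[OF mn, of "\<lambda>_. F q" "\<lambda>_. 0"] F(1) F(2)[of q]
      by (simp add: \<eta>_def[OF mn] Lm_0[OF mn] FC_const Fnull_closed)
    then show ?thesis using FnullD by fastforce
  qed
  have "SF k F N \<in> Kf m n p" for k N p
    unfolding SF_def by (intro Kf_sum Kf_modcentral_left modcentral_cst K)
  then have "(\<lambda>N. SF k F N - 0) \<in> Fnull m n" for k
    using Kf_closed by (intro FnullI) auto
  then have "Lm m n (SF k F) = Lm m n (\<lambda>_. 0)" for k
    using Lm_eq_iff[OF mn SF_FC[OF F(1)] FC_const[OF freeC_0]] by simp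
  then show ?thesis by (intro fps_ext) (simp add: F(3) Lm_0[OF mn])
qed

lemma shrel_add:
  assumes "shrel f f'" "shrel g g'"
  shows "shrel (f + g) (f' + g')"
proof -
  obtain F G where F: "F \<in> Fnull m n" "!!q. f $ q = \<eta> m n (F q)" "!!k. f' $ k = Lm m n (SF k F)"
    and G: "G \<in> Fnull m n" "!!q. g $ q = \<eta> m n (G q)" "!!k. g' $ k = Lm m n (SF k G)"
    using assms unfolding shrel_def by metis
  have S: "SF k (\<lambda>s. F s + G s) = (\<lambda>N. SF k F N + SF k G N)" for k
    by (rule ext) (simp add: SF_def distrib_left sum.distrib)
  show ?thesis
    unfolding shrel_def
    using F G by (intro bexI[of _ "\<lambda>s. F s + G s"])
      (auto simp: S \<eta>_add[OF mn] Fnull_closed Lm_add[OF mn] SF_FC Fnull_add)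
qed

lemma shrel_left:
  assumes "shrel f f'" and c: "c \<in> freeC m n"
  shows "shrel (fps_const (\<eta> m n c) * f) (fps_const (\<eta> m n c) * f')"
proof -
  obtain F where F: "F \<in> Fnull m n" "!!q. f $ q = \<eta> m n (F q)" "!!k. f' $ k = Lm m n (SF k F)"
    using assms unfolding shrel_def by metis
  have S: "SF k (\<lambda>s. c * F s) = (\<lambda>N. c * SF k F N)" for k
  proof
    fix N
    have "cst a * (c * x) = c * (cst a * x)" for a x
      by (metis cst_commute mult.assoc)
    then show "SF k (\<lambda>s. c * F s) N = c * SF k F N"
      by (simp add: SF_def sum_distrib_left)
  qed
  show ?thesis
    unfolding shrel_def
    using F c by (intro bexI[of _ "\<lambda>s. c * F s"])
      (auto simp: S \<eta>_mult[OF mn] Fnull_closed Lm_mult[OF mn] SF_FC Fnull_left[OF mn] FC_const \<eta>_def[OF mn])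
qed

lemma shrel_right:
  assumes "shrel f f'" and c: "c \<in> freeC m n"
  shows "shrel (f * fps_const (\<eta> m n c)) (f' * fps_const (\<eta> m n c))"
proof -
  obtain F where F: "F \<in> Fnull m n" "!!q. f $ q = \<eta> m n (F q)" "!!k. f' $ k = Lm m n (SF k F)"
    using assms unfolding shrel_def by metis
  have S: "SF k (\<lambda>s. F s * c) = (\<lambda>N. SF k F N * c)" for k
    by (rule ext) (simp add: SF_def sum_distrib_right mult.assoc)
  show ?thesis
    unfolding shrel_def
    using F c by (intro bexI[of _ "\<lambda>s. F s * c"])
      (auto simp: S \<eta>_mult[OF mn] Fnull_closed Lm_mult[OF mn] SF_FC Fnull_right FC_const \<eta>_def[OF mn])
qed

lemma shrel_cs:
  assumes "shrel f f'"
  shows "shrel (fps_const (cs_dyp c) * f) (fps_const (cs_dyp c) * f')"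
proof -
  obtain F where F: "F \<in> Fnull m n" "!!q. f $ q = \<eta> m n (F q)" "!!k. f' $ k = Lm m n (SF k F)"
    using assms unfolding shrel_def by metis
  have S: "SF k (\<lambda>s. cst c * F s) = (\<lambda>N. cst c * SF k F N)" for k
    by (rule ext) (simp add: SF_def sum_distrib_left mult_single mult.commute flip: mult.assoc)
  show ?thesis
    unfolding shrel_def
    using F by (intro bexI[of _ "\<lambda>s. cst c * F s"])
      (auto simp: S \<eta>_cst[OF mn] Fnull_closed Lm_cst[OF mn] SF_FC Fnull_left[OF mn])
qed

lemma shrel_minus: "shrel f f' ==> shrel (- f) (- f')"
  using shrel_cs[of f f' "- 1"] by (simp add: dyp.cs_minus dyp.cs_1 flip: fps_const_neg)

lemma shrel_diff: "shrel f f' ==> shrel g g' ==> shrel (f - g) (f' - g')"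
  using shrel_add[OF _ shrel_minus, of f f' g g'] by simp

lemma shrel_sg: "shrel f f' ==> shrel (sg d f) (sg d f')"
  by (simp add: sg_def shrel_minus)

lemma shrel_sum: "(!!x. x \<in> S ==> shrel (f x) (f' x)) ==> shrel (sum f S) (sum f' S)"
  by (induction S rule: infinite_finite_induct) (auto intro: shrel_0 shrel_add)

lemma shrel_unique: "shrel f f' ==> shrel f f'' ==> f' = f''"
  using shrel_0_imp[of "f' - f''"] shrel_diff[of f f' f f''] by simp

text \<open>Pascal's rule turns the substitution \<open>u \<mapsto> u + \<kappa>\<close> in \<open>u f(u)\<close> into \<open>(u + \<kappa>) f(u + \<kappa>)\<close>.\<close>

lemma shrel_X:
  assumes "shrel f f'"
  shows "shrel (fps_X * f) ((fps_X + fps_const (cs_dyp \<kappa>c)) * f')"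
proof -
  obtain F where F: "F \<in> Fnull m n" "!!q. f $ q = \<eta> m n (F q)" "!!k. f' $ k = Lm m n (SF k F)"
    using assms unfolding shrel_def by metis
  define G where "G s = (if s = 0 then 0 else F (s - 1))" for s
  have G: "G \<in> Fnull m n" using Fnull_shift[OF F(1)] by (simp add: G_def[abs_def])
  have Gc: "G s \<in> freeC m n" and Fc: "F s \<in> freeC m n" for s
    using Fnull_closed[OF G] Fnull_closed[OF F(1)] by auto
  let ?c = "\<lambda>k s. of_nat (s choose k) * \<kappa>c ^ (s - k)"
  let ?H = "\<lambda>k N. (if k = 0 then 0 else SF (k - 1) F N) + cst \<kappa>c * SF k F N"
  have HFC: "?H k \<in> FC m n" for k
    using FC_mult[OF mn FC_const[OF freeC_cst[of \<kappa>c]] SF_FC[OF F(1), of k]] SF_FC[OF F(1), of "k - 1"] FC_const[OF freeC_0]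
    by (cases "k = 0") (auto intro!: FC_add[OF mn])
  \<comment> \<open>At a finite stage the index shift leaves one boundary term, a scalar multiple of
    \<open>F N\<close>, which tends to 0.\<close>
  have diff: "?H k N - SF k G N \<in> Kf m n p" if "F N \<in> Kf m n p" "k \<le> N" for k N p
  proof -
    have Gs: "SF k G N = (\<Sum>s<N. (if k \<le> Suc s then cst (?c k (Suc s)) * F s else 0))" if "k \<le> N" for N
    proof -
      have "SF k G N = (\<Sum>s\<in>{0..N}. if k \<le> s then cst (?c k s) * G s else 0)"
	unfolding SF_def by (rule sum.mono_neutral_cong_left) auto
      also have "\<dots> = (\<Sum>s<N. if k \<le> Suc s then cst (?c k (Suc s)) * G (Suc s) else 0)"
      proof (cases N)
	case (Suc N')
	show ?thesis
	  unfolding Suc sum.atLeast0_atMost_Suc_shift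
	  by (simp add: G_def lessThan_Suc_atMost atLeast0AtMost del: sum.lessThan_Suc sum.atMost_Suc)
      next
	case 0
	have "G 0 = 0" by (simp add: G_def)
	then show ?thesis unfolding 0 atLeastAtMost_singleton by simp
      qed
      finally show ?thesis by (simp add: G_def cong: if_cong)
    qed
    have Fs: "SF k' F N = (\<Sum>s<N. (if k' \<le> s then cst (?c k' s) * F s else 0)) + (if k' \<le> N then cst (?c k' N) * F N else 0)" for k'
    proof -
      have "SF k' F N = (\<Sum>s\<in>{..N}. if k' \<le> s then cst (?c k' s) * F s else 0)"
	unfolding SF_def by (rule sum.mono_neutral_cong_left) auto
      then show ?thesis by (simp add: lessThan_Suc_atMost[symmetric])
    qed
    have pascal: "(if k = 0 then 0 else if k - 1 \<le> s then cst (?c (k - 1) s) * F s else 0)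
	+ cst \<kappa>c * (if k \<le> s then cst (?c k s) * F s else 0) = (if k \<le> Suc s then cst (?c k (Suc s)) * F s else 0)" for s
    proof (cases k)
      case 0
      then show ?thesis by (simp add: mult_single flip: mult.assoc)
    next
      case (Suc k')
      consider "k' < s" | "k' = s" | "s < k'" by linarith
      then show ?thesis
      proof cases
	case 1
	then have "s - k' = Suc (s - Suc k')" by simp
	then have "?c k' s + \<kappa>c * ?c (Suc k') s = ?c (Suc k') (Suc s)"
	  by (simp add: algebra_simps)
	then have "cst (?c k' s) * F s + cst (\<kappa>c * ?c (Suc k') s) * F s = cst (?c (Suc k') (Suc s)) * F s"
	  by (simp only: single_add[symmetric] distrib_right[symmetric])
	then show ?thesis using 1 Suc by (simp add: mult_single flip: mult.assoc)
      qed (use Suc in auto)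
    qed
    have "(if k = 0 then 0 else SF (k - 1) F N) + cst \<kappa>c * SF k F N
       = (\<Sum>s<N. (if k = 0 then 0 else if k - 1 \<le> s then cst (?c (k - 1) s) * F s else 0)
	  + cst \<kappa>c * (if k \<le> s then cst (?c k s) * F s else 0))
	+ ((if k = 0 then 0 else if k - 1 \<le> N then cst (?c (k - 1) N) * F N else 0) + cst \<kappa>c * (if k \<le> N then cst (?c k N) * F N else 0))"
      unfolding Fs by (cases "k = 0") (simp_all add: sum.distrib sum_distrib_left algebra_simps)
    also have "\<dots> = SF k G N + (if k \<le> Suc N then cst (?c k (Suc N)) * F N else 0)"
      unfolding pascal Gs[OF that(2)] ..
    finally show ?thesis
      using that by (auto intro!: Kf_modcentral_left modcentral_cst simp: Kf_0)
  qed
  have "Lm m n (SF k G) = Lm m n (?H k)" for k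
  proof -
    have "(\<lambda>N. ?H k N - SF k G N) \<in> Fnull m n"
    proof (rule FnullI)
      show "?H k N - SF k G N \<in> freeC m n" for N
	using FC_closed[OF HFC] FC_closed[OF SF_FC[OF G]] by (intro freeC_diff) blast+
      fix p
      obtain N0 where "\<forall>s\<ge>N0. F s \<in> Kf m n p" using FnullD[OF F(1)] by blast
      then show "\<exists>N0. \<forall>N\<ge>N0. ?H k N - SF k G N \<in> Kf m n p"
	by (intro exI[of _ "max N0 k"] allI impI diff) auto
    qed
    then show ?thesis by (rule Lm_eq_iff[OF mn HFC SF_FC[OF G], THEN iffD2, symmetric])
  qed
  moreover have "Lm m n (?H k) = (if k = 0 then 0 else f' $ (k - 1)) + cs_dyp \<kappa>c * f' $ k" for k
    using SF_FC[OF F(1)] FC_mult[OF mn FC_const[OF freeC_cst[of \<kappa>c]] SF_FC[OF F(1), of k]] FC_const[OF freeC_0]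
    by (subst Lm_add[OF mn]; cases "k = 0") (auto simp: F(3) Lm_cst[OF mn] Lm_0[OF mn])
  ultimately show ?thesis
    unfolding shrel_def
    by (intro bexI[OF _ G]) (auto simp: G_def F(2) \<eta>_0[OF mn] distrib_right)
qed

interpretation S: scalar_hom "\<lambda>c. fps_const (cs_dyp c)"
  by unfold_locales
     (simp_all add: dyp.cs_add dyp.cs_mult dyp.cs_1 is_central_fps_const[OF dyp.cs_central])

lemma shrel_yy:
  assumes "shrel f f'"
  shows "shrel (yy m n c * f) ((yy m n c + fps_const (cs_dyp \<kappa>c)) * f')"
  using shrel_diff[OF shrel_X[OF assms] shrel_left[OF assms Chalf_closed[of c m n]]]
  by (simp add: yy_def[OF mn] algebra_simps)

text \<open>The coefficients of the R-matrix are polynomials in \<open>yy\<close>, so they move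
  along with the shift; Horner's scheme reduces this to \<open>shrel_yy\<close>.\<close>

lemma shrel_pev:
  assumes f: "shrel f f'"
  shows "shrel (S.pev (yy m n c) p * f) (S.pev (yy m n c + fps_const (cs_dyp \<kappa>c)) p * f')"
proof (induction p)
  case 0
  show ?case by (simp add: shrel_0)
next
  case (pCons a p)
  have y: "is_central (yy m n c)" "is_central (yy m n c + fps_const (cs_dyp \<kappa>c))"
    by (intro is_central_plus yy_central[OF mn] S.cs_central)+
  show ?case
    unfolding S.pev_pCons[OF y(1)] S.pev_pCons[OF y(2)] distrib_right mult.assoc
    unfolding distrib_right[symmetric]
    by (intro shrel_add shrel_cs f shrel_yy pCons.IH)
qed

text \<open>The coefficient of \<open>u^q\<close> in \<open>T\<^sup>+\<close> is a generator of
  degree \<open>q + 1\<close>, apart from the constant 1 at \<open>q = 0\<close>, which the bound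
  \<open>Suc p \<le> q\<close> avoids.\<close>

lemma bN_null: "i \<in> {1..m+n} ==> j \<in> {1..m+n} ==> bN m i j \<in> Fnull m n"
proof (rule FnullI)
  assume ij: "i \<in> {1..m+n}" "j \<in> {1..m+n}"
  show "bN m i j k \<in> freeC m n" for k using ij by (rule bN_closed)
  fix p
  have "bN m i j q \<in> Kf m n p" if "Suc p \<le> q" for q
  proof -
    have "gen_el (TMinusGen i j (Suc q)) * 1 \<in> Kf m n (Suc q + 0)"
      by (rule Kf_minus_gen[OF ij]) (auto intro: Kf_all)
    then have "gen_el (TMinusGen i j (Suc q)) \<in> Kf m n p"
      using that Kf_mono[of p "Suc q"] by simp
    then show ?thesis using that by (auto simp: bN_def tpF_def intro!: Kf_sg Kf_minus)
  qed
  then show "\<exists>N. \<forall>k\<ge>N. bN m i j k \<in> Kf m n p" by blast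
qed

definition Bsh :: "nat => nat => nat => dyp" where
  "Bsh i j k = Lm m n (SF k (bN m i j))"

lemma shrel_B:
  assumes "i \<in> {1..m+n}" "j \<in> {1..m+n}"
  shows "shrel (Abs_fps (B m n i j)) (Abs_fps (Bsh i j))"
  unfolding shrel_def using bN_null[OF assms]
  by (intro bexI[of _ "bN m i j"]) (auto simp: B_def[OF mn] Bsh_def)

end

section \<open>Contractions commute with the generators\<close>

definition gr_inverse :: "nat set => (nat => nat) => 'r => (nat => nat => 'r::ring_1) => (nat => nat => 'r) => bool" where
  "gr_inverse K p e a s \<longleftrightarrow> (\<forall>k\<in>K. \<forall>l\<in>K.
     (\<Sum>q\<in>K. sg (pp p q l k q) (a k q * s q l)) = (if k = l then e else 0) \<and>
     (\<Sum>q\<in>K. sg (pp p q l k q) (s k q * a q l)) = (if k = l then e else 0))"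

text \<open>The entrywise form of the equation of \<open>z\<close>, with \<open>a\<close> the
  shifted matrix and \<open>s\<close> the inverse of the unshifted one. Because of the transposition
  a row index of \<open>a\<close> is paired with a column index of \<open>s\<close>, so this is not
  a matrix product.\<close>

definition contracts :: "nat set => (nat => nat => 'r::ring_1) => (nat => nat => 'r) => 'r => bool" where
  "contracts K a s z \<longleftrightarrow> (\<forall>j\<in>K. \<forall>l\<in>K. (\<Sum>q\<in>K. a q j * s l q) = (if j = l then z else 0))"

locale rng_hom =
  fixes h :: "'r::ring_1 => 's::ring_1"
  assumes h_add: "h (x + y) = h x + h y"
    and h_mult: "h (x * y) = h x * h y"
begin

lemma h_0: "h 0 = 0"
  using h_add[of 0 0] by simp

lemma h_minus: "h (- x) = - h x"
  using h_add[of x "- x"] by (simp add: h_0 eq_neg_iff_add_eq_0 add.commute)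

lemma h_diff: "h (x - y) = h x - h y"
  using h_add[of x "- y"] by (simp add: h_minus)

lemma h_sg: "h (sg d x) = sg d (h x)"
  by (simp add: sg_def h_minus)

lemma h_sum: "h (sum f S) = (\<Sum>x\<in>S. h (f x))"
  by (induction S rule: infinite_finite_induct) (simp_all add: h_0 h_add)

lemma gr_inverse_hom:
  assumes "gr_inverse K p e a s"
  shows "gr_inverse K p (h e) (\<lambda>i j. h (a i j)) (\<lambda>i j. h (s i j))"
proof -
  have "(\<Sum>q\<in>K. sg (pp p q l k q) (h (a k q) * h (s q l))) = (if k = l then h e else 0) \<and>
     (\<Sum>q\<in>K. sg (pp p q l k q) (h (s k q) * h (a q l))) = (if k = l then h e else 0)"
    if "k \<in> K" "l \<in> K" for k l
  proof -
    have "(\<Sum>q\<in>K. sg (pp p q l k q) (h (a k q) * h (s q l))) = h (\<Sum>q\<in>K. sg (pp p q l k q) (a k q * s q l))"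
      "(\<Sum>q\<in>K. sg (pp p q l k q) (h (s k q) * h (a q l))) = h (\<Sum>q\<in>K. sg (pp p q l k q) (s k q * a q l))"
      by (simp_all only: h_sum h_sg h_mult)
    then show ?thesis
      using assms that unfolding gr_inverse_def by (simp add: h_0)
  qed
  then show ?thesis unfolding gr_inverse_def by blast
qed

lemma contracts_hom:
  assumes "contracts K a s z"
  shows "contracts K (\<lambda>i j. h (a i j)) (\<lambda>i j. h (s i j)) (h z)"
proof -
  have "(\<Sum>q\<in>K. h (a q j) * h (s l q)) = (if j = l then h z else 0)" if "j \<in> K" "l \<in> K" for j l
  proof -
    have "(\<Sum>q\<in>K. h (a q j) * h (s l q)) = h (\<Sum>q\<in>K. a q j * s l q)"
      by (simp only: h_sum h_mult)
    then show ?thesis using assms that unfolding contracts_def by (simp add: h_0)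
  qed
  then show ?thesis unfolding contracts_def by blast
qed

lemma rtt_hom:
  assumes "rtt K p \<alpha>p \<beta>p \<alpha>m \<beta>m a b"
  shows "rtt K p (h \<alpha>p) (h \<beta>p) (h \<alpha>m) (h \<beta>m) (\<lambda>i j. h (a i j)) (\<lambda>i j. h (b i j))"
  unfolding rtt_def
proof (intro ballI)
  fix i j k l assume "i \<in> K" "j \<in> K" "k \<in> K" "l \<in> K"
  from arg_cong[OF rttD[OF assms this], of h]
  show "h \<alpha>p * sg (pp p i j k l) (h (a i j) * h (b k l))
       - h \<beta>p * sg (pt p k j l) (h (a k j) * h (b i l))
     = h \<alpha>m * (h (b k l) * h (a i j)) - h \<beta>m * sg (pt p k j l) (h (b k j) * h (a i l))"
    by (simp only: h_diff h_mult h_sg)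
qed

end

lemma rtt_scale:
  assumes "rtt K p \<alpha>p \<beta>p \<alpha>m \<beta>m a b"
  shows "rtt K p (c * \<alpha>p) (c * \<beta>p) (c * \<alpha>m) (c * \<beta>m) a b"
  unfolding rtt_def
proof (intro ballI)
  fix i j k l assume "i \<in> K" "j \<in> K" "k \<in> K" "l \<in> K"
  from arg_cong[OF rttD[OF assms this], of "(*) c"]
  show "c * \<alpha>p * sg (pp p i j k l) (a i j * b k l)
       - c * \<beta>p * sg (pt p k j l) (a k j * b i l)
     = c * \<alpha>m * (b k l * a i j) - c * \<beta>m * sg (pt p k j l) (b k j * a i l)"
    by (simp only: right_diff_distrib mult.assoc)
qed

lemma rtt_inverseI:
  assumes "rtt K p \<gamma>p (- \<delta>p) \<gamma>m (- \<delta>m) b a" "gr_inverse K p e a s" "finite K"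
    and "is_central \<gamma>p" "is_central \<delta>p" "is_central \<gamma>m" "is_central \<delta>m"
    and "!!i j. i \<in> K ==> j \<in> K ==> e * b i j = b i j \<and> b i j * e = b i j"
  shows "rtt_inverse K p \<gamma>p \<delta>p \<gamma>m \<delta>m e a b s"
  using assms unfolding gr_inverse_def rtt_inverse_def by blast

definition outer_emb :: "'s::ring_1 fps => 's fps fps" where
  "outer_emb f = Abs_fps (\<lambda>r. fps_const (f $ r))"

lemma outer_eq: "outer x i j = outer_emb (Abs_fps (x i j))"
  by (simp add: outer_def outer_emb_def)

lemma fps_const_sum': "fps_const (sum f S) = (\<Sum>x\<in>S. fps_const (f x))"
  by (rule fps_ext) (simp add: fps_sum_nth)

interpretation outer_emb: rng_hom outer_emb
proof
  show "outer_emb (f * g) = outer_emb f * outer_emb g" for f g :: "'a fps"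
    by (rule fps_ext) (simp add: outer_emb_def fps_mult_nth fps_const_sum')
qed (rule fps_ext, simp add: outer_emb_def)

interpretation fps_const: rng_hom fps_const
  by standard simp_all

lemma outer_emb_const: "outer_emb (fps_const c) = fps_const (fps_const c)"
  by (rule fps_ext) (simp add: outer_emb_def)

text \<open>The coefficients satisfy \<open>c * f $ r = d * f $ (r - 1)\<close>, so regularity of
  the lowest coefficient propagates. The ring \<open>dyp\<close> has zero divisors, so cancelling a
  scalar series needs such a criterion.\<close>

lemma fps_linear_regular:
  fixes f :: "'r::ring_1 fps"
  assumes c: "!!x. c * x = 0 ==> x = 0" and f: "(fps_const c - fps_X * fps_const d) * f = 0"
  shows "f = 0"
proof (rule fps_ext)
  fix r
  have eq: "c * f $ r = (if r = 0 then 0 else d * f $ (r - 1))" for r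
    using arg_cong[OF f, of "\<lambda>h. h $ r"] by (simp add: left_diff_distrib mult.assoc)
  show "f $ r = 0 $ r"
    by (induction r) (use c eq in \<open>auto simp del: mult_eq_0_iff\<close>)
qed

lemma mult_mult_diff_eq_0: "a * b * x = a * b * y ==> a * (b * (x - y)) = (0 :: 'r::ring_1)"
  by (simp add: mult.assoc right_diff_distrib)

lemma fps_X_regular: "fps_X * x = 0 ==> x = (0 :: 'r::ring_1 fps)"
proof (rule fps_ext)
  fix n assume "fps_X * x = 0"
  from arg_cong[OF this, of "\<lambda>h. h $ Suc n"] show "x $ n = 0 $ n" by simp
qed

lemma sum_sg_pbar: "(\<Sum>i\<in>{1..m + n}. sg (pbar m i) (1 :: 'r::ring_1)) = of_nat m - of_nat n"
proof -
  have "(\<Sum>i\<in>{1..m + n}. sg (pbar m i) (1 :: 'r)) = (\<Sum>i\<in>{1..m}. sg (pbar m i) 1) + (\<Sum>i\<in>{m + 1..m + n}. sg (pbar m i) 1)"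
    by (subst sum.union_disjoint[symmetric]) (auto intro: sum.cong)
  then show ?thesis by (simp add: pbar_def sg_def)
qed

lemma (in scalar_hom) cs_of_nat: "cs (of_nat k) = of_nat k"
  by (induction k) (simp_all add: cs_0 cs_1 cs_add)

lemma (in scalar_hom) cs_regular: "c \<noteq> 0 ==> cs c * x = 0 ==> x = 0"
proof -
  assume "c \<noteq> 0" "cs c * x = 0"
  then have "cs (inverse c * c) * x = 0" by (simp only: cs_mult mult.assoc mult_zero_right)
  then show "x = 0" using \<open>c \<noteq> 0\<close> by (simp add: cs_1)
qed

context
  fixes m n :: nat
  assumes mn: "m \<noteq> n"
begin

abbreviation \<kappa>d :: complex where "\<kappa>d \<equiv> of_nat m - of_nat n"
abbreviation Ix where "Ix \<equiv> {1..m + n}"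
abbreviation px where "px \<equiv> pbar m"
abbreviation "gx \<equiv> g_series m n"
abbreviation "\<phi> \<equiv> shift_fps \<kappa>d"
abbreviation "a1 i j \<equiv> Abs_fps (A m n i j)"
abbreviation "b1 i j \<equiv> Abs_fps (B m n i j)"
abbreviation "E2 \<equiv> fps_const (fps_const (e1 m n))"

interpretation S: scalar_hom "\<lambda>c. fps_const (cs_dyp c)"
  by unfold_locales
     (simp_all add: dyp.cs_add dyp.cs_mult dyp.cs_1 is_central_fps_const[OF dyp.cs_central])

interpretation S2: scalar_hom "\<lambda>c. fps_const (fps_const (cs_dyp c))"
  by unfold_locales
     (simp_all add: S.cs_add S.cs_mult S.cs_1 is_central_fps_const[OF S.cs_central])

lemma \<kappa>_sum: "fps_const (fps_const (cs_dyp \<kappa>d)) = (\<Sum>i\<in>Ix. sg (px i) 1)"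
  unfolding sum_sg_pbar using S2.cs_add[of "of_nat m" "- of_nat n"]
  by (simp add: S2.cs_minus S2.cs_of_nat)

lemma \<kappa>d: "\<kappa>d \<noteq> 0"
  using mn by simp

text \<open>For \<open>\<alpha> = g(w)\<close> and \<open>\<beta> = g(w)/w\<close> the difference of
  the squares is \<open>g(w)^2 (1 - w^(-2))\<close>, whose inverse \<open>rtt_dual\<close> asks for.
  The functional equation then makes \<open>g\<mu> * gx\<close> the inverse of
  \<open>g(w + \<kappa>)\<close>.\<close>

definition g\<mu> :: "complex fps" where
  "g\<mu> = inverse (gx * gx * (1 - fps_X\<^sup>2))"

lemma g\<mu>: "g\<mu> * (gx * gx * (1 - fps_X\<^sup>2)) = 1"
  unfolding g\<mu>_def using g_series_spec(1)[OF mn] by (intro inverse_mult_eq_1) simp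

lemma g\<mu>': "g\<mu> * (gx * gx - (gx * fps_X) * (gx * fps_X)) = 1"
  using g\<mu> by (simp add: algebra_simps power2_eq_square)

lemma g\<mu>'': "(gx oo \<phi>) * (g\<mu> * gx) = 1"
  using g\<mu> unfolding g_series_spec(2)[OF mn] by (simp add: ac_simps)

lemma \<phi>: "\<phi> * (1 + fps_const \<kappa>d * fps_X) = fps_X"
  by (rule shift_fps_mult)

lemma gX_compose: "(gx * fps_X) oo \<phi> = (gx oo \<phi>) * \<phi>"
  by (simp add: fps_compose_mult_distrib)

definition F :: "dyp fps => complex fps => dyp fps fps" where
  "F y f = S.fev y (Sf f)"

lemma F_simps:
  assumes "is_central y"
  shows "F y f * F y g = F y (f * g)" "F y f + F y g = F y (f + g)" "- F y f = F y (- f)" "F y 1 = 1"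
    "fps_const (fps_const (cs_dyp c)) * F y f = F y (fps_const c * f)"
proof -
  have "Sf (- f) = - Sf f" using Sf_diff[of 0 f] Sf_diff[of 0 0] by simp
  then show "F y f * F y g = F y (f * g)" "F y f + F y g = F y (f + g)" "- F y f = F y (- f)" "F y 1 = 1"
    "fps_const (fps_const (cs_dyp c)) * F y f = F y (fps_const c * f)"
    using assms by (simp_all add: F_def Sf_mult Sf_add Sf_1 Sf_const S.fev_mult S.fev_add S.fev_minus S.fev_1 S.fev_const)
qed

lemma F_diff: "is_central y ==> F y f - F y g = F y (f - g)"
  by (simp only: diff_conv_add_uminus[of "F y f"] diff_conv_add_uminus[of f] F_simps)

lemma F_central: "is_central y ==> is_central (F y f)"
  unfolding F_def by (rule S.is_central_fev)

abbreviation "yp \<equiv> yy m n (1/2)"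
abbreviation "ym \<equiv> yy m n (-1/2)"
lemmas y_central = yy_central[OF mn, of "1/2"] yy_central[OF mn, of "-1/2"]
lemmas Fc = F_central[OF y_central(1)] F_central[OF y_central(2)]

lemma rtt_AB: "rtt Ix px (F yp gx) (F yp (gx * fps_X)) (F ym gx) (F ym (gx * fps_X)) (outer (A m n)) (inner (B m n))"
  unfolding F_def by (rule rtt_TT'[OF mn])

lemma rtt_BA: "rtt Ix px (F yp (g\<mu> * gx)) (- F yp (g\<mu> * (gx * fps_X))) (F ym (g\<mu> * gx)) (- F ym (g\<mu> * (gx * fps_X)))
    (inner (B m n)) (outer (A m n))"
proof -
  have "F y g\<mu> * (F y gx * F y gx - F y (gx * fps_X) * F y (gx * fps_X)) = 1" if "is_central y" for y
    unfolding F_simps(1)[OF that] F_diff[OF that] g\<mu>' F_simps(4)[OF that] ..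
  from rtt_dual[OF rtt_AB Fc(1) Fc(1) Fc(2) Fc(2) Fc(1) Fc(2) this[OF y_central(1)] this[OF y_central(2)]]
  show ?thesis unfolding F_simps(1)[OF y_central(1)] F_simps(1)[OF y_central(2)] .
qed

lemma e1_inner_A: "k \<in> Ix ==> l \<in> Ix ==> E2 * inner (A m n) k l = inner (A m n) k l \<and> inner (A m n) k l * E2 = inner (A m n) k l"
  unfolding inner_def using e1_A[OF mn] by (auto intro!: arg_cong[of _ _ fps_const] fps_ext)

lemma e1_inner_B: "k \<in> Ix ==> l \<in> Ix ==> E2 * inner (B m n) k l = inner (B m n) k l \<and> inner (B m n) k l * E2 = inner (B m n) k l"
  unfolding inner_def using e1_B[OF mn] by (auto intro!: arg_cong[of _ _ fps_const] fps_ext)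

lemma e1_outer_A: "k \<in> Ix ==> l \<in> Ix ==> E2 * outer (A m n) k l = outer (A m n) k l \<and> outer (A m n) k l * E2 = outer (A m n) k l"
  unfolding outer_def using e1_A[OF mn] by (auto intro!: fps_ext)

lemma e1_outer_B: "k \<in> Ix ==> l \<in> Ix ==> E2 * outer (B m n) k l = outer (B m n) k l \<and> outer (B m n) k l * E2 = outer (B m n) k l"
  unfolding outer_def using e1_B[OF mn] by (auto intro!: fps_ext)

lemma VX_central: "is_central (Vs - fps_X :: dyp fps fps)" "is_central (fps_X * Vs :: dyp fps fps)" "is_central (1 :: dyp fps fps)"
  by (intro is_central_diff is_central_mult is_central_fps_const is_central_fps_X is_central_1)+

lemma VX_regular: "(Vs - fps_X) * f = 0 ==> f = (0 :: dyp fps fps)"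
  by (rule fps_linear_regular[where c=fps_X and d=1]) (simp_all add: fps_X_regular)

context
  fixes s :: "nat => nat => dyp fps" and z :: "dyp fps"
  assumes inv: "gr_inverse Ix px (fps_const (e1 m n)) a1 s"
    and contr: "contracts Ix (\<lambda>i j. dyp.shU \<kappa>d (a1 i j)) s z"
begin

lemma shU_outer_emb: "S.shU c (outer_emb f) = outer_emb (dyp.shU c f)"
  by (intro fps_ext) (simp add: S.shU_def dyp.shU_def outer_emb_def fps_sum_nth)

lemma inv_A: "gr_inverse Ix px E2 (outer (A m n)) (\<lambda>i j. outer_emb (s i j))"
  using outer_emb.gr_inverse_hom[OF inv] by (simp add: outer_eq[abs_def] outer_emb_const)

lemma contr_A: "contracts Ix (\<lambda>i j. S.shU \<kappa>d (outer (A m n) i j)) (\<lambda>i j. outer_emb (s i j)) (outer_emb z)"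
  using outer_emb.contracts_hom[OF contr] by (simp add: outer_eq[abs_def] shU_outer_emb)

interpretation sh: rng_hom "S.shU \<kappa>d"
  by standard (simp_all add: S.shU_add S.shU_mult)

lemma shU_inner: "(\<lambda>i j. S.shU c (inner x i j)) = inner x"
  by (intro ext) (simp add: inner_def S.shU_const)

lemma shU_F: "is_central y ==> S.shU \<kappa>d (F y f) = F y (f oo \<phi>)"
  unfolding F_def by (simp add: S.shU_fev Sf_compose)

lemma z_commutes_B:
  assumes kl: "k \<in> Ix" "l \<in> Ix"
  shows "B m n k l q * z $ r = z $ r * B m n k l q"
proof -
  interpret rtt_inverse Ix px "F yp (g\<mu> * gx)" "F yp (g\<mu> * (gx * fps_X))" "F ym (g\<mu> * gx)" "F ym (g\<mu> * (gx * fps_X))"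
    E2 "outer (A m n)" "inner (B m n)" "\<lambda>i j. outer_emb (s i j)"
    by (rule rtt_inverseI[OF rtt_BA inv_A finite_atLeastAtMost Fc(1) Fc(1) Fc(2) Fc(2) e1_inner_B])
  have rel: "rtt Ix px (F yp (gx oo \<phi>)) (F yp ((gx oo \<phi>) * \<phi>)) (F ym (gx oo \<phi>)) (F ym ((gx oo \<phi>) * \<phi>))
      (\<lambda>i j. S.shU \<kappa>d (outer (A m n) i j)) (inner (B m n))"
    using sh.rtt_hom[OF rtt_AB]
    unfolding shU_F[OF y_central(1)] shU_F[OF y_central(2)] gX_compose shU_inner .
  \<comment> \<open>The quotients are \<open>\<beta>/\<alpha> = 1/(w + \<kappa>)\<close> and
    \<open>\<delta>/\<gamma> = 1/w\<close>, so apart from factors involving \<open>g\<close> this is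
    the equation \<open>\<phi>\<close>.\<close>
  have ratio: "F y ((gx oo \<phi>) * \<phi>) * (F y (g\<mu> * gx) + fps_const (fps_const (cs_dyp \<kappa>d)) * F y (g\<mu> * (gx * fps_X)))
      = F y (gx oo \<phi>) * F y (g\<mu> * (gx * fps_X))" if "is_central y" for y
  proof -
    have "(gx oo \<phi>) * \<phi> * (g\<mu> * gx + fps_const \<kappa>d * (g\<mu> * (gx * fps_X))) = (gx oo \<phi>) * (g\<mu> * gx) * (\<phi> * (1 + fps_const \<kappa>d * fps_X))"
      by (simp add: algebra_simps)
    then have "(gx oo \<phi>) * \<phi> * (g\<mu> * gx + fps_const \<kappa>d * (g\<mu> * (gx * fps_X))) = (gx oo \<phi>) * (g\<mu> * (gx * fps_X))"
      unfolding \<phi> by (simp add: ac_simps)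
    then show ?thesis unfolding F_simps[OF that] by (rule arg_cong)
  qed
  have "F ym (gx oo \<phi>) * F ym (g\<mu> * gx) * (inner (B m n) k l * outer_emb z)
      = F yp (gx oo \<phi>) * F yp (g\<mu> * gx) * (outer_emb z * inner (B m n) k l)"
    using contr_A by (intro contraction_commutes[OF rel Fc(1) Fc(1) Fc(2) Fc(2) \<kappa>_sum _ _ _ kl] ratio y_central)
      (simp add: contracts_def)
  moreover have N: "F y (gx oo \<phi>) * F y (g\<mu> * gx) = 1" if "is_central y" for y
    unfolding F_simps[OF that] g\<mu>'' ..
  ultimately have "inner (B m n) k l * outer_emb z = outer_emb z * inner (B m n) k l"
    by (simp only: N[OF y_central(1)] N[OF y_central(2)] mult_1_left)
  from arg_cong[OF this, of "\<lambda>h. h $ r $ q"] show ?thesis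
    by (simp add: inner_def outer_emb_def)
qed

lemma z_commutes_A:
  assumes kl: "k \<in> Ix" "l \<in> Ix"
  shows "A m n k l q * z $ r = z $ r * A m n k l q"
proof -
  interpret rtt_inverse Ix px "Vs - fps_X" "fps_X * Vs" "Vs - fps_X" "fps_X * Vs"
    E2 "outer (A m n)" "inner (A m n)" "\<lambda>i j. outer_emb (s i j)"
    by (rule rtt_inverseI[OF yang_rel_neg(2)[OF yang_rel_A[OF mn]] inv_A finite_atLeastAtMost
	VX_central(1,2) VX_central(1,2) e1_inner_A])
  let ?\<kappa> = "fps_const (fps_const (cs_dyp \<kappa>d)) :: dyp fps fps"
  \<comment> \<open>The shift makes \<open>1/u\<close> a fraction with denominator
    \<open>1 + \<kappa>/u\<close>; scaling the relation by this central series clears it.\<close>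
  let ?c = "1 + ?\<kappa> * fps_X"
  have \<kappa>dent: "is_central ?\<kappa>" by (rule S2.cs_central)
  have X: "?c * S.shU \<kappa>d fps_X = fps_X"
    using S.shU_fps_X[of \<kappa>d] is_centralD[OF is_central_plus[OF is_central_1 is_central_mult[OF \<kappa>dent is_central_fps_X]]] by simp
  let ?\<alpha> = "Vs + ?\<kappa> * fps_X * Vs - fps_X" and ?\<beta> = "fps_X * Vs :: dyp fps fps"
  have rel: "rtt Ix px ?\<alpha> ?\<beta> ?\<alpha> ?\<beta> (\<lambda>i j. S.shU \<kappa>d (outer (A m n) i j)) (inner (A m n))"
  proof -
    have "?c * S.shU \<kappa>d (Vs - fps_X) = ?\<alpha>" "?c * S.shU \<kappa>d (fps_X * Vs) = ?\<beta>"
      using X by (simp_all add: sh.h_diff sh.h_mult S.shU_const algebra_simps flip: mult.assoc)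
    with rtt_scale[OF sh.rtt_hom[OF yang_rel_neg(1)[OF yang_rel_A[OF mn]]], of ?c] show ?thesis
      by (simp only: shU_inner)
  qed
  have \<alpha>cent: "is_central ?\<alpha>"
    by (intro is_central_diff is_central_plus is_central_mult \<kappa>dent is_central_fps_const is_central_fps_X)
  have ratio: "?\<beta> * (Vs - fps_X + ?\<kappa> * (fps_X * Vs)) = ?\<alpha> * (fps_X * Vs)"
    using is_centralD[OF VX_central(2), of ?\<alpha>] by (simp add: algebra_simps)
  have N: "?\<alpha> * (Vs - fps_X) * (inner (A m n) k l * outer_emb z)
      = ?\<alpha> * (Vs - fps_X) * (outer_emb z * inner (A m n) k l)"
    using contr_A by (intro contraction_commutes[OF rel \<alpha>cent VX_central(2) \<alpha>cent VX_central(2) \<kappa>_sum ratio ratio _ kl])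
      (simp add: contracts_def)
  \<comment> \<open>Linear in the outer variable with the inner variable as lowest coefficient,
    which is regular though not invertible.\<close>
  have \<alpha>: "?\<alpha> = fps_const fps_X - fps_X * fps_const (1 - fps_const (cs_dyp \<kappa>d) * fps_X)"
  proof -
    have "?\<kappa> * fps_X * Vs = fps_X * fps_const (fps_const (cs_dyp \<kappa>d) * fps_X)"
      using is_centralD[OF \<kappa>dent, of fps_X] by (simp add: mult.assoc flip: fps_const_mult)
    then show ?thesis by (simp add: right_diff_distrib flip: fps_const_sub fps_const_mult)
  qed
  have "?\<alpha> * ((Vs - fps_X) * (inner (A m n) k l * outer_emb z - outer_emb z * inner (A m n) k l)) = 0"
    by (rule mult_mult_diff_eq_0[OF N])
  then have "(Vs - fps_X) * (inner (A m n) k l * outer_emb z - outer_emb z * inner (A m n) k l) = 0"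
    unfolding \<alpha> by (rule fps_linear_regular[rotated]) (rule fps_X_regular)
  then have "inner (A m n) k l * outer_emb z - outer_emb z * inner (A m n) k l = 0"
    by (rule VX_regular)
  from arg_cong[OF this, of "\<lambda>h. h $ r $ q"] show ?thesis
    by (simp add: inner_def outer_emb_def)
qed

end

section \<open>Relations for the shifted dual series\<close>

lemma A_image: "i \<in> Ix ==> j \<in> Ix ==> \<exists>f\<in>freeC m n. A m n i j r = \<eta> m n f"
  unfolding A_def[OF mn] by (rule bexI[OF refl aN_closed])

lemma B_image: "i \<in> Ix ==> j \<in> Ix ==> \<exists>f\<in>freeC m n. B m n i j r = \<eta> m n f"
  unfolding B_def[OF mn] by (rule bexI[OF refl bN_closed])

text \<open>\<open>\<alpha>'\<close> is \<open>\<alpha>\<close> with the inner variable shifted.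
  This is expressed by the effect on \<open>shrel\<close>, since the scalars in \<open>dyp\<close>
  are not images under \<open>\<eta>\<close>.\<close>

definition shiftable :: "dyp fps fps => dyp fps fps => bool" where
  "shiftable \<alpha> \<alpha>' \<longleftrightarrow> (\<forall>r f f'. shrel m n f f' --> shrel m n (\<alpha> $ r * f) (\<alpha>' $ r * f'))"

lemma shiftable_F: "shiftable (F (yy m n c) f) (F (yy m n c + fps_const (cs_dyp \<kappa>d)) f)"
  unfolding shiftable_def F_def by (simp add: shrel_pev[OF mn])

lemma shiftable_minus: "shiftable \<alpha> \<alpha>' ==> shiftable (- \<alpha>) (- \<alpha>')"
  unfolding shiftable_def by (simp add: shrel_minus[OF mn])

lemma shiftable_1: "shiftable 1 1"
  unfolding shiftable_def
proof (intro allI impI)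
  fix r f f' assume "shrel m n f f'"
  then show "shrel m n ((1 :: dyp fps fps) $ r * f) ((1 :: dyp fps fps) $ r * f')"
    by (cases "r = 0") (simp_all add: shrel_0[OF mn])
qed

lemma shiftable_VX: "shiftable (Vs - fps_X) (Vs + fps_const (fps_const (cs_dyp \<kappa>d)) - fps_X)"
  unfolding shiftable_def
proof (intro allI impI)
  fix r :: nat and f f' assume f: "shrel m n f f'"
  consider "r = 0" | "r = 1" | "r > 1" by (metis less_one nat_neq_iff)
  then show "shrel m n ((Vs - fps_X :: dyp fps fps) $ r * f) ((Vs + fps_const (fps_const (cs_dyp \<kappa>d)) - fps_X :: dyp fps fps) $ r * f')"
    using shrel_X[OF mn f] shrel_minus[OF mn f] by cases (simp_all add: shrel_0[OF mn])
qed

lemma rtt_shift_inner: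
  assumes rel: "rtt Ix px \<alpha>p \<beta>p \<alpha>m \<beta>m (inner (B m n)) (outer x)"
    and x: "!!i j r. i \<in> Ix ==> j \<in> Ix ==> \<exists>f\<in>freeC m n. x i j r = \<eta> m n f"
    and sh: "shiftable \<alpha>p \<alpha>p'" "shiftable \<beta>p \<beta>p'" "shiftable \<alpha>m \<alpha>m'" "shiftable \<beta>m \<beta>m'"
  shows "rtt Ix px \<alpha>p' \<beta>p' \<alpha>m' \<beta>m' (inner (Bsh m n)) (outer x)"
  unfolding rtt_def
proof (intro ballI fps_ext[where 'a="dyp fps"])
  fix i j k l r assume ijkl: "i \<in> Ix" "j \<in> Ix" "k \<in> Ix" "l \<in> Ix"
  let ?\<sigma> = "pp px i j k l" and ?\<theta> = "pt px k j l"
  have 1: "shrel m n ((\<alpha> * sg d (inner (B m n) u v * outer x u' v')) $ r) ((\<alpha>' * sg d (inner (Bsh m n) u v * outer x u' v')) $ r)"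
    if h: "shiftable \<alpha> \<alpha>'" "u \<in> Ix" "v \<in> Ix" "u' \<in> Ix" "v' \<in> Ix" for \<alpha> \<alpha>' d u v u' v'
    unfolding fps_mult_nth[of \<alpha>] fps_mult_nth[of \<alpha>'] sg_fps_nth
  proof (rule shrel_sum[OF mn])
    fix y
    obtain f where "f \<in> freeC m n" "x u' v' (r - y) = \<eta> m n f" using x[OF h(4,5)] by blast
    then have "shrel m n (b1 u v * fps_const (x u' v' (r - y))) (Abs_fps (Bsh m n u v) * fps_const (x u' v' (r - y)))"
      using shrel_right[OF mn shrel_B[OF mn h(2,3)]] by simp
    then show "shrel m n (\<alpha> $ y * sg d ((inner (B m n) u v * outer x u' v') $ (r - y))) (\<alpha>' $ y * sg d ((inner (Bsh m n) u v * outer x u' v') $ (r - y)))"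
      using h(1) unfolding shiftable_def by (auto simp: inner_def outer_def intro!: shrel_sg[OF mn])
  qed
  have 2: "shrel m n ((\<alpha> * sg d (outer x u' v' * inner (B m n) u v)) $ r) ((\<alpha>' * sg d (outer x u' v' * inner (Bsh m n) u v)) $ r)"
    if h: "shiftable \<alpha> \<alpha>'" "u \<in> Ix" "v \<in> Ix" "u' \<in> Ix" "v' \<in> Ix" for \<alpha> \<alpha>' d u v u' v'
    unfolding fps_mult_nth[of \<alpha>] fps_mult_nth[of \<alpha>'] sg_fps_nth
  proof (rule shrel_sum[OF mn])
    fix y
    obtain f where "f \<in> freeC m n" "x u' v' (r - y) = \<eta> m n f" using x[OF h(4,5)] by blast
    then have "shrel m n (fps_const (x u' v' (r - y)) * b1 u v) (fps_const (x u' v' (r - y)) * Abs_fps (Bsh m n u v))"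
      using shrel_left[OF mn shrel_B[OF mn h(2,3)]] by simp
    then show "shrel m n (\<alpha> $ y * sg d ((outer x u' v' * inner (B m n) u v) $ (r - y))) (\<alpha>' $ y * sg d ((outer x u' v' * inner (Bsh m n) u v) $ (r - y)))"
      using h(1) unfolding shiftable_def by (auto simp: inner_def outer_def intro!: shrel_sg[OF mn])
  qed
  have L: "shrel m n ((\<alpha>p * sg ?\<sigma> (inner (B m n) i j * outer x k l) - \<beta>p * sg ?\<theta> (inner (B m n) k j * outer x i l)) $ r)
     ((\<alpha>p' * sg ?\<sigma> (inner (Bsh m n) i j * outer x k l) - \<beta>p' * sg ?\<theta> (inner (Bsh m n) k j * outer x i l)) $ r)"
    unfolding fps_sub_nth by (intro shrel_diff[OF mn] 1 sh ijkl)
  have R: "shrel m n ((\<alpha>m * sg 0 (outer x k l * inner (B m n) i j) - \<beta>m * sg ?\<theta> (outer x k j * inner (B m n) i l)) $ r)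
     ((\<alpha>m' * sg 0 (outer x k l * inner (Bsh m n) i j) - \<beta>m' * sg ?\<theta> (outer x k j * inner (Bsh m n) i l)) $ r)"
    unfolding fps_sub_nth by (intro shrel_diff[OF mn] 2 sh ijkl)
  show "(\<alpha>p' * sg ?\<sigma> (inner (Bsh m n) i j * outer x k l) - \<beta>p' * sg ?\<theta> (inner (Bsh m n) k j * outer x i l)) $ r
     = (\<alpha>m' * (outer x k l * inner (Bsh m n) i j) - \<beta>m' * sg ?\<theta> (outer x k j * inner (Bsh m n) i l)) $ r"
    using shrel_unique[OF mn L R[unfolded sg_zero, folded rttD[OF rel ijkl]]] .
qed

context
  fixes s :: "nat => nat => dyp fps" and z :: "dyp fps"
  assumes inv: "gr_inverse Ix px (fps_const (e1 m n)) b1 s"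
    and contr: "contracts Ix (\<lambda>i j. Abs_fps (Bsh m n i j)) s z"
begin

lemma inv_B: "gr_inverse Ix px E2 (inner (B m n)) (\<lambda>i j. fps_const (s i j))"
  using fps_const.gr_inverse_hom[OF inv] by (simp add: inner_def[abs_def])

lemma contr_B: "contracts Ix (inner (Bsh m n)) (\<lambda>i j. fps_const (s i j)) (fps_const z)"
  using fps_const.contracts_hom[OF contr] by (simp add: inner_def[abs_def])

lemma zplus_commutes_A:
  assumes kl: "k \<in> Ix" "l \<in> Ix"
  shows "A m n k l r * z $ q = z $ q * A m n k l r"
proof -
  let ?\<kappa> = "fps_const (cs_dyp \<kappa>d) :: dyp fps"
  have yc: "is_central (yp + ?\<kappa>)" "is_central (ym + ?\<kappa>)"
    by (intro is_central_plus y_central S.cs_central)+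
  \<comment> \<open>Rewrites the unshifted scalars at the argument \<open>y + \<kappa>\<close>, so
    that all products below are evaluated at one central element.\<close>
  have FG: "F (yy m n c) f = F (yy m n c + ?\<kappa>) (f oo \<phi>)" for c f
    unfolding F_def by (subst Sf_eq_pshift[of _ \<kappa>d]) (rule S.fev_pshift[OF yy_central[OF mn]])
  \<comment> \<open>The roles are exchanged: the mixed relation itself moves \<open>A\<close> past
    the inverse of \<open>B\<close>, and its dual is the relation that gets shifted.\<close>
  interpret rtt_inverse Ix px "F yp gx" "- F yp (gx * fps_X)" "F ym gx" "- F ym (gx * fps_X)"
    E2 "inner (B m n)" "outer (A m n)" "\<lambda>i j. fps_const (s i j)"
    by (rule rtt_inverseI[OF _ inv_B finite_atLeastAtMost Fc(1) is_central_uminus[OF Fc(1)] Fc(2) is_central_uminus[OF Fc(2)] e1_outer_A])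
      (simp only: minus_minus rtt_AB)
  have rel: "rtt Ix px (F (yp + ?\<kappa>) (g\<mu> * gx)) (- F (yp + ?\<kappa>) (g\<mu> * (gx * fps_X)))
      (F (ym + ?\<kappa>) (g\<mu> * gx)) (- F (ym + ?\<kappa>) (g\<mu> * (gx * fps_X))) (inner (Bsh m n)) (outer (A m n))"
    by (intro rtt_shift_inner[OF rtt_BA A_image] shiftable_minus shiftable_F)
  have ratio: "- F (yy m n c + ?\<kappa>) (g\<mu> * (gx * fps_X)) * (F (yy m n c) gx + fps_const ?\<kappa> * (- F (yy m n c) (gx * fps_X)))
      = F (yy m n c + ?\<kappa>) (g\<mu> * gx) * (- F (yy m n c) (gx * fps_X))" if "is_central (yy m n c + ?\<kappa>)" for c
  proof -
    have X: "fps_X - fps_const \<kappa>d * fps_X * \<phi> = \<phi>"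
      using \<phi> by (simp add: algebra_simps)
    have "g\<mu> * (gx * fps_X) * ((gx oo \<phi>) + fps_const \<kappa>d * - ((gx oo \<phi>) * \<phi>)) = g\<mu> * gx * (gx oo \<phi>) * (fps_X - fps_const \<kappa>d * fps_X * \<phi>)"
      by (simp add: algebra_simps)
    then have E: "g\<mu> * (gx * fps_X) * ((gx oo \<phi>) + fps_const \<kappa>d * - ((gx oo \<phi>) * \<phi>)) = g\<mu> * gx * (gx oo \<phi>) * \<phi>"
      unfolding X .
    have "- (g\<mu> * (gx * fps_X)) * ((gx oo \<phi>) + fps_const \<kappa>d * - ((gx oo \<phi>) * \<phi>)) = - (g\<mu> * gx * (gx oo \<phi>) * \<phi>)"
      using E by (subst mult_minus_left) (rule arg_cong)
    also have "\<dots> = g\<mu> * gx * (- ((gx oo \<phi>) * \<phi>))"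
      by (simp add: mult.assoc)
    finally have "- (g\<mu> * (gx * fps_X)) * ((gx oo \<phi>) + fps_const \<kappa>d * - ((gx oo \<phi>) * \<phi>)) = g\<mu> * gx * (- ((gx oo \<phi>) * \<phi>))" .
    then show ?thesis unfolding FG gX_compose F_simps[OF that] by (rule arg_cong)
  qed
  have "F (ym + ?\<kappa>) (g\<mu> * gx) * F ym gx * (outer (A m n) k l * fps_const z)
      = F (yp + ?\<kappa>) (g\<mu> * gx) * F yp gx * (fps_const z * outer (A m n) k l)"
    using contr_B
    by (intro contraction_commutes[OF rel _ _ _ _ \<kappa>_sum _ _ _ kl] ratio yc is_central_uminus F_central)
      (simp add: contracts_def)
  moreover have "F (yy m n c + ?\<kappa>) (g\<mu> * gx) * F (yy m n c) gx = 1" if "is_central (yy m n c + ?\<kappa>)" for c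
    unfolding FG F_simps[OF that] using g\<mu>'' by (simp add: mult.commute F_simps[OF that])
  ultimately have "outer (A m n) k l * fps_const z = fps_const z * outer (A m n) k l"
    using yc by simp
  from arg_cong[OF this, of "\<lambda>h. h $ r $ q"] show ?thesis
    by (simp add: outer_def)
qed

lemma zplus_commutes_B:
  assumes kl: "k \<in> Ix" "l \<in> Ix"
  shows "B m n k l r * z $ q = z $ q * B m n k l r"
proof -
  interpret rtt_inverse Ix px "Vs - fps_X" 1 "Vs - fps_X" 1
    E2 "inner (B m n)" "outer (B m n)" "\<lambda>i j. fps_const (s i j)"
    by (rule rtt_inverseI[OF yang_rel_pos(2)[OF yang_rel_B[OF mn]] inv_B finite_atLeastAtMost
	VX_central(1,3) VX_central(1,3) e1_outer_B])
  let ?\<kappa> = "fps_const (fps_const (cs_dyp \<kappa>d)) :: dyp fps fps"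
  let ?\<alpha> = "Vs + ?\<kappa> - fps_X"
  have rel: "rtt Ix px ?\<alpha> 1 ?\<alpha> 1 (inner (Bsh m n)) (outer (B m n))"
    by (intro rtt_shift_inner[OF yang_rel_pos(1)[OF yang_rel_B[OF mn]] B_image] shiftable_VX shiftable_1)
  have \<alpha>cent: "is_central ?\<alpha>"
    by (intro is_central_diff is_central_plus S2.cs_central is_central_fps_const is_central_fps_X)
  have ratio: "1 * (Vs - fps_X + ?\<kappa> * 1) = ?\<alpha> * 1" by simp
  have N: "?\<alpha> * (Vs - fps_X) * (outer (B m n) k l * fps_const z) = ?\<alpha> * (Vs - fps_X) * (fps_const z * outer (B m n) k l)"
    using contr_B by (intro contraction_commutes[OF rel \<alpha>cent VX_central(3) \<alpha>cent VX_central(3) \<kappa>_sum ratio ratio _ kl])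
      (simp add: contracts_def)
  \<comment> \<open>The constant term \<open>\<kappa>\<close> is nonzero, so
    \<open>?\<alpha>\<close> is regular, as a series first in the outer and then in the inner
    variable.\<close>
  have \<alpha>: "?\<alpha> = fps_const (fps_const (cs_dyp \<kappa>d) - fps_X * fps_const (- 1)) - fps_X * fps_const 1"
    by (simp add: add.commute flip: fps_const_neg fps_const_add)
  have "?\<alpha> * ((Vs - fps_X) * (outer (B m n) k l * fps_const z - fps_const z * outer (B m n) k l)) = 0"
    by (rule mult_mult_diff_eq_0[OF N])
  then have "(Vs - fps_X) * (outer (B m n) k l * fps_const z - fps_const z * outer (B m n) k l) = 0"
    unfolding \<alpha> by (rule fps_linear_regular[rotated])
      (erule fps_linear_regular[rotated], erule dyp.cs_regular[OF \<kappa>d])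
  then have "outer (B m n) k l * fps_const z - fps_const z * outer (B m n) k l = 0"
    by (rule VX_regular)
  from arg_cong[OF this, of "\<lambda>h. h $ r $ q"] show ?thesis
    by (simp add: outer_def)
qed

end

end

declare One_nat_def [simp del]

section \<open>Central elements of the completion\<close>

context
  fixes m n :: nat
  assumes mn: "m \<noteq> n"
begin

lemma FC_left_bound:
  assumes h: "h \<in> FC m n"
  shows "\<exists>N q. \<forall>k\<ge>N. \<forall>x\<in>Kf m n q. h k * x \<in> Kf m n p"
proof -
  obtain N where N: "\<forall>k\<ge>N. \<forall>l\<ge>N. h k - h l \<in> Kf m n p"
    using h unfolding FC_def by blast
  obtain q where q: "\<forall>x\<in>Kf m n q. h N * x \<in> Kf m n p"
    using Kf_left_continuous[OF mn FC_closed[OF h]] by blast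
  have "h k * x \<in> Kf m n p" if "k \<ge> N" "x \<in> Kf m n q" for k x
  proof -
    have "h k - h N \<in> Kf m n p" "h N * x \<in> Kf m n p" using that N q by auto
    then have "(h k - h N) * x + h N * x \<in> Kf m n p"
      by (rule Kf_add[OF Kf_right[OF _ Kf_closed[OF that(2)]]])
    then show ?thesis by (simp add: left_diff_distrib)
  qed
  then show ?thesis by blast
qed

context
  fixes h :: "nat => free_el"
  assumes h: "h \<in> FC m n"
    and gens: "!!x. x \<in> dy_gens m n ==> Lm m n h * \<eta> m n (gen_el x) = \<eta> m n (gen_el x) * Lm m n h"
begin

lemma Lm_commute_free: "f \<in> freeC m n ==> Lm m n h * \<eta> m n f = \<eta> m n f * Lm m n h"
proof (induction rule: freeC_induct)
  case (add f g)
  then show ?case by (simp add: \<eta>_add[OF mn] distrib_left distrib_right)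
next
  case (mult f g)
  have "Lm m n h * (\<eta> m n f * \<eta> m n g) = \<eta> m n f * (Lm m n h * \<eta> m n g)"
    by (simp only: mult.assoc[symmetric] mult.IH(1))
  then show ?case using mult by (simp only: \<eta>_mult[OF mn] mult.assoc)
next
  case (cst c)
  show ?case by (rule is_centralD[OF \<eta>_central[OF mn modcentral_cst], symmetric])
qed (rule gens)

text \<open>The index \<open>j\<close> is fixed before \<open>k\<close>. The commutator of
  \<open>h k\<close> with the single element \<open>f j\<close> is null by
  \<open>Lm_commute_free\<close>; \<open>h k * (f k - f j)\<close> is small by
  \<open>FC_left_bound\<close>, and \<open>(f k - f j) * h k\<close> because the filtration consists
  of right ideals.\<close>

lemma Lm_commute_FC:
  assumes f: "f \<in> FC m n"
  shows "Lm m n h * Lm m n f = Lm m n f * Lm m n h"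
proof -
  have "(\<lambda>k. h k * f k - f k * h k) \<in> Fnull m n"
  proof (rule FnullI)
    show "h k * f k - f k * h k \<in> freeC m n" for k
      using FC_closed[OF f] FC_closed[OF h] by (intro freeC_diff freeC_mult)
    fix p
    obtain N1 q where N1: "\<forall>k\<ge>N1. \<forall>x\<in>Kf m n q. h k * x \<in> Kf m n p"
      using FC_left_bound[OF h] by blast
    obtain N2 where N2: "\<forall>k\<ge>N2. \<forall>l\<ge>N2. f k - f l \<in> Kf m n q"
      using f unfolding FC_def by blast
    obtain N3 where N3: "\<forall>k\<ge>N3. \<forall>l\<ge>N3. f k - f l \<in> Kf m n p"
      using f unfolding FC_def by blast
    define j where "j = max N2 N3"
    have "(\<lambda>k. h k * f j - f j * h k) \<in> Fnull m n"
      using Lm_commute_free[OF FC_closed[OF f, of j]] h FC_const[OF FC_closed[OF f, of j]]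
	Lm_eq_iff[OF mn, of "\<lambda>k. h k * f j" "\<lambda>k. f j * h k"]
      by (simp add: \<eta>_def[OF mn] Lm_mult[OF mn] FC_mult[OF mn])
    then obtain N4 where N4: "\<forall>k\<ge>N4. h k * f j - f j * h k \<in> Kf m n p"
      using FnullD by blast
    have "h k * f k - f k * h k \<in> Kf m n p" if "k \<ge> max N1 (max j N4)" for k
    proof -
      have jk: "N1 \<le> k" "N2 \<le> k" "N3 \<le> k" "N4 \<le> k" "N2 \<le> j" "N3 \<le> j" using that by (auto simp: j_def)
      have "h k * (f k - f j) \<in> Kf m n p" "h k * f j - f j * h k \<in> Kf m n p" "f k - f j \<in> Kf m n p"
	using jk N1 N2 N3 N4 by auto
      then have "h k * (f k - f j) + (h k * f j - f j * h k) - (f k - f j) * h k \<in> Kf m n p"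
	by (intro Kf_diff[OF Kf_add] Kf_right[OF _ FC_closed[OF h]])
      then show ?thesis by (simp add: algebra_simps)
    qed
    then show "\<exists>N. \<forall>k\<ge>N. h k * f k - f k * h k \<in> Kf m n p" by blast
  qed
  then show ?thesis
    using Lm_eq_iff[OF mn FC_mult[OF mn h f] FC_mult[OF mn f h]] f h by (simp add: Lm_mult[OF mn])
qed

end

end

section \<open>Inverses of the generating matrices\<close>

definition mat_mult :: "nat set => (nat => nat => 'r::ring_1) => (nat => nat => 'r) => nat => nat => 'r" where
  "mat_mult K X Y i j = (\<Sum>p\<in>K. X i p * Y p j)"

primrec mat_pow :: "nat set => (nat => nat => 'r::ring_1) => nat => nat => nat => 'r" where
  "mat_pow K X 0 = (\<lambda>i j. if i = j then 1 else 0)"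
| "mat_pow K X (Suc k) = mat_mult K X (mat_pow K X k)"

lemma mat_pow_Suc_right:
  assumes "finite K" "i \<in> K" "j \<in> K"
  shows "mat_pow K X (Suc k) i j = mat_mult K (mat_pow K X k) X i j"
  using assms(2)
proof (induction k arbitrary: i)
  case 0
  have 1: "X i p * (if p = j then 1 else 0) = (if p = j then X i j else 0)"
    "(if i = p then 1 else 0) * X p j = (if i = p then X i j else 0)" for p
    by auto
  show ?case using assms(1,3) 0 by (simp add: mat_mult_def 1)
next
  case (Suc k)
  have "mat_pow K X (Suc (Suc k)) i j = (\<Sum>p\<in>K. X i p * mat_mult K (mat_pow K X k) X p j)"
    unfolding mat_pow.simps(2)[of K X "Suc k"] mat_mult_def[of K X] by (intro sum.cong refl) (simp only: Suc.IH)
  also have "\<dots> = (\<Sum>p\<in>K. \<Sum>q\<in>K. X i p * (mat_pow K X k p q * X q j))"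
    by (simp add: mat_mult_def sum_distrib_left)
  also have "\<dots> = (\<Sum>q\<in>K. \<Sum>p\<in>K. X i p * (mat_pow K X k p q * X q j))"
    by (rule sum.swap)
  also have "\<dots> = mat_mult K (mat_pow K X (Suc k)) X i j"
    by (simp add: mat_mult_def sum_distrib_right mult.assoc)
  finally show ?case .
qed

definition geom :: "nat set => (nat => nat => 'r::ring_1) => nat => nat => nat => 'r" where
  "geom K X N i j = (\<Sum>k\<le>N. mat_pow K X k i j)"

lemma geom_telescope:
  "geom K X N i j - (\<Sum>k\<le>N. mat_pow K X (Suc k) i j) = (if i = j then 1 else 0) - mat_pow K X (Suc N) i j"
proof -
  have "geom K X N i j + mat_pow K X (Suc N) i j = (if i = j then 1 else 0) + (\<Sum>k\<le>N. mat_pow K X (Suc k) i j)"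
    using sum.atMost_Suc_shift[of "\<lambda>k. mat_pow K X k i j" N] by (simp add: geom_def)
  then show ?thesis by (simp only: diff_eq_eq) (simp add: algebra_simps)
qed

lemma sum_delta_mult:
  assumes "finite K" "i \<in> K"
  shows "(\<Sum>p\<in>K. (if i = p then 1 else 0) * f p) = f i" "(\<Sum>p\<in>K. f p * (if p = i then 1 else 0)) = (f i :: 'r::ring_1)"
proof -
  have "(if i = p then 1 else 0) * f p = (if i = p then f i else 0)" "f p * (if p = i then 1 else 0) = (if p = i then f i else 0)" for p
    by auto
  then show "(\<Sum>p\<in>K. (if i = p then 1 else 0) * f p) = f i" "(\<Sum>p\<in>K. f p * (if p = i then 1 else 0)) = f i"
    using assms by simp_all
qed

lemma geom_inverse:
  assumes K: "finite K" "i \<in> K" "j \<in> K"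
  shows "(\<Sum>p\<in>K. ((if i = p then 1 else 0) - X i p) * geom K X N p j) = (if i = j then 1 else 0) - mat_pow K X (Suc N) i j"
    and "(\<Sum>p\<in>K. geom K X N i p * ((if p = j then 1 else 0) - X p j)) = (if i = j then 1 else 0) - mat_pow K X (Suc N) i j"
proof -
  have "(\<Sum>p\<in>K. X i p * geom K X N p j) = (\<Sum>k\<le>N. mat_pow K X (Suc k) i j)"
    unfolding geom_def sum_distrib_left by (subst sum.swap) (simp add: mat_mult_def)
  then show "(\<Sum>p\<in>K. ((if i = p then 1 else 0) - X i p) * geom K X N p j) = (if i = j then 1 else 0) - mat_pow K X (Suc N) i j"
    by (simp only: left_diff_distrib sum_subtractf sum_delta_mult(1)[OF K(1,2)] geom_telescope)
  have "(\<Sum>p\<in>K. geom K X N i p * X p j) = (\<Sum>k\<le>N. mat_pow K X (Suc k) i j)"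
    unfolding geom_def sum_distrib_right
    by (subst sum.swap) (simp only: mat_pow_Suc_right[OF K] mat_mult_def)
  then show "(\<Sum>p\<in>K. geom K X N i p * ((if p = j then 1 else 0) - X p j)) = (if i = j then 1 else 0) - mat_pow K X (Suc N) i j"
    by (simp only: right_diff_distrib sum_subtractf sum_delta_mult(2)[OF K(1,3)] geom_telescope)
qed

text \<open>\<open>T = 1 - \<tau>\<close> is inverted by a Neumann series in the completion. For
  \<open>T(u)\<close> the powers of \<open>\<tau>\<close> vanish eventually at each fixed power of
  \<open>1/u\<close>. For \<open>T\<^sup>+(u)\<close>, whose coefficient at \<open>u^0\<close>
  already involves generators, they tend to 0 because each factor raises the degree of the
  filtration.\<close>

locale geometric_inverse =
  fixes m n :: nat and \<tau> :: "nat => nat => free_el fps"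
  assumes mn: "m \<noteq> n"
    and \<tau>_closed: "i \<in> {1..m+n} ==> j \<in> {1..m+n} ==> \<tau> i j $ q \<in> freeC m n"
    and \<tau>_par: "freepar m (\<tau> i j $ q) = sg (pbar m i + pbar m j) (\<tau> i j $ q)"
    and pow_null: "i \<in> {1..m+n} ==> j \<in> {1..m+n} ==> (\<lambda>k. mat_pow {1..m+n} \<tau> k i j $ q) \<in> Fnull m n"
begin

abbreviation "Ig \<equiv> {1..m+n}"
abbreviation "SN \<equiv> geom Ig \<tau>"
abbreviation "tg i j \<equiv> (if i = j then 1 else 0) - \<tau> i j"

lemma pow_closed: "i \<in> Ig ==> j \<in> Ig ==> mat_pow Ig \<tau> k i j $ q \<in> freeC m n"
  using Fnull_closed[OF pow_null] .

lemma SN_closed: "i \<in> Ig ==> j \<in> Ig ==> SN N i j $ q \<in> freeC m n"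
  unfolding geom_def fps_sum_nth by (intro freeC_sum pow_closed)

lemma SN_FC:
  assumes ij: "i \<in> Ig" "j \<in> Ig"
  shows "(\<lambda>N. SN N i j $ q) \<in> FC m n"
  unfolding FC_def
proof (intro CollectI conjI allI SN_closed ij)
  fix p
  obtain N0 where N0: "\<forall>k\<ge>N0. mat_pow Ig \<tau> k i j $ q \<in> Kf m n p"
    using FnullD[OF pow_null[OF ij]] by blast
  have *: "SN N i j $ q - SN M i j $ q \<in> Kf m n p" if "N0 \<le> M" "M \<le> N" for M N
  proof -
    have "SN N i j $ q = SN M i j $ q + (\<Sum>k\<in>{..N} - {..M}. mat_pow Ig \<tau> k i j $ q)"
      unfolding geom_def fps_sum_nth using that by (subst sum.subset_diff[of "{..M}"]) (auto simp: add.commute)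
    moreover have "(\<Sum>k\<in>{..N} - {..M}. mat_pow Ig \<tau> k i j $ q) \<in> Kf m n p"
      using that N0 by (intro Kf_sum) auto
    ultimately show ?thesis by simp
  qed
  show "\<exists>N. \<forall>k\<ge>N. \<forall>l\<ge>N. SN k i j $ q - SN l i j $ q \<in> Kf m n p"
  proof (intro exI[of _ N0] allI impI)
    fix k l assume "N0 \<le> k" "N0 \<le> l"
    then show "SN k i j $ q - SN l i j $ q \<in> Kf m n p"
      using *[of l k] Kf_minus[OF *[of k l]] by (cases "l \<le> k") auto
  qed
qed

lemma pow_par: "freepar m (mat_pow Ig \<tau> k i j $ q) = sg (pbar m i + pbar m j) (mat_pow Ig \<tau> k i j $ q)"
proof (induction k arbitrary: i q)
  case 0
  show ?case by (cases "i = j") (auto simp: sg_cancel)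
next
  case (Suc k)
  show ?case
    by (simp add: mat_mult_def fps_sum_nth fps_mult_nth freepar_sum freepar_mult \<tau>_par Suc.IH sg_mult_left sg_mult_right sg_sum)
       (intro sum.cong refl sg_cong, auto)
qed

lemma SN_par: "freepar m (SN N i j $ q) = sg (pbar m i + pbar m j) (SN N i j $ q)"
  by (simp add: geom_def fps_sum_nth freepar_sum pow_par sg_sum)

definition TT :: "nat => nat => dyp fps" where
  "TT i j = Abs_fps (\<lambda>r. \<eta> m n (tg i j $ r))"

definition SS :: "nat => nat => dyp fps" where
  "SS i j = Abs_fps (\<lambda>q. Lm m n (\<lambda>N. SN N i j $ q))"

lemma tg_closed: "i \<in> Ig ==> j \<in> Ig ==> tg i j $ r \<in> freeC m n"
  using \<tau>_closed[of i j r] by (cases "i = j"; cases "r = 0") (auto intro: freeC_diff)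

lemma FC_sum: "(!!x. x \<in> S ==> f x \<in> FC m n) ==> (\<lambda>k. \<Sum>x\<in>S. f x k) \<in> FC m n"
  by (induction S rule: infinite_finite_induct) (auto intro: FC_add[OF mn] FC_const)

lemma Lm_sum: "(!!x. x \<in> S ==> f x \<in> FC m n) ==> Lm m n (\<lambda>k. \<Sum>x\<in>S. f x k) = (\<Sum>x\<in>S. Lm m n (f x))"
proof (induction S rule: infinite_finite_induct)
  case (insert x S)
  then show ?case using Lm_add[OF mn, of "f x" "\<lambda>k. \<Sum>x\<in>S. f x k"] FC_sum[of S f] by simp
qed (simp_all add: Lm_0[OF mn])

lemma Lm_limit:
  assumes ij: "i \<in> Ig" "j \<in> Ig" and f: "f = (\<lambda>N. ((if i = j then 1 else 0) - mat_pow Ig \<tau> (Suc N) i j) $ q)" "f \<in> FC m n"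
  shows "Lm m n f = (if i = j then fps_const (e1 m n) else 0) $ q"
proof -
  let ?d = "(if i = j then 1 else 0 :: free_el fps) $ q"
  have dc: "?d \<in> freeC m n" by (cases "i = j"; cases "q = 0") auto
  have "(\<lambda>N. f N - ?d) \<in> Fnull m n"
  proof (rule FnullI)
    fix p
    obtain N0 where "\<forall>k\<ge>N0. mat_pow Ig \<tau> k i j $ q \<in> Kf m n p"
      using FnullD[OF pow_null[OF ij]] by blast
    then show "\<exists>N. \<forall>k\<ge>N. f k - ?d \<in> Kf m n p"
      unfolding f(1) by (intro exI[of _ N0]) (auto intro!: Kf_minus simp del: mat_pow.simps)
  qed (use dc FC_closed[OF f(2)] in \<open>auto intro: freeC_diff\<close>)
  then have "Lm m n f = \<eta> m n ?d"
    using Lm_eq_iff[OF mn f(2) FC_const[OF dc]] by (simp add: \<eta>_def[OF mn])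
  then show ?thesis
    by (cases "i = j"; cases "q = 0") (auto simp: e1_def[OF mn] \<eta>_0[OF mn])
qed

lemma limit_matrix_product:
  assumes ij: "i \<in> Ig" "j \<in> Ig" and X: "!!p a. p \<in> Ig ==> X p a \<in> FC m n" and Y: "!!p a. p \<in> Ig ==> Y p a \<in> FC m n"
    and rel: "!!N. (\<Sum>p\<in>Ig. Abs_fps (\<lambda>a. X p a N) * Abs_fps (\<lambda>a. Y p a N)) = (if i = j then 1 else 0) - mat_pow Ig \<tau> (Suc N) i j"
  shows "(\<Sum>p\<in>Ig. Abs_fps (\<lambda>a. Lm m n (X p a)) * Abs_fps (\<lambda>a. Lm m n (Y p a))) = (if i = j then fps_const (e1 m n) else 0)"
proof (rule fps_ext)
  fix q
  let ?f = "\<lambda>N. \<Sum>p\<in>Ig. \<Sum>a=0..q. X p a N * Y p (q - a) N"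
  have XY: "(\<lambda>N. X p a N * Y p b N) \<in> FC m n" if "p \<in> Ig" for p a b
    by (rule FC_mult[OF mn X[OF that] Y[OF that]])
  have XYs: "(\<lambda>N. \<Sum>a=0..q. X p a N * Y p (q - a) N) \<in> FC m n" if "p \<in> Ig" for p
    by (rule FC_sum[OF XY[OF that]])
  have "(\<Sum>p\<in>Ig. Abs_fps (\<lambda>a. Lm m n (X p a)) * Abs_fps (\<lambda>a. Lm m n (Y p a))) $ q = (\<Sum>p\<in>Ig. \<Sum>a=0..q. Lm m n (\<lambda>N. X p a N * Y p (q - a) N))"
    unfolding fps_sum_nth fps_mult_nth fps_nth_Abs_fps
    by (intro sum.cong refl Lm_mult[OF mn, symmetric] X Y)
  also have "\<dots> = (\<Sum>p\<in>Ig. Lm m n (\<lambda>N. \<Sum>a=0..q. X p a N * Y p (q - a) N))"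
    by (intro sum.cong refl Lm_sum[symmetric] XY)
  also have "\<dots> = Lm m n ?f"
    by (rule Lm_sum[OF XYs, symmetric])
  also have "\<dots> = (if i = j then fps_const (e1 m n) else 0) $ q"
    by (rule Lm_limit[OF ij _ FC_sum[OF XYs]]) (simp only: rel[symmetric] fps_sum_nth fps_mult_nth fps_nth_Abs_fps)
  finally show "(\<Sum>p\<in>Ig. Abs_fps (\<lambda>a. Lm m n (X p a)) * Abs_fps (\<lambda>a. Lm m n (Y p a))) $ q = (if i = j then fps_const (e1 m n) else 0) $ q" .
qed

lemma TT_SS:
  assumes ij: "i \<in> Ig" "j \<in> Ig"
  shows "(\<Sum>p\<in>Ig. TT i p * SS p j) = (if i = j then fps_const (e1 m n) else 0)"
    and "(\<Sum>p\<in>Ig. SS i p * TT p j) = (if i = j then fps_const (e1 m n) else 0)"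
proof -
  have TT: "TT k l = Abs_fps (\<lambda>r. Lm m n (\<lambda>_. tg k l $ r))" for k l
    by (simp only: TT_def \<eta>_def[OF mn])
  show "(\<Sum>p\<in>Ig. TT i p * SS p j) = (if i = j then fps_const (e1 m n) else 0)"
    unfolding TT SS_def
  proof (rule limit_matrix_product[OF ij])
    show "(\<Sum>p\<in>Ig. Abs_fps (\<lambda>a. tg i p $ a) * Abs_fps (\<lambda>a. SN N p j $ a)) = (if i = j then 1 else 0) - mat_pow Ig \<tau> (Suc N) i j" for N
      unfolding fps_nth_inverse by (rule geom_inverse(1)[OF finite_atLeastAtMost ij])
  qed (intro FC_const tg_closed SN_FC ij; assumption)+
  show "(\<Sum>p\<in>Ig. SS i p * TT p j) = (if i = j then fps_const (e1 m n) else 0)"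
    unfolding TT SS_def
  proof (rule limit_matrix_product[OF ij])
    show "(\<Sum>p\<in>Ig. Abs_fps (\<lambda>a. SN N i p $ a) * Abs_fps (\<lambda>a. tg p j $ a)) = (if i = j then 1 else 0) - mat_pow Ig \<tau> (Suc N) i j" for N
      unfolding fps_nth_inverse by (rule geom_inverse(2)[OF finite_atLeastAtMost ij])
  qed (intro FC_const tg_closed SN_FC ij; assumption)+
qed

text \<open>The sign \<open>(-1)^(ij+j)\<close> in the definition of \<open>T\<close> turns the
  signed product of matrices over a superalgebra into the plain product of the entries, up to a sign
  that depends on the outer indices only and is trivial on the diagonal.\<close>

lemma gr_inverse_TT_SS:
  "gr_inverse Ig (pbar m) (fps_const (e1 m n)) (\<lambda>i j. sg (tsg m i j) (TT i j)) (\<lambda>i j. sg (tsg m i j) (SS i j))"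
proof -
  have *: "(\<Sum>q\<in>Ig. sg (pp (pbar m) q l k q) (sg (tsg m k q) (x k q) * sg (tsg m q l) (y q l)))
      = (if k = l then fps_const (e1 m n) else 0)"
    if "(\<Sum>q\<in>Ig. x k q * y q l) = (if k = l then fps_const (e1 m n) else 0)" for k l and x y :: "nat => nat => dyp fps"
  proof -
    have "(\<Sum>q\<in>Ig. sg (pp (pbar m) q l k q) (sg (tsg m k q) (x k q) * sg (tsg m q l) (y q l)))
	= sg (pbar m k * pbar m l + pbar m l) (\<Sum>q\<in>Ig. x k q * y q l)"
      unfolding sg_sum
    proof (rule sum.cong[OF refl])
      fix q
      show "sg (pp (pbar m) q l k q) (sg (tsg m k q) (x k q) * sg (tsg m q l) (y q l))
	  = sg (pbar m k * pbar m l + pbar m l) (x k q * y q l)"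
	by (simp add: sg_mult_left sg_mult_right tsg_def, rule sg_cong) auto
    qed
    then show ?thesis unfolding that by (auto simp: sg_cancel)
  qed
  show ?thesis
    unfolding gr_inverse_def using TT_SS by (intro ballI conjI *)
qed

end

subsection \<open>The two cases\<close>

definition \<tau>A :: "nat => nat => free_el fps" where
  "\<tau>A i j = Abs_fps (\<lambda>r. if r = 0 then 0 else - gen_el (TGen i j r))"

definition \<tau>B :: "nat => nat => free_el fps" where
  "\<tau>B i j = Abs_fps (\<lambda>q. gen_el (TMinusGen i j (Suc q)))"

lemma \<tau>A_nth: "\<tau>A i j $ r = (if r = 0 then 0 else - gen_el (TGen i j r))"
  by (simp add: \<tau>A_def)

lemma \<tau>B_nth: "\<tau>B i j $ q = gen_el (TMinusGen i j (Suc q))"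
  by (simp add: \<tau>B_def)

definition freeG :: "dy_gen set => free_el set" where
  "freeG G = {f. \<forall>w \<in> Poly_Mapping.keys f. set (letters w) \<subseteq> G}"

text \<open>Representatives of the filtration of the dual Yangian (\<open>dual_filt_eq\<close>), on
  which degrees add up under products.\<close>

definition freeJ :: "nat => nat => nat => free_el set" where
  "freeJ m n p = {f. \<forall>w \<in> Poly_Mapping.keys f. set (letters w) \<subseteq> plus_gens m n \<and> p \<le> word_degree w}"

lemma freeC_eq: "freeC m n = freeG (dy_gens m n)"
  by (simp add: freeC_def freeG_def)

lemma freeG_mono: "G \<subseteq> G' ==> freeG G \<subseteq> freeG G'"
  unfolding freeG_def by blast

lemma freeG_simps:
  "0 \<in> freeG G" "cst c \<in> freeG G" "1 \<in> freeG G" "x \<in> G ==> gen_el x \<in> freeG G"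
  "f \<in> freeG G ==> g \<in> freeG G ==> f + g \<in> freeG G"
  "f \<in> freeG G ==> - f \<in> freeG G"
  "f \<in> freeG G ==> g \<in> freeG G ==> f * g \<in> freeG G"
  "f \<in> freeG G ==> freepar m f \<in> freeG G"
proof -
  show c: "0 \<in> freeG G" "cst c \<in> freeG G" for c by (auto simp: freeG_def)
  show "1 \<in> freeG G" using c(2)[of 1] by simp
  show "x \<in> G ==> gen_el x \<in> freeG G" by (simp add: freeG_def gen_el_def)
  show "f \<in> freeG G ==> g \<in> freeG G ==> f + g \<in> freeG G"
    using keys_add[of f g] unfolding freeG_def by blast
  show "f \<in> freeG G ==> - f \<in> freeG G" by (simp add: freeG_def)
  show "f \<in> freeG G ==> g \<in> freeG G ==> f * g \<in> freeG G"
    using keys_mult[of f g] unfolding freeG_def by fastforce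
  show "f \<in> freeG G ==> freepar m f \<in> freeG G"
    by (auto simp: freeG_def in_keys_iff lookup_freepar)
qed

lemma freeG_sum: "(!!x. x \<in> S ==> f x \<in> freeG G) ==> sum f S \<in> freeG G"
  by (induction S rule: infinite_finite_induct) (auto simp: freeG_simps)

lemma word_degree_plus: "word_degree (v + w) = word_degree v + word_degree w"
  by (simp add: word_degree_def)

lemma freeJ_simps:
  "0 \<in> freeJ m n p" "i \<in> {1..m+n} ==> j \<in> {1..m+n} ==> gen_el (TMinusGen i j (Suc r)) \<in> freeJ m n (Suc r)"
  "f \<in> freeJ m n p ==> g \<in> freeJ m n p ==> f + g \<in> freeJ m n p"
  "f \<in> freeJ m n p ==> - f \<in> freeJ m n p"
  "f \<in> freeJ m n p ==> g \<in> freeJ m n q ==> f * g \<in> freeJ m n (p + q)"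
  "f \<in> freeJ m n p ==> freepar m f \<in> freeJ m n p"
  "p \<le> q ==> f \<in> freeJ m n q ==> f \<in> freeJ m n p"
  "freeJ m n 0 = freeG (plus_gens m n)"
proof -
  show "0 \<in> freeJ m n p" "f \<in> freeJ m n p ==> - f \<in> freeJ m n p" "freeJ m n 0 = freeG (plus_gens m n)"
    "p \<le> q ==> f \<in> freeJ m n q ==> f \<in> freeJ m n p"
    by (auto simp: freeJ_def freeG_def)
  show "i \<in> {1..m+n} ==> j \<in> {1..m+n} ==> gen_el (TMinusGen i j (Suc r)) \<in> freeJ m n (Suc r)"
    by (auto simp: freeJ_def gen_el_def plus_gens_def word_degree_def)
  show "f \<in> freeJ m n p ==> g \<in> freeJ m n p ==> f + g \<in> freeJ m n p"
    using keys_add[of f g] unfolding freeJ_def by blast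
  show "f \<in> freeJ m n p ==> g \<in> freeJ m n q ==> f * g \<in> freeJ m n (p + q)"
    using keys_mult[of f g] unfolding freeJ_def by (fastforce simp: word_degree_plus)
  show "f \<in> freeJ m n p ==> freepar m f \<in> freeJ m n p"
    unfolding freeJ_def by (auto simp: in_keys_iff lookup_freepar)
qed

lemma freeJ_sum: "(!!x. x \<in> S ==> f x \<in> freeJ m n p) ==> sum f S \<in> freeJ m n p"
  by (induction S rule: infinite_finite_induct) (auto simp: freeJ_simps)

lemma freeJ_Kf:
  assumes "f \<in> freeJ m n p"
  shows "f \<in> Kf m n p"
proof -
  have "(\<Sum>w\<in>Poly_Mapping.keys f. Poly_Mapping.single w (Poly_Mapping.lookup f w)) \<in> Kf m n p"
  proof (rule Kf_sum)
    fix w assume "w \<in> Poly_Mapping.keys f"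
    then have "wmono w \<in> Kf m n p"
      using assms by (intro Kf_word) (auto simp: freeJ_def plus_word_def)
    then show "Poly_Mapping.single w (Poly_Mapping.lookup f w) \<in> Kf m n p"
      unfolding single_wmono[of w] by (rule Kf_right) simp
  qed
  from this[folded poly_mapping_decomp[of f]] show ?thesis .
qed

lemma \<tau>B_pow: "i \<in> {1..m+n} ==> j \<in> {1..m+n} ==> mat_pow {1..m+n} \<tau>B k i j $ q \<in> freeJ m n k"
proof (induction k arbitrary: i q)
  case 0
  then show ?case by (cases "i = j"; cases "q = 0") (auto simp: freeJ_simps freeG_simps)
next
  case (Suc k)
  have "\<tau>B i p $ a * mat_pow {1..m+n} \<tau>B k p j $ b \<in> freeJ m n (Suc k)" if "p \<in> {1..m+n}" for p a b
    using freeJ_simps(7)[OF _ freeJ_simps(5)[OF freeJ_simps(2)[OF Suc.prems(1) that, of a] Suc.IH[OF that Suc.prems(2), of b]], of "Suc k"]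
    by (simp add: \<tau>B_nth)
  then show ?case
    by (simp only: mat_pow.simps mat_mult_def fps_sum_nth fps_mult_nth) (intro freeJ_sum)
qed

lemma \<tau>A_pow: "i \<in> {1..m+n} ==> j \<in> {1..m+n} ==>
    mat_pow {1..m+n} \<tau>A k i j $ q \<in> freeG (yangian_gens m n) \<and> (q < k --> mat_pow {1..m+n} \<tau>A k i j $ q = 0)"
proof (induction k arbitrary: i q)
  case 0
  then show ?case by (cases "i = j"; cases "q = 0") (auto simp: freeG_simps)
next
  case (Suc k)
  have "\<tau>A i p $ a * mat_pow {1..m+n} \<tau>A k p j $ b \<in> freeG (yangian_gens m n)" if "p \<in> {1..m+n}" for p a b
  proof (rule freeG_simps(7))
    show "\<tau>A i p $ a \<in> freeG (yangian_gens m n)"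
      using Suc.prems(1) that by (auto simp: \<tau>A_nth yangian_gens_def intro!: freeG_simps)
    show "mat_pow {1..m+n} \<tau>A k p j $ b \<in> freeG (yangian_gens m n)"
      using Suc.IH[OF that Suc.prems(2)] by blast
  qed
  moreover have "\<tau>A i p $ a * mat_pow {1..m+n} \<tau>A k p j $ (q - a) = 0" if "p \<in> {1..m+n}" "q < Suc k" "a \<le> q" for p a
    using Suc.IH[OF that(1) Suc.prems(2), of "q - a"] that by (cases "a = 0") (auto simp: \<tau>A_nth)
  ultimately show ?case
    by (auto simp: mat_mult_def fps_sum_nth fps_mult_nth intro!: freeG_sum sum.neutral)
qed

lemma geometric_inverse_B: "m \<noteq> n ==> geometric_inverse m n \<tau>B"
proof
  show "(\<lambda>k. mat_pow {1..m+n} \<tau>B k i j $ q) \<in> Fnull m n" if ij: "i \<in> {1..m+n}" "j \<in> {1..m+n}" for i j q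
  proof (rule FnullI)
    show "mat_pow {1..m+n} \<tau>B k i j $ q \<in> freeC m n" for k
      by (rule Kf_closed[OF freeJ_Kf[OF \<tau>B_pow[OF ij]]])
    show "\<exists>N. \<forall>k\<ge>N. mat_pow {1..m+n} \<tau>B k i j $ q \<in> Kf m n p" for p
      using Kf_mono[OF _ freeJ_Kf[OF \<tau>B_pow[OF ij]]] by blast
  qed
qed (auto simp: \<tau>B_nth freepar_gen intro!: freeC_gen)

lemma geometric_inverse_A: "m \<noteq> n ==> geometric_inverse m n \<tau>A"
proof
  show "(\<lambda>k. mat_pow {1..m+n} \<tau>A k i j $ q) \<in> Fnull m n" if ij: "i \<in> {1..m+n}" "j \<in> {1..m+n}" for i j q
  proof (rule FnullI)
    show "mat_pow {1..m+n} \<tau>A k i j $ q \<in> freeC m n" for k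
      using \<tau>A_pow[OF ij] freeG_mono[of "yangian_gens m n" "dy_gens m n"] unfolding freeC_eq by (auto simp: dy_gens_def)
    show "\<exists>N. \<forall>k\<ge>N. mat_pow {1..m+n} \<tau>A k i j $ q \<in> Kf m n p" for p
      using \<tau>A_pow[OF ij] by (intro exI[of _ "Suc q"]) (auto simp: Kf_0)
  qed
qed (auto simp: \<tau>A_nth freepar_gen freepar_minus sg_minus intro!: freeC_gen freeC_minus)

section \<open>The extended double Yangian inside the completion\<close>

lemma subalg_gen_DY:
  assumes G: "G \<subseteq> dy_gens m n"
  shows "subalg_gen (DY m n) ((\<lambda>x. dy_class m n (gen_el x)) ` G) = dy_class m n ` freeG G" (is "?R = _")
proof
  interpret D: ring "DY m n" by (rule ring_DY)
  have sub: "f \<in> freeG G ==> f \<in> freeC m n" for f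
    using freeG_mono[OF G] by (auto simp: freeC_eq)
  show "?R \<subseteq> dy_class m n ` freeG G"
  proof
    fix x assume "x \<in> ?R"
    then show "x \<in> dy_class m n ` freeG G"
      unfolding subalg_gen_def
    proof (induction rule: generate_ring.induct)
      case one
      show ?case unfolding dy_class_1 by (intro imageI freeG_simps)
    next
      case (incl h)
      then show ?case by (auto simp: DY_scal intro!: imageI freeG_simps)
    next
      case (a_inv h)
      then show ?case using sub by (auto simp: dy_class_neg intro!: imageI freeG_simps)
    next
      case (eng_add h1 h2)
      then show ?case using sub by (auto simp: dy_class_add intro!: imageI freeG_simps)
    next
      case (eng_mult h1 h2)
      then show ?case using sub by (auto simp: dy_class_mult intro!: imageI freeG_simps)
    qed
  qed
  have word: "wmono (FWord gs) \<in> freeC m n \<and> dy_class m n (wmono (FWord gs)) \<in> ?R" if "set gs \<subseteq> G" for gs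
    using that
  proof (induction gs)
    case Nil
    show ?case using generate_ring.one[of "DY m n"] by (simp add: wmono_Nil subalg_gen_def dy_class_1)
  next
    case (Cons g gs)
    then have g: "gen_el g \<in> freeC m n" "g \<in> G" and IH: "wmono (FWord gs) \<in> freeC m n" "dy_class m n (wmono (FWord gs)) \<in> ?R"
      using G by (auto intro!: freeC_gen)
    have "dy_class m n (gen_el g) \<in> ?R"
      unfolding subalg_gen_def using g by (intro generate_ring.incl) auto
    then have "dy_class m n (gen_el g) \<otimes>\<^bsub>DY m n\<^esub> dy_class m n (wmono (FWord gs)) \<in> ?R"
      using IH unfolding subalg_gen_def by (intro generate_ring.eng_mult)
    then show ?case using g IH by (simp add: wmono_Cons dy_class_mult freeC_mult)
  qed
  have single: "dy_class m n (Poly_Mapping.single w c) \<in> ?R" if "set (letters w) \<subseteq> G" for w c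
  proof -
    have w: "wmono w \<in> freeC m n" "dy_class m n (wmono w) \<in> ?R" using word[of "letters w"] that by simp_all
    have "dy_class m n (cst c) \<in> ?R"
      unfolding subalg_gen_def DY_scal[symmetric] by (intro generate_ring.incl) auto
    then have "dy_class m n (wmono w) \<otimes>\<^bsub>DY m n\<^esub> dy_class m n (cst c) \<in> ?R"
      using w unfolding subalg_gen_def by (intro generate_ring.eng_mult)
    then show ?thesis unfolding single_wmono[of w] using w by (simp add: dy_class_mult)
  qed
  show "dy_class m n ` freeG G \<subseteq> ?R"
  proof
    fix x assume "x \<in> dy_class m n ` freeG G"
    then obtain f where f: "f \<in> freeG G" "x = dy_class m n f" by blast
    have "(\<Sum>w\<in>S. Poly_Mapping.single w (Poly_Mapping.lookup f w)) \<in> freeC m n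
	\<and> dy_class m n (\<Sum>w\<in>S. Poly_Mapping.single w (Poly_Mapping.lookup f w)) \<in> ?R"
      if "finite S" "S \<subseteq> Poly_Mapping.keys f" for S
      using that
    proof (induction S)
      case empty
      show ?case using D.zero_in_generate by (simp add: subalg_gen_def dy_class_0)
    next
      case (insert w S)
      then have w: "set (letters w) \<subseteq> G" using f by (auto simp: freeG_def)
      then have wc: "Poly_Mapping.single w c \<in> freeC m n" for c using G by (intro freeC_single) auto
      show ?case using insert single[OF w] wc generate_ring.eng_add[of _ "DY m n"]
	by (auto simp: dy_class_add[symmetric] subalg_gen_def freeC_add)
    qed
    from this[OF finite_keys order_refl] show "x \<in> ?R"
      unfolding f(2) poly_mapping_decomp[of f, symmetric] by blast
  qed
qed

lemma yangian_eq: "yangian m n = dy_class m n ` freeG (yangian_gens m n)"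
  unfolding yangian_def by (rule subalg_gen_DY) (auto simp: dy_gens_def)

lemma dual_yangian_eq: "dual_yangian m n = dy_class m n ` freeG (plus_gens m n)"
  unfolding dual_yangian_def by (rule subalg_gen_DY) (auto simp: dy_gens_def)

lemma freeJ_freeC: "f \<in> freeJ m n p ==> f \<in> freeC m n"
  by (rule Kf_closed[OF freeJ_Kf])

lemma dual_filt_eq: "dual_yangian_filt m n p = dy_class m n ` freeJ m n p"
proof
  interpret D: ring "DY m n" by (rule ring_DY)
  let ?G = "{dy_class m n (Poly_Mapping.single w c) | w c. set (letters w) \<subseteq> plus_gens m n \<and> p \<le> word_degree w}"
  have gens: "h \<in> dy_class m n ` freeJ m n p" if "h \<in> ?G" for h
    using that by (auto simp: freeJ_def intro!: imageI split: if_splits)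
  show "dual_yangian_filt m n p \<subseteq> dy_class m n ` freeJ m n p"
  proof
    fix x assume "x \<in> dual_yangian_filt m n p"
    then show "x \<in> dy_class m n ` freeJ m n p"
      unfolding dual_yangian_filt_def
    proof (induction rule: generate.induct)
      case one
      show ?case using freeJ_simps(1)[of m n p] dy_class_0[of m n] by auto
    next
      case (incl h)
      then show ?case by (rule gens)
    next
      case (inv h)
      then obtain f where "f \<in> freeJ m n p" "h = dy_class m n f" using gens by blast
      then show ?case using freeJ_freeC[of f m n p]
	by (auto simp: a_inv_def[symmetric] dy_class_neg intro!: imageI freeJ_simps(1,3,4))
    next
      case (eng h1 h2)
      then obtain f g where "f \<in> freeJ m n p" "h1 = dy_class m n f" "g \<in> freeJ m n p" "h2 = dy_class m n g" by blast
      then show ?case using freeJ_freeC[of f m n p] freeJ_freeC[of g m n p]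
	by (auto simp: dy_class_add intro!: imageI freeJ_simps(1,3,4))
    qed
  qed
  show "dy_class m n ` freeJ m n p \<subseteq> dual_yangian_filt m n p"
  proof
    fix x assume "x \<in> dy_class m n ` freeJ m n p"
    then obtain f where f: "f \<in> freeJ m n p" "x = dy_class m n f" by blast
    have "(\<Sum>w\<in>S. Poly_Mapping.single w (Poly_Mapping.lookup f w)) \<in> freeC m n
	\<and> dy_class m n (\<Sum>w\<in>S. Poly_Mapping.single w (Poly_Mapping.lookup f w)) \<in> dual_yangian_filt m n p"
      if "finite S" "S \<subseteq> Poly_Mapping.keys f" for S
      using that
    proof (induction S)
      case empty
      show ?case using subgroup.one_closed[OF dual_filt_subgroup[of m n p]] by (simp add: dy_class_0)
    next
      case (insert w S)
      then have w: "set (letters w) \<subseteq> plus_gens m n" "p \<le> word_degree w" using f by (auto simp: freeJ_def)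
      then have wc: "Poly_Mapping.single w c \<in> freeC m n" for c
	using plus_gens_subset[of m n] by (intro freeC_single) auto
      have "dy_class m n (Poly_Mapping.single w c) \<in> dual_yangian_filt m n p" for c
	unfolding dual_yangian_filt_def using w by (intro generate.incl) auto
      then show ?case using insert wc subgroup.m_closed[OF dual_filt_subgroup[of m n p]]
	by (auto simp: dy_class_add[symmetric] freeC_add)
    qed
    from this[OF finite_keys order_refl] show "x \<in> dual_yangian_filt m n p"
      unfolding f(2) poly_mapping_decomp[of f, symmetric] by blast
  qed
qed

subsection \<open>Completion of the dual Yangian\<close>

text \<open>The filtration of the dual Yangian itself, pulled back to words.
  \<open>ext_dual_yangian\<close> is completed with respect to it and not to \<open>dy_filt\<close>;
  the inclusion \<open>JC_Kf\<close> maps one completion to the other. Inside the dual Yangian these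
  are two-sided ideals (\<open>JC_mult\<close>), so products of limits cause no difficulty.\<close>

definition JC :: "nat => nat => nat => free_el set" where
  "JC m n p = {f \<in> freeG (plus_gens m n). \<exists>g\<in>freeJ m n p. f - g \<in> dy_ideal m n}"

lemma plus_freeC: "f \<in> freeG (plus_gens m n) ==> f \<in> freeC m n"
  using freeG_mono[OF plus_gens_subset[of m n]] by (auto simp: freeC_eq)

lemma JC_iff: "f \<in> JC m n p \<longleftrightarrow> f \<in> freeG (plus_gens m n) \<and> dy_class m n f \<in> dual_yangian_filt m n p"
  using plus_freeC freeJ_freeC unfolding JC_def dual_filt_eq by (auto simp: dy_class_eq_iff image_iff)

lemma JC_add: "f \<in> JC m n p ==> g \<in> JC m n p ==> f + g \<in> JC m n p"
proof -
  assume "f \<in> JC m n p" "g \<in> JC m n p"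
  then obtain f' g' where *: "f \<in> freeG (plus_gens m n)" "g \<in> freeG (plus_gens m n)" "f' \<in> freeJ m n p" "g' \<in> freeJ m n p"
      "f - f' \<in> dy_ideal m n" "g - g' \<in> dy_ideal m n"
    unfolding JC_def by blast
  then have "(f + g) - (f' + g') \<in> dy_ideal m n"
    using dy_ideal_add[of "f - f'" m n "g - g'"] by (simp add: algebra_simps)
  then show ?thesis unfolding JC_def using * by (auto intro!: freeG_simps bexI[of _ "f' + g'"] freeJ_simps(1,3,4,6))
qed

lemma JC_par: "f \<in> JC m n p ==> freepar m f \<in> JC m n p"
proof -
  assume "f \<in> JC m n p"
  then obtain f' where *: "f \<in> freeG (plus_gens m n)" "f' \<in> freeJ m n p" "f - f' \<in> dy_ideal m n"
    unfolding JC_def by blast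
  then have "freepar m f - freepar m f' \<in> dy_ideal m n"
    using freepar_ideal[of "f - f'" m n] by (simp add: freepar_diff)
  then show ?thesis unfolding JC_def using * by (auto intro!: freeG_simps bexI[of _ "freepar m f'"] freeJ_simps(1,3,4,6))
qed

lemma JC_mult:
  assumes "f \<in> JC m n p" and g: "g \<in> freeG (plus_gens m n)"
  shows "f * g \<in> JC m n p" "g * f \<in> JC m n p"
proof -
  obtain f' where *: "f \<in> freeG (plus_gens m n)" "f' \<in> freeJ m n p" "f - f' \<in> dy_ideal m n"
    using assms unfolding JC_def by blast
  have g0: "g \<in> freeJ m n 0" using g by (simp add: freeJ_simps(8))
  have "f * g - f' * g \<in> dy_ideal m n" "g * f - g * f' \<in> dy_ideal m n"
    using dy_ideal_mult_right[OF *(3) plus_freeC[OF g]] dy_ideal_mult_left[OF *(3) plus_freeC[OF g]]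
    by (simp_all add: algebra_simps)
  moreover have "f' * g \<in> freeJ m n p" "g * f' \<in> freeJ m n p"
    using freeJ_simps(5)[OF *(2) g0] freeJ_simps(5)[OF g0 *(2)] by simp_all
  ultimately show "f * g \<in> JC m n p" "g * f \<in> JC m n p"
    unfolding JC_def using * g by (auto intro!: freeG_simps)
qed

lemma JC_0: "0 \<in> JC m n p"
  using subgroup.one_closed[OF dual_filt_subgroup[of m n p]] by (simp add: JC_iff freeG_simps dy_class_0)

lemma JC_minus: "f \<in> JC m n p ==> - f \<in> JC m n p"
  using JC_mult(1)[of f m n p "- 1"] by (simp add: freeG_simps)

lemma JC_Kf: "f \<in> JC m n p ==> f \<in> Kf m n p"
  unfolding JC_def by (auto intro: Kf_cong freeJ_Kf)

definition FX :: "nat => nat => (nat => free_el) set" where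
  "FX m n = {f. (\<forall>k. f k \<in> freeG (plus_gens m n)) \<and> (\<forall>p. \<exists>N. \<forall>k\<ge>N. \<forall>l\<ge>N. f k - f l \<in> JC m n p)}"

lemma FX_FC: "f \<in> FX m n ==> f \<in> FC m n"
  unfolding FX_def FC_def using plus_freeC JC_Kf by blast

lemma FX_const: "c \<in> freeG (plus_gens m n) ==> (\<lambda>_. c) \<in> FX m n"
  by (simp add: FX_def JC_0)

lemma FX_add: "f \<in> FX m n ==> g \<in> FX m n ==> (\<lambda>k. f k + g k) \<in> FX m n"
proof -
  assume f: "f \<in> FX m n" and g: "g \<in> FX m n"
  have "\<exists>N. \<forall>k\<ge>N. \<forall>l\<ge>N. (f k + g k) - (f l + g l) \<in> JC m n p" for p
  proof -
    obtain N1 N2 where N: "\<forall>k\<ge>N1. \<forall>l\<ge>N1. f k - f l \<in> JC m n p" "\<forall>k\<ge>N2. \<forall>l\<ge>N2. g k - g l \<in> JC m n p"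
      using f g unfolding FX_def by blast
    have "(f k + g k) - (f l + g l) \<in> JC m n p" if "k \<ge> max N1 N2" "l \<ge> max N1 N2" for k l
      using JC_add[of "f k - f l" m n p "g k - g l"] N that by (simp add: algebra_simps)
    then show ?thesis by blast
  qed
  then show ?thesis using f g by (auto simp: FX_def intro!: freeG_simps)
qed

lemma FX_mult: "f \<in> FX m n ==> g \<in> FX m n ==> (\<lambda>k. f k * g k) \<in> FX m n"
proof -
  assume f: "f \<in> FX m n" and g: "g \<in> FX m n"
  have fc: "f k \<in> freeG (plus_gens m n)" "g k \<in> freeG (plus_gens m n)" for k
    using f g by (auto simp: FX_def)
  have "\<exists>N. \<forall>k\<ge>N. \<forall>l\<ge>N. f k * g k - f l * g l \<in> JC m n p" for p
  proof -
    obtain N1 N2 where N: "\<forall>k\<ge>N1. \<forall>l\<ge>N1. f k - f l \<in> JC m n p" "\<forall>k\<ge>N2. \<forall>l\<ge>N2. g k - g l \<in> JC m n p"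
      using f g unfolding FX_def by blast
    have "f k * g k - f l * g l \<in> JC m n p" if "k \<ge> max N1 N2" "l \<ge> max N1 N2" for k l
      using JC_add[OF JC_mult(2)[of "g k - g l" m n p "f k"] JC_mult(1)[of "f k - f l" m n p "g l"]] N that fc
      by (simp add: algebra_simps)
    then show ?thesis by blast
  qed
  then show ?thesis using fc by (auto simp: FX_def intro!: freeG_simps)
qed

lemma FX_par: "f \<in> FX m n ==> (\<lambda>k. freepar m (f k)) \<in> FX m n"
proof -
  assume f: "f \<in> FX m n"
  have "\<exists>N. \<forall>k\<ge>N. \<forall>l\<ge>N. freepar m (f k) - freepar m (f l) \<in> JC m n p" for p
  proof -
    obtain N1 where "\<forall>k\<ge>N1. \<forall>l\<ge>N1. f k - f l \<in> JC m n p" using f unfolding FX_def by blast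
    then have "\<forall>k\<ge>N1. \<forall>l\<ge>N1. freepar m (f k) - freepar m (f l) \<in> JC m n p"
      by (simp add: freepar_diff[symmetric] JC_par)
    then show ?thesis by blast
  qed
  then show ?thesis using f by (auto simp: FX_def intro!: freeG_simps)
qed

lemma FX_minus: "f \<in> FX m n ==> (\<lambda>k. - f k) \<in> FX m n"
  using FX_mult[OF FX_const[of "- 1" m n]] by (simp add: freeG_simps)

lemma ext_dual_eq: "ext_dual_yangian m n = flim m n ` FX m n"
proof -
  have F: "(\<lambda>k. dy_class m n (f k)) \<in> cauchy_seqs (DY m n) (dual_yangian_filt m n) \<longleftrightarrow> f \<in> FX m n"
    if "\<forall>k. f k \<in> freeG (plus_gens m n)" for f
  proof -
    have "dy_class m n (f k) \<ominus>\<^bsub>DY m n\<^esub> dy_class m n (f l) \<in> dual_yangian_filt m n p \<longleftrightarrow> f k - f l \<in> JC m n p" for k l p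
      using that plus_freeC[of "f k"] plus_freeC[of "f l"] freeG_simps(5)[of "f k" "plus_gens m n" "- f l"]
      by (simp add: JC_iff dy_class_minus freeG_simps)
    then show ?thesis using that plus_freeC by (auto simp: cauchy_seqs_def FX_def dy_class_closed)
  qed
  show ?thesis
  proof
    show "ext_dual_yangian m n \<subseteq> flim m n ` FX m n"
    proof
      fix x assume "x \<in> ext_dual_yangian m n"
      then obtain y where y: "x = dy_limit m n y" "y \<in> cauchy_seqs (DY m n) (dual_yangian_filt m n)" "\<forall>k. y k \<in> dual_yangian m n"
	by (auto simp: ext_dual_yangian_def)
      then obtain f where f: "!!k. f k \<in> freeG (plus_gens m n)" "!!k. y k = dy_class m n (f k)"
	unfolding dual_yangian_eq image_iff by metis
      then have "y = (\<lambda>k. dy_class m n (f k))" by auto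
      then show "x \<in> flim m n ` FX m n" using y f F by (auto simp: flim_def)
    qed
    show "flim m n ` FX m n \<subseteq> ext_dual_yangian m n"
    proof
      fix x assume "x \<in> flim m n ` FX m n"
      then obtain f where f: "f \<in> FX m n" "x = flim m n f" by blast
      then have c: "\<forall>k. f k \<in> freeG (plus_gens m n)" by (simp add: FX_def)
      then show "x \<in> ext_dual_yangian m n"
	unfolding ext_dual_yangian_def f(2) flim_def using F[OF c] f(1)
	by (intro imageI CollectI conjI) (auto simp: dual_yangian_eq)
    qed
  qed
qed

context
  fixes m n :: nat
  assumes mn: "m \<noteq> n"
begin

abbreviation "Hh \<equiv> DY_hat m n"
abbreviation "YH \<equiv> dy_embed m n ` yangian m n"
abbreviation "XH \<equiv> ext_dual_yangian m n"
abbreviation "E \<equiv> ext_DY m n"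
abbreviation "DD \<equiv> carrier (ext_DY m n)"
abbreviation "CH \<equiv> subalg_gen Hh {dy_embed m n (dy_class m n (gen_el CGen))}"

interpretation Hh: ring "DY_hat m n"
  by (rule ring_DY_hat[OF mn])

lemma dy_embed_flim: "dy_embed m n (dy_class m n f) = flim m n (\<lambda>_. f)"
  by (simp add: dy_embed_def flim_def)

lemma YH_eq: "YH = (\<lambda>f. flim m n (\<lambda>_. f)) ` freeG (yangian_gens m n)"
  unfolding yangian_eq image_image dy_embed_flim ..

lemma yang_freeC: "f \<in> freeG (yangian_gens m n) ==> f \<in> freeC m n"
  using freeG_mono[of "yangian_gens m n" "dy_gens m n"] by (auto simp: freeC_eq dy_gens_def)

definition subring_par :: "(nat => free_el set) set set => bool" where
  "subring_par U \<longleftrightarrow> U \<subseteq> carrier Hh \<and> \<zero>\<^bsub>Hh\<^esub> \<in> U \<and> \<one>\<^bsub>Hh\<^esub> \<in> U \<and> (\<forall>x\<in>U. \<ominus>\<^bsub>Hh\<^esub> x \<in> U \<and> par Hh x \<in> U)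
     \<and> (\<forall>x\<in>U. \<forall>y\<in>U. x \<oplus>\<^bsub>Hh\<^esub> y \<in> U \<and> x \<otimes>\<^bsub>Hh\<^esub> y \<in> U)"

lemma subring_par_flim:
  assumes "S \<subseteq> FC m n" "(\<lambda>_. 0) \<in> S" "(\<lambda>_. 1) \<in> S"
    and "!!f. f \<in> S ==> (\<lambda>k. - f k) \<in> S" "!!f. f \<in> S ==> (\<lambda>k. freepar m (f k)) \<in> S"
    and "!!f g. f \<in> S ==> g \<in> S ==> (\<lambda>k. f k + g k) \<in> S" "!!f g. f \<in> S ==> g \<in> S ==> (\<lambda>k. f k * g k) \<in> S"
  shows "subring_par (flim m n ` S)"
  unfolding subring_par_def
proof (intro conjI ballI)
  have S: "f \<in> S ==> f \<in> FC m n" for f using assms(1) by blast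
  show "flim m n ` S \<subseteq> carrier Hh" using S by (auto simp: flim_closed[OF mn])
  show "\<zero>\<^bsub>Hh\<^esub> \<in> flim m n ` S" "\<one>\<^bsub>Hh\<^esub> \<in> flim m n ` S"
    using assms(2,3) by (auto simp: flim_0[OF mn] flim_1[OF mn])
  fix x assume "x \<in> flim m n ` S"
  then obtain f where f: "f \<in> S" "x = flim m n f" by blast
  show "\<ominus>\<^bsub>Hh\<^esub> x \<in> flim m n ` S" using f S assms(4) by (auto simp: flim_neg[OF mn])
  show "par Hh x \<in> flim m n ` S" using f S assms(5) by (auto simp: DY_hat_par[OF mn])
  fix y assume "y \<in> flim m n ` S"
  then obtain g where g: "g \<in> S" "y = flim m n g" by blast
  show "x \<oplus>\<^bsub>Hh\<^esub> y \<in> flim m n ` S" using f g S assms(6) by (auto simp: flim_add[OF mn])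
  show "x \<otimes>\<^bsub>Hh\<^esub> y \<in> flim m n ` S" using f g S assms(7) by (auto simp: flim_mult[OF mn])
qed

lemma subring_par_YH: "subring_par YH"
proof -
  have "YH = flim m n ` ((\<lambda>f _. f) ` freeG (yangian_gens m n))"
    unfolding YH_eq by (simp add: image_image)
  also have "subring_par \<dots>"
    by (rule subring_par_flim) (auto simp: FC_const yang_freeC freeG_simps)
  finally show ?thesis .
qed

lemma subring_par_XH: "subring_par XH"
  unfolding ext_dual_eq
  by (rule subring_par_flim) (auto simp: FX_FC FX_add FX_mult FX_minus FX_par freeG_simps intro!: FX_const)

text \<open>Polynomials in \<open>C\<close> are limits of constant sequences of even elements that
  are central modulo the ideal; so they can be moved across any factor and are fixed by the grading
  involution.\<close>

lemma CH_elem: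
  assumes "c \<in> CH"
  shows "\<exists>f. modcentral m n f \<and> freepar m f = f \<and> c = flim m n (\<lambda>_. f)"
  using assms unfolding subalg_gen_def
proof (induction rule: generate_ring.induct)
  case one
  show ?case using modcentral_cst[of m n 1] by (intro exI[of _ 1]) (simp add: flim_1[OF mn])
next
  case (incl h)
  then consider c where "h = scal Hh c" | "h = flim m n (\<lambda>_. gen_el CGen)"
    by (auto simp: dy_embed_flim)
  then show ?case
  proof cases
    case 1
    then show ?thesis using modcentral_cst by (intro exI[of _ "cst c"]) (simp add: DY_hat_scal[OF mn])
  next
    case 2
    then show ?thesis using modcentral_CGen by (intro exI[of _ "gen_el CGen"]) (simp add: freepar_gen)
  qed
next
  case (a_inv h)
  then obtain f where f: "modcentral m n f" "freepar m f = f" "h = flim m n (\<lambda>_. f)" by blast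
  have "cst (- 1) * f = - f" by (simp add: single_uminus)
  then have "modcentral m n (- f)" using modcentral_mult[OF modcentral_cst[of m n "- 1"] f(1)] by simp
  then show ?case using f
    by (intro exI[of _ "- f"]) (auto simp: flim_neg[OF mn] freepar_minus modcentral_def FC_const)
next
  case (eng_add h1 h2)
  then obtain f g where "modcentral m n f" "freepar m f = f" "h1 = flim m n (\<lambda>_. f)"
    "modcentral m n g" "freepar m g = g" "h2 = flim m n (\<lambda>_. g)" by blast
  then show ?case
    by (intro exI[of _ "f + g"] conjI modcentral_add) (auto simp: flim_add[OF mn] freepar_add modcentral_def FC_const)
next
  case (eng_mult h1 h2)
  then obtain f g where "modcentral m n f" "freepar m f = f" "h1 = flim m n (\<lambda>_. f)"
    "modcentral m n g" "freepar m g = g" "h2 = flim m n (\<lambda>_. g)" by blast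
  then show ?case
    by (intro exI[of _ "f * g"] conjI modcentral_mult) (auto simp: flim_mult[OF mn] freepar_mult modcentral_def FC_const)
qed

lemma CH_facts:
  assumes "c \<in> CH"
  shows "c \<in> carrier Hh" "par Hh c = c" "x \<in> carrier Hh ==> c \<otimes>\<^bsub>Hh\<^esub> x = x \<otimes>\<^bsub>Hh\<^esub> c"
proof -
  obtain f where f: "modcentral m n f" "freepar m f = f" "c = flim m n (\<lambda>_. f)" using CH_elem[OF assms] by blast
  then have "(\<lambda>_. f) \<in> FC m n" by (auto simp: modcentral_def FC_const)
  then show "c \<in> carrier Hh" "par Hh c = c" "x \<in> carrier Hh ==> c \<otimes>\<^bsub>Hh\<^esub> x = x \<otimes>\<^bsub>Hh\<^esub> c"
    using f by (auto simp: flim_closed[OF mn] DY_hat_par[OF mn] flim_modcentral[OF mn])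
qed

lemma Hh_par:
  "x \<in> carrier Hh ==> par Hh x \<in> carrier Hh"
  "x \<in> carrier Hh ==> y \<in> carrier Hh ==> par Hh (x \<oplus>\<^bsub>Hh\<^esub> y) = par Hh x \<oplus>\<^bsub>Hh\<^esub> par Hh y"
  "x \<in> carrier Hh ==> y \<in> carrier Hh ==> par Hh (x \<otimes>\<^bsub>Hh\<^esub> y) = par Hh x \<otimes>\<^bsub>Hh\<^esub> par Hh y"
  using dyr_par(1-3)[where m = m and n = n] by (simp_all add: dyr_neq[OF mn])

lemma YH_carrier: "y \<in> YH ==> y \<in> carrier Hh" and XH_carrier: "y \<in> XH ==> y \<in> carrier Hh"
  using subring_par_YH subring_par_XH unfolding subring_par_def by blast+

abbreviation "GE \<equiv> {c \<otimes>\<^bsub>Hh\<^esub> x \<otimes>\<^bsub>Hh\<^esub> y | c x y. c \<in> CH \<and> x \<in> XH \<and> y \<in> YH}"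

lemma E_ops: "mult E = mult Hh" "add E = add Hh" "one E = one Hh" "zero E = zero Hh" "par E = par Hh"
    "DD = generate (add_monoid Hh) GE"
  by (simp_all add: ext_DY_def)

lemma GE_carrier: "GE \<subseteq> carrier Hh"
  using CH_facts(1) YH_carrier XH_carrier by auto

section \<open>The extended double Yangian as a bimodule\<close>

lemma DD_subgroup: "subgroup DD (add_monoid Hh)"
  unfolding E_ops by (rule Hh.add.generate_is_subgroup) (use GE_carrier in simp)

lemma DD_carrier: "x \<in> DD ==> x \<in> carrier Hh"
  using subgroup.mem_carrier[OF DD_subgroup] by simp

lemma DD_zero: "\<zero>\<^bsub>Hh\<^esub> \<in> DD"
  using subgroup.one_closed[OF DD_subgroup] by simp

lemma DD_add: "x \<in> DD ==> y \<in> DD ==> x \<oplus>\<^bsub>Hh\<^esub> y \<in> DD"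
  using subgroup.m_closed[OF DD_subgroup] by simp

lemma DD_neg: "x \<in> DD ==> \<ominus>\<^bsub>Hh\<^esub> x \<in> DD"
  using subgroup.m_inv_closed[OF DD_subgroup] by (simp add: a_inv_def)

lemma DD_gen: "c \<in> CH ==> x \<in> XH ==> y \<in> YH ==> c \<otimes>\<^bsub>Hh\<^esub> x \<otimes>\<^bsub>Hh\<^esub> y \<in> DD"
  unfolding E_ops by (rule generate.incl) blast

lemma CH_one: "\<one>\<^bsub>Hh\<^esub> \<in> CH"
  unfolding subalg_gen_def by (rule generate_ring.one)

lemma YH_DD: "YH \<subseteq> DD" and XH_DD: "XH \<subseteq> DD"
proof -
  have 1: "\<one>\<^bsub>Hh\<^esub> \<in> XH" "\<one>\<^bsub>Hh\<^esub> \<in> YH"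
    using subring_par_YH subring_par_XH unfolding subring_par_def by blast+
  show "YH \<subseteq> DD"
    using DD_gen[OF CH_one 1(1)] YH_carrier by fastforce
  show "XH \<subseteq> DD"
    using DD_gen[OF CH_one _ 1(2)] XH_carrier by fastforce
qed

lemma DD_induct [consumes 1, case_names zero gen add neg]:
  assumes x: "x \<in> DD"
    and zero: "P \<zero>\<^bsub>Hh\<^esub>"
    and gen: "!!c x y. c \<in> CH ==> x \<in> XH ==> y \<in> YH ==> P (c \<otimes>\<^bsub>Hh\<^esub> x \<otimes>\<^bsub>Hh\<^esub> y)"
    and add: "!!x y. x \<in> carrier Hh ==> y \<in> carrier Hh ==> P x ==> P y ==> P (x \<oplus>\<^bsub>Hh\<^esub> y)"
    and neg: "!!x. x \<in> carrier Hh ==> P x ==> P (\<ominus>\<^bsub>Hh\<^esub> x)"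
  shows "P x"
proof -
  have "x \<in> generate (add_monoid Hh) GE" using x by (simp only: E_ops)
  then have "P x \<and> x \<in> carrier Hh"
  proof (induction rule: generate.induct)
    case one
    show ?case using zero by simp
  next
    case (incl h)
    then show ?case using gen GE_carrier by blast
  next
    case (inv h)
    then have "h \<in> carrier Hh" "P h" using gen GE_carrier by blast+
    then show ?case using neg by (simp add: a_inv_def[symmetric])
  next
    case (eng h1 h2)
    then show ?case using add by simp
  qed
  then show ?thesis ..
qed

lemma Hh_par_0: "par Hh \<zero>\<^bsub>Hh\<^esub> = \<zero>\<^bsub>Hh\<^esub>"
  by (simp add: flim_0[OF mn] DY_hat_par[OF mn] FC_const)

lemma Hh_par_neg: "x \<in> carrier Hh ==> par Hh (\<ominus>\<^bsub>Hh\<^esub> x) = \<ominus>\<^bsub>Hh\<^esub> par Hh x"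
  using Hh_par(2)[of "\<ominus>\<^bsub>Hh\<^esub> x" x] Hh_par(1)[of x] Hh_par(1)[of "\<ominus>\<^bsub>Hh\<^esub> x"]
  by (intro Hh.minus_equality[symmetric]) (simp_all add: Hh.l_neg Hh_par_0)

lemma DD_par:
  assumes "x \<in> DD"
  shows "par Hh x \<in> DD"
  using assms
proof (induction rule: DD_induct)
  case (gen c x y)
  have "par Hh x \<in> XH" "par Hh y \<in> YH"
    using gen subring_par_YH subring_par_XH unfolding subring_par_def by blast+
  then show ?case using CH_facts(1,2)[OF gen(1)] gen(2,3) XH_carrier[of x] YH_carrier[of y] DD_gen[OF gen(1)]
    by (simp add: Hh_par)
qed (simp_all add: Hh_par Hh_par_0 Hh_par_neg DD_zero DD_add DD_neg)

text \<open>The span of the products \<open>c x y\<close> is visibly stable under the Yangian on the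
  right, and by \<open>XH_DD_mult\<close> under the extended dual Yangian on the left. General
  products would require a reordering of \<open>y x\<close>.\<close>

lemma DD_YH:
  assumes "x \<in> DD" and y: "y \<in> YH"
  shows "x \<otimes>\<^bsub>Hh\<^esub> y \<in> DD"
  using assms(1)
proof (induction rule: DD_induct)
  case (gen c x' y')
  have "y' \<otimes>\<^bsub>Hh\<^esub> y \<in> YH" using gen y subring_par_YH unfolding subring_par_def by blast
  then have "c \<otimes>\<^bsub>Hh\<^esub> x' \<otimes>\<^bsub>Hh\<^esub> (y' \<otimes>\<^bsub>Hh\<^esub> y) \<in> DD" by (rule DD_gen[OF gen(1,2)])
  then show ?case using CH_facts(1)[OF gen(1)] XH_carrier[OF gen(2)] YH_carrier[OF gen(3)] YH_carrier[OF y]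
    by (simp add: Hh.m_assoc)
qed (use YH_carrier[OF y] in \<open>simp_all add: DD_zero DD_add DD_neg Hh.l_distr Hh.l_minus\<close>)

lemma XH_DD_mult:
  assumes x: "x \<in> XH" and "y \<in> DD"
  shows "x \<otimes>\<^bsub>Hh\<^esub> y \<in> DD"
  using assms(2)
proof (induction rule: DD_induct)
  case (gen c x' y')
  note cl = CH_facts(1)[OF gen(1)] XH_carrier[OF gen(2)] YH_carrier[OF gen(3)] XH_carrier[OF x]
  have "x \<otimes>\<^bsub>Hh\<^esub> x' \<in> XH" using gen x subring_par_XH unfolding subring_par_def by blast
  then have "c \<otimes>\<^bsub>Hh\<^esub> (x \<otimes>\<^bsub>Hh\<^esub> x') \<otimes>\<^bsub>Hh\<^esub> y' \<in> DD" by (rule DD_gen[OF gen(1) _ gen(3)])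
  moreover have "c \<otimes>\<^bsub>Hh\<^esub> (x \<otimes>\<^bsub>Hh\<^esub> x') = x \<otimes>\<^bsub>Hh\<^esub> (c \<otimes>\<^bsub>Hh\<^esub> x')"
    using cl CH_facts(3)[OF gen(1) cl(4)] by (simp add: Hh.m_assoc[symmetric])
  ultimately show ?case using cl by (simp add: Hh.m_assoc)
qed (use XH_carrier[OF x] in \<open>simp_all add: DD_zero DD_add DD_neg Hh.r_distr Hh.r_minus\<close>)

end

lemma (in abelian_group) finsum_in_subset:
  assumes W: "W \<subseteq> carrier G" "\<zero> \<in> W" "!!x y. x \<in> W ==> y \<in> W ==> x \<oplus> y \<in> W"
    and f: "!!t. t \<in> T ==> f t \<in> W"
  shows "finsum G f T \<in> W"
  using f
proof (induction T rule: infinite_finite_induct)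
  case (insert t T)
  have "f \<in> T \<rightarrow> carrier G" "f t \<in> carrier G" using insert.prems W(1) by auto
  then have "finsum G f (insert t T) = f t \<oplus> finsum G f T"
    using insert.hyps by (intro finsum_insert)
  then show ?case using insert W(3) by simp
qed (simp_all add: W finsum_infinite)

subsection \<open>Matrices over power series\<close>

definition pfps :: "dyp fps => dyp fps" where
  "pfps f = Abs_fps (\<lambda>k. par_dyp (f $ k))"

lemma pfps_0: "pfps 0 = 0"
  using par_dyp_add[of 0 0] by (intro fps_ext) (simp add: pfps_def)

lemma pfps_add: "pfps (f + g) = pfps f + pfps g"
  by (rule fps_ext) (simp add: pfps_def par_dyp_add)

lemma par_dyp_sum: "par_dyp (sum f S) = (\<Sum>x\<in>S. par_dyp (f x))"
  using par_dyp_add[of 0 0] by (induction S rule: infinite_finite_induct) (simp_all add: par_dyp_add)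

lemma pfps_mult: "pfps (f * g) = pfps f * pfps g"
  by (rule fps_ext) (simp add: pfps_def fps_mult_nth par_dyp_sum par_dyp_mult)

lemma pfps_pfps [simp]: "pfps (pfps f) = f"
  by (rule fps_ext) (simp add: pfps_def)

interpretation pfps: rng_hom pfps
  by standard (simp_all add: pfps_add pfps_mult)

lemma pfps_pow_hom: "rng_hom (pfps ^^ e)"
  by standard (induction e; simp add: pfps_add pfps_mult)+

lemma pfps_pow_homog:
  assumes "pfps x = sg d x"
  shows "(pfps ^^ e) x = sg (e * d) x"
  by (induction e) (simp_all add: pfps.h_sg assms add.commute)

lemma pfps_pow_0 [simp]: "(pfps ^^ e) 0 = 0"
  using pfps_pow_homog[of 0 0 e] pfps_0 by simp

context
  fixes m n :: nat
  assumes mn: "m \<noteq> n"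
begin

interpretation Hh: ring "DY_hat m n"
  by (rule ring_DY_hat[OF mn])

abbreviation "H \<equiv> DY_hat m n"
abbreviation "D \<equiv> carrier (ext_DY m n)"
abbreviation "Ey \<equiv> ext_DY m n"
abbreviation "PS \<equiv> power_series (ext_DY m n)"
abbreviation "MM \<equiv> End2 m n (power_series (ext_DY m n))"
abbreviation "J \<equiv> {1..m + n}"

lemmas Eops = E_ops[OF mn]

lemma abelian_group_E: "abelian_group Ey"
proof (rule abelian_groupI)
  fix x assume "x \<in> D"
  then show "\<exists>y\<in>D. y \<oplus>\<^bsub>Ey\<^esub> x = \<zero>\<^bsub>Ey\<^esub>"
    by (intro bexI[of _ "\<ominus>\<^bsub>H\<^esub> x"]) (simp_all add: Eops(2,4) DD_neg[OF mn] Hh.l_neg DD_carrier[OF mn])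
qed (simp_all add: Eops(2,4) DD_add[OF mn] DD_zero[OF mn] DD_carrier[OF mn] Hh.a_ac)

lemma PS_ops: "carrier PS = {f. \<forall>k. f k \<in> D}" "add PS = (\<lambda>f g k. f k \<oplus>\<^bsub>H\<^esub> g k)" "zero PS = (\<lambda>k. \<zero>\<^bsub>H\<^esub>)"
   "one PS = (\<lambda>k. if k = 0 then \<one>\<^bsub>H\<^esub> else \<zero>\<^bsub>H\<^esub>)" "par PS = (\<lambda>f k. par H (f k))"
   "mult PS = (\<lambda>f g k. \<Oplus>\<^bsub>Ey\<^esub>i\<in>{..k}. f i \<otimes>\<^bsub>H\<^esub> g (k - i))"
  by (simp_all add: power_series_def Eops(1-5) cong: if_cong)

lemma abelian_group_PS: "abelian_group PS"
proof (rule abelian_groupI)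
  fix x assume "x \<in> carrier PS"
  then show "\<exists>y\<in>carrier PS. y \<oplus>\<^bsub>PS\<^esub> x = \<zero>\<^bsub>PS\<^esub>"
    by (intro bexI[of _ "\<lambda>k. \<ominus>\<^bsub>H\<^esub> x k"]) (simp_all add: PS_ops DD_neg[OF mn] Hh.l_neg DD_carrier[OF mn])
qed (simp_all add: PS_ops DD_add[OF mn] DD_zero[OF mn] DD_carrier[OF mn] Hh.a_ac)

lemma PS_neg: "f \<in> carrier PS ==> \<ominus>\<^bsub>PS\<^esub> f = (\<lambda>k. \<ominus>\<^bsub>H\<^esub> f k)"
  by (rule abelian_group.minus_equality[OF abelian_group_PS])
    (simp_all add: PS_ops DD_neg[OF mn] Hh.l_neg DD_carrier[OF mn])

definition addclosed :: "(nat => free_el set) set set => bool" where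
  "addclosed W \<longleftrightarrow> W \<subseteq> D \<and> \<zero>\<^bsub>H\<^esub> \<in> W \<and> (\<forall>x\<in>W. \<ominus>\<^bsub>H\<^esub> x \<in> W \<and> par H x \<in> W) \<and> (\<forall>x\<in>W. \<forall>y\<in>W. x \<oplus>\<^bsub>H\<^esub> y \<in> W)"

lemma addclosed_D: "addclosed D"
  by (simp add: addclosed_def DD_zero[OF mn] DD_neg[OF mn] DD_add[OF mn] DD_par[OF mn])

lemma addclosed_YH: "addclosed (dy_embed m n ` yangian m n)" and addclosed_XH: "addclosed (ext_dual_yangian m n)"
  using subring_par_YH[OF mn] subring_par_XH[OF mn] YH_DD[OF mn] XH_DD[OF mn]
  unfolding addclosed_def subring_par_def[OF mn] by blast+

definition \<Phi> :: "(nat => (nat => free_el set) set) => dyp fps" where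
  "\<Phi> f = Abs_fps (\<lambda>k. inj_dyp m n (f k))"

lemma \<Phi>_add: "f \<in> carrier PS ==> g \<in> carrier PS ==> \<Phi> (f \<oplus>\<^bsub>PS\<^esub> g) = \<Phi> f + \<Phi> g"
  by (rule fps_ext) (simp add: \<Phi>_def PS_ops inj_dyp_add[OF mn] DD_carrier[OF mn])

lemma inj_dyp_0: "inj_dyp m n \<zero>\<^bsub>H\<^esub> = 0"
  using inj_dyp_add[OF mn, of "\<zero>\<^bsub>H\<^esub>" "\<zero>\<^bsub>H\<^esub>"] by simp

lemma \<Phi>_zero: "\<Phi> \<zero>\<^bsub>PS\<^esub> = 0"
  by (rule fps_ext) (simp add: \<Phi>_def PS_ops inj_dyp_0)

lemma \<Phi>_one: "\<Phi> \<one>\<^bsub>PS\<^esub> = fps_const (e1 m n)"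
  by (rule fps_ext) (simp add: \<Phi>_def PS_ops inj_dyp_0 e1_def[OF mn] \<eta>_def[OF mn] Lm_def[OF mn] flim_1[OF mn])

lemma \<Phi>_inj: "f \<in> carrier PS ==> g \<in> carrier PS ==> \<Phi> f = \<Phi> g ==> f = g"
proof
  fix k assume fg: "f \<in> carrier PS" "g \<in> carrier PS" and eq: "\<Phi> f = \<Phi> g"
  have "\<Phi> f $ k = \<Phi> g $ k" by (simp only: eq)
  then have "inj_dyp m n (f k) = inj_dyp m n (g k)" by (simp only: \<Phi>_def fps_nth_Abs_fps)
  then show "f k = g k"
    using fg by (intro inj_dyp_inj[OF mn]) (simp_all add: PS_ops DD_carrier[OF mn])
qed

lemma par_pow_closed: "addclosed U ==> x \<in> U ==> (par H ^^ e) x \<in> U"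
  by (induction e) (auto simp: addclosed_def)

lemma PS_par_pow: "(par PS ^^ e) f = (\<lambda>k. (par H ^^ e) (f k))"
  by (induction e) (simp_all add: PS_ops)

lemma \<Phi>_par:
  assumes "!!k. f k \<in> D"
  shows "\<Phi> ((par PS ^^ e) f) = (pfps ^^ e) (\<Phi> f)"
proof (induction e)
  case (Suc e)
  have "(par H ^^ e) (f k) \<in> carrier H" for k
    using par_pow_closed[OF addclosed_D assms] by (rule DD_carrier[OF mn])
  then have "\<Phi> ((par PS ^^ Suc e) f) = pfps (\<Phi> ((par PS ^^ e) f))"
    unfolding PS_par_pow by (intro fps_ext) (simp add: \<Phi>_def pfps_def par_dyp_inj[OF mn])
  then show ?case using Suc by simp
qed simp

text \<open>The product of two series is formed with \<open>finsum\<close> in \<open>ext_DY\<close>,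
  which behaves as a sum only for summands in the carrier. Hence the products of coefficients are
  assumed to lie in a subset \<open>W\<close> of it.\<close>

lemma PS_mult:
  assumes W: "addclosed W" and prod: "!!i j. f i \<otimes>\<^bsub>H\<^esub> g j \<in> W" and f: "!!i. f i \<in> carrier H" and g: "!!i. g i \<in> carrier H"
  shows "(f \<otimes>\<^bsub>PS\<^esub> g) k \<in> W" "\<Phi> (f \<otimes>\<^bsub>PS\<^esub> g) = \<Phi> f * \<Phi> g"
proof -
  interpret E: abelian_group Ey by (rule abelian_group_E)
  have WD: "W \<subseteq> D" using W by (simp add: addclosed_def)
  show "(f \<otimes>\<^bsub>PS\<^esub> g) k \<in> W"
    using W prod unfolding PS_ops addclosed_def
    by (intro E.finsum_in_subset) (auto simp: Eops(2,4))
  show "\<Phi> (f \<otimes>\<^bsub>PS\<^esub> g) = \<Phi> f * \<Phi> g"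
  proof (rule fps_ext)
    fix k
    have "inj_dyp m n (\<Oplus>\<^bsub>Ey\<^esub>i\<in>{..k}. f i \<otimes>\<^bsub>H\<^esub> g (k - i)) = (\<Sum>i\<in>{..k}. inj_dyp m n (f i \<otimes>\<^bsub>H\<^esub> g (k - i)))"
      using prod WD by (intro E.finsum_hom) (auto simp: Eops(2) inj_dyp_add[OF mn] DD_carrier[OF mn])
    then show "\<Phi> (f \<otimes>\<^bsub>PS\<^esub> g) $ k = (\<Phi> f * \<Phi> g) $ k"
      by (simp add: \<Phi>_def PS_ops(6) inj_dyp_mult[OF mn] f g fps_mult_nth atLeast0AtMost)
  qed
qed

definition vals :: "(nat => free_el set) set set => (nat => (nat => free_el set) set) mat2 => bool" where
  "vals U X \<longleftrightarrow> (\<forall>i j k l a. X i j k l a \<in> U)"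

lemma with_sign_PS:
  assumes W: "addclosed W" and f: "!!k. f k \<in> W"
  shows "with_sign PS e f k \<in> W" "\<Phi> (with_sign PS e f) = sg e (\<Phi> f)"
proof -
  have fc: "f \<in> carrier PS" using W f by (auto simp: PS_ops addclosed_def)
  show "with_sign PS e f k \<in> W"
    using W f PS_neg[OF fc] by (auto simp: with_sign_def addclosed_def)
  show "\<Phi> (with_sign PS e f) = sg e (\<Phi> f)"
    by (rule abelian_group.with_sign_hom[OF abelian_group_PS \<Phi>_add fc])
qed

text \<open>Three sets are kept apart because the products that occur have both entries in the
  Yangian or its dual, or one of them there and the other anywhere in \<open>ext_DY\<close>, on a
  definite side.\<close>

lemma End2_mult:
  assumes U: "addclosed U" and V: "addclosed V" and W: "addclosed W"
    and prod: "!!x y. x \<in> U ==> y \<in> V ==> x \<otimes>\<^bsub>H\<^esub> y \<in> W"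
    and X: "vals U X" and Y: "vals V Y"
  shows "vals W (X \<otimes>\<^bsub>MM\<^esub> Y)"
    and "in_range4 m n i j k l ==> \<Phi> ((X \<otimes>\<^bsub>MM\<^esub> Y) i j k l) = (\<Sum>p\<in>J. \<Sum>q\<in>J.
      sg (pp (pbar m) k q p j)
	((pfps ^^ (pbar m p + pbar m j + pbar m q + pbar m l)) (\<Phi> (X i p k q)) * \<Phi> (Y p j q l)))"
proof -
  interpret PS: abelian_group PS by (rule abelian_group_PS)
  let ?W = "{f. \<forall>k. f k \<in> W}"
  have W': "?W \<subseteq> carrier PS" "\<zero>\<^bsub>PS\<^esub> \<in> ?W" "x \<in> ?W ==> y \<in> ?W ==> x \<oplus>\<^bsub>PS\<^esub> y \<in> ?W" for x y
    using W by (auto simp: addclosed_def PS_ops)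
  have UV: "U \<subseteq> D" "V \<subseteq> D" using U V by (auto simp: addclosed_def)
  let ?t = "\<lambda>i j k l p q. (par PS ^^ (pbar m p + pbar m j + pbar m q + pbar m l)) (X i p k q) \<otimes>\<^bsub>PS\<^esub> Y p j q l"
  let ?s = "\<lambda>i j k l p q. with_sign PS (pp (pbar m) k q p j) (?t i j k l p q)"
  have XU: "(par H ^^ e) (X i p k q a) \<in> U" and YV: "Y i p k q a \<in> V" for i p k q a e
    using X Y par_pow_closed[OF U] by (auto simp: vals_def)
  have t: "?t i j k l p q a \<in> W" "\<Phi> (?t i j k l p q) = (pfps ^^ (pbar m p + pbar m j + pbar m q + pbar m l)) (\<Phi> (X i p k q)) * \<Phi> (Y p j q l)"
    for i j k l p q a
  proof -
    have c: "(par PS ^^ e) (X i p k q) a \<in> carrier H" "Y p j q l a \<in> carrier H" "(par PS ^^ e) (X i p k q) a \<otimes>\<^bsub>H\<^esub> Y p j q l b \<in> W" for a b e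
      using XU YV UV prod DD_carrier[OF mn] unfolding PS_par_pow by blast+
    show "?t i j k l p q a \<in> W" by (rule PS_mult(1)[OF W c(3,1,2)])
    have "X i p k q a \<in> D" for a using XU[of 0] UV by auto
    then show "\<Phi> (?t i j k l p q) = (pfps ^^ (pbar m p + pbar m j + pbar m q + pbar m l)) (\<Phi> (X i p k q)) * \<Phi> (Y p j q l)"
      by (simp only: PS_mult(2)[OF W c(3,1,2)] \<Phi>_par)
  qed
  have s: "?s i j k l p q \<in> ?W" for i j k l p q
    by (intro CollectI allI with_sign_PS(1)[OF W] t(1))
  have inner: "(\<Oplus>\<^bsub>PS\<^esub>q\<in>J. ?s i j k l p q) \<in> ?W" for i j k l p
    by (rule PS.finsum_in_subset[OF W' s])
  have outer: "(\<Oplus>\<^bsub>PS\<^esub>p\<in>J. \<Oplus>\<^bsub>PS\<^esub>q\<in>J. ?s i j k l p q) \<in> ?W" for i j k l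
    by (rule PS.finsum_in_subset[OF W' inner])
  have XY: "(X \<otimes>\<^bsub>MM\<^esub> Y) i j k l = (if in_range4 m n i j k l then (\<Oplus>\<^bsub>PS\<^esub>p\<in>J. \<Oplus>\<^bsub>PS\<^esub>q\<in>J. ?s i j k l p q) else \<zero>\<^bsub>PS\<^esub>)" for i j k l
    by (simp add: End2_def cong: if_cong)
  show "vals W (X \<otimes>\<^bsub>MM\<^esub> Y)"
    unfolding vals_def XY
  proof (intro allI)
    fix i j k l a
    show "(if in_range4 m n i j k l then (\<Oplus>\<^bsub>PS\<^esub>p\<in>J. \<Oplus>\<^bsub>PS\<^esub>q\<in>J. ?s i j k l p q) else \<zero>\<^bsub>PS\<^esub>) a \<in> W"
      using outer[unfolded mem_Collect_eq, rule_format, of k j l i a] W'(2)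
      by (cases "in_range4 m n i j k l") (simp_all only: if_True if_False mem_Collect_eq)
  qed
  assume r: "in_range4 m n i j k l"
  have "\<Phi> ((X \<otimes>\<^bsub>MM\<^esub> Y) i j k l) = (\<Sum>p\<in>J. \<Phi> (\<Oplus>\<^bsub>PS\<^esub>q\<in>J. ?s i j k l p q))"
    unfolding XY if_P[OF r] by (rule PS.finsum_hom[OF \<Phi>_add subsetD[OF W'(1) inner]])
  also have "\<dots> = (\<Sum>p\<in>J. \<Sum>q\<in>J. \<Phi> (?s i j k l p q))"
    by (rule sum.cong[OF refl PS.finsum_hom[OF \<Phi>_add subsetD[OF W'(1) s]]])
  also have "\<dots> = (\<Sum>p\<in>J. \<Sum>q\<in>J.
      sg (pp (pbar m) k q p j)
	((pfps ^^ (pbar m p + pbar m j + pbar m q + pbar m l)) (\<Phi> (X i p k q)) * \<Phi> (Y p j q l)))"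
    by (simp only: with_sign_PS(2)[OF W t(1)] t(2))
  finally show "\<Phi> ((X \<otimes>\<^bsub>MM\<^esub> Y) i j k l) = (\<Sum>p\<in>J. \<Sum>q\<in>J.
      sg (pp (pbar m) k q p j)
	((pfps ^^ (pbar m p + pbar m j + pbar m q + pbar m l)) (\<Phi> (X i p k q)) * \<Phi> (Y p j q l)))" .
qed

lemma MM_carrier: "X \<in> carrier MM \<longleftrightarrow> vals D X \<and> (\<forall>i j k l. \<not> in_range4 m n i j k l --> X i j k l = \<zero>\<^bsub>PS\<^esub>)"
proof
  assume X: "X \<in> carrier MM"
  have c: "if in_range4 m n i j k l then X i j k l \<in> carrier PS else X i j k l = \<zero>\<^bsub>PS\<^esub>" for i j k l
    using X by (simp add: End2_def)
  have "X i j k l a \<in> D" for i j k l a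
    using c[of i j k l] DD_zero[OF mn] by (cases "in_range4 m n i j k l") (simp_all add: PS_ops)
  then show "vals D X \<and> (\<forall>i j k l. \<not> in_range4 m n i j k l --> X i j k l = \<zero>\<^bsub>PS\<^esub>)"
    using c unfolding vals_def by metis
qed (auto simp: End2_def vals_def PS_ops)

lemma MM_mult_range: "\<not> in_range4 m n i j k l ==> (X \<otimes>\<^bsub>MM\<^esub> Y) i j k l = \<zero>\<^bsub>PS\<^esub>"
  by (simp add: End2_def)

lemma mat_eqI:
  assumes "vals D X" "vals D Y" "!!i j k l. \<not> in_range4 m n i j k l ==> X i j k l = Y i j k l"
    and "!!i j k l. in_range4 m n i j k l ==> \<Phi> (X i j k l) = \<Phi> (Y i j k l)"
  shows "X = Y"
proof (intro ext)
  fix i j k l a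
  have "X i j k l = Y i j k l"
  proof (cases "in_range4 m n i j k l")
    case True
    then show ?thesis using assms by (intro \<Phi>_inj) (auto simp: vals_def PS_ops)
  qed (rule assms(3))
  then show "X i j k l a = Y i j k l a" by simp
qed

lemma MM_one: "\<one>\<^bsub>MM\<^esub> i j k l = (if in_range4 m n i j k l \<and> i = j \<and> k = l then \<one>\<^bsub>PS\<^esub> else \<zero>\<^bsub>PS\<^esub>)"
  by (simp add: End2_def)

end

lemma pfps_pow_even: "even e ==> (pfps ^^ e) x = x"
proof (elim evenE)
  fix b assume "e = 2 * b"
  moreover have "(pfps ^^ (2 * b)) x = x" by (induction b) simp_all
  ultimately show "(pfps ^^ e) x = x" by simp
qed

lemma pfps_pow_add: "(pfps ^^ (x + y)) v = (pfps ^^ x) ((pfps ^^ y) v)"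
  by (simp add: funpow_add)

text \<open>Common frame for \<open>z\<close> and \<open>z\<^sup>+\<close>: \<open>U\<close> is the
  embedded Yangian or the extended dual Yangian, and \<open>side\<close> records on which side it
  acts on \<open>ext_DY\<close>. \<open>a\<close>, \<open>a'\<close> and \<open>s\<close> are the
  signed entries of the matrix, of its shift by \<open>m - n\<close> and of its inverse, as series
  over \<open>dyp\<close>; \<open>sH\<close> shows that the inverse has entries in
  \<open>U\<close>.\<close>

locale z_data =
  fixes m n :: nat
    and U :: "(nat => free_el set) set set"
    and t :: "complex => nat => nat => nat => (nat => free_el set) set"
    and a a' s :: "nat => nat => dyp fps"
    and sH :: "nat => nat => nat => (nat => free_el set) set"
    and z :: "nat => (nat => free_el set) set"
  assumes mn: "m \<noteq> n"
    and U: "addclosed m n U" "\<one>\<^bsub>DY_hat m n\<^esub> \<in> U" "!!x y. x \<in> U ==> y \<in> U ==> x \<otimes>\<^bsub>DY_hat m n\<^esub> y \<in> U"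
    and side: "(\<forall>x\<in>carrier (ext_DY m n). \<forall>y\<in>U. x \<otimes>\<^bsub>DY_hat m n\<^esub> y \<in> carrier (ext_DY m n)) \<or>
      (\<forall>x\<in>U. \<forall>y\<in>carrier (ext_DY m n). x \<otimes>\<^bsub>DY_hat m n\<^esub> y \<in> carrier (ext_DY m n))"
    and t0: "!!i j k. i \<in> {1..m+n} ==> j \<in> {1..m+n} ==> t 0 i j k \<in> U"
      "!!i j. i \<in> {1..m+n} ==> j \<in> {1..m+n} ==> sg (tsg m i j) (\<Phi> m n (t 0 i j)) = a i j"
      "!!i j. i \<in> {1..m+n} ==> j \<in> {1..m+n} ==> pfps (a i j) = sg (pbar m i + pbar m j) (a i j)"
    and t1: "!!i j k. i \<in> {1..m+n} ==> j \<in> {1..m+n} ==> t (of_nat m - of_nat n) i j k \<in> U"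
      "!!i j. i \<in> {1..m+n} ==> j \<in> {1..m+n} ==> sg (tsg m i j) (\<Phi> m n (t (of_nat m - of_nat n) i j)) = a' i j"
      "!!i j. i \<in> {1..m+n} ==> j \<in> {1..m+n} ==> pfps (a' i j) = sg (pbar m i + pbar m j) (a' i j)"
    and s: "!!i j k. i \<in> {1..m+n} ==> j \<in> {1..m+n} ==> sH i j k \<in> U"
      "!!i j. i \<in> {1..m+n} ==> j \<in> {1..m+n} ==> sg (tsg m i j) (\<Phi> m n (sH i j)) = s i j"
      "!!i j. i \<in> {1..m+n} ==> j \<in> {1..m+n} ==> pfps (s i j) = sg (pbar m i + pbar m j) (s i j)"
    and inv: "gr_inverse {1..m+n} (pbar m) (fps_const (e1 m n)) a s"
    and z: "!!k. z k \<in> U" "z_equation m n t z"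
begin

abbreviation "K \<equiv> {1..m+n}"
abbreviation "P \<equiv> power_series (ext_DY m n)"
abbreviation "M \<equiv> End2 m n (power_series (ext_DY m n))"
abbreviation "ph \<equiv> \<Phi> m n"
abbreviation "e \<equiv> fps_const (e1 m n)"
abbreviation "b \<equiv> pbar m"

lemma UD: "x \<in> U ==> x \<in> carrier (ext_DY m n)"
  using U(1) unfolding addclosed_def[OF mn] by blast

lemma U0: "\<zero>\<^bsub>P\<^esub> k \<in> U" "\<one>\<^bsub>P\<^esub> k \<in> U"
  using U(1,2) unfolding addclosed_def[OF mn] PS_ops[OF mn] by auto

lemma Phi_e:
  assumes "!!k. f k \<in> carrier (ext_DY m n)"
  shows "e * ph f = ph f" "ph f * e = ph f"
proof -
  interpret H: ring "DY_hat m n" by (rule ring_DY_hat[OF mn])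
  have c: "f k \<in> carrier (DY_hat m n)" for k by (rule DD_carrier[OF mn assms])
  have e1: "e1 m n = inj_dyp m n \<one>\<^bsub>DY_hat m n\<^esub>"
    by (simp add: e1_def[OF mn] \<eta>_def[OF mn] Lm_def[OF mn] flim_1[OF mn])
  have "e1 m n * inj_dyp m n (f k) = inj_dyp m n (f k)" "inj_dyp m n (f k) * e1 m n = inj_dyp m n (f k)" for k
    unfolding e1 using c by (simp_all add: inj_dyp_mult[OF mn, symmetric])
  then show "e * ph f = ph f" "ph f * e = ph f"
    by (auto intro!: fps_ext simp: \<Phi>_def[OF mn])
qed

lemma pfps_e: "pfps e = e"
proof (rule fps_ext)
  fix k
  have "par_dyp (e1 m n) = e1 m n"
    using Lm_par[OF mn FC_const[OF freeC_1]] by (simp add: e1_def[OF mn] \<eta>_def[OF mn])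
  then show "pfps e $ k = e $ k"
    using pfps_0 by (cases "k = 0") (auto simp: pfps_def fps_eq_iff)
qed

lemma copy2_facts:
  assumes "!!i j k. i \<in> K ==> j \<in> K ==> x i j k \<in> U"
  shows "vals U (copy2 m n P x)" "!!i j k l. \<not> in_range4 m n i j k l ==> copy2 m n P x i j k l = \<zero>\<^bsub>P\<^esub>"
    "!!i j k l. in_range4 m n i j k l ==> ph (copy2 m n P x i j k l) = (if i = j then sg (tsg m k l) (ph (x k l)) else 0)"
proof -
  show "!!i j k l. \<not> in_range4 m n i j k l ==> copy2 m n P x i j k l = \<zero>\<^bsub>P\<^esub>"
    by (simp add: copy2_def)
  have x: "x k l q \<in> U" if "in_range4 m n i j k l" for i j k l q
    using that assms by (auto simp: in_range4_def)
  show "vals U (copy2 m n P x)"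
    unfolding vals_def[OF mn] copy2_def
    using with_sign_PS(1)[OF mn U(1)] x U0(1) by (auto simp: if_split_mem1)
  show "!!i j k l. in_range4 m n i j k l ==> ph (copy2 m n P x i j k l) = (if i = j then sg (tsg m k l) (ph (x k l)) else 0)"
    using with_sign_PS(2)[OF mn U(1) x] by (auto simp: copy2_def tsg_def \<Phi>_zero[OF mn])
qed

lemma copy1_facts:
  assumes "!!i j k. i \<in> K ==> j \<in> K ==> x i j k \<in> U"
  shows "vals U (copy1 m n P x)"
    "!!i j k l. in_range4 m n i j k l ==> ph (copy1 m n P x i j k l) = (if k = l then sg (tsg m i j) (ph (x i j)) else 0)"
proof -
  have x: "x i j q \<in> U" if "in_range4 m n i j k l" for i j k l q
    using that assms by (auto simp: in_range4_def)
  show "vals U (copy1 m n P x)"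
    unfolding vals_def[OF mn] copy1_def
    using with_sign_PS(1)[OF mn U(1)] x U0(1) by (auto simp: if_split_mem1)
  show "!!i j k l. in_range4 m n i j k l ==> ph (copy1 m n P x i j k l) = (if k = l then sg (tsg m i j) (ph (x i j)) else 0)"
    using with_sign_PS(2)[OF mn U(1) x] by (auto simp: copy1_def tsg_def \<Phi>_zero[OF mn])
qed

section \<open>The equation of \<open>z\<close> in matrix entries\<close>

definition "T2 = copy2 m n P (t 0)"
definition "S2 = copy2 m n P sH"

lemma T2_facts:
  "vals U T2" "\<not> in_range4 m n i j k l ==> T2 i j k l = \<zero>\<^bsub>P\<^esub>"
  "in_range4 m n i j k l ==> ph (T2 i j k l) = (if i = j then a k l else 0)"
  using copy2_facts[of "t 0"] t0 unfolding T2_def by (auto simp: in_range4_def)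

lemma S2_facts:
  "vals U S2" "\<not> in_range4 m n i j k l ==> S2 i j k l = \<zero>\<^bsub>P\<^esub>"
  "in_range4 m n i j k l ==> ph (S2 i j k l) = (if i = j then s k l else 0)"
  using copy2_facts[of sH] s unfolding S2_def by (auto simp: in_range4_def)

lemma vals_UD: "vals U X ==> vals (carrier (ext_DY m n)) X"
  using UD by (auto simp: vals_def[OF mn])

lemma range4D: "in_range4 m n i j k l ==> i \<in> K \<and> j \<in> K \<and> k \<in> K \<and> l \<in> K"
  by (auto simp: in_range4_def)

lemma range4I: "i \<in> K ==> j \<in> K ==> k \<in> K ==> l \<in> K ==> in_range4 m n i j k l"
  by (auto simp: in_range4_def)

lemma mult_right_diag:
  assumes V: "addclosed m n V" and W: "addclosed m n W" "!!x y. x \<in> V ==> y \<in> U ==> x \<otimes>\<^bsub>DY_hat m n\<^esub> y \<in> W"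
    and X: "vals V X" and Y: "vals U Y" "!!i j k l. in_range4 m n i j k l ==> ph (Y i j k l) = (if i = j then c k l else 0)"
    and r: "in_range4 m n i j k l"
  shows "ph ((X \<otimes>\<^bsub>M\<^esub> Y) i j k l) = (\<Sum>q\<in>K. (pfps ^^ (b q + b l)) (ph (X i j k q)) * c q l)"
proof -
  note ijkl = range4D[OF r]
  have "ph ((X \<otimes>\<^bsub>M\<^esub> Y) i j k l) = (\<Sum>p\<in>K. \<Sum>q\<in>K. sg (pp b k q p j)
      ((pfps ^^ (b p + b j + b q + b l)) (ph (X i p k q)) * ph (Y p j q l)))"
    by (rule End2_mult(2)[OF mn V U(1) W X Y(1) r])
  also have "\<dots> = (\<Sum>p\<in>K. if p = j then (\<Sum>q\<in>K. (pfps ^^ (b q + b l)) (ph (X i j k q)) * c q l) else 0)"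
  proof (rule sum.cong[OF refl])
    fix p assume p: "p \<in> K"
    have y: "ph (Y p j q l) = (if p = j then c q l else 0)" if "q \<in> K" for q
      using Y(2)[OF range4I] p that ijkl by simp
    have sgj: "sg (pp b k q j j) v = v" for q v by (rule sg_cancel) simp
    have pj: "(pfps ^^ (b j + b j + b q + b l)) v = (pfps ^^ (b q + b l)) v" for q v
      using pfps_pow_even[of "b j + b j" "(pfps ^^ (b q + b l)) v"] by (simp add: funpow_add add.assoc)
    show "(\<Sum>q\<in>K. sg (pp b k q p j) ((pfps ^^ (b p + b j + b q + b l)) (ph (X i p k q)) * ph (Y p j q l)))
	= (if p = j then (\<Sum>q\<in>K. (pfps ^^ (b q + b l)) (ph (X i j k q)) * c q l) else 0)"
    proof (cases "p = j")
      case True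
      show ?thesis unfolding True if_P[OF refl] sgj pj using y True by (intro sum.cong) simp_all
    next
      case False
      then show ?thesis using y by simp
    qed
  qed
  finally show ?thesis using ijkl by simp
qed

lemma mult_left_diag:
  assumes V: "addclosed m n V" and W: "addclosed m n W" "!!x y. x \<in> U ==> y \<in> V ==> x \<otimes>\<^bsub>DY_hat m n\<^esub> y \<in> W"
    and X: "vals U X" "!!i j k l. in_range4 m n i j k l ==> ph (X i j k l) = (if i = j then c k l else 0)" and Y: "vals V Y"
    and c: "!!k l. k \<in> K ==> l \<in> K ==> pfps (c k l) = sg (b k + b l) (c k l)"
    and r: "in_range4 m n i j k l"
  shows "ph ((X \<otimes>\<^bsub>M\<^esub> Y) i j k l) = (\<Sum>q\<in>K. sg (pp b k q q l) (c k q * ph (Y i j q l)))"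
proof -
  note ijkl = range4D[OF r]
  have "ph ((X \<otimes>\<^bsub>M\<^esub> Y) i j k l) = (\<Sum>p\<in>K. \<Sum>q\<in>K. sg (pp b k q p j)
      ((pfps ^^ (b p + b j + b q + b l)) (ph (X i p k q)) * ph (Y p j q l)))"
    by (rule End2_mult(2)[OF mn U(1) V W X(1) Y r])
  also have "\<dots> = (\<Sum>p\<in>K. if i = p then (\<Sum>q\<in>K. sg (pp b k q q l) (c k q * ph (Y i j q l))) else 0)"
  proof (rule sum.cong[OF refl])
    fix p assume p: "p \<in> K"
    have x: "ph (X i p k q) = (if i = p then c k q else 0)" if "q \<in> K" for q
      using X(2)[OF range4I] p that ijkl by simp
    show "(\<Sum>q\<in>K. sg (pp b k q p j) ((pfps ^^ (b p + b j + b q + b l)) (ph (X i p k q)) * ph (Y p j q l)))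
	= (if i = p then (\<Sum>q\<in>K. sg (pp b k q q l) (c k q * ph (Y i j q l))) else 0)"
    proof (cases "i = p")
      case True
      have "sg (pp b k q p j) ((pfps ^^ (b p + b j + b q + b l)) (ph (X i p k q)) * ph (Y p j q l))
	  = sg (pp b k q q l) (c k q * ph (Y i j q l))" if q: "q \<in> K" for q
      proof -
	have "(pfps ^^ (b p + b j + b q + b l)) (ph (X i p k q)) = sg ((b p + b j + b q + b l) * (b k + b q)) (c k q)"
	  using x[OF q] pfps_pow_homog[OF c] ijkl q True by simp
	then show ?thesis using True
	  by (simp only: sg_mult_left sg_sg) (rule sg_cong, auto)
      qed
      then show ?thesis unfolding if_P[OF True] by (rule sum.cong[OF refl])
    next
      case False
      then show ?thesis using x by simp
    qed
  qed
  finally show ?thesis using ijkl by simp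
qed

lemma one_vals: "vals (carrier (ext_DY m n)) \<one>\<^bsub>M\<^esub>"
  using U0 UD unfolding vals_def[OF mn] MM_one[OF mn] by simp

lemma Phi_one_MM: "in_range4 m n i j k l ==> ph (\<one>\<^bsub>M\<^esub> i j k l) = (if i = j then if k = l then e else 0 else 0)"
  by (simp add: MM_one[OF mn] \<Phi>_zero[OF mn] \<Phi>_one[OF mn])

lemma diag_inverse:
  assumes X: "vals U X" "!!i j k l. in_range4 m n i j k l ==> ph (X i j k l) = (if i = j then c k l else 0)"
    and Y: "vals U Y" "!!i j k l. in_range4 m n i j k l ==> ph (Y i j k l) = (if i = j then d k l else 0)"
    and c: "!!k l. k \<in> K ==> l \<in> K ==> pfps (c k l) = sg (b k + b l) (c k l)"
    and cd: "!!k l. k \<in> K ==> l \<in> K ==> (\<Sum>q\<in>K. sg (pp b q l k q) (c k q * d q l)) = (if k = l then e else 0)"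
  shows "X \<otimes>\<^bsub>M\<^esub> Y = \<one>\<^bsub>M\<^esub>"
proof (rule mat_eqI[OF mn])
  show "vals (carrier (ext_DY m n)) (X \<otimes>\<^bsub>M\<^esub> Y)"
    by (rule vals_UD[OF End2_mult(1)[OF mn U(1) U(1) U(1) U(3) X(1) Y(1)]])
  show "vals (carrier (ext_DY m n)) \<one>\<^bsub>M\<^esub>" by (rule one_vals)
  fix i j k l
  show "(X \<otimes>\<^bsub>M\<^esub> Y) i j k l = \<one>\<^bsub>M\<^esub> i j k l" if "\<not> in_range4 m n i j k l"
    using that by (simp add: MM_mult_range[OF mn] MM_one[OF mn])
  assume r: "in_range4 m n i j k l"
  note ijkl = range4D[OF r]
  have "ph ((X \<otimes>\<^bsub>M\<^esub> Y) i j k l) = (\<Sum>q\<in>K. sg (pp b k q q l) (c k q * ph (Y i j q l)))"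
    by (rule mult_left_diag[OF U(1) U(1) U(3) X Y(1) c r])
  also have "\<dots> = (\<Sum>q\<in>K. if i = j then sg (pp b q l k q) (c k q * d q l) else 0)"
    using Y(2)[OF range4I] ijkl by (intro sum.cong refl) (simp add: mult.commute[of "b k + b _"])
  also have "\<dots> = (if i = j then if k = l then e else 0 else 0)"
    using cd ijkl by (cases "i = j") simp_all
  finally show "ph ((X \<otimes>\<^bsub>M\<^esub> Y) i j k l) = ph (\<one>\<^bsub>M\<^esub> i j k l)" by (simp only: Phi_one_MM[OF r])
qed

lemma inv_sums:
  assumes "k \<in> K" "l \<in> K"
  shows "(\<Sum>q\<in>K. sg (pp b q l k q) (a k q * s q l)) = (if k = l then e else 0)"
    and "(\<Sum>q\<in>K. sg (pp b q l k q) (s k q * a q l)) = (if k = l then e else 0)"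
  using inv assms unfolding gr_inverse_def by blast+

text \<open>A row that the matrix \<open>a\<close> kills from the right vanishes, as one sees by
  multiplying with the inverse \<open>s\<close>. These products are formed in series over
  \<open>dyp\<close>, where associativity holds, and not over \<open>ext_DY\<close>.\<close>

lemma unique_right:
  assumes d: "!!l. l \<in> K ==> (\<Sum>q\<in>K. (pfps ^^ (b q + b l)) (d q) * a q l) = 0" and r: "r \<in> K" and de: "d r * e = d r"
  shows "d r = 0"
proof -
  \<comment> \<open>The twist of \<open>d q\<close> depends on the column \<open>l\<close>. Applying
    the involution \<open>b l\<close> more times leaves the twist by \<open>b q\<close> and a mere
    sign on the homogeneous entry \<open>a q l\<close>.\<close>
  define w where "w q = (pfps ^^ b q) (d q)" for q
  have w0: "(\<Sum>q\<in>K. w q * sg (b l * (b q + b l)) (a q l)) = 0" if l: "l \<in> K" for l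
  proof -
    interpret h: rng_hom "pfps ^^ b l" by (rule pfps_pow_hom)
    have "0 = (pfps ^^ b l) (\<Sum>q\<in>K. (pfps ^^ (b q + b l)) (d q) * a q l)"
      using d[OF l] by simp
    also have "\<dots> = (\<Sum>q\<in>K. w q * sg (b l * (b q + b l)) (a q l))"
      unfolding h.h_sum h.h_mult
    proof (rule sum.cong[OF refl])
      fix q assume q: "q \<in> K"
      have "(pfps ^^ b l) ((pfps ^^ (b q + b l)) (d q)) = (pfps ^^ (b l + (b q + b l))) (d q)"
	by (rule pfps_pow_add[symmetric])
      also have "b l + (b q + b l) = (b l + b l) + b q" by simp
      also have "(pfps ^^ ((b l + b l) + b q)) (d q) = (pfps ^^ (b l + b l)) ((pfps ^^ b q) (d q))"
	by (rule pfps_pow_add)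
      finally show "(pfps ^^ b l) ((pfps ^^ (b q + b l)) (d q)) * (pfps ^^ b l) (a q l) = w q * sg (b l * (b q + b l)) (a q l)"
	by (simp add: w_def pfps_pow_even pfps_pow_homog[OF t0(3)[OF q l]])
    qed
    finally show ?thesis ..
  qed
  have "0 = (\<Sum>l\<in>K. (\<Sum>q\<in>K. w q * sg (b l * (b q + b l)) (a q l)) * sg (b r * b l) (s l r))"
    using w0 by simp
  also have "\<dots> = (\<Sum>q\<in>K. w q * sg (b r * b q) (\<Sum>l\<in>K. sg (pp b l r q l) (a q l * s l r)))"
    unfolding sum_distrib_right sum_distrib_left sg_sum
    by (subst sum.swap, intro sum.cong refl)
       (simp add: sg_mult_left sg_mult_right mult.assoc, rule sg_cong, auto)
  also have "\<dots> = (\<Sum>q\<in>K. if q = r then w r * sg (b r * b r) e else 0)"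
    using r by (intro sum.cong refl) (simp add: inv_sums)
  finally have "sg (b r * b r) (w r * e) = 0" using r by (simp add: sg_mult_right)
  then have "w r * e = 0" by simp
  moreover have "(pfps ^^ b r) e = e" using pfps_pow_homog[of e 0] pfps_e by simp
  ultimately have "(pfps ^^ b r) (d r * e) = 0"
    by (simp add: w_def rng_hom.h_mult[OF pfps_pow_hom])
  then have "(pfps ^^ b r) ((pfps ^^ b r) (d r)) = 0" by (simp add: de)
  then show ?thesis using pfps_pow_even[of "b r + b r" "d r"] by (simp add: funpow_add)
qed

lemma unique_left:
  assumes d: "!!k. k \<in> K ==> (\<Sum>q\<in>K. sg (pp b k q q l) (a k q * d q)) = 0" and r: "r \<in> K" and de: "e * d r = d r"
  shows "d r = 0"
proof -
  have "0 = (\<Sum>k\<in>K. sg (b k * b l + b k * b r + b k) (s r k) * (\<Sum>q\<in>K. sg (pp b k q q l) (a k q * d q)))"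
    using d by simp
  also have "\<dots> = (\<Sum>q\<in>K. sg (b q + b q * b l + b q * b r) ((\<Sum>k\<in>K. sg (pp b k q r k) (s r k * a k q)) * d q))"
    unfolding sum_distrib_right sum_distrib_left sg_sum
    by (subst sum.swap, intro sum.cong refl)
       (simp add: sg_mult_left sg_mult_right mult.assoc, rule sg_cong, auto)
  also have "\<dots> = (\<Sum>q\<in>K. if q = r then sg (b r + b r * b l + b r * b r) (e * d r) else 0)"
    using r by (intro sum.cong refl) (simp add: inv_sums)
  finally show ?thesis using r by (simp add: de)
qed

lemma T2_inverse: "T2 \<otimes>\<^bsub>M\<^esub> S2 = \<one>\<^bsub>M\<^esub>" "S2 \<otimes>\<^bsub>M\<^esub> T2 = \<one>\<^bsub>M\<^esub>"
  by (rule diag_inverse[OF T2_facts(1,3) S2_facts(1,3) t0(3) inv_sums(1)]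
      diag_inverse[OF S2_facts(1,3) T2_facts(1,3) s(3) inv_sums(2)]; assumption)+

text \<open>Associativity is not at hand for matrices over \<open>ext_DY\<close>, so the usual proof
  of uniqueness is replaced: of the two equations only the one is used whose products
  \<open>side\<close> keeps inside \<open>ext_DY\<close>, and the matrix is cancelled from it over
  \<open>dyp\<close>.\<close>

lemma T2_inverse_unique:
  assumes Y: "Y \<in> carrier M" "T2 \<otimes>\<^bsub>M\<^esub> Y = \<one>\<^bsub>M\<^esub>" "Y \<otimes>\<^bsub>M\<^esub> T2 = \<one>\<^bsub>M\<^esub>"
  shows "Y = S2"
proof (rule mat_eqI[OF mn])
  note D = addclosed_D[OF mn]
  have YD: "vals (carrier (ext_DY m n)) Y" and Y0: "!!i j k l. \<not> in_range4 m n i j k l ==> Y i j k l = \<zero>\<^bsub>P\<^esub>"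
    using Y(1) unfolding MM_carrier[OF mn] by auto
  have SD: "vals (carrier (ext_DY m n)) S2" by (rule vals_UD[OF S2_facts(1)])
  show "vals (carrier (ext_DY m n)) Y" "vals (carrier (ext_DY m n)) S2" by (rule YD SD)+
  show "Y i j k l = S2 i j k l" if "\<not> in_range4 m n i j k l" for i j k l
    using that Y0 S2_facts(2) by simp
  fix i j k l assume r: "in_range4 m n i j k l"
  note ijkl = range4D[OF r]
  have de: "(ph (Y i j k l) - ph (S2 i j k l)) * e = ph (Y i j k l) - ph (S2 i j k l)"
    "e * (ph (Y i j k l) - ph (S2 i j k l)) = ph (Y i j k l) - ph (S2 i j k l)" for i j k l
    using Phi_e YD SD unfolding vals_def[OF mn] by (simp_all add: left_diff_distrib right_diff_distrib)
  from side show "ph (Y i j k l) = ph (S2 i j k l)"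
  proof
    assume R: "\<forall>x\<in>carrier (ext_DY m n). \<forall>y\<in>U. x \<otimes>\<^bsub>DY_hat m n\<^esub> y \<in> carrier (ext_DY m n)"
    have eq: "(\<Sum>q\<in>K. (pfps ^^ (b q + b l')) (ph (X i j k q)) * a q l') = ph (\<one>\<^bsub>M\<^esub> i j k l')"
      if "l' \<in> K" "vals (carrier (ext_DY m n)) X" "X \<otimes>\<^bsub>M\<^esub> T2 = \<one>\<^bsub>M\<^esub>" for l' X
      using mult_right_diag[OF D D _ that(2) T2_facts(1,3), of i j k l'] R that ijkl by (simp add: in_range4_def)
    have "(\<Sum>q\<in>K. (pfps ^^ (b q + b l')) (ph (Y i j k q) - ph (S2 i j k q)) * a q l') = 0" if "l' \<in> K" for l'
      using eq[OF that YD Y(3)] eq[OF that SD T2_inverse(2)]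
      by (simp add: rng_hom.h_diff[OF pfps_pow_hom] left_diff_distrib sum_subtractf)
    from unique_right[OF this, of l] show ?thesis using de(1) ijkl by simp
  next
    assume L: "\<forall>x\<in>U. \<forall>y\<in>carrier (ext_DY m n). x \<otimes>\<^bsub>DY_hat m n\<^esub> y \<in> carrier (ext_DY m n)"
    have eq: "(\<Sum>q\<in>K. sg (pp b k' q q l) (a k' q * ph (X i j q l))) = ph (\<one>\<^bsub>M\<^esub> i j k' l)"
      if "k' \<in> K" "vals (carrier (ext_DY m n)) X" "T2 \<otimes>\<^bsub>M\<^esub> X = \<one>\<^bsub>M\<^esub>" for k' X
      using mult_left_diag[OF D D _ T2_facts(1,3) that(2) t0(3), of i j k' l] L that ijkl by (simp add: in_range4_def)
    have "(\<Sum>q\<in>K. sg (pp b k' q q l) (a k' q * (ph (Y i j q l) - ph (S2 i j q l)))) = 0" if "k' \<in> K" for k'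
      using eq[OF that YD Y(2)] eq[OF that SD T2_inverse(1)]
      by (simp add: right_diff_distrib sg_diff sum_subtractf)
    from unique_left[OF this, of k] show ?thesis using de(2) ijkl by simp
  qed
qed

lemma inv_T2: "inv\<^bsub>M\<^esub> T2 = S2"
  unfolding m_inv_def
proof (rule the_equality)
  show "S2 \<in> carrier M \<and> T2 \<otimes>\<^bsub>M\<^esub> S2 = \<one>\<^bsub>M\<^esub> \<and> S2 \<otimes>\<^bsub>M\<^esub> T2 = \<one>\<^bsub>M\<^esub>"
    using T2_inverse S2_facts vals_UD by (auto simp: MM_carrier[OF mn])
qed (use T2_inverse_unique in blast)

definition "Pt = tau2 m P (perm_op m n P)"

lemma Pt_facts:
  "vals U Pt"
  "in_range4 m n i j k l ==> ph (Pt i j k l) = (if k = i \<and> l = j then sg (b l * b k + b l + b j) e else 0)"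
proof -
  have perm: "perm_op m n P i j k l q \<in> U" for i j k l q
    unfolding perm_op_def using with_sign_PS(1)[OF mn U(1) U0(2)] U0(1) by simp
  show "vals U Pt"
    unfolding vals_def[OF mn] Pt_def tau2_def by (intro allI with_sign_PS(1)[OF mn U(1)] perm)
  assume r: "in_range4 m n i j k l"
  then have r': "in_range4 m n i j l k" by (auto simp: in_range4_def)
  have "ph (perm_op m n P i j l k) = (if l = j \<and> k = i then sg (b j) e else 0)"
    using with_sign_PS(2)[OF mn U(1) U0(2)] r' by (simp add: perm_op_def \<Phi>_zero[OF mn] \<Phi>_one[OF mn])
  then show "ph (Pt i j k l) = (if k = i \<and> l = j then sg (b l * b k + b l + b j) e else 0)"
    by (auto simp: Pt_def tau2_def with_sign_PS(2)[OF mn U(1) perm] add.assoc)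
qed

definition "T1 = copy1 m n P (t (of_nat m - of_nat n))"

lemma T1_facts:
  "vals U T1" "in_range4 m n i j k l ==> ph (T1 i j k l) = (if k = l then a' i j else 0)"
  using copy1_facts[of "t (of_nat m - of_nat n)"] t1 unfolding T1_def by (auto simp: in_range4_def)

lemma a'_e: "i \<in> K ==> j \<in> K ==> e * a' i j = a' i j"
  using Phi_e(1)[of "t (of_nat m - of_nat n) i j"] UD[OF t1(1)] t1(2)[of i j, symmetric] by (simp add: sg_mult_right)

lemma Pt_T1:
  "vals U (Pt \<otimes>\<^bsub>M\<^esub> T1)"
  "in_range4 m n i j k l ==> ph ((Pt \<otimes>\<^bsub>M\<^esub> T1) i j k l) = (if k = i then sg (pp b i l l j + b l * b i) (a' l j) else 0)"
proof -
  show "vals U (Pt \<otimes>\<^bsub>M\<^esub> T1)" by (rule End2_mult(1)[OF mn U(1) U(1) U(1) U(3) Pt_facts(1) T1_facts(1)])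
  assume r: "in_range4 m n i j k l"
  note ijkl = range4D[OF r]
  define v where "v = (if k = i then sg (pp b i l l j + b l * b i) (a' l j) else 0)"
  have "ph ((Pt \<otimes>\<^bsub>M\<^esub> T1) i j k l) = (\<Sum>p\<in>K. \<Sum>q\<in>K. sg (pp b k q p j)
      ((pfps ^^ (b p + b j + b q + b l)) (ph (Pt i p k q)) * ph (T1 p j q l)))"
    by (rule End2_mult(2)[OF mn U(1) U(1) U(1) U(3) Pt_facts(1) T1_facts(1) r])
  also have "\<dots> = (\<Sum>p\<in>K. \<Sum>q\<in>K. if p = l then if q = l then v else 0 else 0)"
  proof (intro sum.cong refl)
    fix p q assume pq: "p \<in> K" "q \<in> K"
    have 1: "ph (Pt i p k q) = (if k = i \<and> q = p then sg (b q * b k + b q + b p) e else 0)"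
      using pq ijkl by (intro Pt_facts(2) range4I) auto
    have 2: "ph (T1 p j q l) = (if q = l then a' p j else 0)"
      using pq ijkl by (intro T1_facts(2) range4I) auto
    have 3: "(pfps ^^ x) (sg y e) = sg y e" for x y
      using pfps_pow_homog[of "sg y e" 0 x] pfps_e by (simp add: pfps.h_sg)
    show "sg (pp b k q p j) ((pfps ^^ (b p + b j + b q + b l)) (ph (Pt i p k q)) * ph (T1 p j q l))
	= (if p = l then if q = l then v else 0 else 0)"
    proof (cases "p = l \<and> q = l \<and> k = i")
      case True
      then have "sg (pp b k q p j) ((pfps ^^ (b p + b j + b q + b l)) (ph (Pt i p k q)) * ph (T1 p j q l))
	  = sg (pp b i l l j) (sg (b l * b i + b l + b l) e * a' l j)"
	unfolding 1 2 by (simp add: 3)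
      also have "\<dots> = sg (pp b i l l j + b l * b i) (a' l j)"
	using ijkl by (simp only: sg_mult_left a'_e sg_sg) (rule sg_cong, auto)
      finally show ?thesis using True by (simp add: v_def)
    next
      case False
      then show ?thesis unfolding 1 2 v_def by auto
    qed
  qed
  also have "\<dots> = v" using ijkl by (intro sum_sum_delta) auto
  finally show "ph ((Pt \<otimes>\<^bsub>M\<^esub> T1) i j k l) = (if k = i then sg (pp b i l l j + b l * b i) (a' l j) else 0)"
    by (simp only: v_def)
qed

lemma tau_S2:
  "vals U (tau2 m P S2)"
  "in_range4 m n i j k l ==> ph (tau2 m P S2 i j k l) = (if i = j then sg (b l * b k + b l) (s l k) else 0)"
proof -
  have S: "S2 i j k l q \<in> U" for i j k l q using S2_facts(1) by (simp add: vals_def[OF mn])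
  show "vals U (tau2 m P S2)"
    unfolding vals_def[OF mn] tau2_def by (intro allI with_sign_PS(1)[OF mn U(1)] S)
  assume "in_range4 m n i j k l"
  then have "in_range4 m n i j l k" by (auto simp: in_range4_def)
  then show "ph (tau2 m P S2 i j k l) = (if i = j then sg (b l * b k + b l) (s l k) else 0)"
    by (simp add: tau2_def with_sign_PS(2)[OF mn U(1) S] S2_facts(3))
qed

lemma contracts_z: "contracts K a' s (ph z)"
  unfolding contracts_def
proof (intro ballI)
  fix j l assume jl: "j \<in> K" "l \<in> K"
  have r: "in_range4 m n j j j l" using jl by (intro range4I)
  have eq: "Pt \<otimes>\<^bsub>M\<^esub> T1 \<otimes>\<^bsub>M\<^esub> tau2 m P S2 = tens P Pt z"
    using z(2) inv_T2 unfolding z_equation_def Let_def T2_def Pt_def T1_def by simp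
  have "ph ((Pt \<otimes>\<^bsub>M\<^esub> T1 \<otimes>\<^bsub>M\<^esub> tau2 m P S2) j j j l)
      = (\<Sum>q\<in>K. (pfps ^^ (b q + b l)) (ph ((Pt \<otimes>\<^bsub>M\<^esub> T1) j j j q)) * sg (b l * b q + b l) (s l q))"
    by (rule mult_right_diag[OF U(1) U(1) U(3) Pt_T1(1) tau_S2 r])
  also have "\<dots> = (\<Sum>q\<in>K. sg (b j + b j * b l + b l) (a' q j * s l q))"
  proof (rule sum.cong[OF refl])
    fix q assume q: "q \<in> K"
    have "ph ((Pt \<otimes>\<^bsub>M\<^esub> T1) j j j q) = sg (pp b j q q j + b q * b j) (a' q j)"
      using Pt_T1(2)[OF range4I] jl q by simp
    moreover have "(pfps ^^ x) (sg y (a' q j)) = sg (x * (b q + b j) + y) (a' q j)" for x y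
      using pfps_pow_homog[OF t1(3)[OF q jl(1)], of x] rng_hom.h_sg[OF pfps_pow_hom] by (simp add: add.commute)
    ultimately show "(pfps ^^ (b q + b l)) (ph ((Pt \<otimes>\<^bsub>M\<^esub> T1) j j j q)) * sg (b l * b q + b l) (s l q)
	= sg (b j + b j * b l + b l) (a' q j * s l q)"
      by (simp only: sg_mult_left sg_mult_right sg_sg) (rule sg_cong, auto)
  qed
  also have "\<dots> = sg (b j + b j * b l + b l) (\<Sum>q\<in>K. a' q j * s l q)"
    by (simp only: sg_sum)
  finally have L: "ph ((Pt \<otimes>\<^bsub>M\<^esub> T1 \<otimes>\<^bsub>M\<^esub> tau2 m P S2) j j j l) = sg (b j + b j * b l + b l) (\<Sum>q\<in>K. a' q j * s l q)" .
  have PtU: "Pt j j j l i \<in> U" for i using Pt_facts(1) by (simp add: vals_def[OF mn])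
  have "ph (tens P Pt z j j j l) = ph (Pt j j j l) * ph z"
    unfolding tens_def
    by (rule PS_mult(2)[OF mn U(1) U(3)[OF PtU z(1)] DD_carrier[OF mn UD[OF PtU]] DD_carrier[OF mn UD[OF z(1)]]])
  also have "\<dots> = (if j = l then sg (b j + b j * b l + b l) (ph z) else 0)"
    using Pt_facts(2)[OF r] Phi_e(1)[OF UD[OF z(1)]] by (auto simp: sg_mult_left intro!: sg_cong)
  finally show "(\<Sum>q\<in>K. a' q j * s l q) = (if j = l then ph z else 0)"
    using L unfolding eq by (auto simp: sg_eq_iff)
qed

end

section \<open>The series \<open>z(u)\<close> and \<open>z\<^sup>+(u)\<close>\<close>

lemma gr_inverse_cong:
  assumes eq: "!!i j. i \<in> K ==> j \<in> K ==> a i j = a' i j" and inv: "gr_inverse K p e a s"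
  shows "gr_inverse K p e a' s"
  unfolding gr_inverse_def
proof (intro ballI conjI)
  fix k l assume kl: "k \<in> K" "l \<in> K"
  have "(\<Sum>q\<in>K. sg (pp p q l k q) (a' k q * s q l)) = (\<Sum>q\<in>K. sg (pp p q l k q) (a k q * s q l))"
    by (rule sum.cong[OF refl]) (simp only: eq[OF kl(1)])
  also have "\<dots> = (if k = l then e else 0)"
    by (rule inv[unfolded gr_inverse_def, rule_format, OF kl, THEN conjunct1])
  finally show "(\<Sum>q\<in>K. sg (pp p q l k q) (a' k q * s q l)) = (if k = l then e else 0)" .
  have "(\<Sum>q\<in>K. sg (pp p q l k q) (s k q * a' q l)) = (\<Sum>q\<in>K. sg (pp p q l k q) (s k q * a q l))"
    by (rule sum.cong[OF refl]) (simp only: eq[OF _ kl(2)])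
  also have "\<dots> = (if k = l then e else 0)"
    by (rule inv[unfolded gr_inverse_def, rule_format, OF kl, THEN conjunct2])
  finally show "(\<Sum>q\<in>K. sg (pp p q l k q) (s k q * a' q l)) = (if k = l then e else 0)" .
qed

lemma zero_power_diff: "x \<le> k ==> (0 :: complex) ^ (k - x) = (if x = k then 1 else 0)"
  by (auto simp: power_0_left)

lemma (in scalar_hom) shU_0: "shU 0 f = f"
proof (rule fps_ext)
  fix n
  have "shU 0 f $ n = (\<Sum>i\<le>n. if i = n then f $ i else 0)"
    unfolding shU_def fps_nth_Abs_fps
    by (intro sum.cong refl) (auto simp: shift_fps_power_nth zero_power_diff cs_0 cs_1)
  then show "shU 0 f $ n = f $ n" by simp
qed

lemma DY_finsum_scal:
  assumes "!!r. r \<in> S ==> f r \<in> freeC m n"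
  shows "(\<Oplus>\<^bsub>DY m n\<^esub>r\<in>S. scal (DY m n) (c r) \<otimes>\<^bsub>DY m n\<^esub> dy_class m n (f r)) = dy_class m n (\<Sum>r\<in>S. cst (c r) * f r)"
proof -
  have "(\<Oplus>\<^bsub>DY m n\<^esub>r\<in>S. scal (DY m n) (c r) \<otimes>\<^bsub>DY m n\<^esub> dy_class m n (f r)) = (\<Oplus>\<^bsub>DY m n\<^esub>r\<in>S. dy_class m n (cst (c r) * f r))"
    using assms dy_class_closed[of "cst (c _) * f _" m n]
    by (intro abelian_monoid.finsum_cong' abelian_group.axioms(1) ring.is_abelian_group ring_DY)
       (auto simp: DY_scal dy_class_mult freeC_mult)
  also have "\<dots> = dy_class m n (\<Sum>r\<in>S. cst (c r) * f r)"
    by (rule dy_class_sum) (intro freeC_mult freeC_cst assms)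
  finally show ?thesis .
qed

lemma t_series_DY: "t_series (DY m n) (tY m n) i j r = dy_class m n (tF i j r)"
  by (simp add: t_series_def tY_def tF_def delta_def dy_class_1 dy_class_0)

lemma tplus_series_DY:
  assumes "i \<in> {1..m+n}" "j \<in> {1..m+n}"
  shows "tplus_series (DY m n) (tYplus m n) i j k = dy_class m n (tpF i j k)"
proof -
  have g: "gen_el (TMinusGen i j (Suc k)) \<in> freeC m n" using assms by (intro freeC_gen) auto
  have "(if k = 0 then delta (DY m n) i j else \<zero>\<^bsub>DY m n\<^esub>) = dy_class m n (if k = 0 \<and> i = j then 1 else 0)"
    by (simp add: delta_def dy_class_1 dy_class_0)
  then show ?thesis using g by (simp add: tplus_series_def tYplus_def tpF_def dy_class_minus)
qed

lemma tF_yang: "i \<in> {1..m+n} ==> j \<in> {1..m+n} ==> tF i j r \<in> freeG (yangian_gens m n)"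
  by (auto simp: tF_def yangian_gens_def intro!: freeG_simps)

lemma tpF_plus: "i \<in> {1..m+n} ==> j \<in> {1..m+n} ==> tpF i j r \<in> freeG (plus_gens m n)"
  unfolding tpF_def diff_conv_add_uminus by (intro freeG_simps) (auto simp: plus_gens_def intro: freeG_simps)

lemma freeJ_JC: "f \<in> freeJ m n p ==> f \<in> JC m n p"
  using freeJ_simps(7)[of 0 p f m n] freeJ_simps(8)[of m n] unfolding JC_def by (auto intro!: bexI[of _ f])

text \<open>Serves the binomial sums of the shift as well as the Neumann series of the dual Yangian:
  in both, the summand of index \<open>s\<close> has degree at least \<open>s\<close>.\<close>

lemma sums_FX:
  assumes W: "!!s. W s \<in> freeG (plus_gens m n)" "!!s. 1 \<le> s ==> W s \<in> freeJ m n s"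
  shows "(\<lambda>N. \<Sum>s\<in>{k..N}. W s) \<in> FX m n"
  unfolding FX_def
proof (intro CollectI conjI allI)
  show "(\<Sum>s\<in>{k..N}. W s) \<in> freeG (plus_gens m n)" for N by (intro freeG_sum W)
  fix p
  have *: "(\<Sum>s\<in>{k..N}. W s) - (\<Sum>s\<in>{k..M}. W s) \<in> JC m n p" if "Suc p \<le> M" "M \<le> N" for M N
  proof -
    have "(\<Sum>s\<in>{k..N}. W s) = (\<Sum>s\<in>{k..M}. W s) + (\<Sum>s\<in>{k..N} - {k..M}. W s)"
      using that by (subst sum.subset_diff[of "{k..M}"]) (auto simp: add.commute)
    moreover have "(\<Sum>s\<in>{k..N} - {k..M}. W s) \<in> freeJ m n p"
    proof (rule freeJ_sum)
      fix s assume "s \<in> {k..N} - {k..M}"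
      then have "1 \<le> s" "p \<le> s" using that by auto
      then show "W s \<in> freeJ m n p" using freeJ_simps(7)[OF _ W(2)] by blast
    qed
    ultimately show ?thesis by (simp add: freeJ_JC)
  qed
  show "\<exists>N. \<forall>k'\<ge>N. \<forall>l\<ge>N. (\<Sum>s\<in>{k..k'}. W s) - (\<Sum>s\<in>{k..l}. W s) \<in> JC m n p"
  proof (intro exI[of _ "Suc p"] allI impI)
    fix k' l assume "Suc p \<le> k'" "Suc p \<le> l"
    then show "(\<Sum>s\<in>{k..k'}. W s) - (\<Sum>s\<in>{k..l}. W s) \<in> JC m n p"
      using *[of l k'] JC_minus[OF *[of k' l]] by (cases "l \<le> k'") auto
  qed
qed

context
  fixes m n :: nat
  assumes mn: "m \<noteq> n"
begin

abbreviation "Kx \<equiv> {1..m+n}"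
abbreviation "kap \<equiv> of_nat m - of_nat n :: complex"

interpretation GA: geometric_inverse m n \<tau>A by (rule geometric_inverse_A[OF mn])
interpretation GB: geometric_inverse m n \<tau>B by (rule geometric_inverse_B[OF mn])

lemma Phi_flim: "\<Phi> m n (\<lambda>k. flim m n (G k)) = Abs_fps (\<lambda>k. Lm m n (G k))"
  by (simp add: \<Phi>_def[OF mn] Lm_def[OF mn])

lemma Lm_sg: "f \<in> FC m n ==> Lm m n (\<lambda>N. sg d (f N)) = sg d (Lm m n f)"
  by (simp add: sg_def Lm_minus[OF mn])

lemma pfps_homog:
  assumes G: "!!k. G k \<in> FC m n" "!!k N. freepar m (G k N) = sg d (G k N)"
  shows "pfps (sg d' (\<Phi> m n (\<lambda>k. flim m n (G k)))) = sg d (sg d' (\<Phi> m n (\<lambda>k. flim m n (G k))))"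
proof -
  have "pfps (\<Phi> m n (\<lambda>k. flim m n (G k))) = sg d (\<Phi> m n (\<lambda>k. flim m n (G k)))"
    unfolding Phi_flim by (rule fps_ext) (simp add: pfps_def Lm_par[OF mn] G Lm_sg sg_fps_nth)
  then show ?thesis by (simp add: pfps.h_sg add.commute)
qed

subsection \<open>The Yangian\<close>

definition tsF :: "complex => nat => nat => nat => free_el" where
  "tsF c i j k = (\<Sum>r\<le>k. cst (((- of_nat r) gchoose (k - r)) * c ^ (k - r)) * tF i j r)"

lemma tsF_yang: "i \<in> Kx ==> j \<in> Kx ==> tsF c i j k \<in> freeG (yangian_gens m n)"
  unfolding tsF_def by (intro freeG_sum freeG_simps(7) freeG_simps(2) tF_yang)

lemma tsF_closed: "i \<in> Kx ==> j \<in> Kx ==> tsF c i j k \<in> freeC m n"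
  by (rule yang_freeC[OF mn tsF_yang])

lemma t_shift_eq:
  assumes "i \<in> Kx" "j \<in> Kx"
  shows "t_shift m n c i j k = flim m n (\<lambda>_. tsF c i j k)"
  unfolding t_shift_def t_series_DY tsF_def
  using DY_finsum_scal[of "{..k}" "tF i j" m n] tF_closed[OF assms] by (simp add: dy_embed_flim[OF mn])

lemma t_shift_Phi:
  assumes ij: "i \<in> Kx" "j \<in> Kx"
  shows "sg (tsg m i j) (\<Phi> m n (t_shift m n c i j)) = dyp.shU c (Abs_fps (A m n i j))"
proof (rule fps_ext)
  fix k
  have t: "tF i j r \<in> freeC m n" for r by (rule tF_closed[OF ij])
  have "sg (tsg m i j) (\<Phi> m n (t_shift m n c i j)) $ k = sg (tsg m i j) (\<eta> m n (tsF c i j k))"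
    by (simp add: sg_fps_nth \<Phi>_def[OF mn] t_shift_eq[OF ij] \<eta>_def[OF mn] Lm_def[OF mn])
  also have "\<eta> m n (tsF c i j k) = (\<Sum>r\<le>k. cs_dyp (((- of_nat r) gchoose (k - r)) * c ^ (k - r)) * \<eta> m n (tF i j r))"
    unfolding tsF_def using t by (subst \<eta>_sum[OF mn]) (auto simp: \<eta>_cst[OF mn] freeC_mult)
  also have "sg (tsg m i j) \<dots> = dyp.shU c (Abs_fps (A m n i j)) $ k"
    unfolding dyp.shU_def fps_nth_Abs_fps sg_sum
    by (intro sum.cong refl) (simp add: shift_fps_power_nth A_def[OF mn] aN_def \<eta>_sg[OF mn t] sg_mult_right)
  finally show "sg (tsg m i j) (\<Phi> m n (t_shift m n c i j)) $ k = dyp.shU c (Abs_fps (A m n i j)) $ k" .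
qed

lemma t_shift_par:
  assumes ij: "i \<in> Kx" "j \<in> Kx"
  shows "pfps (sg d (\<Phi> m n (t_shift m n c i j))) = sg (pbar m i + pbar m j) (sg d (\<Phi> m n (t_shift m n c i j)))"
proof -
  have "t_shift m n c i j = (\<lambda>k. flim m n (\<lambda>_. tsF c i j k))" using t_shift_eq[OF ij] by (intro ext)
  moreover have "freepar m (tsF c i j k) = sg (pbar m i + pbar m j) (tsF c i j k)" for k
    by (simp add: tsF_def freepar_sum freepar_mult tF_par sg_sum sg_mult_right)
  ultimately show ?thesis using pfps_homog[of "\<lambda>k _. tsF c i j k"] FC_const[OF tsF_closed[OF ij]] by simp
qed

text \<open>The coefficient \<open>q\<close> of the Neumann series is stationary from
  \<open>N = q\<close> on. So the inverse of \<open>T(u)\<close> has its entries in the Yangian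
  itself and not merely in the completion.\<close>

lemma geom_A_stable:
  assumes ij: "i \<in> Kx" "j \<in> Kx"
  shows "flim m n (\<lambda>N. geom Kx \<tau>A N i j $ q) = flim m n (\<lambda>_. geom Kx \<tau>A q i j $ q)"
proof -
  have stable: "geom Kx \<tau>A N i j $ q = geom Kx \<tau>A q i j $ q" if "q \<le> N" for N
    unfolding geom_def fps_sum_nth using that \<tau>A_pow[OF ij] by (intro sum.mono_neutral_right) auto
  have "\<exists>N0. \<forall>N\<ge>N0. geom Kx \<tau>A N i j $ q - geom Kx \<tau>A q i j $ q \<in> Kf m n p" for p
  proof (intro exI allI impI)
    fix N assume "q \<le> N"
    show "geom Kx \<tau>A N i j $ q - geom Kx \<tau>A q i j $ q \<in> Kf m n p"
      unfolding stable[OF \<open>q \<le> N\<close>] diff_self by (rule Kf_0)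
  qed
  then have "(\<lambda>N. geom Kx \<tau>A N i j $ q - geom Kx \<tau>A q i j $ q) \<in> Fnull m n"
    by (intro FnullI freeC_diff GA.SN_closed[OF ij])
  then show ?thesis
    by (simp only: flim_eq_iff[OF mn GA.SN_FC[OF ij] FC_const[OF GA.SN_closed[OF ij]]])
qed

lemma TT_A: "i \<in> Kx ==> j \<in> Kx ==> sg (tsg m i j) (GA.TT i j) = Abs_fps (A m n i j)"
proof (rule fps_ext)
  fix r assume ij: "i \<in> Kx" "j \<in> Kx"
  have "((if i = j then 1 else 0) - \<tau>A i j) $ r = tF i j r"
    by (simp add: tF_def \<tau>A_nth)
  then show "sg (tsg m i j) (GA.TT i j) $ r = Abs_fps (A m n i j) $ r"
    by (simp add: GA.TT_def sg_fps_nth A_def[OF mn] aN_def \<eta>_sg[OF mn tF_closed[OF ij]])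
qed

lemma inv_A': "gr_inverse Kx (pbar m) (fps_const (e1 m n)) (\<lambda>i j. Abs_fps (A m n i j)) (\<lambda>i j. sg (tsg m i j) (GA.SS i j))"
  by (rule gr_inverse_cong[OF TT_A GA.gr_inverse_TT_SS])

lemma SS_facts:
  assumes "geometric_inverse m n \<tau>" and ij: "i \<in> Kx" "j \<in> Kx"
  shows "\<Phi> m n (\<lambda>q. flim m n (\<lambda>N. geom Kx \<tau> N i j $ q)) = geometric_inverse.SS m n \<tau> i j"
    and "pfps (sg d (geometric_inverse.SS m n \<tau> i j)) = sg (pbar m i + pbar m j) (sg d (geometric_inverse.SS m n \<tau> i j))"
proof -
  interpret G: geometric_inverse m n \<tau> by (rule assms)
  show 1: "\<Phi> m n (\<lambda>q. flim m n (\<lambda>N. geom Kx \<tau> N i j $ q)) = G.SS i j"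
    unfolding Phi_flim G.SS_def ..
  show "pfps (sg d (G.SS i j)) = sg (pbar m i + pbar m j) (sg d (G.SS i j))"
    unfolding 1[symmetric] by (rule pfps_homog[OF G.SN_FC[OF ij] G.SN_par])
qed

lemma contracts_z_series:
  assumes z: "is_z_series m n z"
  shows "contracts Kx (\<lambda>i j. dyp.shU kap (Abs_fps (A m n i j))) (\<lambda>i j. sg (tsg m i j) (GA.SS i j)) (\<Phi> m n z)"
proof -
  note SP = subring_par_YH[OF mn, unfolded subring_par_def[OF mn]]
  have tU: "t_shift m n c i j k \<in> dy_embed m n ` yangian m n" if "i \<in> Kx" "j \<in> Kx" for c i j k
    unfolding YH_eq[OF mn] t_shift_eq[OF that] by (intro imageI tsF_yang that)
  have sU: "flim m n (\<lambda>N. geom Kx \<tau>A N i j $ q) \<in> dy_embed m n ` yangian m n" if ij: "i \<in> Kx" "j \<in> Kx" for i j q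
    unfolding YH_eq[OF mn] geom_A_stable[OF ij]
    using \<tau>A_pow[OF ij] by (intro imageI) (simp add: geom_def fps_sum_nth freeG_sum)
  interpret z_data m n "dy_embed m n ` yangian m n" "t_shift m n" "\<lambda>i j. Abs_fps (A m n i j)"
    "\<lambda>i j. dyp.shU kap (Abs_fps (A m n i j))" "\<lambda>i j. sg (tsg m i j) (GA.SS i j)"
    "\<lambda>i j q. flim m n (\<lambda>N. geom Kx \<tau>A N i j $ q)" z
  proof
    show t0: "sg (tsg m i j) (\<Phi> m n (t_shift m n 0 i j)) = Abs_fps (A m n i j)" if "i \<in> Kx" "j \<in> Kx" for i j
      using t_shift_Phi[OF that, of 0] by (simp add: dyp.shU_0)
    show "pfps (Abs_fps (A m n i j)) = sg (pbar m i + pbar m j) (Abs_fps (A m n i j))" if "i \<in> Kx" "j \<in> Kx" for i j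
      unfolding t0[OF that, symmetric] by (rule t_shift_par[OF that])
    show "pfps (dyp.shU kap (Abs_fps (A m n i j))) = sg (pbar m i + pbar m j) (dyp.shU kap (Abs_fps (A m n i j)))" if "i \<in> Kx" "j \<in> Kx" for i j
      unfolding t_shift_Phi[OF that, symmetric] by (rule t_shift_par[OF that])
    show "z k \<in> dy_embed m n ` yangian m n" "z_equation m n (t_shift m n) z" for k
      using z unfolding is_z_series_def by blast+
    show "(\<forall>x\<in>carrier (ext_DY m n). \<forall>y\<in>dy_embed m n ` yangian m n. x \<otimes>\<^bsub>DY_hat m n\<^esub> y \<in> carrier (ext_DY m n)) \<or>
      (\<forall>x\<in>dy_embed m n ` yangian m n. \<forall>y\<in>carrier (ext_DY m n). x \<otimes>\<^bsub>DY_hat m n\<^esub> y \<in> carrier (ext_DY m n))"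
      using DD_YH[OF mn] by blast
    show "\<one>\<^bsub>DY_hat m n\<^esub> \<in> dy_embed m n ` yangian m n" using SP by blast
    show "x \<otimes>\<^bsub>DY_hat m n\<^esub> y \<in> dy_embed m n ` yangian m n" if "x \<in> dy_embed m n ` yangian m n" "y \<in> dy_embed m n ` yangian m n" for x y
      using SP that by blast
    show "sg (tsg m i j) (\<Phi> m n (\<lambda>q. flim m n (\<lambda>N. geom Kx \<tau>A N i j $ q))) = sg (tsg m i j) (GA.SS i j)" if "i \<in> Kx" "j \<in> Kx" for i j
      by (simp only: SS_facts(1)[OF geometric_inverse_A[OF mn] that])
    show "pfps (sg (tsg m i j) (GA.SS i j)) = sg (pbar m i + pbar m j) (sg (tsg m i j) (GA.SS i j))" if "i \<in> Kx" "j \<in> Kx" for i j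
      by (rule SS_facts(2)[OF geometric_inverse_A[OF mn] that])
  qed (rule mn addclosed_YH[OF mn] tU sU t_shift_Phi inv_A'; assumption)+
  show ?thesis by (rule contracts_z)
qed

subsection \<open>The dual Yangian\<close>

definition tpsF :: "complex => nat => nat => nat => nat => free_el" where
  "tpsF c i j k N = (\<Sum>s\<in>{k..N}. cst (of_nat (s choose k) * c ^ (s - k)) * tpF i j s)"

lemma tpsF_FX:
  assumes ij: "i \<in> Kx" "j \<in> Kx"
  shows "tpsF c i j k \<in> FX m n"
  unfolding tpsF_def
proof (rule sums_FX)
  fix s
  show "cst (of_nat (s choose k) * c ^ (s - k)) * tpF i j s \<in> freeG (plus_gens m n)"
    by (intro freeG_simps(7) freeG_simps(2) tpF_plus ij)
  assume "1 \<le> s"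
  then have "tpF i j s = - gen_el (TMinusGen i j (Suc s))" by (simp add: tpF_def)
  then have "tpF i j s \<in> freeJ m n (Suc s)" using freeJ_simps(2,4) ij by simp
  then have "tpF i j s \<in> freeJ m n s" by (rule freeJ_simps(7)[rotated]) simp
  moreover have "cst x \<in> freeJ m n 0" for x by (simp add: freeJ_simps(8) freeG_simps)
  ultimately show "cst (of_nat (s choose k) * c ^ (s - k)) * tpF i j s \<in> freeJ m n s"
    using freeJ_simps(5)[of _ m n 0 _ s] by simp
qed

lemma tplus_shift_eq:
  assumes ij: "i \<in> Kx" "j \<in> Kx"
  shows "tplus_shift m n c i j k = flim m n (tpsF c i j k)"
  unfolding tplus_shift_def tplus_series_DY[OF ij] flim_def tpsF_def
  by (subst DY_finsum_scal) (use tpF_closed[OF ij] in auto)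

lemma tpsF_par: "freepar m (tpsF c i j k N) = sg (pbar m i + pbar m j) (tpsF c i j k N)"
  by (simp add: tpsF_def freepar_sum freepar_mult tpF_par sg_sum sg_mult_right)

lemma tplus_shift_par:
  assumes ij: "i \<in> Kx" "j \<in> Kx"
  shows "pfps (sg d (\<Phi> m n (tplus_shift m n c i j))) = sg (pbar m i + pbar m j) (sg d (\<Phi> m n (tplus_shift m n c i j)))"
proof -
  have "tplus_shift m n c i j = (\<lambda>k. flim m n (tpsF c i j k))" using tplus_shift_eq[OF ij] by (intro ext)
  then show ?thesis using pfps_homog[of "tpsF c i j", OF FX_FC[OF tpsF_FX[OF ij]] tpsF_par] by simp
qed

lemma tplus_shift_Phi:
  assumes ij: "i \<in> Kx" "j \<in> Kx"
  shows "sg (tsg m i j) (\<Phi> m n (tplus_shift m n kap i j)) = Abs_fps (Bsh m n i j)"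
    and "sg (tsg m i j) (\<Phi> m n (tplus_shift m n 0 i j)) = Abs_fps (B m n i j)"
proof -
  have nth: "sg (tsg m i j) (\<Phi> m n (tplus_shift m n c i j)) $ k = Lm m n (\<lambda>N. sg (tsg m i j) (tpsF c i j k N))" for c k
    by (simp add: sg_fps_nth \<Phi>_def[OF mn] tplus_shift_eq[OF ij] Lm_sg[OF FX_FC[OF tpsF_FX[OF ij]]]) (simp add: Lm_def[OF mn])
  show "sg (tsg m i j) (\<Phi> m n (tplus_shift m n kap i j)) = Abs_fps (Bsh m n i j)"
  proof (rule fps_ext)
    fix k
    have "(\<lambda>N. sg (tsg m i j) (tpsF kap i j k N)) = SF m n k (bN m i j)"
      by (rule ext) (simp add: tpsF_def SF_def[OF mn] bN_def sg_sum sg_mult_right)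
    then show "sg (tsg m i j) (\<Phi> m n (tplus_shift m n kap i j)) $ k = Abs_fps (Bsh m n i j) $ k"
      by (simp add: nth Bsh_def[OF mn])
  qed
  show "sg (tsg m i j) (\<Phi> m n (tplus_shift m n 0 i j)) = Abs_fps (B m n i j)"
  proof (rule fps_ext)
    fix k
    \<comment> \<open>For \<open>c = 0\<close> only the summand \<open>s = k\<close> survives, by
      \<open>0 ^ 0 = 1\<close>, and it is present only once \<open>N\<close> has reached
      \<open>k\<close>; hence the comparison of limits below.\<close>
    have eq: "tpsF 0 i j k N = tpF i j k" if "k \<le> N" for N
    proof -
      have "tpsF 0 i j k N = (\<Sum>s\<in>{k..N}. if s = k then tpF i j k else 0)"
	unfolding tpsF_def by (intro sum.cong refl) (auto simp: zero_power_diff)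
      then show ?thesis using that by simp
    qed
    have "(\<lambda>N. tpsF 0 i j k N - tpF i j k) \<in> Fnull m n"
    proof (rule FnullI)
      show "tpsF 0 i j k N - tpF i j k \<in> freeC m n" for N
	by (intro freeC_diff FC_closed[OF FX_FC[OF tpsF_FX[OF ij]]] tpF_closed ij)
      show "\<exists>N0. \<forall>N\<ge>N0. tpsF 0 i j k N - tpF i j k \<in> Kf m n p" for p
	by (intro exI[of _ k]) (simp add: eq Kf_0)
    qed
    then have "Lm m n (tpsF 0 i j k) = \<eta> m n (tpF i j k)"
      using Lm_eq_iff[OF mn FX_FC[OF tpsF_FX[OF ij]] FC_const[OF tpF_closed[OF ij]]] by (simp add: \<eta>_def[OF mn])
    then show "sg (tsg m i j) (\<Phi> m n (tplus_shift m n 0 i j)) $ k = Abs_fps (B m n i j) $ k"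
      by (simp add: nth Lm_sg[OF FX_FC[OF tpsF_FX[OF ij]]] B_def[OF mn] bN_def \<eta>_sg[OF mn tpF_closed[OF ij]])
  qed
qed

lemma TT_B: "i \<in> Kx ==> j \<in> Kx ==> sg (tsg m i j) (GB.TT i j) = Abs_fps (B m n i j)"
proof (rule fps_ext)
  fix r assume ij: "i \<in> Kx" "j \<in> Kx"
  have "((if i = j then 1 else 0) - \<tau>B i j) $ r = tpF i j r"
    by (simp add: tpF_def \<tau>B_nth)
  then show "sg (tsg m i j) (GB.TT i j) $ r = Abs_fps (B m n i j) $ r"
    by (simp add: GB.TT_def sg_fps_nth B_def[OF mn] bN_def \<eta>_sg[OF mn tpF_closed[OF ij]])
qed

lemma inv_B': "gr_inverse Kx (pbar m) (fps_const (e1 m n)) (\<lambda>i j. Abs_fps (B m n i j)) (\<lambda>i j. sg (tsg m i j) (GB.SS i j))"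
  by (rule gr_inverse_cong[OF TT_B GB.gr_inverse_TT_SS])

lemma geom_B_FX:
  assumes ij: "i \<in> Kx" "j \<in> Kx"
  shows "(\<lambda>N. geom Kx \<tau>B N i j $ q) \<in> FX m n"
proof -
  have "mat_pow Kx \<tau>B s i j $ q \<in> freeG (plus_gens m n)" for s
    using freeJ_simps(7)[OF _ \<tau>B_pow[OF ij], of 0] freeJ_simps(8) by simp
  then show ?thesis
    using sums_FX[of "\<lambda>s. mat_pow Kx \<tau>B s i j $ q" m n 0] \<tau>B_pow[OF ij]
    by (simp add: geom_def fps_sum_nth atLeast0AtMost)
qed

lemma contracts_zplus_series:
  assumes z: "is_zplus_series m n z"
  shows "contracts Kx (\<lambda>i j. Abs_fps (Bsh m n i j)) (\<lambda>i j. sg (tsg m i j) (GB.SS i j)) (\<Phi> m n z)"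
proof -
  note SP = subring_par_XH[OF mn, unfolded subring_par_def[OF mn]]
  have tU: "tplus_shift m n c i j k \<in> ext_dual_yangian m n" if "i \<in> Kx" "j \<in> Kx" for c i j k
    unfolding ext_dual_eq tplus_shift_eq[OF that] by (intro imageI tpsF_FX that)
  have sU: "flim m n (\<lambda>N. geom Kx \<tau>B N i j $ q) \<in> ext_dual_yangian m n" if ij: "i \<in> Kx" "j \<in> Kx" for i j q
    unfolding ext_dual_eq by (intro imageI geom_B_FX ij)
  interpret z_data m n "ext_dual_yangian m n" "tplus_shift m n" "\<lambda>i j. Abs_fps (B m n i j)"
    "\<lambda>i j. Abs_fps (Bsh m n i j)" "\<lambda>i j. sg (tsg m i j) (GB.SS i j)"
    "\<lambda>i j q. flim m n (\<lambda>N. geom Kx \<tau>B N i j $ q)" z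
  proof
    show "pfps (Abs_fps (B m n i j)) = sg (pbar m i + pbar m j) (Abs_fps (B m n i j))" if "i \<in> Kx" "j \<in> Kx" for i j
      unfolding tplus_shift_Phi(2)[OF that, symmetric] by (rule tplus_shift_par[OF that])
    show "pfps (Abs_fps (Bsh m n i j)) = sg (pbar m i + pbar m j) (Abs_fps (Bsh m n i j))" if "i \<in> Kx" "j \<in> Kx" for i j
      unfolding tplus_shift_Phi(1)[OF that, symmetric] by (rule tplus_shift_par[OF that])
    show "z k \<in> ext_dual_yangian m n" "z_equation m n (tplus_shift m n) z" for k
      using z unfolding is_zplus_series_def by blast+
    show "(\<forall>x\<in>carrier (ext_DY m n). \<forall>y\<in>ext_dual_yangian m n. x \<otimes>\<^bsub>DY_hat m n\<^esub> y \<in> carrier (ext_DY m n)) \<or>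
      (\<forall>x\<in>ext_dual_yangian m n. \<forall>y\<in>carrier (ext_DY m n). x \<otimes>\<^bsub>DY_hat m n\<^esub> y \<in> carrier (ext_DY m n))"
      using XH_DD_mult[OF mn] by blast
    show "\<one>\<^bsub>DY_hat m n\<^esub> \<in> ext_dual_yangian m n" using SP by blast
    show "x \<otimes>\<^bsub>DY_hat m n\<^esub> y \<in> ext_dual_yangian m n" if "x \<in> ext_dual_yangian m n" "y \<in> ext_dual_yangian m n" for x y
      using SP that by blast
    show "sg (tsg m i j) (\<Phi> m n (\<lambda>q. flim m n (\<lambda>N. geom Kx \<tau>B N i j $ q))) = sg (tsg m i j) (GB.SS i j)" if "i \<in> Kx" "j \<in> Kx" for i j
      by (simp only: SS_facts(1)[OF geometric_inverse_B[OF mn] that])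
    show "pfps (sg (tsg m i j) (GB.SS i j)) = sg (pbar m i + pbar m j) (sg (tsg m i j) (GB.SS i j))" if "i \<in> Kx" "j \<in> Kx" for i j
      by (rule SS_facts(2)[OF geometric_inverse_B[OF mn] that])
  qed (rule mn addclosed_XH[OF mn] tU sU tplus_shift_Phi inv_B'; assumption)+
  show ?thesis by (rule contracts_z)
qed

subsection \<open>Centrality\<close>

text \<open>Commuting with the generators extends to the whole completion by
  \<open>Lm_commute_FC\<close>, and \<open>ext_DY\<close> is a part of it with the same product. The
  generator \<open>C\<close> commutes by the defining relations.\<close>

lemma centre_criterion:
  assumes x: "x \<in> carrier (ext_DY m n)"
    and A: "!!i j r. i \<in> Kx ==> j \<in> Kx ==> A m n i j r * inj_dyp m n x = inj_dyp m n x * A m n i j r"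
    and B: "!!i j q. i \<in> Kx ==> j \<in> Kx ==> B m n i j q * inj_dyp m n x = inj_dyp m n x * B m n i j q"
  shows "x \<in> centre (ext_DY m n)"
  unfolding centre_def
proof (intro CollectI conjI ballI x)
  have xH: "x \<in> carrier (DY_hat m n)" by (rule DD_carrier[OF mn x])
  obtain h where h: "h \<in> FC m n" "x = flim m n h" using DY_hat_elem[OF mn xH] .
  then have xh: "inj_dyp m n x = Lm m n h" by (simp add: Lm_def[OF mn])
  have gens: "Lm m n h * \<eta> m n (gen_el g) = \<eta> m n (gen_el g) * Lm m n h" if g: "g \<in> dy_gens m n" for g
  proof (cases g)
    case CGen
    then show ?thesis using is_centralD[OF \<eta>_central[OF mn modcentral_CGen]] by simp
  next
    case (TGen i j r)
    then have ij: "i \<in> Kx" "j \<in> Kx" and r: "1 \<le> r" using g by simp_all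
    have "gen_el g = tF i j r" using TGen r by (simp add: tF_def)
    then have "sg (tsg m i j) (A m n i j r) = \<eta> m n (gen_el g)"
      by (simp add: A_def[OF mn] aN_def \<eta>_sg[OF mn tF_closed[OF ij]] sg_cancel)
    then show ?thesis using A[OF ij, of r] unfolding xh by (metis sg_mult_left sg_mult_right)
  next
    case (TMinusGen i j r)
    then have ij: "i \<in> Kx" "j \<in> Kx" and r: "Suc (r - 1) = r" using g by simp_all
    \<comment> \<open>The generator is recovered from \<open>T\<^sup>+\<close> as the constant term
      minus the entry; the constant term is mapped to \<open>e1\<close> or 0, which are
      central.\<close>
    define \<delta> :: free_el where "\<delta> = (if r - 1 = 0 \<and> i = j then 1 else 0)"
    have \<delta>: "\<delta> \<in> freeC m n" "\<eta> m n \<delta> * y = y * \<eta> m n \<delta>" for y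
      using e1_central[OF mn] unfolding \<delta>_def is_central_def e1_def[OF mn] by (auto simp: \<eta>_0[OF mn])
    have "gen_el g = \<delta> - tpF i j (r - 1)"
      using TMinusGen r by (simp add: tpF_def \<delta>_def)
    then have "\<eta> m n (gen_el g) = \<eta> m n \<delta> - sg (tsg m i j) (B m n i j (r - 1))"
      by (simp add: \<eta>_diff[OF mn \<delta>(1) tpF_closed[OF ij]] B_def[OF mn] bN_def \<eta>_sg[OF mn tpF_closed[OF ij]] sg_cancel)
    then show ?thesis using B[OF ij, of "r - 1"] unfolding xh
      by (simp add: left_diff_distrib right_diff_distrib sg_mult_left sg_mult_right \<delta>(2))
  qed
  fix w assume "w \<in> carrier (ext_DY m n)"
  then have wH: "w \<in> carrier (DY_hat m n)" by (rule DD_carrier[OF mn])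
  obtain f where f: "f \<in> FC m n" "w = flim m n f" using DY_hat_elem[OF mn wH] .
  have "inj_dyp m n (x \<otimes>\<^bsub>DY_hat m n\<^esub> w) = inj_dyp m n (w \<otimes>\<^bsub>DY_hat m n\<^esub> x)"
    using Lm_commute_FC[OF mn h(1) gens f(1)]
    unfolding inj_dyp_mult[OF mn xH wH] inj_dyp_mult[OF mn wH xH] xh unfolding f(2) Lm_def[OF mn] .
  then have "x \<otimes>\<^bsub>DY_hat m n\<^esub> w = w \<otimes>\<^bsub>DY_hat m n\<^esub> x"
    by (intro inj_dyp_inj[OF mn] DY_hat_closed(2)[OF mn] xH wH)
  then show "x \<otimes>\<^bsub>ext_DY m n\<^esub> w = w \<otimes>\<^bsub>ext_DY m n\<^esub> x"
    by (simp only: E_ops(1)[OF mn])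
qed

lemma z_central:
  assumes z: "is_z_series m n z"
  shows "z k \<in> centre (ext_DY m n)"
proof (rule centre_criterion)
  show "z k \<in> carrier (ext_DY m n)"
    using z YH_DD[OF mn] unfolding is_z_series_def by blast
  note C = contracts_z_series[OF z]
  have nth: "\<Phi> m n z $ k = inj_dyp m n (z k)" by (simp add: \<Phi>_def[OF mn])
  show "A m n i j r * inj_dyp m n (z k) = inj_dyp m n (z k) * A m n i j r" if "i \<in> Kx" "j \<in> Kx" for i j r
    using z_commutes_A[OF mn inv_A' C that] by (simp only: nth[symmetric])
  show "B m n i j r * inj_dyp m n (z k) = inj_dyp m n (z k) * B m n i j r" if "i \<in> Kx" "j \<in> Kx" for i j r
    using z_commutes_B[OF mn inv_A' C that] by (simp only: nth[symmetric])
qed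

lemma zplus_central:
  assumes z: "is_zplus_series m n z"
  shows "z k \<in> centre (ext_DY m n)"
proof (rule centre_criterion)
  show "z k \<in> carrier (ext_DY m n)"
    using z XH_DD[OF mn] unfolding is_zplus_series_def by blast
  note C = contracts_zplus_series[OF z]
  have nth: "\<Phi> m n z $ k = inj_dyp m n (z k)" by (simp add: \<Phi>_def[OF mn])
  show "A m n i j r * inj_dyp m n (z k) = inj_dyp m n (z k) * A m n i j r" if "i \<in> Kx" "j \<in> Kx" for i j r
    using zplus_commutes_A[OF mn inv_B' C that] by (simp only: nth[symmetric])
  show "B m n i j r * inj_dyp m n (z k) = inj_dyp m n (z k) * B m n i j r" if "i \<in> Kx" "j \<in> Kx" for i j r
    using zplus_commutes_B[OF mn inv_B' C that] by (simp only: nth[symmetric])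
qed

end

theorem theorem2p12:
  fixes m n :: nat
  assumes "m \<noteq> n"
  shows "(\<forall>z. is_z_series m n z \<longrightarrow> (\<forall>k. z k \<in> centre (ext_DY m n))) \<and>
         (\<forall>zp. is_zplus_series m n zp \<longrightarrow> (\<forall>k. zp k \<in> centre (ext_DY m n)))"
  using z_central[OF assms] zplus_central[OF assms] by blast

end
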